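(* Let $\Omega\subset\mathbb{R}^2$ be a bounded simply connected Lipschitz domain, let $L,\lambda>0$ be fixed, and let $D=\Omega\times[0,L]$. Let $h_{ex}=h_{ex}(\epsilon)$ satisfy $|\ln\epsilon|\ll h_{ex}\ll\epsilon^{-2}$ as $\epsilon\to0$. For $\epsilon>0$ and $s=L/N$, $N\ge1$, let $(\{u_n\}_{n=0}^N,\vec A)\in[H^1(\Omega;\mathbb{C})]^{N+1}\times K$ be a minimizer of the Lawrence-Doniach energy $\mathcal{G}_{LD}^{\epsilon,s}$. Then $$\frac{1}{N+1}\sum_{n=0}^N\int_\Omega(1-|u_n|^2)^2d\hat x+\frac12\int_{\mathbb{R}^3}\Bigl|\frac{\nabla\times\vec A}{h_{ex}}-\vec e_3\Bigr|^2dx\to0$$ and $$\frac{1}{N+1}\sum_{n=0}^N\frac{\mu_n}{h_{ex}}\to d\hat x\quad\text{in }H^{-1}(\Omega)$$ as $(\epsilon,s)\to(0,0)$, where $d\hat x$ is the two-dimensional Lebesgue measure and $\mu_n$ is the vorticity in the $n$th layer, defined by $$\mu_n:=\hat{\mathrm{curl}}(\imath u_n,\hat\nabla_{\hat A_n}u_n)+\hat{\mathrm{curl}}\hat A_n.$$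
   Context: Notation: $x=(x_1,x_2,x_3)$, $\hat x=(x_1,x_2)$, $\hat\nabla=(\partial_1,\partial_2)$, $\vec A=(A^1,A^2,A^3)$, $\hat A=(A^1,A^2)$, $\imath=\sqrt{-1}$, $\vec e_3=(0,0,1)$. For an integer $N\ge1$, $s=L/N$ is the interlayer distance, so $s\to0$ means $N\to\infty$. $\hat A_n(\hat x)=(A^1(\hat x,ns),A^2(\hat x,ns))$ is the trace of $\hat A$ on the plane $\{x_3=ns\}$, and $\hat\nabla_{\hat A_n}u_n=\hat\nabla u_n-\imath\hat A_nu_n$. The two-dimensional curl is $\hat{\mathrm{curl}}(B^1,B^2)=\partial_1B^2-\partial_2B^1$ (in the distributional sense on $\Omega$). For $u,v\in\mathbb{C}$, $(u,v)=\Re(u\bar v)$; thus $(\imath u_n,\hat\nabla_{\hat A_n}u_n)$ is the $\mathbb{R}^2$-valued function with $j$th component $(\imath u_n,\partial_ju_n-\imath A_n^ju_n)$, $j=1,2$. Lawrence-Doniach energy: $$\mathcal{G}_{LD}^{\epsilon,s}(\{u_n\}_{n=0}^N,\vec A)=s\sum_{n=0}^N\int_\Omega\Bigl[\tfrac12|\hat\nabla_{\hat A_n}u_n|^2+\tfrac1{4\epsilon^2}(1-|u_n|^2)^2\Bigr]d\hat x+s\sum_{n=0}^{N-1}\int_\Omega\frac{1}{2\lambda^2s^2}\Bigl|u_{n+1}-u_ne^{\imath\int_{ns}^{(n+1)s}A^3dx_3}\Bigr|^2d\hat x+\frac12\int_{\mathbb{R}^3}|\nabla\times\vec A-h_{ex}\vec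 e_3|^2dx,$$ for $\{u_n\}_{n=0}^N\in[H^1(\Omega;\mathbb{C})]^{N+1}$ and $\vec A\in E:=\{\vec C\in H^1_{loc}(\mathbb{R}^3;\mathbb{R}^3):\nabla\times\vec C-h_{ex}\vec e_3\in L^2(\mathbb{R}^3;\mathbb{R}^3)\}$. Coulomb gauge space: $K:=\{\vec C\in E:\nabla\cdot\vec C=0,\ \vec C-h_{ex}\vec a\in\check H^1(\mathbb{R}^3)\cap L^6(\mathbb{R}^3;\mathbb{R}^3)\}$, where $\vec a(x)=\frac12(-x_2,x_1,0)$ and $\check H^1(\mathbb{R}^3)$ is the completion of $C_0^\infty(\mathbb{R}^3;\mathbb{R}^3)$ with respect to $\|\vec C\|_{\check H^1(\mathbb{R}^3)}=(\int_{\mathbb{R}^3}|\nabla\vec C|^2dx)^{1/2}$. For minimizers with $\vec A\in K$ it is known (Bauman-Ko) that $|u_n|\le1$ a.e. in $\Omega$ and $\hat A_n\in H^1_{loc}(\mathbb{R}^2;\mathbb{R}^2)$, so $\mu_n\in H^{-1}(\Omega)$. $|\ln\epsilon|\ll h_{ex}\ll\epsilon^{-2}$ means $|\ln\epsilon|/h_{ex}\to0$ and $\epsilon^2h_{ex}\to0$ as $\epsilon\to0$. *)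

theory Defs
  imports "HOL-Analysis.Analysis"
begin

section \<open>Smooth functions and test functions\<close>

definition pderiv_at :: "'n::finite \<Rightarrow> (real^'n \<Rightarrow> 'b::real_normed_vector) \<Rightarrow> real^'n \<Rightarrow> 'b" where
  "pderiv_at i f x = frechet_derivative f (at x) (axis i 1)"

primrec Ck :: "nat \<Rightarrow> (real^'n::finite \<Rightarrow> 'b::real_normed_vector) \<Rightarrow> bool" where
  "Ck 0 f \<longleftrightarrow> continuous_on UNIV f"
| "Ck (Suc k) f \<longleftrightarrow> (\<forall>x. f differentiable (at x)) \<and> (\<forall>i. Ck k (pderiv_at i f))"

definition smooth :: "(real^'n::finite \<Rightarrow> 'b::real_normed_vector) \<Rightarrow> bool" where
  "smooth f \<longleftrightarrow> (\<forall>k. Ck k f)"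

definition test_functions :: "(real^'n::finite) set \<Rightarrow> (real^'n \<Rightarrow> 'b::real_normed_vector) set" where
  "test_functions U =
     {\<phi>. smooth \<phi> \<and> compact (closure {x. \<phi> x \<noteq> 0}) \<and> closure {x. \<phi> x \<noteq> 0} \<subseteq> U}"

section \<open>Lebesgue and Sobolev spaces\<close>

text \<open>
  Elements of these spaces are functions defined on the whole space, of which only the
  restriction to \<^term>\<open>U\<close>, up to null sets, matters.
\<close>

definition Lp :: "nat \<Rightarrow> (real^'n::finite) set \<Rightarrow> (real^'n \<Rightarrow> 'b::euclidean_space) set" where
  "Lp p U = {f. set_borel_measurable lebesgue U f \<and>
                set_integrable lebesgue U (\<lambda>x. norm (f x) ^ p)}"

definition Lp_loc :: "nat \<Rightarrow> (real^'n::finite) set \<Rightarrow> (real^'n \<Rightarrow> 'b::euclidean_space) set" where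
  "Lp_loc p U = {f. \<forall>K. compact K \<and> K \<subseteq> U \<longrightarrow> f \<in> Lp p K}"

definition has_weak_pderiv ::
  "(real^'n::finite) set \<Rightarrow> 'n \<Rightarrow> (real^'n \<Rightarrow> 'b::euclidean_space) \<Rightarrow> (real^'n \<Rightarrow> 'b) \<Rightarrow> bool" where
  "has_weak_pderiv U i f g \<longleftrightarrow>
     f \<in> Lp_loc 1 U \<and> g \<in> Lp_loc 1 U \<and>
     (\<forall>\<phi>::real^'n \<Rightarrow> real. \<phi> \<in> test_functions U \<longrightarrow>
        (LINT x:U|lebesgue. pderiv_at i \<phi> x *\<^sub>R f x) = - (LINT x:U|lebesgue. \<phi> x *\<^sub>R g x))"

text \<open>
  For open \<^term>\<open>U\<close> the weak derivative is unique almost everywhere on \<^term>\<open>U\<close>; all uses below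
  are insensitive to the chosen representative.
\<close>

definition weak_pderiv ::
  "(real^'n::finite) set \<Rightarrow> 'n \<Rightarrow> (real^'n \<Rightarrow> 'b::euclidean_space) \<Rightarrow> real^'n \<Rightarrow> 'b" where
  "weak_pderiv U i f = (SOME g. has_weak_pderiv U i f g)"

definition H1 :: "(real^'n::finite) set \<Rightarrow> (real^'n \<Rightarrow> 'b::euclidean_space) set" where
  "H1 U = {f. f \<in> Lp 2 U \<and> (\<forall>i. \<exists>g. has_weak_pderiv U i f g \<and> g \<in> Lp 2 U)}"

definition H1_loc :: "(real^'n::finite) set \<Rightarrow> (real^'n \<Rightarrow> 'b::euclidean_space) set" where
  "H1_loc U = {f. f \<in> Lp_loc 2 U \<and> (\<forall>i. \<exists>g. has_weak_pderiv U i f g \<and> g \<in> Lp_loc 2 U)}"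

text \<open>
  The completion of the compactly supported smooth fields in the norm of the gradient, as a space
  of functions: \<^term>\<open>f\<close> represents the limit of \<^term>\<open>\<phi>\<close> if the gradients converge in the square
  mean. This determines \<^term>\<open>f\<close> up to an additive constant, which is fixed below by intersecting
  with \<^term>\<open>Lp 6 UNIV\<close>.
\<close>

definition Hcheck1 :: "(real^3 \<Rightarrow> real^3) set" where
  "Hcheck1 = {f. (\<forall>i. \<exists>g. has_weak_pderiv UNIV i f g \<and> g \<in> Lp 2 UNIV) \<and>
     (\<exists>\<phi>::nat \<Rightarrow> real^3 \<Rightarrow> real^3. (\<forall>k. \<phi> k \<in> test_functions UNIV) \<and>
        ((\<lambda>k. \<integral>\<^sup>+x. ennreal (\<Sum>i\<in>UNIV. (norm (pderiv_at i (\<phi> k) x - weak_pderiv UNIV i f x))\<^sup>2)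
               \<partial>lebesgue) \<longlonglongrightarrow> 0))}"

section \<open>Traces on horizontal planes\<close>

definition hat :: "real^3 \<Rightarrow> real^2" where
  "hat v = vector [v $ 1, v $ 2]"

definition at_height :: "real^2 \<Rightarrow> real \<Rightarrow> real^3" where
  "at_height y t = vector [y $ 1, y $ 2, t]"

text \<open>
  The trace operator is the extension by continuity, from smooth functions to \<^term>\<open>H1_loc UNIV\<close>,
  of the restriction to the plane at height \<^term>\<open>t\<close>.
\<close>

definition is_plane_trace ::
  "real \<Rightarrow> (real^3 \<Rightarrow> 'b::euclidean_space) \<Rightarrow> (real^2 \<Rightarrow> 'b) \<Rightarrow> bool" where
  "is_plane_trace t f g \<longleftrightarrow>
     f \<in> H1_loc UNIV \<and> g \<in> Lp_loc 2 UNIV \<and>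
     (\<exists>\<phi>::nat \<Rightarrow> real^3 \<Rightarrow> 'b. (\<forall>k. smooth (\<phi> k)) \<and>
        (\<forall>K. compact K \<longrightarrow>
           (\<lambda>k. \<integral>\<^sup>+x\<in>K. ennreal ((norm (\<phi> k x - f x))\<^sup>2 +
                  (\<Sum>i\<in>UNIV. (norm (pderiv_at i (\<phi> k) x - weak_pderiv UNIV i f x))\<^sup>2))
                \<partial>lebesgue) \<longlonglongrightarrow> 0) \<and>
        (\<forall>K. compact K \<longrightarrow>
           (\<lambda>k. \<integral>\<^sup>+y\<in>K. ennreal ((norm (\<phi> k (at_height y t) - g y))\<^sup>2) \<partial>lebesgue) \<longlonglongrightarrow> 0))"

definition plane_trace :: "real \<Rightarrow> (real^3 \<Rightarrow> 'b::euclidean_space) \<Rightarrow> real^2 \<Rightarrow> 'b" where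
  "plane_trace t f = (SOME g. is_plane_trace t f g)"

definition layer_potential :: "(real^3 \<Rightarrow> real^3) \<Rightarrow> real \<Rightarrow> real^2 \<Rightarrow> real^2" where
  "layer_potential A t = plane_trace t (\<lambda>x. hat (A x))"

section \<open>The Lawrence--Doniach energy\<close>

definition weak_curl :: "(real^3 \<Rightarrow> real^3) \<Rightarrow> real^3 \<Rightarrow> real^3" where
  "weak_curl A x =
     vector [weak_pderiv UNIV 2 A x $ 3 - weak_pderiv UNIV 3 A x $ 2,
             weak_pderiv UNIV 3 A x $ 1 - weak_pderiv UNIV 1 A x $ 3,
             weak_pderiv UNIV 1 A x $ 2 - weak_pderiv UNIV 2 A x $ 1]"

definition weak_div :: "(real^3 \<Rightarrow> real^3) \<Rightarrow> real^3 \<Rightarrow> real" where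
  "weak_div A x = (\<Sum>i\<in>UNIV. weak_pderiv UNIV i A x $ i)"

definition e3 :: "real^3" where
  "e3 = axis 3 1"

definition a_field :: "real^3 \<Rightarrow> real^3" where
  "a_field x = (1/2) *\<^sub>R vector [- x $ 2, x $ 1, 0]"

definition E_space :: "real \<Rightarrow> (real^3 \<Rightarrow> real^3) set" where
  "E_space h = {C. C \<in> H1_loc UNIV \<and> (\<lambda>x. weak_curl C x - h *\<^sub>R e3) \<in> Lp 2 UNIV}"

definition K_space :: "real \<Rightarrow> (real^3 \<Rightarrow> real^3) set" where
  "K_space h = {C \<in> E_space h. (AE x in lebesgue. weak_div C x = 0) \<and>
                  (\<lambda>x. C x - h *\<^sub>R a_field x) \<in> Hcheck1 \<inter> Lp 6 UNIV}"

definition cov_grad ::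
  "(real^2) set \<Rightarrow> (real^2 \<Rightarrow> real^2) \<Rightarrow> (real^2 \<Rightarrow> complex) \<Rightarrow> real^2 \<Rightarrow> complex^2" where
  "cov_grad \<Omega> B v y = (\<chi> j. weak_pderiv \<Omega> j v y - \<i> * complex_of_real (B y $ j) * v y)"

text \<open>The energy takes values in \<open>[0, \<infinity>]\<close>: all integrands are nonnegative.\<close>

definition LD_energy ::
  "(real^2) set \<Rightarrow> real \<Rightarrow> real \<Rightarrow> real \<Rightarrow> nat \<Rightarrow> real \<Rightarrow>
   (nat \<Rightarrow> real^2 \<Rightarrow> complex) \<Rightarrow> (real^3 \<Rightarrow> real^3) \<Rightarrow> ennreal" where
  "LD_energy \<Omega> lam \<epsilon> s N h u A =
     ennreal s * (\<Sum>n=0..N. \<integral>\<^sup>+y\<in>\<Omega>. ennreal (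
         1/2 * (norm (cov_grad \<Omega> (layer_potential A (real n * s)) (u n) y))\<^sup>2
         + 1 / (4 * \<epsilon>\<^sup>2) * (1 - (cmod (u n y))\<^sup>2)\<^sup>2) \<partial>lebesgue)
   + ennreal s * (\<Sum>n<N. \<integral>\<^sup>+y\<in>\<Omega>. ennreal (
         1 / (2 * lam\<^sup>2 * s\<^sup>2) *
         (cmod (u (Suc n) y - u n y *
            exp (\<i> * complex_of_real
               (LINT t:{real n * s..real (Suc n) * s}|lebesgue. A (at_height y t) $ 3))))\<^sup>2)
       \<partial>lebesgue)
   + ennreal (1/2) * (\<integral>\<^sup>+x. ennreal ((norm (weak_curl A x - h *\<^sub>R e3))\<^sup>2) \<partial>lebesgue)"

definition LD_admissible ::
  "(real^2) set \<Rightarrow> nat \<Rightarrow> real \<Rightarrow> (nat \<Rightarrow> real^2 \<Rightarrow> complex) \<Rightarrow> (real^3 \<Rightarrow> real^3) \<Rightarrow> bool" where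
  "LD_admissible \<Omega> N h u A \<longleftrightarrow> (\<forall>n\<le>N. u n \<in> H1 \<Omega>) \<and> A \<in> K_space h"

text \<open>
  By gauge invariance of the energy, minimality within the Coulomb gauge space \<^term>\<open>K_space h\<close> is
  the same as minimality within \<^term>\<open>E_space h\<close>.
\<close>

definition is_LD_minimizer ::
  "(real^2) set \<Rightarrow> real \<Rightarrow> real \<Rightarrow> real \<Rightarrow> nat \<Rightarrow> real \<Rightarrow>
   (nat \<Rightarrow> real^2 \<Rightarrow> complex) \<Rightarrow> (real^3 \<Rightarrow> real^3) \<Rightarrow> bool" where
  "is_LD_minimizer \<Omega> lam \<epsilon> s N h u A \<longleftrightarrow>
     LD_admissible \<Omega> N h u A \<and>
     (\<forall>v B. LD_admissible \<Omega> N h v B \<longrightarrow>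
        LD_energy \<Omega> lam \<epsilon> s N h u A \<le> LD_energy \<Omega> lam \<epsilon> s N h v B)"

section \<open>Vorticity and the dual Sobolev norm\<close>

text \<open>Distributions are represented by their action on real test functions.\<close>

definition dist_curl ::
  "(real^2) set \<Rightarrow> (real^2 \<Rightarrow> real^2) \<Rightarrow> (real^2 \<Rightarrow> real) \<Rightarrow> real" where
  "dist_curl \<Omega> B \<phi> =
     - (LINT y:\<Omega>|lebesgue. B y $ 2 * pderiv_at 1 \<phi> y - B y $ 1 * pderiv_at 2 \<phi> y)"

definition current ::
  "(real^2) set \<Rightarrow> (real^2 \<Rightarrow> real^2) \<Rightarrow> (real^2 \<Rightarrow> complex) \<Rightarrow> real^2 \<Rightarrow> real^2" where
  "current \<Omega> B v y = (\<chi> j. Re (\<i> * v y * cnj (cov_grad \<Omega> B v y $ j)))"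

definition vorticity ::
  "(real^2) set \<Rightarrow> (real^2 \<Rightarrow> real^2) \<Rightarrow> (real^2 \<Rightarrow> complex) \<Rightarrow> (real^2 \<Rightarrow> real) \<Rightarrow> real" where
  "vorticity \<Omega> B v \<phi> = dist_curl \<Omega> (current \<Omega> B v) \<phi> + dist_curl \<Omega> B \<phi>"

definition H1_norm :: "(real^2) set \<Rightarrow> (real^2 \<Rightarrow> real) \<Rightarrow> real" where
  "H1_norm \<Omega> \<phi> =
     sqrt (LINT y:\<Omega>|lebesgue. (\<phi> y)\<^sup>2 + (\<Sum>i\<in>UNIV. (pderiv_at i \<phi> y)\<^sup>2))"

text \<open>
  The norm of the dual of \<open>H\<^sub>0\<^sup>1\<close>; since test functions are dense in \<open>H\<^sub>0\<^sup>1\<close> by definition,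
  the supremum may be taken over them. It is infinite for distributions outside the dual.
\<close>

definition Hminus1_norm :: "(real^2) set \<Rightarrow> ((real^2 \<Rightarrow> real) \<Rightarrow> real) \<Rightarrow> ennreal" where
  "Hminus1_norm \<Omega> T = (SUP \<phi>\<in>{\<phi> \<in> test_functions \<Omega>. H1_norm \<Omega> \<phi> \<le> 1}. ennreal \<bar>T \<phi>\<bar>)"

section \<open>Lipschitz domains in the plane\<close>

definition lipschitz_domain :: "(real^2) set \<Rightarrow> bool" where
  "lipschitz_domain \<Omega> \<longleftrightarrow>
     open \<Omega> \<and> connected \<Omega> \<and> \<Omega> \<noteq> {} \<and>
     (\<forall>p\<in>frontier \<Omega>. \<exists>r>0. \<exists>d1 d2. \<exists>\<gamma>::real \<Rightarrow> real. \<exists>C.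
        norm d1 = 1 \<and> norm d2 = 1 \<and> d1 \<bullet> d2 = 0 \<and> C-lipschitz_on UNIV \<gamma> \<and>
        \<Omega> \<inter> ball p r = {y \<in> ball p r. \<gamma> (y \<bullet> d1) < y \<bullet> d2})"

end

theory Submission
  imports Defs
begin

text \<open>
  Comparison with \<open>A = h a\<close> and one periodic array of vortices, placed in every layer, of lattice
  spacing \<open>l = sqrt (2 pi / h)\<close> and core size \<open>\<epsilon>\<close>, bounds the minimal energy by
  \<open>\<kappa> = C h ln (1 + l / \<epsilon>)\<close>. The hypotheses on \<open>h\<close> imply that \<open>\<kappa> / h\<^sup>2\<close> and \<open>\<epsilon>\<^sup>2 \<kappa>\<close> tend
  to \<open>0\<close>, which gives the first limit. Truncating the \<open>u n\<close> by a gauge equivariant contraction lowers the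
  energy, so minimizers satisfy \<open>\<bar>u n\<bar> \<le> 1\<close>; hence the currents are bounded by the covariant gradients
  and their contribution to the vorticity is \<open>O(sqrt \<kappa>)\<close> in the dual norm. For the potentials, the trace
  on the plane at height \<open>t\<close> is written as an integral over the slab between \<open>t\<close> and \<open>t + 1\<close>;
  integration by parts then expresses the curl of the trace through the three-dimensional curl, and
  its distance to the constant \<open>h\<close> is again \<open>O(sqrt \<kappa>)\<close>, uniformly in \<open>n\<close>. Division by \<open>h\<close> gives
  the second limit.
\<close>

section \<open>Partial derivatives and test functions\<close>

text \<open>The energy is a sum of nonnegative terms, so one upper bound on its minimum controls
  every term separately. With the same planar function in all layers and a potential without
  vertical component, the coupling and magnetic terms of the comparison vanish, so the bound is
  uniform in \<open>N\<close> and no relation between \<epsilon> and s enters. The spacing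
  \<open>l\<close> puts one flux quantum into each cell, so the phases follow the potential up to an
  error of order \<open>1 / l\<close>; the logarithm is the usual cost of a vortex core. It is
  estimated twice, by \<open>2 * \<bar>ln \<epsilon>\<bar>\<close> for
  \<open>\<kappa> / h\<^sup>2\<close> and by \<open>l / \<epsilon>\<close> for
  \<open>\<epsilon>\<^sup>2 * \<kappa>\<close>, and each estimate consumes one growth condition. The
  main obstacle is the trace, a chosen limit of restrictions that is determined only almost
  everywhere. A slab of fixed thickness one gives it a formula and keeps the flux estimate
  independent of the layer spacing. Weighted Young inequalities replace Cauchy-Schwarz: they can be
  integrated in \<open>ennreal\<close> before any finiteness is known, and their weight is chosen
  last.\<close>

lemma pderiv_at_eq:
  assumes "(f has_derivative D) (at x)"
  shows "pderiv_at i f x = D (axis i 1)"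
  using frechet_derivative_at[OF assms] by (simp add: pderiv_at_def)

lemma frechet_derivative_worksI:
  "f differentiable F \<Longrightarrow> (f has_derivative frechet_derivative f F) F"
  by (simp add: frechet_derivative_works)

lemma frechet_derivative_pderiv:
  fixes f :: "real^'n::finite \<Rightarrow> 'b::real_normed_vector"
  assumes "f differentiable (at x)"
  shows "frechet_derivative f (at x) h = (\<Sum>i\<in>UNIV. (h $ i) *\<^sub>R pderiv_at i f x)"
proof -
  have lin: "linear (frechet_derivative f (at x))"
    using assms by (simp add: linear_frechet_derivative)
  have "h = (\<Sum>i\<in>UNIV. (h $ i) *\<^sub>R axis i 1)"
    by (simp add: vec_eq_iff axis_def if_distrib cong: if_cong)
  then have "frechet_derivative f (at x) h = frechet_derivative f (at x) (\<Sum>i\<in>UNIV. (h $ i) *\<^sub>R axis i 1)"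
    by simp
  also have "\<dots> = (\<Sum>i\<in>UNIV. (h $ i) *\<^sub>R pderiv_at i f x)"
    by (simp add: linear_sum[OF lin] linear_cmul[OF lin] pderiv_at_def)
  finally show ?thesis .
qed

lemma Ck_continuous: "Ck k f \<Longrightarrow> continuous_on UNIV f"
proof (cases k)
  case (Suc m)
  assume "Ck k f"
  then have "\<And>x. f differentiable (at x)" using Suc by simp
  then show ?thesis
    by (intro continuous_at_imp_continuous_on ballI differentiable_imp_continuous_within)
qed auto

lemma Ck_SucD: "Ck (Suc k) f \<Longrightarrow> Ck k f"
proof (induction k arbitrary: f)
  case 0 from Ck_continuous[OF this] show ?case by simp
next
  case (Suc k) then show ?case by simp
qed

lemma pderiv_at_const [simp]: "pderiv_at i (\<lambda>x. c) = (\<lambda>x. 0)"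
  by (auto simp: pderiv_at_def)

lemma Ck_const: "Ck k (\<lambda>x. c)"
  by (induction k arbitrary: c) auto

lemma Ck_add: "Ck k f \<Longrightarrow> Ck k g \<Longrightarrow> Ck k (\<lambda>x. f x + g x)"
proof (induction k arbitrary: f g)
  case 0 then show ?case by (auto intro: continuous_intros)
next
  case (Suc k)
  have "pderiv_at i (\<lambda>x. f x + g x) = (\<lambda>x. pderiv_at i f x + pderiv_at i g x)" for i
    using Suc.prems
    by (auto simp: fun_eq_iff pderiv_at_def[of _ f] pderiv_at_def[of _ g]
        intro!: pderiv_at_eq derivative_intros frechet_derivative_worksI)
  with Suc show ?case by (auto intro: differentiable_add)
qed

lemma Ck_scaleR:
  fixes f :: "real^'n::finite \<Rightarrow> real" and g :: "real^'n \<Rightarrow> 'b::real_normed_vector"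
  shows "Ck k f \<Longrightarrow> Ck k g \<Longrightarrow> Ck k (\<lambda>x. f x *\<^sub>R g x)"
proof (induction k arbitrary: f g)
  case 0 then show ?case by (auto intro: continuous_intros)
next
  case (Suc k)
  have "((\<lambda>x. f x *\<^sub>R g x) has_derivative (\<lambda>h. f x *\<^sub>R frechet_derivative g (at x) h + frechet_derivative f (at x) h *\<^sub>R g x)) (at x)" for x
    using Suc.prems by (intro derivative_intros frechet_derivative_worksI) auto
  note d = this
  have "pderiv_at i (\<lambda>x. f x *\<^sub>R g x) = (\<lambda>x. f x *\<^sub>R pderiv_at i g x + pderiv_at i f x *\<^sub>R g x)" for i
    using pderiv_at_eq[OF d] by (auto simp: fun_eq_iff pderiv_at_def[of _ f] pderiv_at_def[of _ g])
  \<comment> \<open>The product rule leaves one factor undifferentiated, so the induction hypothesis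
    at order \<open>k\<close> needs the factors themselves at that order, not only their
    derivatives.\<close>
  moreover have "Ck k f" "Ck k g" using Suc.prems Ck_SucD by blast+
  ultimately show ?case using Suc differentiableI[OF d] by (auto intro!: Ck_add)
qed

text \<open>A scalar factor preserves the coordinate directions, so the chain rule merely multiplies
  each partial derivative by \<open>c\<close>. This covers the dilation of the bump and the
  reflection of the kernel in a convolution.\<close>

lemma Ck_affine:
  shows "Ck k f \<Longrightarrow> Ck k (\<lambda>x. f (c *\<^sub>R x + b))"
proof (induction k arbitrary: f)
  case 0 then show ?case
    by (auto intro!: continuous_on_compose2[of UNIV f] continuous_intros)
next
  case (Suc k)
  have d: "((\<lambda>x. f (c *\<^sub>R x + b)) has_derivative (\<lambda>h. frechet_derivative f (at (c *\<^sub>R x + b)) (c *\<^sub>R h))) (at x)" for x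
    using Suc.prems
    by (intro has_derivative_compose[of "\<lambda>x. c *\<^sub>R x + b" "\<lambda>h. c *\<^sub>R h" x UNIV f, simplified] frechet_derivative_worksI)
       (auto intro!: derivative_eq_intros)
  have "pderiv_at i (\<lambda>x. f (c *\<^sub>R x + b)) = (\<lambda>x. c *\<^sub>R pderiv_at i f (c *\<^sub>R x + b))" for i
  proof
    fix x
    have "linear (frechet_derivative f (at (c *\<^sub>R x + b)))"
      using Suc.prems by (simp add: linear_frechet_derivative)
    then show "pderiv_at i (\<lambda>x. f (c *\<^sub>R x + b)) x = c *\<^sub>R pderiv_at i f (c *\<^sub>R x + b)"
      using pderiv_at_eq[OF d] by (simp add: pderiv_at_def linear_cmul)
  qed
  moreover have "Ck k (\<lambda>x. c *\<^sub>R g x)" if "Ck k g" for g :: "real^'a \<Rightarrow> 'b"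
    using Ck_scaleR[OF Ck_const that] .
  ultimately show ?case using Suc differentiableI[OF d] by simp
qed

lemma Ck_nth: "Ck k (\<lambda>x::real^'n::finite. x $ i)"
proof (cases k)
  case (Suc m)
  have d: "((\<lambda>x::real^'n. x $ i) has_derivative (\<lambda>h. h $ i)) (at x)" for x
    by (intro bounded_linear_imp_has_derivative bounded_linear_vec_nth)
  have "pderiv_at j (\<lambda>x::real^'n. x $ i) = (\<lambda>x. axis j 1 $ i)" for j
    using pderiv_at_eq[OF d] by auto
  with differentiableI[OF d] Suc show ?thesis by (simp add: Ck_const)
qed (auto intro: continuous_intros)

text \<open>The functions \<open>exp (-1/t) / t ^ j\<close> on the positive half line are stable under differentiation and multiplication by \<open>1/t\<close>, which makes \<open>flat 0 (1 - x \<bullet> x)\<close> smooth.\<close>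

definition flat :: "nat \<Rightarrow> real \<Rightarrow> real" where
  "flat j t = (if t > 0 then exp (- (1 / t)) / t ^ j else 0)"

text \<open>The substitution \<open>x = 1 / t\<close> turns the limit from the right into the decay
  of \<open>x ^ j / exp x\<close> at infinity; from the left the function is identically
  zero.\<close>

lemma flat_tendsto_0: "(flat j \<longlongrightarrow> 0) (at 0)"
proof -
  have "((\<lambda>x. x ^ j / exp x) \<longlongrightarrow> (0::real)) at_top" by (rule tendsto_power_div_exp_0)
  then have "((\<lambda>t. (1/t) ^ j / exp (1/t)) \<longlongrightarrow> (0::real)) (at_right 0)"
    by (rule filterlim_compose) (use filterlim_inverse_at_top_right in \<open>simp add: inverse_eq_divide\<close>)
  then have r: "(flat j \<longlongrightarrow> 0) (at_right 0)"
    by (rule Lim_transform_eventually)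
       (auto simp: flat_def eventually_at_filter exp_minus field_simps power_one_over)
  have "((\<lambda>t. 0) \<longlongrightarrow> (0::real)) (at_left 0)" by simp
  then have l: "(flat j \<longlongrightarrow> 0) (at_left 0)"
    by (rule Lim_transform_eventually) (auto simp: flat_def eventually_at_filter)
  from l r show ?thesis by (simp add: filterlim_split_at)
qed

lemma flat_deriv:
  "(flat j has_real_derivative flat (j + 2) t - real j * flat (j + 1) t) (at t)"
proof -
  consider "t > 0" | "t < 0" | "t = 0" by linarith
  then show ?thesis
  proof cases
    case 1
    have i: "((\<lambda>t. - (1 / t)) has_real_derivative 1 / t\<^sup>2) (at t)"
      using 1 by (auto intro!: derivative_eq_intros simp: power2_eq_square)
    have "((\<lambda>t. exp (- (1 / t)) / t ^ j) has_real_derivative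
        ((exp (- (1 / t)) * (1 / t\<^sup>2)) * t ^ j - exp (- (1 / t)) * (real j * t ^ (j - Suc 0))) / (t ^ j * t ^ j)) (at t)"
      using 1 by (intro DERIV_divide DERIV_fun_exp i DERIV_pow) auto
    also have "(e * (1 / t\<^sup>2) * t ^ j - e * (real j * t ^ (j - Suc 0))) / (t ^ j * t ^ j)
        = e / t ^ (j + 2) - real j * (e / t ^ (j + 1))" for e
      using 1 by (cases j) (simp_all add: field_simps power2_eq_square)
    also have "exp (- (1 / t)) / t ^ (j + 2) - real j * (exp (- (1 / t)) / t ^ (j + 1)) = flat (j + 2) t - real j * flat (j + 1) t"
      using 1 by (simp add: flat_def)
    finally have "((\<lambda>t. exp (- (1 / t)) / t ^ j) has_real_derivative flat (j + 2) t - real j * flat (j + 1) t) (at t)" .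
    from has_field_derivative_transform_within_open[OF this, of "{0<..}" "flat j"] 1
    show ?thesis by (auto simp: flat_def)
  next
    case 2
    have "((\<lambda>t. 0) has_real_derivative flat (j + 2) t - real j * flat (j + 1) t) (at t)"
      using 2 by (auto simp: flat_def)
    from has_field_derivative_transform_within_open[OF this, of "{..<0}" "flat j"] 2
    show ?thesis by (auto simp: flat_def)
  next
    case 3
    \<comment> \<open>At the origin the difference quotient of \<open>flat j\<close> is
      \<open>flat (Suc j)\<close>, whose limit is already known to be zero.\<close>
    have "((\<lambda>h. (flat j (0 + h) - flat j 0) / h) \<longlongrightarrow> 0) (at 0)"
      by (rule Lim_transform_eventually[OF flat_tendsto_0[of "Suc j"]])
         (auto simp: flat_def eventually_at_filter field_simps)
    then show ?thesis using 3 by (simp add: DERIV_def flat_def)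
  qed
qed

definition bump :: "real^'n::finite \<Rightarrow> real" where
  "bump x = flat 0 (1 - x \<bullet> x)"

text \<open>The index \<open>j\<close> must stay arbitrary in the induction on \<open>k\<close>: one
  derivative trades \<open>flat j\<close> for \<open>flat (j + 2)\<close> and
  \<open>flat (j + 1)\<close>, multiplied by a linear factor.\<close>

lemma Ck_flat: "Ck k (\<lambda>x::real^'n::finite. flat j (1 - x \<bullet> x))"
proof (induction k arbitrary: j)
  case 0
  have "continuous_on UNIV (flat j)"
    using flat_deriv DERIV_isCont continuous_at_imp_continuous_on by blast
  then show ?case by (auto intro!: continuous_on_compose2[of UNIV "flat j"] continuous_intros)
next
  case (Suc k)
  let ?g = "\<lambda>x::real^'n. flat (j + 2) (1 - x \<bullet> x) + (- real j) *\<^sub>R flat (j + 1) (1 - x \<bullet> x)"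
  have d: "((\<lambda>x::real^'n. flat j (1 - x \<bullet> x)) has_derivative (\<lambda>h. - (2 * (x \<bullet> h)) * ?g x)) (at x)" for x
  proof -
    have "((\<lambda>x::real^'n. 1 - x \<bullet> x) has_derivative (\<lambda>h. - (2 * (x \<bullet> h)))) (at x)"
      by (auto intro!: derivative_eq_intros simp: inner_commute)
    from DERIV_compose_FDERIV[OF flat_deriv this] show ?thesis by (simp add: o_def)
  qed
  have "pderiv_at i (\<lambda>x::real^'n. flat j (1 - x \<bullet> x)) = (\<lambda>x. ((-2) *\<^sub>R (x $ i)) *\<^sub>R ?g x)" for i
    using pderiv_at_eq[OF d] by (auto simp: inner_axis)
  moreover have "Ck k (\<lambda>x. ((-2) *\<^sub>R (x $ i)) *\<^sub>R ?g x)" for i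
    by (intro Ck_scaleR Ck_const Ck_nth Ck_add Suc)
  ultimately show ?case using differentiableI[OF d] by simp
qed

lemma smooth_bump: "smooth bump"
  unfolding smooth_def bump_def using Ck_flat by auto

lemma bump_nonneg: "bump x \<ge> 0"
  by (simp add: bump_def flat_def)

lemma bump_pos_iff: "bump x > 0 \<longleftrightarrow> norm x < 1"
  by (auto simp: bump_def flat_def dot_square_norm power_less_one_iff abs_square_less_1)

lemma smooth_continuous: "smooth f \<Longrightarrow> continuous_on UNIV f"
  using Ck_continuous smooth_def by blast

lemma smooth_pderiv: "smooth f \<Longrightarrow> smooth (pderiv_at i f)"
  unfolding smooth_def by (metis Ck.simps(2))

lemma smooth_differentiable: "smooth f \<Longrightarrow> f differentiable (at x)"
  unfolding smooth_def by (metis Ck.simps(2))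

lemma smooth_scaleR:
  fixes f :: "real^'n::finite \<Rightarrow> real"
  shows "smooth f \<Longrightarrow> smooth g \<Longrightarrow> smooth (\<lambda>x. f x *\<^sub>R g x)"
  by (simp add: smooth_def Ck_scaleR)

lemma smooth_const: "smooth (\<lambda>x. c)"
  by (simp add: smooth_def Ck_const)

lemma smooth_affine: "smooth f \<Longrightarrow> smooth (\<lambda>x. f (c *\<^sub>R x + b))"
  by (simp add: smooth_def Ck_affine)

lemma pderiv_at_zero_outside:
  fixes f :: "real^'n::finite \<Rightarrow> 'b::real_normed_vector"
  assumes "\<And>x. r < norm x \<Longrightarrow> f x = 0" "r < norm x"
  shows "pderiv_at i f x = 0"
proof -
  have "open {x::real^'n. r < norm x}" by (intro open_Collect_less continuous_intros)
  from has_derivative_transform_within_open[OF has_derivative_const this, of x 0 f] assms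
  have "(f has_derivative (\<lambda>h. 0)) (at x)" by simp
  from pderiv_at_eq[OF this] show ?thesis .
qed

lemma continuous_zero_outside_bounded:
  fixes f :: "real^'n::finite \<Rightarrow> 'b::real_normed_vector"
  assumes "continuous_on UNIV f" "\<And>x. r < norm x \<Longrightarrow> f x = 0"
  shows "\<exists>M\<ge>0. \<forall>x. norm (f x) \<le> M"
proof -
  have "compact (f ` cball 0 r)"
    using continuous_on_subset[OF assms(1) subset_UNIV] by (intro compact_continuous_image) simp_all
  then obtain M where "\<And>x. x \<in> cball 0 r \<Longrightarrow> norm (f x) \<le> M"
    using compact_imp_bounded[of "f ` cball 0 r"] unfolding bounded_iff by blast
  then have "norm (f x) \<le> max M 0" for x
    using assms(2)[of x] by (cases "r < norm x") (auto simp: le_max_iff_disj)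
  then show ?thesis by (intro exI[of _ "max M 0"]) auto
qed

text \<open>The sum of the suprema of the partial derivatives serves as one constant for both
  bounds. Together they dominate the remainder of the first order expansion when a convolution is
  differentiated under the integral.\<close>

lemma smooth_zero_outside_lipschitz:
  fixes f :: "real^'n::finite \<Rightarrow> 'b::real_normed_vector"
  assumes "smooth f" "\<And>x. r < norm x \<Longrightarrow> f x = 0"
  obtains M where "M \<ge> 0" "\<And>x y. norm (f x - f y) \<le> M * norm (x - y)"
    "\<And>x h. norm (frechet_derivative f (at x) h) \<le> M * norm h"
proof -
  have "\<forall>i. \<exists>M\<ge>0. \<forall>x. norm (pderiv_at i f x) \<le> M"
    using smooth_continuous[OF smooth_pderiv[OF assms(1)]] pderiv_at_zero_outside[OF assms(2)]
    by (intro allI continuous_zero_outside_bounded) auto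
  then obtain M where M: "\<And>i. M i \<ge> 0" "\<And>i x. norm (pderiv_at i f x) \<le> M i" by metis
  let ?M = "\<Sum>i\<in>UNIV. M i"
  have b: "norm (frechet_derivative f (at x) h) \<le> ?M * norm h" for x h
  proof -
    have "norm (frechet_derivative f (at x) h) \<le> (\<Sum>i\<in>UNIV. \<bar>h $ i\<bar> * norm (pderiv_at i f x))"
      using frechet_derivative_pderiv[OF smooth_differentiable[OF assms(1)]]
      by (simp add: norm_sum order_trans[OF norm_sum])
    also have "\<dots> \<le> (\<Sum>i\<in>UNIV. norm h * M i)"
      by (intro sum_mono mult_mono M component_le_norm_cart) auto
    finally show ?thesis by (simp add: sum_distrib_left mult.commute)
  qed
  have "norm (f x - f y) \<le> ?M * norm (x - y)" for x y
    by (rule differentiable_bound[of UNIV f "\<lambda>x. frechet_derivative f (at x)"])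
       (use b smooth_differentiable[OF assms(1)] in \<open>auto intro!: onorm_bound sum_nonneg M frechet_derivative_worksI\<close>)
  with b that[of ?M] M show ?thesis by (auto intro: sum_nonneg)
qed

lemma test_functions_zero_outside:
  fixes \<phi> :: "real^'n::finite \<Rightarrow> 'b::real_normed_vector"
  assumes "\<phi> \<in> test_functions U"
  obtains r where "r > 0" "\<And>x. r < norm x \<Longrightarrow> \<phi> x = 0"
proof -
  have "bounded (closure {x. \<phi> x \<noteq> 0})" using assms by (auto simp: test_functions_def compact_imp_bounded)
  then obtain r where r: "\<And>x. x \<in> closure {x. \<phi> x \<noteq> 0} \<Longrightarrow> norm x \<le> r" by (auto simp: bounded_iff)
  have "\<phi> x = 0" if "max r 1 < norm x" for x
    using r[of x] closure_subset[of "{x. \<phi> x \<noteq> 0}"] that by (auto)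
  then show ?thesis by (intro that[of "max r 1"]) auto
qed

section \<open>Mollification in Lebesgue spaces\<close>

text \<open>The function spaces live on \<open>lebesgue\<close>, whereas Fubini and translation
  invariance are used on \<open>lborel\<close>; a Borel representative links the two. The continuous
  functions that converge to it are returned as well, because they start the density
  argument.\<close>

lemma borel_representative:
  fixes f :: "real^'n::finite \<Rightarrow> 'b::euclidean_space"
  assumes "f \<in> borel_measurable lebesgue"
  obtains g h where "g \<in> borel_measurable borel" "AE x in lebesgue. g x = f x"
    "\<forall>n::nat. continuous_on UNIV (h n)" "AE x in lborel. (\<lambda>n. h n x) \<longlonglongrightarrow> g x"
proof -
  have "f measurable_on UNIV"
    using lebesgue_measurable_imp_measurable_on[of f UNIV] assms by simp
  then obtain N h where h: "negligible N" "\<And>n. continuous_on UNIV (h n)"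
    "\<And>x. x \<notin> N \<Longrightarrow> (\<lambda>n. h n x) \<longlonglongrightarrow> f x"
    unfolding measurable_on_def by auto
  \<comment> \<open>Taking \<open>lim\<close> at every point, with an arbitrary value where the
    sequence diverges, yields a Borel function; the values of \<open>f\<close> are recovered off the
    null set.\<close>
  define g where "g x = lim (\<lambda>n. h n x)" for x
  have eq: "g x = f x" if "x \<notin> N" for x using limI[OF h(3)[OF that]] by (simp add: g_def)
  have hb: "\<And>n. h n \<in> borel_measurable borel" using h(2) by (rule borel_measurable_continuous_onI)
  then have gb: "g \<in> borel_measurable borel" unfolding g_def[abs_def]
    by (rule borel_measurable_lim_metric)
  have "N \<in> null_sets lebesgue" using h(1) negligible_iff_null_sets by blast
  then have ae: "AE x in lebesgue. x \<notin> N" by (rule AE_not_in)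
  have "AE x in lebesgue. (\<lambda>n. h n x) \<longlonglongrightarrow> g x"
    using ae h(3) eq by (auto elim!: eventually_mono)
  then have "AE x in lborel. (\<lambda>n. h n x) \<longlonglongrightarrow> g x" by (simp add: AE_completion_iff)
  moreover have "AE x in lebesgue. g x = f x" using ae eq by (auto elim!: eventually_mono)
  ultimately show ?thesis using gb h(2) by (intro that) auto
qed

lemma nn_integral_translate:
  fixes F :: "real^'n::finite \<Rightarrow> ennreal"
  assumes [measurable]: "F \<in> borel_measurable borel"
  shows "(\<integral>\<^sup>+x. F (x + t) \<partial>lborel) = (\<integral>\<^sup>+x. F x \<partial>lborel)"
proof -
  have "(\<integral>\<^sup>+x. F (t + x) \<partial>lborel) = (\<integral>\<^sup>+x. F x \<partial>lborel)"
    using nn_integral_distr[of "\<lambda>x. t + x" lborel borel F] lborel_distr_plus[of t] by simp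
  then show ?thesis by (simp add: add.commute)
qed

lemma nn_integral_uminus:
  fixes F :: "real^'n::finite \<Rightarrow> ennreal"
  assumes [measurable]: "F \<in> borel_measurable borel"
  shows "(\<integral>\<^sup>+x. F (- x) \<partial>lborel) = (\<integral>\<^sup>+x. F x \<partial>lborel)"
proof -
  have "lborel = density (distr lborel borel (\<lambda>x::real^'n. 0 + (-1) *\<^sub>R x)) (\<lambda>_. ennreal (\<bar>-1\<bar> ^ DIM(real^'n)))"
    by (rule lborel_affine) simp
  then have "lborel = distr lborel borel (\<lambda>x::real^'n. - x)" by (simp add: density_1 )
  then have "(\<integral>\<^sup>+x. F x \<partial>lborel) = (\<integral>\<^sup>+x. F x \<partial>distr lborel borel (\<lambda>x::real^'n. - x))" by simp
  also have "\<dots> = (\<integral>\<^sup>+x. F (- x) \<partial>lborel)" by (subst nn_integral_distr) auto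
  finally show ?thesis by simp
qed

lemma norm_add_power_le:
  fixes a b :: "'b::real_normed_vector"
  shows "norm (a + b) ^ p \<le> 2 ^ p * (norm a ^ p + norm b ^ p)"
proof -
  have "norm (a + b) ^ p \<le> (2 * max (norm a) (norm b)) ^ p"
    using norm_triangle_ineq[of a b] by (intro power_mono) auto
  also have "\<dots> = 2 ^ p * max (norm a) (norm b) ^ p" by (simp add: power_mult_distrib)
  also have "max (norm a) (norm b) ^ p \<le> norm a ^ p + norm b ^ p" by (auto simp: max_def)
  finally show ?thesis by simp
qed

lemma nn_integral_norm_add_power_le:
  fixes f g :: "'a \<Rightarrow> 'b::euclidean_space"
  assumes [measurable]: "f \<in> borel_measurable M" "g \<in> borel_measurable M"
  shows "(\<integral>\<^sup>+x. ennreal (norm (f x + g x) ^ p) \<partial>M)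
     \<le> 2 ^ p * ((\<integral>\<^sup>+x. ennreal (norm (f x) ^ p) \<partial>M) + (\<integral>\<^sup>+x. ennreal (norm (g x) ^ p) \<partial>M))"
proof -
  have "(\<integral>\<^sup>+x. ennreal (norm (f x + g x) ^ p) \<partial>M) \<le>
     (\<integral>\<^sup>+x. ennreal (2 ^ p) * (ennreal (norm (f x) ^ p) + ennreal (norm (g x) ^ p)) \<partial>M)"
    by (intro nn_integral_mono) (simp add: norm_add_power_le flip: ennreal_mult ennreal_plus)
  also have "\<dots> = ennreal (2 ^ p) * ((\<integral>\<^sup>+x. ennreal (norm (f x) ^ p) \<partial>M) + (\<integral>\<^sup>+x. ennreal (norm (g x) ^ p) \<partial>M))"
    by (subst nn_integral_cmult, measurable) (simp add: nn_integral_add)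
  finally show ?thesis by (simp add: ennreal_power flip: ennreal_numeral)
qed

section \<open>Density of continuous functions and continuity of translations\<close>

text \<open>For positive \<open>m\<close> this is the radial retraction onto the ball of radius
  \<open>m\<close>; the form with \<open>max\<close> makes its continuity immediate.\<close>

definition clip :: "real \<Rightarrow> 'b::real_normed_vector \<Rightarrow> 'b" where
  "clip m v = (m / max m (norm v)) *\<^sub>R v"

lemma norm_clip: "m > 0 \<Longrightarrow> norm (clip m v) \<le> m"
  unfolding clip_def by (simp add: divide_le_eq max_def)

lemma norm_clip_le: "m > 0 \<Longrightarrow> norm (clip m v) \<le> norm v"
  unfolding clip_def
  by (simp add: divide_le_eq) (metis max.cobounded1 max.commute mult.commute mult_left_mono norm_ge_zero)

lemma clip_id: "m > 0 \<Longrightarrow> norm v \<le> m \<Longrightarrow> clip m v = v"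
  by (simp add: clip_def max_def)

lemma continuous_clip: "m > 0 \<Longrightarrow> continuous_on S (clip m)"
  unfolding clip_def by (intro continuous_intros) auto

lemma clip_measurable: "m > 0 \<Longrightarrow> clip m \<in> borel_measurable borel"
  by (intro borel_measurable_continuous_onI continuous_clip)

text \<open>Almost everywhere convergence of continuous functions carries no bound. Clipping
  \<open>f\<close> at a large height costs little by domination with the p-th power of
  \<open>f\<close>; clipping and cutting off the approximants then bounds them on a fixed ball, so
  dominated convergence applies a second time.\<close>

lemma continuous_dense_Lp:
  fixes f :: "real^'n::finite \<Rightarrow> 'b::euclidean_space"
  assumes f [measurable]: "f \<in> borel_measurable borel"
    and f0: "\<And>x. R < norm x \<Longrightarrow> f x = 0"
    and fin: "(\<integral>\<^sup>+x. ennreal (norm (f x) ^ p) \<partial>lborel) < \<infinity>" and p: "p \<ge> 1" and e: "e > (0::real)"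
  obtains g where "continuous_on UNIV g" "\<And>x. R + 1 < norm x \<Longrightarrow> g x = 0"
    "(\<integral>\<^sup>+x. ennreal (norm (f x - g x) ^ p) \<partial>lborel) < ennreal e"
proof -
  obtain h f' where h: "\<And>n. continuous_on UNIV (h n)" "AE x in lborel. (\<lambda>n::nat. h n x) \<longlonglongrightarrow> f' x"
    "AE x in lborel. f' x = f x"
  proof -
    have "f \<in> borel_measurable lebesgue" using f by (simp add: measurable_completion)
    from borel_representative[OF this] obtain g h where gh: "g \<in> borel_measurable borel" "AE x in lebesgue. g x = f x"
      "\<forall>n::nat. continuous_on UNIV (h n)" "AE x in lborel. (\<lambda>n. h n x) \<longlonglongrightarrow> g x" .
    show ?thesis using gh(2,3) by (intro that[OF _ gh(4)]) (simp_all add: AE_completion_iff)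
  qed
  have hc: "AE x in lborel. (\<lambda>n::nat. h n x) \<longlonglongrightarrow> f x" using h(2,3) by eventually_elim simp
  \<comment> \<open>There are two errors below \<open>e'\<close>, and the triangle inequality for
    p-th powers costs \<open>2 ^ p\<close>; the total \<open>2 / 3 * e\<close> leaves room for the
    strict inequality.\<close>
  define e' where "e' = e / (2 ^ p * 3)"
  have [measurable]: "clip (real (Suc m)) \<in> borel_measurable (borel :: 'b measure)" for m
    by (rule clip_measurable) simp
  have "((\<lambda>m. \<integral>\<^sup>+x. ennreal (norm (f x - clip (real (Suc m)) (f x)) ^ p) \<partial>lborel) \<longlonglongrightarrow> (\<integral>\<^sup>+x. 0 \<partial>(lborel :: (real^'n) measure)))"
  proof (rule nn_integral_dominated_convergence[where w="\<lambda>x. ennreal (2 ^ p) * ennreal (2 * norm (f x) ^ p)"])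
    show "AE x in lborel. ennreal (norm (f x - clip (real (Suc m)) (f x)) ^ p) \<le> ennreal (2 ^ p) * ennreal (2 * norm (f x) ^ p)" for m
    proof (intro AE_I2)
      fix x
      have "norm (f x - clip (real (Suc m)) (f x)) ^ p \<le> 2 ^ p * (norm (f x) ^ p + norm (clip (real (Suc m)) (f x)) ^ p)"
        using norm_add_power_le[of "f x" "- clip (real (Suc m)) (f x)" p] by simp
      also have "\<dots> \<le> 2 ^ p * (norm (f x) ^ p + norm (f x) ^ p)"
        by (intro mult_left_mono add_left_mono power_mono norm_clip_le) auto
      finally show "ennreal (norm (f x - clip (real (Suc m)) (f x)) ^ p) \<le> ennreal (2 ^ p) * ennreal (2 * norm (f x) ^ p)"
        by (simp flip: ennreal_mult)
    qed
    show "(\<integral>\<^sup>+x. ennreal (2 ^ p) * ennreal (2 * norm (f x) ^ p) \<partial>lborel) < \<infinity>"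
      using fin by (simp add: nn_integral_cmult ennreal_mult_less_top ennreal_mult'')
    show "AE x in lborel. (\<lambda>m. ennreal (norm (f x - clip (real (Suc m)) (f x)) ^ p)) \<longlonglongrightarrow> 0"
    proof (intro AE_I2 tendsto_eventually)
      fix x
      obtain m0 where "norm (f x) \<le> real m0" using real_arch_simple by blast
      then show "\<forall>\<^sub>F m in sequentially. ennreal (norm (f x - clip (real (Suc m)) (f x)) ^ p) = 0"
        using p by (intro eventually_sequentiallyI[of m0]) (simp add: clip_id)
    qed
  qed (use f in measurable)
  moreover have e': "e' > 0" using e by (simp add: e'_def)
  ultimately have "\<forall>\<^sub>F m in sequentially. (\<integral>\<^sup>+x. ennreal (norm (f x - clip (real (Suc m)) (f x)) ^ p) \<partial>lborel) < ennreal e'"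
    by (auto simp: order_tendsto_iff)
  then obtain m where m: "(\<integral>\<^sup>+x. ennreal (norm (f x - clip (real (Suc m)) (f x)) ^ p) \<partial>lborel) < ennreal e'"
    using eventually_sequentially by auto
  define M where "M = real (Suc m)"
  have M: "M > 0" by (simp add: M_def)
  have [measurable]: "cball (0::real^'n) (R + 1) \<in> sets borel" by simp
  define cut where "cut x = max 0 (min 1 (R + 1 - norm x))" for x :: "real^'n"
  have cutc: "continuous_on UNIV cut" unfolding cut_def by (intro continuous_intros)
  then have [measurable]: "cut \<in> borel_measurable borel" by (rule borel_measurable_continuous_onI)
  have cutb: "0 \<le> cut x" "cut x \<le> 1" for x by (auto simp: cut_def)
  have cutf: "cut x *\<^sub>R clip M (f x) = clip M (f x)" for x
    using f0[of x] by (cases "R < norm x") (auto simp: cut_def clip_def)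
  define G where "G n x = cut x *\<^sub>R clip M (h n x)" for n x
  have hcont [measurable]: "h n \<in> borel_measurable borel" for n using h(1) by (rule borel_measurable_continuous_onI)
  have [measurable]: "clip M \<in> borel_measurable (borel :: 'b measure)" by (rule clip_measurable[OF M])
  have Gc: "continuous_on UNIV (G n)" for n
    unfolding G_def by (intro continuous_intros cutc continuous_on_compose2[OF continuous_clip[OF M] h(1)]) auto
  then have [measurable]: "G n \<in> borel_measurable borel" for n by (rule borel_measurable_continuous_onI)
  have "((\<lambda>n. \<integral>\<^sup>+x. ennreal (norm (clip M (f x) - G n x) ^ p) \<partial>lborel) \<longlonglongrightarrow> (\<integral>\<^sup>+x. 0 \<partial>(lborel :: (real^'n) measure)))"
  proof (rule nn_integral_dominated_convergence[where w="\<lambda>x. ennreal ((2*M) ^ p) * indicator (cball 0 (R+1)) x"])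
    show "AE x in lborel. ennreal (norm (clip M (f x) - G n x) ^ p) \<le> ennreal ((2*M) ^ p) * indicator (cball 0 (R+1)) x" for n
    proof (intro AE_I2)
      fix x
      show "ennreal (norm (clip M (f x) - G n x) ^ p) \<le> ennreal ((2*M) ^ p) * indicator (cball 0 (R+1)) x"
      proof (cases "norm x \<le> R + 1")
        case True
        have "norm (G n x) \<le> 1 * M" unfolding G_def norm_scaleR
          by (intro mult_mono) (use cutb[of x] norm_clip[OF M] in auto)
        then have "norm (clip M (f x) - G n x) \<le> 2 * M"
          using norm_triangle_ineq4[of "clip M (f x)" "G n x"] norm_clip[OF M, of "f x"] by simp
        from power_mono[OF this norm_ge_zero, of p] show ?thesis using True by (simp add: power_mult_distrib ennreal_leI)
      next
        case False
        then have "f x = 0" "cut x = 0" using f0 by (auto simp: cut_def)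
        then show ?thesis using p by (simp add: G_def clip_def power_0_left)
      qed
    qed
    show "(\<integral>\<^sup>+x. ennreal ((2*M) ^ p) * indicator (cball 0 (R+1)) x \<partial>(lborel :: (real^'n) measure)) < \<infinity>"
      using emeasure_lborel_cball_finite[of "0::real^'n" "R + 1"]
      by (subst nn_integral_cmult_indicator) (simp_all add: ennreal_mult_less_top)
    show "AE x in lborel. (\<lambda>n. ennreal (norm (clip M (f x) - G n x) ^ p)) \<longlonglongrightarrow> 0"
      using hc
    proof eventually_elim
      case (elim x)
      have "isCont (clip M :: 'b \<Rightarrow> 'b) (f x)" using continuous_clip[OF M, of UNIV] continuous_on_eq_continuous_at by blast
      then have "(\<lambda>n. clip M (h n x)) \<longlonglongrightarrow> clip M (f x)"
        using isCont_tendsto_compose[OF _ elim] by blast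
      then have "(\<lambda>n. norm (clip M (f x) - G n x) ^ p) \<longlonglongrightarrow> norm (clip M (f x) - cut x *\<^sub>R clip M (f x)) ^ p"
        unfolding G_def by (intro tendsto_intros)
      moreover have "norm (clip M (f x) - cut x *\<^sub>R clip M (f x)) ^ p = 0" using p by (simp add: cutf power_0_left)
      ultimately have "(\<lambda>n. norm (clip M (f x) - G n x) ^ p) \<longlonglongrightarrow> 0" by (simp only:)
      then show ?case using tendsto_ennrealI by fastforce
    qed
  qed (use f in measurable)
  then have "\<forall>\<^sub>F n in sequentially. (\<integral>\<^sup>+x. ennreal (norm (clip M (f x) - G n x) ^ p) \<partial>lborel) < ennreal e'"
    using e' by (auto simp: order_tendsto_iff)
  then obtain n where n: "(\<integral>\<^sup>+x. ennreal (norm (clip M (f x) - G n x) ^ p) \<partial>lborel) < ennreal e'"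
    using eventually_sequentially by auto
  have "(\<integral>\<^sup>+x. ennreal (norm (f x - G n x) ^ p) \<partial>lborel) = (\<integral>\<^sup>+x. ennreal (norm ((f x - clip M (f x)) + (clip M (f x) - G n x)) ^ p) \<partial>lborel)"
    by simp
  also have "\<dots> \<le> 2 ^ p * ((\<integral>\<^sup>+x. ennreal (norm (f x - clip M (f x)) ^ p) \<partial>lborel) + (\<integral>\<^sup>+x. ennreal (norm (clip M (f x) - G n x) ^ p) \<partial>lborel))"
    by (rule nn_integral_norm_add_power_le) measurable
  also have "\<dots> \<le> 2 ^ p * (ennreal e' + ennreal e')"
    using m n by (intro mult_left_mono add_mono) (auto simp: M_def)
  also have "\<dots> = ennreal (2 ^ p * (e' + e'))"
    using e' by (simp add: ennreal_power flip: ennreal_numeral ennreal_mult ennreal_plus)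
  also have "2 ^ p * (e' + e') = e * (2/3)" by (simp add: e'_def field_simps)
  also have "ennreal (e * (2/3)) < ennreal e" using e by (simp add: ennreal_lessI)
  finally have "(\<integral>\<^sup>+x. ennreal (norm (f x - G n x) ^ p) \<partial>lborel) < ennreal e" .
  moreover have "G n x = 0" if "R + 1 < norm x" for x using that by (auto simp: G_def cut_def)
  ultimately show ?thesis using Gc that by blast
qed

text \<open>A compactly supported continuous \<open>g\<close> near \<open>f\<close> is uniformly
  continuous, so its translates are uniformly close on a ball of finite volume. Translation
  invariance makes the two errors between \<open>f\<close> and \<open>g\<close> equal.\<close>

lemma Lp_translation_continuous:
  fixes f :: "real^'n::finite \<Rightarrow> 'b::euclidean_space"
  assumes f [measurable]: "f \<in> borel_measurable borel"
    and f0: "\<And>x. R < norm x \<Longrightarrow> f x = 0"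
    and fin: "(\<integral>\<^sup>+x. ennreal (norm (f x) ^ p) \<partial>lborel) < \<infinity>" and p: "p \<ge> 1" and e: "e > (0::real)"
  obtains d where "d > 0" "\<And>z. norm z < d \<Longrightarrow> (\<integral>\<^sup>+x. ennreal (norm (f (x - z) - f x) ^ p) \<partial>lborel) \<le> ennreal e"
proof -
  \<comment> \<open>Three errors, and two applications of the triangle inequality for p-th powers
    with factor \<open>2 ^ p\<close> each, give \<open>4 ^ p * 3\<close>.\<close>
  define e' where "e' = e / (4 ^ p * 3)"
  have e': "e' > 0" using e by (simp add: e'_def)
  from continuous_dense_Lp[OF f f0 fin p, where e="e'"] e' obtain g where
    g: "continuous_on UNIV g" "\<And>x. R + 1 < norm x \<Longrightarrow> g x = 0"
    "(\<integral>\<^sup>+x. ennreal (norm (f x - g x) ^ p) \<partial>lborel) < ennreal e'" by auto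
  have [measurable]: "g \<in> borel_measurable borel" using g(1) by (rule borel_measurable_continuous_onI)
  define v where "v = measure lborel (cball 0 (R + 2) :: (real^'n) set) + 1"
  have v: "v > 0" by (simp add: v_def add_nonneg_pos)
  \<comment> \<open>The bound \<open>q \<le> 1\<close> allows \<open>q ^ p\<close> to be replaced by
    \<open>q\<close>, and \<open>q * v \<le> e'\<close> makes the integral over a ball of volume
    below \<open>v\<close> small.\<close>
  define q where "q = min 1 (e' / v)"
  have q: "q > 0" "q \<le> 1" "q * v \<le> e'" using e' v by (auto simp: q_def min_def field_simps)
  \<comment> \<open>For shifts shorter than one, a point of the ball of radius \<open>R + 2\<close>
    stays in the ball of radius \<open>R + 3\<close>, while outside \<open>R + 2\<close> both the
    point and its shift lie where \<open>g\<close> vanishes.\<close>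
  have "uniformly_continuous_on (cball 0 (R + 3)) g"
    by (intro compact_uniformly_continuous continuous_on_subset[OF g(1)]) auto
  then obtain d where d: "d > 0" "\<And>x y. norm x \<le> R + 3 \<Longrightarrow> norm y \<le> R + 3 \<Longrightarrow> dist y x < d \<Longrightarrow> dist (g y) (g x) < q"
    unfolding uniformly_continuous_on_def using q(1) by (metis mem_cball_0)
  have gb: "norm (g (x - z) - g x) ^ p \<le> q * indicator (cball 0 (R + 2)) x" if z: "norm z < min d 1" for x z
  proof (cases "norm x \<le> R + 2")
    case True
    have "norm (x - z) \<le> R + 3" using True z norm_triangle_ineq4[of x z] by auto
    then have "dist (g (x - z)) (g x) < q" using True z by (intro d(2)) (auto simp: dist_norm)
    then have "norm (g (x - z) - g x) ^ p \<le> q ^ p" by (intro power_mono) (auto simp: dist_norm)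
    also have "\<dots> \<le> q ^ 1" using q p by (intro power_decreasing) auto
    finally show ?thesis using True by simp
  next
    case False
    moreover have "norm (x - z) > R + 1" using False z norm_triangle_ineq2[of x z] by auto
    ultimately show ?thesis using g(2)[of x] g(2)[of "x - z"] p by (simp add: power_0_left)
  qed
  have "(\<integral>\<^sup>+x. ennreal (norm (f (x - z) - f x) ^ p) \<partial>lborel) \<le> ennreal e" if z: "norm z < min d 1" for z
  proof -
    have I1: "(\<integral>\<^sup>+x. ennreal (norm (f (x - z) - g (x - z)) ^ p) \<partial>lborel) \<le> ennreal e'"
      using nn_integral_translate[of "\<lambda>x. ennreal (norm (f x - g x) ^ p)" "- z"] g(3) by simp
    have I3: "(\<integral>\<^sup>+x. ennreal (norm (g x - f x) ^ p) \<partial>lborel) \<le> ennreal e'"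
      using g(3) by (simp add: norm_minus_commute)
    have "(\<integral>\<^sup>+x. ennreal (norm (g (x - z) - g x) ^ p) \<partial>lborel) \<le> (\<integral>\<^sup>+x. ennreal q * indicator (cball 0 (R + 2)) x \<partial>(lborel :: (real^'n) measure))"
    proof (rule nn_integral_mono)
      fix x
      show "ennreal (norm (g (x - z) - g x) ^ p) \<le> ennreal q * indicator (cball 0 (R + 2)) x"
        using ennreal_leI[OF gb[OF z, of x]] by (auto simp: indicator_def split: if_splits)
    qed
    also have "\<dots> = ennreal (q * measure lborel (cball 0 (R + 2) :: (real^'n) set))"
      using q emeasure_lborel_cball_finite[of "0::real^'n" "R + 2"]
      by (simp add: nn_integral_cmult_indicator emeasure_eq_ennreal_measure less_top ennreal_mult)
    also have "\<dots> \<le> ennreal e'"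
      using q v by (intro ennreal_leI) (auto simp: v_def algebra_simps)
    finally have I2: "(\<integral>\<^sup>+x. ennreal (norm (g (x - z) - g x) ^ p) \<partial>lborel) \<le> ennreal e'" .
    have "(\<integral>\<^sup>+x. ennreal (norm (f (x - z) - f x) ^ p) \<partial>lborel)
        = (\<integral>\<^sup>+x. ennreal (norm ((f (x - z) - g (x - z)) + ((g (x - z) - g x) + (g x - f x))) ^ p) \<partial>lborel)" by simp
    also have "\<dots> \<le> 2 ^ p * ((\<integral>\<^sup>+x. ennreal (norm (f (x - z) - g (x - z)) ^ p) \<partial>lborel) +
        (\<integral>\<^sup>+x. ennreal (norm ((g (x - z) - g x) + (g x - f x)) ^ p) \<partial>lborel))"
      by (rule nn_integral_norm_add_power_le) measurable
    also have "\<dots> \<le> 2 ^ p * (ennreal e' + 2 ^ p * (ennreal e' + ennreal e'))"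
      by (intro mult_left_mono add_mono I1 order_trans[OF nn_integral_norm_add_power_le] I2 I3) auto
    also have "\<dots> = ennreal (2 ^ p * (e' + 2 ^ p * (e' + e')))"
      using e' by (simp add: ennreal_power flip: ennreal_numeral ennreal_plus ennreal_mult)
    also have "\<dots> \<le> ennreal e"
    proof (rule ennreal_leI)
      have "2 ^ p * (e' + 2 ^ p * (e' + e')) \<le> 2 ^ p * (2 ^ p * e' + 2 ^ p * (e' + e'))"
        using e' by (intro mult_left_mono add_right_mono) (auto simp: mult_le_cancel_right1)
      also have "\<dots> = (2 ^ p * 2 ^ p) * 3 * e'" by (simp add: algebra_simps)
      also have "(2 ^ p * 2 ^ p) = (4 ^ p :: real)" by (simp flip: power_mult_distrib)
      finally show "2 ^ p * (e' + 2 ^ p * (e' + e')) \<le> e" by (simp add: e'_def)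
    qed
    finally show ?thesis .
  qed
  then show ?thesis using that[of "min d 1"] d by auto
qed

section \<open>Mollifiers and Jensen's inequality\<close>

text \<open>Divided by \<open>m ^ p\<close>, this is Bernoulli's inequality for
  \<open>x / m - 1 \<ge> -1\<close>. It is the supporting line of a convex power on which Jensen's
  inequality rests.\<close>

lemma power_tangent_le:
  fixes m x :: real
  assumes "m \<ge> 0" "x \<ge> 0" "p \<ge> 1"
  shows "m ^ p + real p * m ^ (p - 1) * (x - m) \<le> x ^ p"
proof (cases "m = 0")
  case True
  then show ?thesis using assms by (cases "p = 1") (auto simp: power_0_left)
next
  case False
  then have m: "m > 0" using assms by simp
  have "1 + real p * (x / m - 1) \<le> (1 + (x / m - 1)) ^ p"
    using assms m by (intro Bernoulli_inequality) auto
  then have "m ^ p * (1 + real p * (x / m - 1)) \<le> m ^ p * (x / m) ^ p"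
    using m by (intro mult_left_mono) auto
  also have "\<dots> = x ^ p" using m by (simp add: power_divide)
  also have "m ^ p * (1 + real p * (x / m - 1)) = m ^ p + real p * m ^ (p - 1) * (x - m)"
    using m assms by (cases p) (auto simp: field_simps)
  finally show ?thesis .
qed

text \<open>Integrating the tangent inequality at the mean against the weight removes the linear
  term. The right side is taken in \<open>ennreal\<close>, so that its divergence becomes a trivial
  case and integrability of the power has to be known only in the other one.\<close>

lemma jensen_power:
  fixes w X :: "'a \<Rightarrow> real"
  assumes [measurable]: "w \<in> borel_measurable M" "X \<in> borel_measurable M"
    and w: "\<And>x. w x \<ge> 0" "integrable M w" "(LINT x|M. w x) = 1" and X: "\<And>x. X x \<ge> 0"
    and wX: "integrable M (\<lambda>x. w x * X x)" and p: "p \<ge> 1"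
  shows "ennreal ((LINT x|M. w x * X x) ^ p) \<le> (\<integral>\<^sup>+x. ennreal (w x * X x ^ p) \<partial>M)"
proof (cases "(\<integral>\<^sup>+x. ennreal (w x * X x ^ p) \<partial>M) = \<infinity>")
  case False
  then have int: "integrable M (\<lambda>x. w x * X x ^ p)"
    using w X by (intro integrableI_nonneg) (auto simp: less_top)
  define m where "m = (LINT x|M. w x * X x)"
  have m: "m \<ge> 0" unfolding m_def using w X by (intro integral_nonneg_AE) auto
  have "m ^ p = (LINT x|M. m ^ p * w x + real p * m ^ (p - 1) * (w x * X x - m * w x))"
    using w wX by (simp add: m_def)
  also have "\<dots> \<le> (LINT x|M. w x * X x ^ p)"
  proof (rule integral_mono)
    fix x
    have "w x * (m ^ p + real p * m ^ (p - 1) * (X x - m)) \<le> w x * X x ^ p"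
      by (intro mult_left_mono power_tangent_le m X p w)
    then show "m ^ p * w x + real p * m ^ (p - 1) * (w x * X x - m * w x) \<le> w x * X x ^ p"
      by (simp add: algebra_simps)
  qed (use w wX int in auto)
  finally have "ennreal (m ^ p) \<le> ennreal (LINT x|M. w x * X x ^ p)" by (rule ennreal_leI)
  also have "\<dots> = (\<integral>\<^sup>+x. ennreal (w x * X x ^ p) \<partial>M)"
    using int w X by (intro nn_integral_eq_integral[symmetric]) auto
  finally show ?thesis by (simp add: m_def)
qed auto

text \<open>Normalizing by the integral of the rescaled bump itself gives total mass one without
  computing a Jacobian.\<close>

definition mol :: "real \<Rightarrow> real^'n::finite \<Rightarrow> real" where
  "mol r x = bump ((1 / r) *\<^sub>R x) / (LINT y|lborel. bump ((1 / r) *\<^sub>R y :: real^'n))"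

definition conv :: "(real^'n::finite \<Rightarrow> real) \<Rightarrow> (real^'n \<Rightarrow> 'b::euclidean_space) \<Rightarrow> real^'n \<Rightarrow> 'b" where
  "conv \<eta> f x = (LINT y|lebesgue. \<eta> (x - y) *\<^sub>R f y)"

lemma integrable_continuous_zero_outside:
  fixes f :: "real^'n::finite \<Rightarrow> 'b::euclidean_space"
  assumes "continuous_on UNIV f" "\<And>x. r < norm x \<Longrightarrow> f x = 0"
  shows "integrable lborel f"
proof -
  have "integrable lborel (\<lambda>x. indicator (cball 0 r) x *\<^sub>R f x)"
    by (intro borel_integrable_compact continuous_on_subset[OF assms(1)]) auto
  also have "(\<lambda>x. indicator (cball 0 r) x *\<^sub>R f x) = f"
    using assms(2) by (auto simp: fun_eq_iff indicator_def not_le)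
  finally show ?thesis .
qed

lemma bump_scaled:
  assumes "r > 0"
  shows "continuous_on UNIV (\<lambda>y::real^'n::finite. bump ((1 / r) *\<^sub>R y))"
    "r \<le> norm x \<Longrightarrow> bump ((1 / r) *\<^sub>R (x::real^'n)) = 0"
    "integrable lborel (\<lambda>y::real^'n. bump ((1 / r) *\<^sub>R y))"
    "(LINT y|lborel. bump ((1 / r) *\<^sub>R y :: real^'n)) > 0"
proof -
  show 1: "continuous_on UNIV (\<lambda>y::real^'n. bump ((1 / r) *\<^sub>R y))"
    using smooth_continuous[OF smooth_affine[OF smooth_bump, of "1/r" 0]] by simp
  show 2: "bump ((1 / r) *\<^sub>R x) = 0" if "r \<le> norm x" for x :: "real^'n"
    using bump_pos_iff[of "(1 / r) *\<^sub>R x"] bump_nonneg[of "(1 / r) *\<^sub>R x"] that assms by (auto simp: field_simps)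
  show 3: "integrable lborel (\<lambda>y::real^'n. bump ((1 / r) *\<^sub>R y))"
    by (rule integrable_continuous_zero_outside[OF 1, of r]) (use 2 in auto)
  have "(LINT y|lborel. bump ((1 / r) *\<^sub>R y :: real^'n)) \<noteq> 0"
  proof
    assume "(LINT y|lborel. bump ((1 / r) *\<^sub>R y :: real^'n)) = 0"
    then have "AE y in lborel. bump ((1 / r) *\<^sub>R y :: real^'n) = 0"
      using integral_nonneg_eq_0_iff_AE[OF 3] bump_nonneg by auto
    then have "AE y in lborel. y \<notin> ball (0::real^'n) r"
    proof eventually_elim
      case (elim y) then show ?case using bump_pos_iff[of "(1 / r) *\<^sub>R y"] assms by (auto simp: field_simps)
    qed
    then have "ball (0::real^'n) r \<in> null_sets lborel" by (subst AE_iff_null_sets) auto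
    then have "negligible (ball (0::real^'n) r)"
      by (simp add: negligible_iff_null_sets null_sets_completionI)
    then show False using assms open_not_negligible[of "ball (0::real^'n) r"] by auto
  qed
  moreover have "(LINT y|lborel. bump ((1 / r) *\<^sub>R y :: real^'n)) \<ge> 0"
    by (intro integral_nonneg_AE) (auto simp: bump_nonneg)
  ultimately show "(LINT y|lborel. bump ((1 / r) *\<^sub>R y :: real^'n)) > 0" by simp
qed

lemma mol_properties:
  assumes r: "r > 0"
  shows "smooth (mol r :: real^'n::finite \<Rightarrow> real)" "mol r (x::real^'n) \<ge> 0" "r \<le> norm x \<Longrightarrow> mol r x = 0"
    "integrable lborel (mol r :: real^'n \<Rightarrow> real)" "(LINT x|lborel. mol r (x::real^'n)) = 1"
    "(mol r :: real^'n \<Rightarrow> real) \<in> borel_measurable borel"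
    "\<exists>B. \<forall>x::real^'n. mol r x \<le> B"
proof -
  let ?I = "(LINT y|lborel. bump ((1 / r) *\<^sub>R y :: real^'n))"
  have "smooth (\<lambda>x::real^'n. (1 / ?I) *\<^sub>R bump ((1 / r) *\<^sub>R x + 0))"
    by (intro smooth_scaleR smooth_const smooth_affine smooth_bump)
  then show s: "smooth (mol r :: real^'n \<Rightarrow> real)" by (simp add: mol_def[abs_def])
  show "mol r (x::real^'n) \<ge> 0"
    unfolding mol_def by (intro divide_nonneg_pos bump_nonneg bump_scaled(4)[OF r])
  show z: "mol r x = 0" if "r \<le> norm x" for x :: "real^'n" using bump_scaled(2)[OF r that] by (simp add: mol_def)
  show "integrable lborel (mol r :: real^'n \<Rightarrow> real)"
    unfolding mol_def[abs_def] by (intro integrable_divide bump_scaled(3)[OF r])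
  show "(LINT x|lborel. mol r (x::real^'n)) = 1" using bump_scaled(3,4)[OF r, where 'n='n] by (simp add: mol_def)
  show "(mol r :: real^'n \<Rightarrow> real) \<in> borel_measurable borel"
    using smooth_continuous[OF s] by (rule borel_measurable_continuous_onI)
  have "\<exists>M\<ge>0. \<forall>x::real^'n. norm (mol r x) \<le> M"
    by (rule continuous_zero_outside_bounded[OF smooth_continuous[OF s], of r]) (use z in auto)
  then show "\<exists>B. \<forall>x::real^'n. mol r x \<le> B" by (auto simp: abs_le_iff)
qed

lemma integrable_lborel_shift:
  fixes f :: "real^'n::finite \<Rightarrow> 'b::euclidean_space"
  assumes "integrable lborel f"
  shows "integrable lborel (\<lambda>y. f (x - y))" "(LINT y|lborel. f (x - y)) = (LINT y|lborel. f y)"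
proof -
  have [measurable]: "f \<in> borel_measurable borel" using assms by auto
  have "lborel = density (distr lborel borel (\<lambda>y::real^'n. x + (-1) *\<^sub>R y)) (\<lambda>_. ennreal (\<bar>-1\<bar> ^ DIM(real^'n)))"
    by (rule lborel_affine) simp
  then have eq: "distr lborel borel (\<lambda>y::real^'n. x - y) = lborel" by (simp add: density_1)
  show "integrable lborel (\<lambda>y. f (x - y))"
    using integrable_distr_eq[of "\<lambda>y. x - y" lborel borel f] assms eq by simp
  show "(LINT y|lborel. f (x - y)) = (LINT y|lborel. f y)"
    using integral_distr[of "\<lambda>y. x - y" lborel borel f] eq by simp
qed

text \<open>The kernel is a probability density, so Jensen bounds the p-th power of the error at
  \<open>x\<close> by the average of the p-th power of \<open>f (x - z) - f x\<close>. Tonelli moves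
  the integral in \<open>x\<close> inside, where the hypothesis applies for
  \<open>norm z < r\<close>; for all other \<open>z\<close> the kernel is zero.\<close>

lemma conv_Lp_bound:
  fixes f :: "real^'n::finite \<Rightarrow> 'b::euclidean_space"
  assumes f [measurable]: "f \<in> borel_measurable borel" and fi: "integrable lborel f"
    and r: "r > 0" and p: "p \<ge> 1"
    and b: "\<And>z. norm z < r \<Longrightarrow> (\<integral>\<^sup>+x. ennreal (norm (f (x - z) - f x) ^ p) \<partial>lborel) \<le> ennreal e"
  shows "(\<integral>\<^sup>+x. ennreal (norm (conv (mol r) f x - f x) ^ p) \<partial>lborel) \<le> ennreal e"
proof -
  note [measurable] = mol_properties(6)[OF r]
  obtain B where B: "\<And>x::real^'n. mol r x \<le> B" using mol_properties(7)[OF r, where 'n='n] by blast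
  note mnn = mol_properties(2)[OF r]
  have pw: "ennreal (norm (conv (mol r) f x - f x) ^ p) \<le> (\<integral>\<^sup>+z. ennreal (mol r z * norm (f (x - z) - f x) ^ p) \<partial>lborel)" for x
  proof -
    have i1: "integrable lborel (\<lambda>y. mol r (x - y))" and v1: "(LINT y|lborel. mol r (x - y)) = 1"
      using integrable_lborel_shift[OF mol_properties(4)[OF r], of x] mol_properties(5)[OF r, where 'n='n] by simp_all
    have i2: "integrable lborel (\<lambda>y. mol r (x - y) *\<^sub>R f y)"
    proof (rule Bochner_Integration.integrable_bound[of _ "\<lambda>y. B *\<^sub>R f y"])
      have "norm (mol r (x - y) *\<^sub>R f y) \<le> norm (B *\<^sub>R f y)" for y
        using B[of "x - y"] mnn[of "x - y"] by (auto intro!: mult_right_mono)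
      then show "AE y in lborel. norm (mol r (x - y) *\<^sub>R f y) \<le> norm (B *\<^sub>R f y)" by simp
    qed (use fi in auto)
    have i3: "integrable lborel (\<lambda>y. mol r (x - y) *\<^sub>R (f y - f x))"
      using i1 i2 by (simp add: scaleR_diff_right)
    have "conv (mol r) f x = (LINT y|lborel. mol r (x - y) *\<^sub>R f y)"
      unfolding conv_def by (intro integral_completion) measurable
    also have "\<dots> - f x = (LINT y|lborel. mol r (x - y) *\<^sub>R (f y - f x))"
      using i1 i2 v1 by (simp add: scaleR_diff_right)
    finally have ceq: "conv (mol r) f x - f x = (LINT y|lborel. mol r (x - y) *\<^sub>R (f y - f x))" .
    have "norm (conv (mol r) f x - f x) \<le> (LINT y|lborel. norm (mol r (x - y) *\<^sub>R (f y - f x)))"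
      unfolding ceq by (rule integral_norm_bound)
    also have "\<dots> = (LINT y|lborel. mol r (x - y) * norm (f y - f x))" by (simp add: mnn)
    finally have "norm (conv (mol r) f x - f x) ^ p \<le> (LINT y|lborel. mol r (x - y) * norm (f y - f x)) ^ p"
      by (intro power_mono) auto
    then have "ennreal (norm (conv (mol r) f x - f x) ^ p) \<le> ennreal ((LINT y|lborel. mol r (x - y) * norm (f y - f x)) ^ p)"
      by (rule ennreal_leI)
    also have "\<dots> \<le> (\<integral>\<^sup>+y. ennreal (mol r (x - y) * norm (f y - f x) ^ p) \<partial>lborel)"
    proof (rule jensen_power)
      show "integrable lborel (\<lambda>y. mol r (x - y) * norm (f y - f x))"
        using integrable_norm[OF i3] by (simp add: mnn)
    qed (use i1 v1 mnn p in \<open>auto simp del: diff_self\<close>)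
    also have "\<dots> = (\<integral>\<^sup>+y. ennreal (mol r (x - (x - y)) * norm (f (x - y) - f x) ^ p) \<partial>lborel)"
    proof -
      let ?H = "\<lambda>y. ennreal (mol r (x - y) * norm (f y - f x) ^ p)"
      have "(\<integral>\<^sup>+y. ?H y \<partial>lborel) = (\<integral>\<^sup>+y. ?H (y + x) \<partial>lborel)"
        by (rule nn_integral_translate[symmetric]) measurable
      also have "\<dots> = (\<integral>\<^sup>+y. ?H (- y + x) \<partial>lborel)"
        by (rule nn_integral_uminus[symmetric]) measurable
      finally show ?thesis by (simp add: add.commute)
    qed
    finally show ?thesis by simp
  qed
  have "(\<integral>\<^sup>+x. ennreal (norm (conv (mol r) f x - f x) ^ p) \<partial>lborel) \<le>
     (\<integral>\<^sup>+x. (\<integral>\<^sup>+z. ennreal (mol r z * norm (f (x - z) - f x) ^ p) \<partial>lborel) \<partial>lborel)"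
    by (intro nn_integral_mono pw)
  also have "\<dots> = (\<integral>\<^sup>+z. (\<integral>\<^sup>+x. ennreal (mol r z * norm (f (x - z) - f x) ^ p) \<partial>lborel) \<partial>lborel)"
    by (rule lborel_pair.Fubini'[symmetric]) measurable
  also have "\<dots> \<le> (\<integral>\<^sup>+z. ennreal (mol r z) * ennreal e \<partial>(lborel :: (real^'n) measure))"
  proof (rule nn_integral_mono)
    fix z
    have "(\<integral>\<^sup>+x. ennreal (mol r z * norm (f (x - z) - f x) ^ p) \<partial>lborel) =
      ennreal (mol r z) * (\<integral>\<^sup>+x. ennreal (norm (f (x - z) - f x) ^ p) \<partial>lborel)"
      by (simp add: nn_integral_cmult ennreal_mult mnn)
    also have "\<dots> \<le> ennreal (mol r z) * ennreal e"
      using b[of z] mol_properties(3)[OF r, of z] by (cases "norm z < r") (auto intro: mult_left_mono)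
    finally show "(\<integral>\<^sup>+x. ennreal (mol r z * norm (f (x - z) - f x) ^ p) \<partial>lborel) \<le> ennreal (mol r z) * ennreal e" .
  qed
  also have "\<dots> = (\<integral>\<^sup>+z. ennreal (mol r (z::real^'n)) \<partial>lborel) * ennreal e"
    by (rule nn_integral_multc) measurable
  also have "(\<integral>\<^sup>+z. ennreal (mol r (z::real^'n)) \<partial>lborel) = 1"
    using nn_integral_eq_integral[OF mol_properties(4)[OF r, where 'n='n]] mol_properties(5)[OF r, where 'n='n] by (simp add: mnn)
  finally show ?thesis by simp
qed

section \<open>Local integrability and local approximation\<close>

lemma Lp_loc_measurable:
  fixes f :: "real^'n::finite \<Rightarrow> 'b::euclidean_space"
  assumes "f \<in> Lp_loc p UNIV"
  shows "f \<in> borel_measurable lebesgue"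
proof (rule borel_measurable_LIMSEQ_metric)
  show "(\<lambda>x. indicator (cball 0 (real n)) x *\<^sub>R f x) \<in> borel_measurable lebesgue" for n
    using assms by (simp add: Lp_loc_def Lp_def set_borel_measurable_def)
  show "(\<lambda>n. indicator (cball 0 (real n)) x *\<^sub>R f x) \<longlonglongrightarrow> f x" for x
  proof (rule tendsto_eventually)
    obtain n0 where "norm x \<le> real n0" using real_arch_simple by blast
    then show "\<forall>\<^sub>F n in sequentially. indicator (cball 0 (real n)) x *\<^sub>R f x = f x"
      by (intro eventually_sequentiallyI[of n0]) auto
  qed
qed

lemma Lp_loc_1:
  fixes f :: "real^'n::finite \<Rightarrow> 'b::euclidean_space"
  assumes "f \<in> Lp_loc p U" "p \<ge> 1"
  shows "f \<in> Lp_loc 1 U"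
  unfolding Lp_loc_def Lp_def
proof (intro CollectI allI impI conjI)
  fix K assume K: "compact K \<and> K \<subseteq> U"
  with assms have m: "set_borel_measurable lebesgue K f" and i: "set_integrable lebesgue K (\<lambda>x. norm (f x) ^ p)"
    by (auto simp: Lp_loc_def Lp_def)
  show "set_borel_measurable lebesgue K f" by (rule m)
  have KL: "K \<in> lmeasurable" using K by (simp add: lmeasurable_compact)
  have "integrable lebesgue (\<lambda>x. indicator K x + indicator K x *\<^sub>R norm (f x) ^ p)"
    using i KL by (intro Bochner_Integration.integrable_add) (auto simp: set_integrable_def fmeasurable_def)
  then show "set_integrable lebesgue K (\<lambda>x. norm (f x) ^ 1)"
    unfolding set_integrable_def
  proof (rule Bochner_Integration.integrable_bound)
    show "(\<lambda>x. indicator K x *\<^sub>R norm (f x) ^ 1) \<in> borel_measurable lebesgue"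
    proof -
      note [measurable] = m[unfolded set_borel_measurable_def]
      have "(\<lambda>x. norm (indicator K x *\<^sub>R f x)) \<in> borel_measurable lebesgue" by measurable
      then show ?thesis by simp
    qed
    have "norm v \<le> 1 + norm v ^ p" for v :: 'b
    proof (cases "norm v \<le> 1")
      case False
      then have "norm v ^ 1 \<le> norm v ^ p" using assms by (intro power_increasing) auto
      then show ?thesis by simp
    qed (simp add: add_increasing2)
    then show "AE x in lebesgue. norm (indicator K x *\<^sub>R norm (f x) ^ 1) \<le> norm (indicator K x + indicator K x *\<^sub>R norm (f x) ^ p)"
      by (intro AE_I2) (auto simp: indicator_def)
  qed
qed

lemma Lp_loc_1_integrable:
  fixes f :: "real^'n::finite \<Rightarrow> 'b::euclidean_space"
  assumes "f \<in> Lp_loc 1 U" "compact K" "K \<subseteq> U"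
  shows "integrable lebesgue (\<lambda>x. indicator K x *\<^sub>R f x)"
proof -
  have "set_borel_measurable lebesgue K f" "set_integrable lebesgue K (\<lambda>x. norm (f x) ^ 1)"
    using assms by (auto simp: Lp_loc_def Lp_def)
  then show ?thesis
    unfolding set_borel_measurable_def set_integrable_def
    by (subst integrable_norm_iff[symmetric]) auto
qed

lemma integrable_mult_Lp_loc:
  fixes f :: "real^'n::finite \<Rightarrow> 'b::euclidean_space" and g :: "real^'n \<Rightarrow> real"
  assumes f: "f \<in> Lp_loc 1 U" and K: "compact K" "K \<subseteq> U" and g: "g \<in> borel_measurable lebesgue"
    "\<And>x. \<bar>g x\<bar> \<le> M" "\<And>x. x \<notin> K \<Longrightarrow> g x = 0"
  shows "integrable lebesgue (\<lambda>x. g x *\<^sub>R f x)"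
proof -
  have i: "integrable lebesgue (\<lambda>x. indicator K x *\<^sub>R f x)" by (rule Lp_loc_1_integrable[OF f K])
  have eq: "(\<lambda>x. g x *\<^sub>R f x) = (\<lambda>x. g x *\<^sub>R (indicator K x *\<^sub>R f x))"
  proof
    fix x show "g x *\<^sub>R f x = g x *\<^sub>R (indicator K x *\<^sub>R f x)" using g(3)[of x] by (cases "x \<in> K") auto
  qed
  show ?thesis unfolding eq
  proof (rule Bochner_Integration.integrable_bound)
    show "integrable lebesgue (\<lambda>x. M *\<^sub>R (indicator K x *\<^sub>R f x))" by (intro integrable_scaleR_right i)
    show "(\<lambda>x. g x *\<^sub>R (indicator K x *\<^sub>R f x)) \<in> borel_measurable lebesgue"
      using i g(1) by measurable
    show "AE x in lebesgue. norm (g x *\<^sub>R indicator K x *\<^sub>R f x) \<le> norm (M *\<^sub>R indicator K x *\<^sub>R f x)"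
      using order_trans[OF g(2) abs_ge_self] by (auto intro!: AE_I2 mult_right_mono simp: indicator_def)
  qed
qed

lemma Lp_loc_nn_finite:
  fixes f :: "real^'n::finite \<Rightarrow> 'b::euclidean_space"
  assumes "f \<in> Lp_loc p U" "compact K" "K \<subseteq> U"
  shows "(\<integral>\<^sup>+x. ennreal (indicator K x * norm (f x) ^ p) \<partial>lebesgue) < \<infinity>"
proof -
  have "integrable lebesgue (\<lambda>x. indicator K x * norm (f x) ^ p)"
    using assms by (auto simp: Lp_loc_def Lp_def set_integrable_def)
  then show ?thesis by (auto simp: integrable_iff_bounded)
qed

lemma conv_zero_outside_cong:
  assumes "\<And>y. r \<le> norm y \<Longrightarrow> \<eta> y = 0" "AE y in lebesgue. norm (x - y) < r \<longrightarrow> f y = g y"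
    and "f \<in> borel_measurable lebesgue" "g \<in> borel_measurable lebesgue" "continuous_on UNIV \<eta>"
  shows "conv \<eta> f x = conv \<eta> g x"
  unfolding conv_def
proof (rule integral_cong_AE)
  have "(\<lambda>y. \<eta> (x - y)) \<in> borel_measurable borel"
    by (intro borel_measurable_continuous_onI continuous_on_compose2[OF assms(5)] continuous_intros) auto
  then have [measurable]: "(\<lambda>y. \<eta> (x - y)) \<in> borel_measurable lebesgue" by (simp add: measurable_completion)
  note [measurable] = assms(3,4)
  show "(\<lambda>y. \<eta> (x - y) *\<^sub>R f y) \<in> borel_measurable lebesgue" "(\<lambda>y. \<eta> (x - y) *\<^sub>R g y) \<in> borel_measurable lebesgue"
    by measurable
  show "AE y in lebesgue. \<eta> (x - y) *\<^sub>R f y = \<eta> (x - y) *\<^sub>R g y"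
    using assms(2)
  proof eventually_elim
    case (elim y)
    then show ?case using assms(1)[of "x - y"] by (cases "norm (x - y) < r") auto
  qed
qed

definition mol_seq :: "nat \<Rightarrow> real^'n::finite \<Rightarrow> real" where
  "mol_seq k = mol (1 / real (Suc k))"

lemma mol_seq_le: "1 / real (Suc k) \<le> 1" "1 / real (Suc k) > 0"
  by (auto simp: divide_le_eq)

lemma tendsto_0_if_eventually_le:
  fixes F :: "nat \<Rightarrow> ennreal"
  assumes "\<And>e::real. e > 0 \<Longrightarrow> \<forall>\<^sub>F k in sequentially. F k \<le> ennreal e"
  shows "F \<longlonglongrightarrow> 0"
  unfolding order_tendsto_iff
proof (intro conjI allI impI)
  fix a :: ennreal assume "0 < a"
  then obtain e where "0 < e" "ennreal e < a"
  proof -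
    obtain b where b: "0 < b" "b < a" using dense[OF \<open>0 < a\<close>] by blast
    then show ?thesis using that by (cases b) auto
  qed
  then show "\<forall>\<^sub>F k in sequentially. F k < a" using assms[of e] by (auto elim!: eventually_mono)
qed auto

lemma tendsto_0_le_ennreal:
  fixes F G :: "nat \<Rightarrow> ennreal"
  assumes "G \<longlonglongrightarrow> 0" "\<And>k. F k \<le> G k"
  shows "F \<longlonglongrightarrow> 0"
  by (rule tendsto_sandwich[OF _ _ tendsto_const assms(1)]) (use assms(2) in auto)

text \<open>The kernels have radius at most one, so on \<open>K\<close> the convolution sees
  \<open>f\<close> only on the ball of radius \<open>R + 1\<close>. There \<open>f\<close> can be
  replaced by a Borel function that vanishes outside this ball, to which the global translation
  estimate applies.\<close>

lemma conv_tendsto_Lp_loc: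
  fixes f :: "real^'n::finite \<Rightarrow> 'b::euclidean_space"
  assumes f: "f \<in> Lp_loc p UNIV" and p: "p \<ge> 1" and K: "compact K"
  shows "(\<lambda>k. \<integral>\<^sup>+x\<in>K. ennreal (norm (conv (mol_seq k) f x - f x) ^ p) \<partial>lebesgue) \<longlonglongrightarrow> 0"
proof -
  obtain R0 where R0: "\<And>x. x \<in> K \<Longrightarrow> norm x \<le> R0" using compact_imp_bounded[OF K] by (auto simp: bounded_iff)
  define R where "R = max R0 0"
  have R: "R \<ge> 0" "\<And>x. x \<in> K \<Longrightarrow> norm x \<le> R" using R0 by (auto simp: R_def le_max_iff_disj)
  define f1 where "f1 x = indicator (cball 0 (R + 1)) x *\<^sub>R f x" for x
  have fm [measurable]: "f \<in> borel_measurable lebesgue" by (rule Lp_loc_measurable[OF f])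
  have [measurable]: "cball (0::real^'n) (R + 1) \<in> sets borel" "cball (0::real^'n) (R + 1) \<in> sets lebesgue" by simp_all
  have f1m [measurable]: "f1 \<in> borel_measurable lebesgue" unfolding f1_def by measurable
  obtain g h where g: "g \<in> borel_measurable borel" "AE x in lebesgue. g x = f1 x"
    "\<forall>n::nat. continuous_on UNIV (h n)" "AE x in lborel. (\<lambda>n. h n x) \<longlonglongrightarrow> g x"
    by (rule borel_representative[OF f1m])
  \<comment> \<open>The representative agrees with \<open>f1\<close> only almost everywhere; cutting
    it off again makes it vanish at every point outside the ball.\<close>
  define f0 where "f0 x = indicator (cball 0 (R + 1)) x *\<^sub>R g x" for x
  note [measurable] = g(1)
  have f0m [measurable]: "f0 \<in> borel_measurable borel" unfolding f0_def by measurable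
  have f0ml [measurable]: "f0 \<in> borel_measurable lebesgue" by (rule measurable_completion) simp
  have f01: "AE x in lebesgue. f0 x = f1 x" using g(2) by eventually_elim (auto simp: f0_def f1_def indicator_def)
  have f0z: "f0 x = 0" if "R + 1 < norm x" for x using that by (simp add: f0_def)
  have "(\<integral>\<^sup>+x. ennreal (norm (f0 x) ^ p) \<partial>lborel) = (\<integral>\<^sup>+x. ennreal (norm (f0 x) ^ p) \<partial>lebesgue)"
    by (simp add: nn_integral_completion)
  also have "\<dots> = (\<integral>\<^sup>+x. ennreal (indicator (cball 0 (R + 1)) x * norm (f x) ^ p) \<partial>lebesgue)"
  proof (rule nn_integral_cong_AE)
    show "AE x in lebesgue. ennreal (norm (f0 x) ^ p) = ennreal (indicator (cball 0 (R + 1)) x * norm (f x) ^ p)"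
      using f01 by eventually_elim (use p in \<open>auto simp: f1_def indicator_def power_0_left\<close>)
  qed
  also have "\<dots> < \<infinity>" by (rule Lp_loc_nn_finite[OF f]) auto
  finally have fin: "(\<integral>\<^sup>+x. ennreal (norm (f0 x) ^ p) \<partial>lborel) < \<infinity>" .
  have "integrable lebesgue f1" unfolding f1_def by (intro Lp_loc_1_integrable[OF Lp_loc_1[OF f p]]) auto
  then have "integrable lebesgue f0" using f01 by (subst integrable_cong_AE[OF f0ml f1m]) auto
  then have fi: "integrable lborel f0" using f0m by (simp add: integrable_completion)
  have pw: "(\<integral>\<^sup>+x\<in>K. ennreal (norm (conv (mol_seq k) f x - f x) ^ p) \<partial>lebesgue)
     \<le> (\<integral>\<^sup>+x. ennreal (norm (conv (mol_seq k) f0 x - f0 x) ^ p) \<partial>lborel)" for k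
  proof -
    have "(\<integral>\<^sup>+x\<in>K. ennreal (norm (conv (mol_seq k) f x - f x) ^ p) \<partial>lebesgue)
      \<le> (\<integral>\<^sup>+x. ennreal (norm (conv (mol_seq k) f0 x - f0 x) ^ p) \<partial>lebesgue)"
    proof (rule nn_integral_mono_AE)
      show "AE x in lebesgue. ennreal (norm (conv (mol_seq k) f x - f x) ^ p) * indicator K x \<le> ennreal (norm (conv (mol_seq k) f0 x - f0 x) ^ p)"
        using f01
      proof eventually_elim
        case (elim x)
        show ?case
        proof (cases "x \<in> K")
          case True
          then have nx: "norm x \<le> R" using R by auto
          then have "f0 x = f x" using elim by (simp add: f1_def)
          moreover have "conv (mol_seq k) f x = conv (mol_seq k) f0 x"
          proof (rule conv_zero_outside_cong[where r = "1 / real (Suc k)"])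
            show "AE y in lebesgue. norm (x - y) < 1 / real (Suc k) \<longrightarrow> f y = f0 y"
              using f01
            proof eventually_elim
              case (elim y)
              show ?case
              proof
                assume "norm (x - y) < 1 / real (Suc k)"
                with mol_seq_le(1)[of k] have "norm (x - y) \<le> 1" by linarith
                then have "norm y \<le> R + 1" using nx norm_triangle_sub[of y x] by (simp add: norm_minus_commute)
                then show "f y = f0 y" using elim by (simp add: f1_def)
              qed
            qed
          qed (use mol_properties(3)[OF mol_seq_le(2)[of k]] smooth_continuous[OF mol_properties(1)[OF mol_seq_le(2)[of k]]] in \<open>auto simp: mol_seq_def\<close>)
          ultimately show ?thesis by (simp add: True)
        qed simp
      qed
    qed
    also have "\<dots> = (\<integral>\<^sup>+x. ennreal (norm (conv (mol_seq k) f0 x - f0 x) ^ p) \<partial>lborel)"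
      by (rule nn_integral_completion)
    finally show ?thesis .
  qed
  have "(\<lambda>k. \<integral>\<^sup>+x. ennreal (norm (conv (mol_seq k) f0 x - f0 x) ^ p) \<partial>lborel) \<longlonglongrightarrow> 0"
  proof (rule tendsto_0_if_eventually_le)
    fix e :: real assume "e > 0"
    from Lp_translation_continuous[OF f0m f0z fin p this] obtain d where d: "d > 0"
      "\<And>z. norm z < d \<Longrightarrow> (\<integral>\<^sup>+x. ennreal (norm (f0 (x - z) - f0 x) ^ p) \<partial>lborel) \<le> ennreal e" by blast
    obtain k0 where k0: "1 / real (Suc k0) < d" using d(1) nat_approx_posE by blast
    show "\<forall>\<^sub>F k in sequentially. (\<integral>\<^sup>+x. ennreal (norm (conv (mol_seq k) f0 x - f0 x) ^ p) \<partial>lborel) \<le> ennreal e"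
    proof (rule eventually_sequentiallyI[of k0])
      fix k assume "k0 \<le> k"
      then have "1 / real (Suc k) \<le> 1 / real (Suc k0)" by (simp add: frac_le)
      with k0 show "(\<integral>\<^sup>+x. ennreal (norm (conv (mol_seq k) f0 x - f0 x) ^ p) \<partial>lborel) \<le> ennreal e"
        unfolding mol_seq_def by (intro conv_Lp_bound[OF f0m fi mol_seq_le(2) p] d(2)) auto
    qed
  qed
  then show ?thesis by (rule tendsto_0_le_ennreal[OF _ pw])
qed

section \<open>Smoothness of convolutions\<close>

text \<open>All derivatives fall on the kernel. The remainders \<open>Q\<close> of the kernel are
  bounded by \<open>2 * M\<close> and, for increments of length at most one, vanish off a fixed
  compact set \<open>K\<close>, so the locally integrable \<open>f\<close> supplies the dominating
  function.\<close>

lemma conv_has_derivative: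
  fixes f :: "real^'n::finite \<Rightarrow> 'b::euclidean_space"
  assumes \<eta>: "smooth \<eta>" "\<And>x. r < norm x \<Longrightarrow> \<eta> x = 0" and f: "f \<in> Lp_loc 1 UNIV"
  shows "(conv \<eta> f has_derivative (\<lambda>h. \<Sum>i\<in>UNIV. (h $ i) *\<^sub>R conv (pderiv_at i \<eta>) f x)) (at x)"
proof -
  obtain M where M: "M \<ge> 0" "\<And>x y. norm (\<eta> x - \<eta> y) \<le> M * norm (x - y)"
    "\<And>x h. norm (frechet_derivative \<eta> (at x) h) \<le> M * norm h"
    using smooth_zero_outside_lipschitz[of \<eta> r, OF \<eta>] by blast
  define K where "K = cball x (max r 0 + 1)"
  have K: "compact K" by (simp add: K_def)
  have fK: "integrable lebesgue (\<lambda>y. indicator K y *\<^sub>R f y)" by (rule Lp_loc_1_integrable[OF f K]) simp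
  have mm: "(\<lambda>y. g (z - y)) \<in> borel_measurable lebesgue" if "continuous_on UNIV g" for g :: "real^'n \<Rightarrow> real" and z
  proof -
    have "(\<lambda>y. g (z - y)) \<in> borel_measurable borel"
      by (intro borel_measurable_continuous_onI continuous_on_compose2[OF that] continuous_intros) auto
    then show ?thesis by (simp add: measurable_completion)
  qed
  have bd: "\<exists>B. \<forall>x. \<bar>g x\<bar> \<le> B" if "smooth g" "\<And>x. r < norm x \<Longrightarrow> g x = 0" for g :: "real^'n \<Rightarrow> real"
    using continuous_zero_outside_bounded[OF smooth_continuous[OF that(1)], of r] that(2) by auto
  have inK: "norm (z - y) > r" if "y \<notin> K" "norm (z - x) \<le> 1" for y z
    using that norm_triangle_ineq[of "x - z" "z - y"] by (auto simp: K_def dist_norm norm_minus_commute)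
  have int: "integrable lebesgue (\<lambda>y. g (z - y) *\<^sub>R f y)"
    if g: "smooth g" "\<And>x. r < norm x \<Longrightarrow> g x = 0" and z: "norm (z - x) \<le> 1" for g :: "real^'n \<Rightarrow> real" and z
  proof -
    obtain B where "\<forall>x. \<bar>g x\<bar> \<le> B" using bd[OF g] by blast
    then show ?thesis
      by (intro integrable_mult_Lp_loc[OF f K subset_UNIV mm[OF smooth_continuous[OF g(1)]], where M=B]) (use g(2) inK z in auto)
  qed
  have dz: "r < norm x \<Longrightarrow> pderiv_at i \<eta> x = 0" for x i using pderiv_at_zero_outside[of r \<eta>, OF \<eta>(2)] by blast
  define Q where "Q h y = (\<eta> (x + h - y) - \<eta> (x - y) - frechet_derivative \<eta> (at (x - y)) h) / norm h" for h y
  have Qeq: "(conv \<eta> f (x + h) - conv \<eta> f x - (\<Sum>i\<in>UNIV. (h $ i) *\<^sub>R conv (pderiv_at i \<eta>) f x)) /\<^sub>R norm h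
      = (LINT y|lebesgue. Q h y *\<^sub>R f y)" if h: "norm h \<le> 1" for h
  proof -
    have i1: "integrable lebesgue (\<lambda>y. \<eta> (x + h - y) *\<^sub>R f y)" by (rule int) (use \<eta> h in auto)
    have i2: "integrable lebesgue (\<lambda>y. \<eta> (x - y) *\<^sub>R f y)" by (rule int) (use \<eta> in auto)
    have i3: "integrable lebesgue (\<lambda>y. pderiv_at i \<eta> (x - y) *\<^sub>R f y)" for i
      by (rule int) (use smooth_pderiv[OF \<eta>(1)] dz in auto)
    have "Q h y *\<^sub>R f y = (\<eta> (x + h - y) *\<^sub>R f y - \<eta> (x - y) *\<^sub>R f y - (\<Sum>i\<in>UNIV. (h $ i) *\<^sub>R (pderiv_at i \<eta> (x - y) *\<^sub>R f y))) /\<^sub>R norm h" for y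
      unfolding Q_def frechet_derivative_pderiv[OF smooth_differentiable[OF \<eta>(1)]]
      by (simp add: scaleR_diff_left divide_inverse mult.commute[of _ "inverse (norm h)"] right_diff_distrib
          scaleR_diff_right scaleR_sum_left sum_distrib_left scaleR_sum_right)
    then have "(LINT y|lebesgue. Q h y *\<^sub>R f y) = (LINT y|lebesgue. (\<eta> (x + h - y) *\<^sub>R f y - \<eta> (x - y) *\<^sub>R f y - (\<Sum>i\<in>UNIV. (h $ i) *\<^sub>R (pderiv_at i \<eta> (x - y) *\<^sub>R f y))) /\<^sub>R norm h)"
      by presburger
    also have "\<dots> = (conv \<eta> f (x + h) - conv \<eta> f x - (\<Sum>i\<in>UNIV. (h $ i) *\<^sub>R conv (pderiv_at i \<eta>) f x)) /\<^sub>R norm h"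
      unfolding conv_def integral_scaleR_right using i1 i2 i3
      by (simp del: scaleR_scaleR)
    finally show ?thesis by simp
  qed
  \<comment> \<open>Dominated convergence is a statement on sequences, hence the sequential form of
    the limit; the shift by \<open>n0\<close> keeps all increments shorter than one, where the
    common support is available.\<close>
  have "((\<lambda>h. (LINT y|lebesgue. Q h y *\<^sub>R f y)) \<longlongrightarrow> 0) (at 0)"
  proof (subst tendsto_at_iff_sequentially, intro allI impI)
    fix X :: "nat \<Rightarrow> real^'n" assume X: "\<forall>i. X i \<in> UNIV - {0}" "X \<longlonglongrightarrow> 0"
    obtain n0 where n0: "\<And>n. n \<ge> n0 \<Longrightarrow> norm (X n) \<le> 1"
      using LIMSEQ_D[OF X(2), of 1] by force
    have "(\<lambda>n. LINT y|lebesgue. Q (X (n + n0)) y *\<^sub>R f y) \<longlonglongrightarrow> (LINT y|(lebesgue :: (real^'n) measure). 0)"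
    proof (rule integral_dominated_convergence)
      show "integrable lebesgue (\<lambda>y. (2 * M) *\<^sub>R norm (indicator K y *\<^sub>R f y))"
        by (intro integrable_scaleR_right integrable_norm fK)
      have Qm: "(\<lambda>y. Q h y) \<in> borel_measurable lebesgue" for h
        unfolding Q_def frechet_derivative_pderiv[OF smooth_differentiable[OF \<eta>(1)]]
        using mm[OF smooth_continuous[OF \<eta>(1)]] mm[OF smooth_continuous[OF smooth_pderiv[OF \<eta>(1)]]]
        by (intro borel_measurable_divide borel_measurable_diff borel_measurable_sum borel_measurable_scaleR) auto
      show "(\<lambda>y. Q (X (n + n0)) y *\<^sub>R f y) \<in> borel_measurable lebesgue" for n
        by (intro borel_measurable_scaleR Qm Lp_loc_measurable[OF f])
      show "AE y in lebesgue. norm (Q (X (n + n0)) y *\<^sub>R f y) \<le> (2 * M) *\<^sub>R norm (indicator K y *\<^sub>R f y)" for n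
      proof (rule AE_I2)
        fix y
        let ?h = "X (n + n0)"
        have h1: "norm ?h \<le> 1" "norm ?h > 0" using n0 X by auto
        show "norm (Q ?h y *\<^sub>R f y) \<le> (2 * M) *\<^sub>R norm (indicator K y *\<^sub>R f y)"
        proof (cases "y \<in> K")
          case True
          have "\<bar>\<eta> (x + ?h - y) - \<eta> (x - y) - frechet_derivative \<eta> (at (x - y)) ?h\<bar>
              \<le> \<bar>\<eta> (x + ?h - y) - \<eta> (x - y)\<bar> + \<bar>frechet_derivative \<eta> (at (x - y)) ?h\<bar>" by simp
          also have "\<dots> \<le> M * norm ?h + M * norm ?h"
            using M(2)[of "x + ?h - y" "x - y"] M(3)[of "x - y" ?h] by (intro add_mono) auto
          finally have "\<bar>Q ?h y\<bar> \<le> 2 * M" using h1 by (simp add: Q_def divide_le_eq)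
          then show ?thesis using True by (auto intro: mult_right_mono)
        next
          case False
          then have "Q ?h y = 0"
            using inK[OF False, of "x + ?h"] inK[OF False, of x] h1 \<eta>(2) dz
            unfolding Q_def frechet_derivative_pderiv[OF smooth_differentiable[OF \<eta>(1)]] by simp
          then show ?thesis using False by simp
        qed
      qed
      show "AE y in lebesgue. (\<lambda>n. Q (X (n + n0)) y *\<^sub>R f y) \<longlonglongrightarrow> 0"
      proof (rule AE_I2)
        fix y
        have "(\<eta> has_derivative frechet_derivative \<eta> (at (x - y))) (at (x - y))"
          by (rule frechet_derivative_worksI[OF smooth_differentiable[OF \<eta>(1)]])
        then have "((\<lambda>h. norm (\<eta> (x - y + h) - \<eta> (x - y) - frechet_derivative \<eta> (at (x - y)) h) / norm h) \<longlongrightarrow> 0) (at 0)"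
          by (simp add: has_derivative_at)
        then have "((\<lambda>h. norm (Q h y)) \<longlongrightarrow> 0) (at 0)" by (simp add: Q_def algebra_simps)
        then have "((\<lambda>h. Q h y) \<longlongrightarrow> 0) (at 0)" by (rule tendsto_norm_zero_cancel)
        moreover have "(\<lambda>n. X (n + n0)) \<longlonglongrightarrow> 0" using X(2) by (rule LIMSEQ_ignore_initial_segment)
        ultimately have "(\<lambda>n. Q (X (n + n0)) y) \<longlonglongrightarrow> 0"
          using X(1) unfolding tendsto_at_iff_sequentially comp_def by auto
        then show "(\<lambda>n. Q (X (n + n0)) y *\<^sub>R f y) \<longlonglongrightarrow> 0"
          using tendsto_scaleR[OF _ tendsto_const, of "\<lambda>n. Q (X (n + n0)) y" 0 sequentially "f y"] by simp
      qed
    qed auto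
    then have "(\<lambda>n. LINT y|lebesgue. Q (X (n + n0)) y *\<^sub>R f y) \<longlonglongrightarrow> 0" by simp
    then show "((\<lambda>h. LINT y|lebesgue. Q h y *\<^sub>R f y) \<circ> X) \<longlonglongrightarrow> 0"
      unfolding comp_def by (rule LIMSEQ_offset)
  qed
  then have "((\<lambda>h. (conv \<eta> f (x + h) - conv \<eta> f x - (\<Sum>i\<in>UNIV. (h $ i) *\<^sub>R conv (pderiv_at i \<eta>) f x)) /\<^sub>R norm h) \<longlongrightarrow> 0) (at 0)"
  proof (rule Lim_transform_eventually)
    show "\<forall>\<^sub>F h in at 0. (LINT y|lebesgue. Q h y *\<^sub>R f y) = (conv \<eta> f (x + h) - conv \<eta> f x - (\<Sum>i\<in>UNIV. (h $ i) *\<^sub>R conv (pderiv_at i \<eta>) f x)) /\<^sub>R norm h"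
      unfolding eventually_at by (intro exI[of _ 1]) (auto simp: Qeq)
  qed
  then have "((\<lambda>h. norm (conv \<eta> f (x + h) - conv \<eta> f x - (\<Sum>i\<in>UNIV. (h $ i) *\<^sub>R conv (pderiv_at i \<eta>) f x)) / norm h) \<longlongrightarrow> 0) (at 0)"
    using tendsto_norm_zero by (fastforce simp: divide_inverse mult.commute)
  moreover have "bounded_linear (\<lambda>h::real^'n. \<Sum>i\<in>UNIV. (h $ i) *\<^sub>R conv (pderiv_at i \<eta>) f x)"
    by (intro bounded_linear_sum bounded_linear_scaleR_const bounded_linear_vec_nth)
  ultimately show ?thesis by (simp add: has_derivative_at)
qed

lemma pderiv_at_conv:
  fixes f :: "real^'n::finite \<Rightarrow> 'b::euclidean_space"
  assumes "smooth \<eta>" "\<And>x. r < norm x \<Longrightarrow> \<eta> x = 0" "f \<in> Lp_loc 1 UNIV"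
  shows "pderiv_at i (conv \<eta> f) = conv (pderiv_at i \<eta>) f"
proof
  fix x
  have "(\<Sum>j\<in>UNIV. (axis i 1 $ j) *\<^sub>R c j) = c i" for c :: "'n \<Rightarrow> 'b"
    by (simp add: axis_def if_distrib[of "\<lambda>a. a *\<^sub>R _"] cong: if_cong)
  then show "pderiv_at i (conv \<eta> f) x = conv (pderiv_at i \<eta>) f x"
    using pderiv_at_eq[OF conv_has_derivative[OF assms]] by simp
qed

lemma smooth_conv:
  fixes f :: "real^'n::finite \<Rightarrow> 'b::euclidean_space"
  assumes "smooth \<eta>" "\<And>x. r < norm x \<Longrightarrow> \<eta> x = 0" "f \<in> Lp_loc 1 UNIV"
  shows "smooth (conv \<eta> f)"
proof -
  have "Ck k (conv \<eta> f)" if "smooth \<eta>" "\<And>x. r < norm x \<Longrightarrow> \<eta> x = 0" for k \<eta>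
    using that
  proof (induction k arbitrary: \<eta>)
    case 0
    have "continuous (at x) (conv \<eta> f)" for x
      using conv_has_derivative[OF 0 assms(3)] has_derivative_continuous by blast
    then show ?case by (simp add: continuous_at_imp_continuous_on)
  next
    case (Suc k)
    have "Ck k (conv (pderiv_at i \<eta>) f)" for i
      by (rule Suc.IH) (use smooth_pderiv[OF Suc.prems(1)] pderiv_at_zero_outside[OF Suc.prems(2)] in auto)
    then show ?case
      using differentiableI[OF conv_has_derivative[OF Suc.prems assms(3)]] pderiv_at_conv[OF Suc.prems assms(3)] by simp
  qed
  then show ?thesis using assms by (auto simp: smooth_def)
qed

section \<open>Weak derivatives\<close>

lemma borel_measurable_lebesgueI:
  "f \<in> borel_measurable borel \<Longrightarrow> f \<in> borel_measurable (lebesgue :: 'a::euclidean_space measure)"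
  by (simp add: measurable_completion)

lemma filterlim_inverse_Suc_at_0: "filterlim (\<lambda>k. 1 / real (Suc k)) (at 0) sequentially"
  using LIMSEQ_inverse_real_of_nat by (simp add: filterlim_at inverse_eq_divide)

section \<open>Integrals of derivatives\<close>

text \<open>The discrete increments \<open>1 / real (Suc k)\<close> exhibit a derivative as a
  countable limit, which serves both its measurability and the passage to the limit under an
  integral.\<close>

lemma has_vector_derivative_difference_quotient:
  fixes g :: "'a::real_normed_vector \<Rightarrow> 'b::real_normed_vector"
  assumes "((\<lambda>t. g (x + t *\<^sub>R v)) has_vector_derivative d) (at 0)"
  shows "(\<lambda>k. real (Suc k) *\<^sub>R (g (x + (1 / real (Suc k)) *\<^sub>R v) - g x)) \<longlonglongrightarrow> d"
proof -
  have "((\<lambda>t. norm (g (x + t *\<^sub>R v) - g x - t *\<^sub>R d) / norm t) \<longlongrightarrow> 0) (at 0)"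
    using assms by (simp add: has_vector_derivative_def has_derivative_at)
  then have "((\<lambda>t. norm ((1 / t) *\<^sub>R (g (x + t *\<^sub>R v) - g x) - d)) \<longlongrightarrow> 0) (at 0)"
  proof (rule Lim_transform_eventually)
    have "norm (g (x + t *\<^sub>R v) - g x - t *\<^sub>R d) / norm t = norm ((1 / t) *\<^sub>R (g (x + t *\<^sub>R v) - g x) - d)" if "t \<noteq> 0" for t
    proof -
      have "(1 / t) *\<^sub>R (g (x + t *\<^sub>R v) - g x) - d = (1 / t) *\<^sub>R (g (x + t *\<^sub>R v) - g x - t *\<^sub>R d)"
        using that by (simp add: scaleR_diff_right)
      then show ?thesis by simp
    qed
    then show "\<forall>\<^sub>F t in at 0. norm (g (x + t *\<^sub>R v) - g x - t *\<^sub>R d) / norm t = norm ((1 / t) *\<^sub>R (g (x + t *\<^sub>R v) - g x) - d)"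
      by (simp add: eventually_at_filter)
  qed
  from LIM_zero_cancel[OF tendsto_norm_zero_cancel[OF this]]
  have "((\<lambda>t. (1 / t) *\<^sub>R (g (x + t *\<^sub>R v) - g x)) \<longlongrightarrow> d) (at 0)" .
  from filterlim_compose[OF this filterlim_inverse_Suc_at_0] show ?thesis by simp
qed

text \<open>Every difference quotient integrates to zero by translation invariance. The mean value
  inequality bounds the quotients by \<open>M\<close>, and they vanish off a common ball, so the
  limit may be taken inside. Only regularity along \<open>v\<close> is asked for: the lemma is later
  applied to functions that jump across a horizontal plane.\<close>

lemma integral_directional_derivative_zero:
  fixes g :: "real^'n::finite \<Rightarrow> 'b::euclidean_space"
  assumes g [measurable]: "g \<in> borel_measurable borel" and gi: "integrable lborel g"
    and d: "\<And>x. ((\<lambda>t. g (x + t *\<^sub>R v)) has_vector_derivative g' x) (at 0)"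
    and M: "\<And>x. norm (g' x) \<le> M" and z: "\<And>x. R < norm x \<Longrightarrow> g x = 0"
  shows "integrable lborel g'" "(LINT x|lborel. g' x) = 0"
proof -
  have ds: "((\<lambda>t. g (x + t *\<^sub>R v)) has_vector_derivative g' (x + s *\<^sub>R v)) (at s)" for x s
  proof -
    have "((\<lambda>t. t - s) has_vector_derivative 1) (at s)" by (auto intro!: derivative_eq_intros)
    from vector_diff_chain_at[OF this, of "\<lambda>t. g ((x + s *\<^sub>R v) + t *\<^sub>R v)" "g' (x + s *\<^sub>R v)"] d[of "x + s *\<^sub>R v"]
    show ?thesis by (simp add: o_def algebra_simps)
  qed
  define D where "D k x = real (Suc k) *\<^sub>R (g (x + (1 / real (Suc k)) *\<^sub>R v) - g x)" for k x
  have M0: "M \<ge> 0" using order_trans[OF norm_ge_zero M] .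
  have Db: "norm (D k x) \<le> M" for k x
  proof -
    have "norm (g (x + (1 / real (Suc k)) *\<^sub>R v) - g (x + 0 *\<^sub>R v)) \<le> M * norm (1 / real (Suc k) - 0)"
      by (rule differentiable_bound[of UNIV "\<lambda>t. g (x + t *\<^sub>R v)" "\<lambda>t h. h *\<^sub>R g' (x + t *\<^sub>R v)"])
         (use ds M in \<open>auto simp: has_vector_derivative_def intro!: onorm_bound M0 mult_left_mono simp: mult.commute[of M]\<close>)
    then have "real (Suc k) * norm (g (x + (1 / real (Suc k)) *\<^sub>R v) - g x) \<le> real (Suc k) * (M * norm (1 / real (Suc k)))"
      by (intro mult_left_mono) auto
    then show ?thesis by (simp add: D_def)
  qed
  have Dz: "D k x = 0" if "R + norm v < norm x" for k x
  proof -
    have "norm ((1 / real (Suc k)) *\<^sub>R v) \<le> norm v"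
      using mult_left_le_one_le[of "norm v" "1 / real (Suc k)"] by (simp add: divide_le_eq)
    then have "R < norm (x + (1 / real (Suc k)) *\<^sub>R v)"
      using that norm_triangle_ineq4[of "x + (1 / real (Suc k)) *\<^sub>R v" "(1 / real (Suc k)) *\<^sub>R v"]
      by (simp)
    moreover have "R < norm x" using that norm_ge_zero[of v] by linarith
    ultimately show ?thesis using z by (simp add: D_def)
  qed
  have Dl: "(\<lambda>k. D k x) \<longlonglongrightarrow> g' x" for x
    unfolding D_def by (rule has_vector_derivative_difference_quotient[OF d])
  have [measurable]: "D k \<in> borel_measurable borel" for k unfolding D_def by measurable
  have g'm: "g' \<in> borel_measurable borel" by (rule borel_measurable_LIMSEQ_metric[OF _ Dl]) measurable
  have w: "integrable lborel (\<lambda>x::real^'n. indicator (cball 0 (R + norm v)) x *\<^sub>R M)"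
    using emeasure_lborel_cball_finite[of "0::real^'n" "R + norm v"]
    by (intro integrable_scaleR_left integrable_real_indicator) auto
  have dom: "AE x in lborel. norm (D k x) \<le> indicator (cball 0 (R + norm v)) x *\<^sub>R M" for k
    using Db Dz by (intro AE_I2) (auto simp: indicator_def not_le)
  have Dlim: "AE x in lborel. (\<lambda>k. D k x) \<longlonglongrightarrow> g' x" using Dl by simp
  show "integrable lborel g'"
    by (rule integrable_dominated_convergence[OF _ _ w Dlim dom]) (use g'm in auto)
  have "(\<lambda>k. LINT x|lborel. D k x) \<longlonglongrightarrow> (LINT x|lborel. g' x)"
    by (rule integral_dominated_convergence[OF _ _ w Dlim dom]) (use g'm in auto)
  moreover have "(LINT x|lborel. D k x) = 0" for k
  proof -
    let ?c = "(1 / real (Suc k)) *\<^sub>R v"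
    have e: "distr lborel borel ((+) ?c) = (lborel :: (real^'n) measure)" by (rule lborel_distr_plus)
    have "integrable lborel (\<lambda>x. g (?c + x))"
      using integrable_distr_eq[of "(+) ?c" lborel borel g] gi e by simp
    moreover have "(LINT x|lborel. g (?c + x)) = (LINT x|lborel. g x)"
      using integral_distr[of "(+) ?c" lborel borel g] e by simp
    ultimately show ?thesis using gi by (simp add: D_def add.commute)
  qed
  ultimately show "(LINT x|lborel. g' x) = 0" by (simp add: LIMSEQ_const_iff)
qed

lemma Lp_loc_bounded:
  fixes f :: "real^'n::finite \<Rightarrow> 'b::euclidean_space"
  assumes f: "f \<in> borel_measurable borel" and b: "\<And>r. \<exists>M. \<forall>x. norm x \<le> r \<longrightarrow> norm (f x) \<le> M"
  shows "f \<in> Lp_loc p U"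
  unfolding Lp_loc_def Lp_def
proof (intro CollectI allI impI conjI)
  fix K assume K: "compact K \<and> K \<subseteq> U"
  have KL: "K \<in> lmeasurable" using K by (simp add: lmeasurable_compact)
  then have [measurable]: "K \<in> sets lebesgue" by auto
  have [measurable]: "f \<in> borel_measurable lebesgue" using f by (simp add: measurable_completion)
  show "set_borel_measurable lebesgue K f" unfolding set_borel_measurable_def by measurable
  obtain r where r: "\<And>x. x \<in> K \<Longrightarrow> norm x \<le> r" using K compact_imp_bounded by (force simp: bounded_iff)
  from b[of r] obtain M where M: "\<And>x. norm x \<le> r \<Longrightarrow> norm (f x) \<le> M" by auto
  have "integrable lebesgue (\<lambda>x. indicator K x *\<^sub>R M ^ p)"
    using KL by (auto simp: fmeasurable_def)
  then show "set_integrable lebesgue K (\<lambda>x. norm (f x) ^ p)"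
    unfolding set_integrable_def
  proof (rule Bochner_Integration.integrable_bound)
    show "(\<lambda>x. indicator K x *\<^sub>R norm (f x) ^ p) \<in> borel_measurable lebesgue" by measurable
    show "AE x in lebesgue. norm (indicator K x *\<^sub>R norm (f x) ^ p) \<le> norm (indicator K x *\<^sub>R M ^ p)"
    proof (rule AE_I2)
      fix x show "norm (indicator K x *\<^sub>R norm (f x) ^ p) \<le> norm (indicator K x *\<^sub>R M ^ p)"
      proof (cases "x \<in> K")
        case True
        then have "norm (f x) \<le> \<bar>M\<bar>" using M[OF r, of x] by simp
        from power_mono[OF this norm_ge_zero, of p] show ?thesis using True by (simp add: power_abs)
      qed simp
    qed
  qed
qed

lemma bounded_on_balls_continuous:
  fixes f :: "real^'n::finite \<Rightarrow> 'b::euclidean_space"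
  assumes "continuous_on UNIV f"
  shows "\<exists>M. \<forall>x. norm x \<le> r \<longrightarrow> norm (f x) \<le> M"
proof -
  have "compact (f ` cball 0 r)"
    using continuous_on_subset[OF assms subset_UNIV] by (intro compact_continuous_image) simp_all
  then obtain M where "\<forall>y\<in>f ` cball 0 r. norm y \<le> M"
    using compact_imp_bounded[of "f ` cball 0 r"] unfolding bounded_iff by blast
  then show ?thesis by (intro exI[of _ M]) auto
qed

lemma Lp_loc_continuous:
  fixes f :: "real^'n::finite \<Rightarrow> 'b::euclidean_space"
  assumes "continuous_on UNIV f"
  shows "f \<in> Lp_loc p U"
  using borel_measurable_continuous_onI[OF assms] bounded_on_balls_continuous[OF assms] by (rule Lp_loc_bounded)

lemma directional_derivative_pderiv:
  fixes f :: "real^'n::finite \<Rightarrow> 'b::euclidean_space"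
  assumes "f differentiable (at x)"
  shows "((\<lambda>t. f (x + t *\<^sub>R axis i 1)) has_vector_derivative pderiv_at i f x) (at 0)"
proof -
  have D: "(f has_derivative frechet_derivative f (at x)) (at (x + 0 *\<^sub>R axis i 1))"
    using frechet_derivative_worksI[OF assms] by simp
  have "((\<lambda>t. x + t *\<^sub>R axis i 1) has_derivative (\<lambda>t. t *\<^sub>R axis i 1)) (at (0::real))"
    by (auto intro!: derivative_eq_intros)
  from has_derivative_compose[OF this D]
  show ?thesis unfolding has_vector_derivative_def pderiv_at_def
    using linear_cmul[OF linear_frechet_derivative[OF assms]] by simp
qed

text \<open>A derivative that is not known to be continuous is still Borel, being the pointwise
  limit of its difference quotients.\<close>

lemma differentiable_pderiv_measurable:
  fixes f :: "real^'n::finite \<Rightarrow> 'b::euclidean_space"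
  assumes "\<And>x. f differentiable (at x)"
  shows "f \<in> borel_measurable borel" "pderiv_at i f \<in> borel_measurable borel" "continuous_on UNIV f"
proof -
  show c: "continuous_on UNIV f"
    using assms by (intro continuous_at_imp_continuous_on ballI differentiable_imp_continuous_within)
  show m: "f \<in> borel_measurable borel" using c by (rule borel_measurable_continuous_onI)
  note [measurable] = m
  show "pderiv_at i f \<in> borel_measurable borel"
  proof (rule borel_measurable_LIMSEQ_metric)
    show "(\<lambda>x. real (Suc k) *\<^sub>R (f (x + (1 / real (Suc k)) *\<^sub>R axis i 1) - f x)) \<in> borel_measurable borel" for k by measurable
    fix x
    show "(\<lambda>k. real (Suc k) *\<^sub>R (f (x + (1 / real (Suc k)) *\<^sub>R axis i 1) - f x)) \<longlonglongrightarrow> pderiv_at i f x"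
      by (rule has_vector_derivative_difference_quotient[OF directional_derivative_pderiv[OF assms]])
  qed
qed

lemma pderiv_at_zero_outside_support:
  fixes f :: "real^'n::finite \<Rightarrow> 'b::euclidean_space"
  assumes "x \<notin> closure {x. f x \<noteq> 0}"
  shows "f x = 0" "pderiv_at i f x = 0"
proof -
  show "f x = 0" using assms closure_subset[of "{x. f x \<noteq> 0}"] by blast
  define S where "S = - closure {x. f x \<noteq> 0}"
  have "open S" unfolding S_def by (rule open_Compl[OF closed_closure])
  moreover have "x \<in> S" unfolding S_def using assms by blast
  moreover have "0 = f y" if "y \<in> S" for y
    using that closure_subset[of "{x. f x \<noteq> 0}"] unfolding S_def by auto
  ultimately have "(f has_derivative (\<lambda>h. 0)) (at x)"
    by (rule has_derivative_transform_within_open[OF has_derivative_const])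
  from pderiv_at_eq[OF this] show "pderiv_at i f x = 0" .
qed

lemma set_integral_supported:
  assumes "\<And>x. x \<notin> U \<Longrightarrow> F x = 0"
  shows "(LINT x:U|M. F x) = (LINT x|M. F x)"
proof -
  have "(\<lambda>x. indicator U x *\<^sub>R F x) = F" using assms by (auto simp: fun_eq_iff indicator_def)
  then show ?thesis by (simp add: set_lebesgue_integral_def)
qed

text \<open>The product with a test function has compact support and a bounded directional
  derivative, whose integral is therefore zero. Local boundedness of the derivative is easier to
  supply than its continuity for functions glued from pieces, such as the vortex lattice.\<close>

lemma has_weak_pderiv_differentiable:
  fixes f :: "real^'n::finite \<Rightarrow> 'b::euclidean_space"
  assumes d: "\<And>x. f differentiable (at x)" and b: "\<And>r. \<exists>M. \<forall>x. norm x \<le> r \<longrightarrow> norm (pderiv_at i f x) \<le> M"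
  shows "has_weak_pderiv U i f (pderiv_at i f)"
  unfolding has_weak_pderiv_def
proof (intro conjI allI impI)
  note c = differentiable_pderiv_measurable[OF d]
  show f1: "f \<in> Lp_loc 1 U" by (rule Lp_loc_continuous[OF c(3)])
  show f2: "pderiv_at i f \<in> Lp_loc 1 U" by (rule Lp_loc_bounded[OF c(2) b])
  fix \<phi> :: "real^'n \<Rightarrow> real" assume \<phi>: "\<phi> \<in> test_functions U"
  obtain r where r: "r > 0" "\<And>x. r < norm x \<Longrightarrow> \<phi> x = 0" using test_functions_zero_outside[OF \<phi>] by blast
  have sm: "smooth \<phi>" and supp: "closure {x. \<phi> x \<noteq> 0} \<subseteq> U" and Kc: "compact (closure {x. \<phi> x \<noteq> 0})"
    using \<phi> by (auto simp: test_functions_def)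
  have z: "\<phi> x = 0" "pderiv_at i \<phi> x = 0" if "x \<notin> U" for x
    using pderiv_at_zero_outside_support[of x \<phi>] that supp by auto
  have dz: "pderiv_at i \<phi> x = 0" if "r < norm x" for x using pderiv_at_zero_outside[of r \<phi>, OF r(2) that] .
  have cp: "continuous_on UNIV \<phi>" "continuous_on UNIV (pderiv_at i \<phi>)"
    using smooth_continuous[OF sm] smooth_continuous[OF smooth_pderiv[OF sm]] by auto
  obtain M1 where M1: "M1 \<ge> 0" "\<And>x. \<bar>\<phi> x\<bar> \<le> M1" using continuous_zero_outside_bounded[OF cp(1) r(2)] by auto
  obtain M2 where M2: "M2 \<ge> 0" "\<And>x. \<bar>pderiv_at i \<phi> x\<bar> \<le> M2" using continuous_zero_outside_bounded[OF cp(2) dz] by auto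
  obtain B1 where B1: "\<And>x. norm x \<le> r \<Longrightarrow> norm (f x) \<le> B1" using bounded_on_balls_continuous[OF c(3), of r] by auto
  obtain B2 where B2: "\<And>x. norm x \<le> r \<Longrightarrow> norm (pderiv_at i f x) \<le> B2" using b[of r] by auto
  define g where "g x = \<phi> x *\<^sub>R f x" for x
  define g' where "g' x = \<phi> x *\<^sub>R pderiv_at i f x + pderiv_at i \<phi> x *\<^sub>R f x" for x
  have gc: "continuous_on UNIV g" unfolding g_def by (intro continuous_intros cp c(3))
  have gz: "g x = 0" if "r < norm x" for x using r(2)[OF that] by (simp add: g_def)
  have gi: "integrable lborel g" by (rule integrable_continuous_zero_outside[OF gc gz])
  have gd: "((\<lambda>t. g (x + t *\<^sub>R axis i 1)) has_vector_derivative g' x) (at 0)" for x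
  proof -
    have 1: "((\<lambda>t. \<phi> (x + t *\<^sub>R axis i 1)) has_field_derivative pderiv_at i \<phi> x) (at 0)"
      using directional_derivative_pderiv[OF smooth_differentiable[OF sm]] by (simp add: has_real_derivative_iff_has_vector_derivative)
    show ?thesis using has_vector_derivative_scaleR[OF 1 directional_derivative_pderiv[OF d]]
      unfolding g_def g'_def by simp
  qed
  have g'b: "norm (g' x) \<le> M1 * \<bar>B2\<bar> + M2 * \<bar>B1\<bar>" for x
  proof (cases "norm x \<le> r")
    case True
    have "norm (g' x) \<le> \<bar>\<phi> x\<bar> * norm (pderiv_at i f x) + \<bar>pderiv_at i \<phi> x\<bar> * norm (f x)"
      unfolding g'_def by (rule order_trans[OF norm_triangle_ineq]) simp
    also have "\<dots> \<le> M1 * \<bar>B2\<bar> + M2 * \<bar>B1\<bar>"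
      using B1[OF True] B2[OF True] by (intro add_mono mult_mono M1 M2) auto
    finally show ?thesis .
  next
    case False
    then show ?thesis using r(2)[of x] dz[of x] M1 M2 by (simp add: g'_def)
  qed
  note I = integral_directional_derivative_zero[OF borel_measurable_continuous_onI[OF gc] gi gd g'b gz]
  let ?K = "closure {x. \<phi> x \<noteq> 0}"
  have ml: "\<phi> \<in> borel_measurable lebesgue" "pderiv_at i \<phi> \<in> borel_measurable lebesgue"
    using cp by (intro borel_measurable_lebesgueI borel_measurable_continuous_onI; simp)+
  have i1: "integrable lebesgue (\<lambda>x. \<phi> x *\<^sub>R pderiv_at i f x)"
    by (rule integrable_mult_Lp_loc[OF f2 Kc supp ml(1) M1(2)]) (rule pderiv_at_zero_outside_support)
  have i2: "integrable lebesgue (\<lambda>x. pderiv_at i \<phi> x *\<^sub>R f x)"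
    by (rule integrable_mult_Lp_loc[OF f1 Kc supp ml(2) M2(2)]) (rule pderiv_at_zero_outside_support)
  have "(LINT x|lebesgue. g' x) = 0"
    using I by (subst integral_completion) auto
  then have "(LINT x|lebesgue. pderiv_at i \<phi> x *\<^sub>R f x) = - (LINT x|lebesgue. \<phi> x *\<^sub>R pderiv_at i f x)"
    unfolding g'_def using i1 i2 by (simp add: add_eq_0_iff)
  then show "(LINT x:U|lebesgue. pderiv_at i \<phi> x *\<^sub>R f x) = - (LINT x:U|lebesgue. \<phi> x *\<^sub>R pderiv_at i f x)"
    using z by (simp add: set_integral_supported)
qed

section \<open>Uniqueness of weak derivatives\<close>

lemma mol_test_function:
  assumes r: "r > 0" and "cball x r \<subseteq> U"
  shows "(\<lambda>y::real^'n::finite. mol r (x - y)) \<in> test_functions U"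
    "pderiv_at i (\<lambda>y. mol r (x - y)) y = - pderiv_at i (mol r) (x - y)"
proof -
  have s: "smooth (mol r :: real^'n \<Rightarrow> real)" by (rule mol_properties(1)[OF r])
  have "smooth (\<lambda>y. mol r ((-1) *\<^sub>R y + x))" by (rule smooth_affine[OF s])
  then have s2: "smooth (\<lambda>y. mol r (x - y))" by simp
  have "{y. mol r (x - y) \<noteq> 0} \<subseteq> cball x r"
    using mol_properties(3)[OF r] by (force simp: dist_norm)
  then have c: "closure {y. mol r (x - y) \<noteq> 0} \<subseteq> cball x r" by (simp add: closure_minimal)
  then have "compact (closure {y. mol r (x - y) \<noteq> 0})"
    by (meson bounded_cball bounded_subset closed_closure compact_eq_bounded_closed)
  then show "(\<lambda>y. mol r (x - y)) \<in> test_functions U"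
    using s2 c assms(2) by (auto simp: test_functions_def)
  have "((\<lambda>y. mol r (x - y)) has_derivative (\<lambda>h. frechet_derivative (mol r) (at (x - y)) (- h))) (at y)"
    by (rule has_derivative_compose[of "\<lambda>y. x - y" "\<lambda>h. - h" y UNIV "mol r"])
       (auto intro!: derivative_eq_intros frechet_derivative_worksI smooth_differentiable[OF s])
  from pderiv_at_eq[OF this] show "pderiv_at i (\<lambda>y. mol r (x - y)) y = - pderiv_at i (mol r) (x - y)"
    using linear_frechet_derivative[OF smooth_differentiable[OF s]] by (simp add: pderiv_at_def linear_neg)
qed

lemma lebesgue_AE_open_from_compact:
  assumes "open (U :: (real^'n::finite) set)" and K: "\<And>K. compact K \<Longrightarrow> K \<subseteq> U \<Longrightarrow> AE x in lebesgue. x \<in> K \<longrightarrow> P x"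
  shows "AE x in lebesgue. x \<in> U \<longrightarrow> P x"
proof -
  obtain C where C: "\<And>n::nat. compact (C n)" "\<And>n. C n \<subseteq> U" "\<Union>(range C) = U"
    using open_Union_compact_subsets[OF assms(1)] by metis
  have "AE x in lebesgue. \<forall>n. x \<in> C n \<longrightarrow> P x"
    unfolding AE_all_countable using K C(1,2) by blast
  then show ?thesis by eventually_elim (use C(3) in blast)
qed

text \<open>For points of \<open>K\<close> and radii below the distance to the complement of
  \<open>U\<close>, the reflected mollifier is an admissible test function, so the mollification of
  \<open>f\<close> vanishes on \<open>K\<close>. It also converges to \<open>f\<close> in the mean
  on \<open>K\<close>.\<close>

lemma fundamental_lemma:
  fixes f :: "real^'n::finite \<Rightarrow> 'b::euclidean_space"
  assumes U: "open U" and f: "f \<in> Lp_loc 1 U"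
    and z: "\<And>\<phi>. \<phi> \<in> test_functions U \<Longrightarrow> (LINT x:U|lebesgue. \<phi> x *\<^sub>R f x) = 0"
  shows "AE x in lebesgue. x \<in> U \<longrightarrow> f x = 0"
proof (rule lebesgue_AE_open_from_compact[OF U])
  fix K assume K: "compact K" "K \<subseteq> U"
  obtain e where e: "e > 0" "(\<Union>x\<in>K. cball x e) \<subseteq> U" using compact_subset_open_imp_cball_epsilon_subset[OF K(1) U K(2)] .
  define K' where "K' = (\<Union>x\<in>K. cball x e)"
  \<comment> \<open>Written as the sum of two compact sets, the closed neighbourhood of
    \<open>K\<close> is compact.\<close>
  have "K' = {x + y |x y. x \<in> K \<and> y \<in> cball 0 e}"
  proof -
    have "z \<in> cball x e \<longleftrightarrow> (\<exists>y\<in>cball 0 e. z = x + y)" for x z :: "real^'n"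
      by (auto simp: dist_norm norm_minus_commute intro!: bexI[of _ "z - x"])
    then show ?thesis unfolding K'_def by blast
  qed
  then have K'c: "compact K'" using compact_sums[OF K(1) compact_cball[of "0::real^'n" e]] by (simp only:)
  have K'U: "K' \<subseteq> U" using e by (simp add: K'_def)
  define f1 where "f1 x = indicator K' x *\<^sub>R f x" for x
  have f1i: "integrable lebesgue f1" unfolding f1_def by (rule Lp_loc_1_integrable[OF f K'c K'U])
  have f1: "f1 \<in> Lp_loc 1 UNIV"
    unfolding Lp_loc_def Lp_def
  proof (intro CollectI allI impI conjI)
    fix C :: "(real^'n) set" assume "compact C \<and> C \<subseteq> UNIV"
    then have [measurable]: "C \<in> sets lebesgue" using lmeasurable_compact by blast
    have [measurable]: "f1 \<in> borel_measurable lebesgue" using f1i by auto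
    show "set_borel_measurable lebesgue C f1" unfolding set_borel_measurable_def by measurable
    show "set_integrable lebesgue C (\<lambda>x. norm (f1 x) ^ 1)"
      unfolding set_integrable_def using integrable_mult_indicator[OF \<open>C \<in> sets lebesgue\<close> integrable_norm[OF f1i]] by simp
  qed
  have lim: "(\<lambda>k. \<integral>\<^sup>+x\<in>K. ennreal (norm (conv (mol_seq k) f1 x - f1 x) ^ 1) \<partial>lebesgue) \<longlonglongrightarrow> 0"
    by (rule conv_tendsto_Lp_loc[OF f1 _ K(1)]) simp
  obtain k0 where k0: "1 / real (Suc k0) < e" using e(1) nat_approx_posE by blast
  have "conv (mol_seq k) f1 x = 0" if "x \<in> K" "k \<ge> k0" for x k
  proof -
    have "1 / real (Suc k) \<le> 1 / real (Suc k0)" using that by (simp add: frac_le)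
    then have r: "1 / real (Suc k) > 0" "1 / real (Suc k) \<le> e" using k0 by auto
    have sub: "cball x (1 / real (Suc k)) \<subseteq> K'" using r that(1) by (force simp: K'_def)
    have "conv (mol_seq k) f1 x = (LINT y:U|lebesgue. mol (1 / real (Suc k)) (x - y) *\<^sub>R f y)"
      unfolding conv_def set_lebesgue_integral_def
    proof (rule Bochner_Integration.integral_cong)
      fix y
      have "mol (1 / real (Suc k)) (x - y) = 0" if "y \<notin> K'"
        using sub that by (intro mol_properties(3)[OF r(1)]) (force simp: dist_norm)
      then show "mol_seq k (x - y) *\<^sub>R f1 y = indicator U y *\<^sub>R (mol (1 / real (Suc k)) (x - y) *\<^sub>R f y)"
        using K'U by (cases "y \<in> K'") (auto simp: mol_seq_def f1_def indicator_def)
    qed simp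
    also have "\<dots> = 0"
      using sub K'U by (intro z mol_test_function(1)[OF r(1)]) auto
    finally show ?thesis .
  qed
  then have "(\<integral>\<^sup>+x\<in>K. ennreal (norm (conv (mol_seq k) f1 x - f1 x) ^ 1) \<partial>lebesgue) = (\<integral>\<^sup>+x\<in>K. ennreal (norm (f x)) \<partial>lebesgue)" if "k \<ge> k0" for k
    using that e by (intro nn_integral_cong) (auto simp: indicator_def f1_def K'_def less_imp_le intro!: bexI)
  then have "(\<lambda>k. \<integral>\<^sup>+x\<in>K. ennreal (norm (conv (mol_seq k) f1 x - f1 x) ^ 1) \<partial>lebesgue) \<longlonglongrightarrow> (\<integral>\<^sup>+x\<in>K. ennreal (norm (f x)) \<partial>lebesgue)"
    by (intro tendsto_eventually eventually_sequentiallyI[of k0]) simp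
  then have "(\<integral>\<^sup>+x\<in>K. ennreal (norm (f x)) \<partial>lebesgue) = 0" using lim LIMSEQ_unique by blast
  moreover have "(\<integral>\<^sup>+x\<in>K. ennreal (norm (f x)) \<partial>lebesgue) = (\<integral>\<^sup>+x. ennreal (norm (indicator K x *\<^sub>R f x)) \<partial>lebesgue)"
    by (intro nn_integral_cong) (auto simp: indicator_def)
  ultimately have I0: "(\<integral>\<^sup>+x. ennreal (norm (indicator K x *\<^sub>R f x)) \<partial>lebesgue) = 0" by simp
  have [measurable]: "(\<lambda>x. indicator K x *\<^sub>R f x) \<in> borel_measurable lebesgue"
    using Lp_loc_1_integrable[OF f K] by (rule borel_measurable_integrable)
  have "(\<lambda>x. ennreal (norm (indicator K x *\<^sub>R f x))) \<in> borel_measurable lebesgue" by measurable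
  from nn_integral_0_iff_AE[OF this] I0 have "AE x in lebesgue. ennreal (norm (indicator K x *\<^sub>R f x)) = 0" by simp
  then show "AE x in lebesgue. x \<in> K \<longrightarrow> f x = 0"
    by eventually_elim (auto simp: indicator_def split: if_splits)
qed

lemma Lp_loc_1_diff:
  fixes f g :: "real^'n::finite \<Rightarrow> 'b::euclidean_space"
  assumes "f \<in> Lp_loc 1 U" "g \<in> Lp_loc 1 U"
  shows "(\<lambda>x. f x - g x) \<in> Lp_loc 1 U"
  unfolding Lp_loc_def Lp_def
proof (intro CollectI allI impI conjI)
  fix K assume "compact K \<and> K \<subseteq> U"
  then have "integrable lebesgue (\<lambda>x. indicator K x *\<^sub>R f x - indicator K x *\<^sub>R g x)"
    using Lp_loc_1_integrable assms by (intro Bochner_Integration.integrable_diff) auto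
  then have i: "integrable lebesgue (\<lambda>x. indicator K x *\<^sub>R (f x - g x))" by (simp add: scaleR_diff_right)
  then show "set_borel_measurable lebesgue K (\<lambda>x. f x - g x)" by (auto simp: set_borel_measurable_def)
  show "set_integrable lebesgue K (\<lambda>x. norm (f x - g x) ^ 1)"
    using integrable_norm[OF i] by (simp add: set_integrable_def)
qed

lemma test_function_integrable:
  fixes f :: "real^'n::finite \<Rightarrow> 'b::euclidean_space"
  assumes \<phi>: "\<phi> \<in> test_functions U" and f: "f \<in> Lp_loc 1 U"
  shows "integrable lebesgue (\<lambda>x. \<phi> x *\<^sub>R f x)" "integrable lebesgue (\<lambda>x. pderiv_at i \<phi> x *\<^sub>R f x)"
    "set_integrable lebesgue U (\<lambda>x. \<phi> x *\<^sub>R f x)" "set_integrable lebesgue U (\<lambda>x. pderiv_at i \<phi> x *\<^sub>R f x)"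
proof -
  obtain r where r: "r > 0" "\<And>x. r < norm x \<Longrightarrow> \<phi> x = 0" using test_functions_zero_outside[OF \<phi>] by blast
  have sm: "smooth \<phi>" and supp: "closure {x. \<phi> x \<noteq> 0} \<subseteq> U" and Kc: "compact (closure {x. \<phi> x \<noteq> 0})"
    using \<phi> by (auto simp: test_functions_def)
  have dz: "pderiv_at i \<phi> x = 0" if "r < norm x" for x using pderiv_at_zero_outside[of r \<phi>, OF r(2) that] .
  have cp: "continuous_on UNIV \<phi>" "continuous_on UNIV (pderiv_at i \<phi>)"
    using smooth_continuous[OF sm] smooth_continuous[OF smooth_pderiv[OF sm]] by auto
  obtain M1 where M1: "M1 \<ge> 0" "\<And>x. \<bar>\<phi> x\<bar> \<le> M1" using continuous_zero_outside_bounded[OF cp(1) r(2)] by auto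
  obtain M2 where M2: "M2 \<ge> 0" "\<And>x. \<bar>pderiv_at i \<phi> x\<bar> \<le> M2" using continuous_zero_outside_bounded[OF cp(2) dz] by auto
  have ml: "\<phi> \<in> borel_measurable lebesgue" "pderiv_at i \<phi> \<in> borel_measurable lebesgue"
    using cp by (intro borel_measurable_lebesgueI borel_measurable_continuous_onI; simp)+
  show i1: "integrable lebesgue (\<lambda>x. \<phi> x *\<^sub>R f x)"
    by (rule integrable_mult_Lp_loc[OF f Kc supp ml(1) M1(2)]) (rule pderiv_at_zero_outside_support)
  show i2: "integrable lebesgue (\<lambda>x. pderiv_at i \<phi> x *\<^sub>R f x)"
    by (rule integrable_mult_Lp_loc[OF f Kc supp ml(2) M2(2)]) (rule pderiv_at_zero_outside_support)
  have e: "(\<lambda>x. indicator U x *\<^sub>R \<phi> x *\<^sub>R f x) = (\<lambda>x. \<phi> x *\<^sub>R f x)"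
    "(\<lambda>x. indicator U x *\<^sub>R pderiv_at i \<phi> x *\<^sub>R f x) = (\<lambda>x. pderiv_at i \<phi> x *\<^sub>R f x)"
  proof -
    have "\<phi> x = 0" "pderiv_at i \<phi> x = 0" if "x \<notin> U" for x
      using pderiv_at_zero_outside_support[of x \<phi>] that supp by auto
    then show "(\<lambda>x. indicator U x *\<^sub>R \<phi> x *\<^sub>R f x) = (\<lambda>x. \<phi> x *\<^sub>R f x)"
      "(\<lambda>x. indicator U x *\<^sub>R pderiv_at i \<phi> x *\<^sub>R f x) = (\<lambda>x. pderiv_at i \<phi> x *\<^sub>R f x)"
      by (auto simp: fun_eq_iff indicator_def)
  qed
  show "set_integrable lebesgue U (\<lambda>x. \<phi> x *\<^sub>R f x)" "set_integrable lebesgue U (\<lambda>x. pderiv_at i \<phi> x *\<^sub>R f x)"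
    unfolding set_integrable_def e by (rule i1, rule i2)
qed

lemma weak_pderiv_unique:
  assumes U: "open U" and "has_weak_pderiv U i f g" "has_weak_pderiv U i f h"
  shows "AE x in lebesgue. x \<in> U \<longrightarrow> g x = h x"
proof -
  have g: "g \<in> Lp_loc 1 U" and h: "h \<in> Lp_loc 1 U" using assms by (auto simp: has_weak_pderiv_def)
  have "AE x in lebesgue. x \<in> U \<longrightarrow> g x - h x = 0"
  proof (rule fundamental_lemma[OF U Lp_loc_1_diff[OF g h]])
    fix \<phi> :: "real^'a \<Rightarrow> real" assume \<phi>: "\<phi> \<in> test_functions U"
    have "(LINT x:U|lebesgue. \<phi> x *\<^sub>R (g x - h x)) = (LINT x:U|lebesgue. \<phi> x *\<^sub>R g x) - (LINT x:U|lebesgue. \<phi> x *\<^sub>R h x)"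
      using test_function_integrable[OF \<phi> g] test_function_integrable[OF \<phi> h] by (simp add: scaleR_diff_right)
    also have "\<dots> = 0" using assms(2,3) \<phi> by (simp add: has_weak_pderiv_def)
    finally show "(LINT x:U|lebesgue. \<phi> x *\<^sub>R (g x - h x)) = 0" .
  qed
  then show ?thesis by simp
qed

lemma weak_pderivI:
  assumes "has_weak_pderiv U i f g"
  shows "has_weak_pderiv U i f (weak_pderiv U i f)"
  unfolding weak_pderiv_def by (rule someI[of "has_weak_pderiv U i f", OF assms])

lemma weak_pderiv_AE:
  assumes "open U" "has_weak_pderiv U i f g"
  shows "AE x in lebesgue. x \<in> U \<longrightarrow> weak_pderiv U i f x = g x"
  using weak_pderiv_unique[OF assms(1) weak_pderivI[OF assms(2)] assms(2)] .

text \<open>Testing with the reflected kernel produces one sign from the reflection and one from the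
  definition of the weak derivative, and the two cancel. The ball around \<open>x\<close> must lie
  in \<open>U\<close>, since otherwise this kernel is not a test function there.\<close>

lemma conv_weak_pderiv:
  fixes f :: "real^'n::finite \<Rightarrow> 'b::euclidean_space"
  assumes "has_weak_pderiv U i f g" "r > 0" "cball x r \<subseteq> U"
  shows "conv (pderiv_at i (mol r)) (\<lambda>y. indicator U y *\<^sub>R f y) x = conv (mol r) (\<lambda>y. indicator U y *\<^sub>R g y) x"
proof -
  note t = mol_test_function[OF assms(2,3)]
  have "(LINT y:U|lebesgue. pderiv_at i (\<lambda>y. mol r (x - y)) y *\<^sub>R f y) = - (LINT y:U|lebesgue. mol r (x - y) *\<^sub>R g y)"
    using assms(1) t(1) by (simp add: has_weak_pderiv_def)
  then have "- (LINT y:U|lebesgue. pderiv_at i (mol r) (x - y) *\<^sub>R f y) = - (LINT y:U|lebesgue. mol r (x - y) *\<^sub>R g y)"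
    by (simp add: t(2) set_lebesgue_integral_def)
  then show ?thesis unfolding conv_def set_lebesgue_integral_def by (simp add: mult.commute)
qed

section \<open>Composition with contractions\<close>

lemma Lp_loc_1I:
  fixes f :: "real^'n::finite \<Rightarrow> 'b::euclidean_space"
  assumes "\<And>K. compact K \<Longrightarrow> K \<subseteq> U \<Longrightarrow> integrable lebesgue (\<lambda>x. indicator K x *\<^sub>R f x)"
  shows "f \<in> Lp_loc 1 U"
  unfolding Lp_loc_def Lp_def
proof (intro CollectI allI impI conjI)
  fix K assume "compact K \<and> K \<subseteq> U"
  then have i: "integrable lebesgue (\<lambda>x. indicator K x *\<^sub>R f x)" using assms by blast
  then show "set_borel_measurable lebesgue K f" unfolding set_borel_measurable_def by (rule borel_measurable_integrable)
  show "set_integrable lebesgue K (\<lambda>x. norm (f x) ^ 1)"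
    using integrable_norm[OF i] by (simp add: set_integrable_def)
qed

lemma Lp_imp_Lp_loc_extension:
  fixes f :: "real^'n::finite \<Rightarrow> 'b::euclidean_space"
  assumes f: "f \<in> Lp p U" and p: "p \<ge> 1"
  shows "(\<lambda>x. indicator U x *\<^sub>R f x) \<in> Lp_loc p UNIV"
  unfolding Lp_loc_def Lp_def
proof (intro CollectI allI impI conjI)
  fix K :: "(real^'n) set" assume "compact K \<and> K \<subseteq> UNIV"
  then have K: "K \<in> sets lebesgue" using lmeasurable_compact by blast
  have fm: "(\<lambda>x. indicator U x *\<^sub>R f x) \<in> borel_measurable lebesgue"
    and fi: "integrable lebesgue (\<lambda>x. indicator U x *\<^sub>R norm (f x) ^ p)"
    using f by (auto simp: Lp_def set_borel_measurable_def set_integrable_def)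
  show "set_borel_measurable lebesgue K (\<lambda>x. indicator U x *\<^sub>R f x)"
    unfolding set_borel_measurable_def by (intro borel_measurable_scaleR fm borel_measurable_indicator K)
  have e: "norm (indicator U x *\<^sub>R f x) ^ p = indicator U x *\<^sub>R norm (f x) ^ p" for x
    using p by (auto simp: indicator_def power_0_left)
  show "set_integrable lebesgue K (\<lambda>x. norm (indicator U x *\<^sub>R f x) ^ p)"
    unfolding set_integrable_def e by (rule integrable_mult_indicator[OF K fi])
qed

lemma mol_seq_properties:
  shows "smooth (mol_seq k :: real^'n::finite \<Rightarrow> real)" "1 / real (Suc k) < norm x \<Longrightarrow> mol_seq k (x::real^'n) = 0"
  using mol_properties(1,3)[OF mol_seq_le(2)[of k]] less_imp_le unfolding mol_seq_def by blast+

lemma conv_mol_seq: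
  fixes f :: "real^'n::finite \<Rightarrow> 'b::euclidean_space"
  assumes "f \<in> Lp_loc 1 UNIV"
  shows "smooth (conv (mol_seq k) f)" "pderiv_at i (conv (mol_seq k) f) = conv (pderiv_at i (mol_seq k)) f"
  by (rule smooth_conv[OF mol_seq_properties(1) _ assms], erule mol_seq_properties(2))
     (rule pderiv_at_conv[OF mol_seq_properties(1) _ assms], erule mol_seq_properties(2))

text \<open>The weight is only bounded and measurable, so that limits can be taken both against test
  functions and against weights with a jump.\<close>

lemma tendsto_integral_mult_L1_loc:
  fixes f :: "real^'n::finite \<Rightarrow> 'b::euclidean_space" and m :: "real^'n \<Rightarrow> real"
  assumes m: "m \<in> borel_measurable lebesgue" "\<And>x. \<bar>m x\<bar> \<le> B" "\<And>x. x \<notin> K \<Longrightarrow> m x = 0" and K: "compact K"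
    and fk: "\<And>k. fk k \<in> Lp_loc 1 UNIV" and f: "f \<in> Lp_loc 1 UNIV"
    and lim: "(\<lambda>k. \<integral>\<^sup>+x\<in>K. ennreal (norm (fk k x - f x)) \<partial>lebesgue) \<longlonglongrightarrow> 0"
  shows "(\<lambda>k. LINT x|lebesgue. m x *\<^sub>R fk k x) \<longlonglongrightarrow> (LINT x|lebesgue. m x *\<^sub>R f x)"
proof (rule tendsto_L1_int)
  have B: "B \<ge> 0" using order_trans[OF abs_ge_zero m(2)] .
  note [measurable] = Lp_loc_measurable[OF f] Lp_loc_measurable[OF fk]
  have [measurable]: "K \<in> sets lebesgue" using lmeasurable_compact[OF K] by auto
  show "integrable lebesgue (\<lambda>x. m x *\<^sub>R fk n x)" for n by (rule integrable_mult_Lp_loc[OF fk K subset_UNIV m])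
  show "integrable lebesgue (\<lambda>x. m x *\<^sub>R f x)" by (rule integrable_mult_Lp_loc[OF f K subset_UNIV m])
  have "(\<lambda>n. ennreal B * (\<integral>\<^sup>+x\<in>K. ennreal (norm (fk n x - f x)) \<partial>lebesgue)) \<longlonglongrightarrow> ennreal B * 0"
    by (intro ennreal_tendsto_cmult lim) auto
  then have l: "(\<lambda>n. ennreal B * (\<integral>\<^sup>+x\<in>K. ennreal (norm (fk n x - f x)) \<partial>lebesgue)) \<longlonglongrightarrow> 0" by simp
  show "(\<lambda>n. \<integral>\<^sup>+x. ennreal (norm (m x *\<^sub>R fk n x - m x *\<^sub>R f x)) \<partial>lebesgue) \<longlonglongrightarrow> 0"
  proof (rule tendsto_0_le_ennreal[OF l])
    fix n
    have "(\<integral>\<^sup>+x. ennreal (norm (m x *\<^sub>R fk n x - m x *\<^sub>R f x)) \<partial>lebesgue)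
       \<le> (\<integral>\<^sup>+x. ennreal B * (ennreal (norm (fk n x - f x)) * indicator K x) \<partial>lebesgue)"
    proof (rule nn_integral_mono)
      fix x
      show "ennreal (norm (m x *\<^sub>R fk n x - m x *\<^sub>R f x)) \<le> ennreal B * (ennreal (norm (fk n x - f x)) * indicator K x)"
      proof (cases "x \<in> K")
        case True
        have "norm (m x *\<^sub>R fk n x - m x *\<^sub>R f x) = \<bar>m x\<bar> * norm (fk n x - f x)" by (simp flip: scaleR_diff_right)
        also have "\<dots> \<le> B * norm (fk n x - f x)" by (intro mult_right_mono m) auto
        finally have "ennreal (norm (m x *\<^sub>R fk n x - m x *\<^sub>R f x)) \<le> ennreal (B * norm (fk n x - f x))" by (rule ennreal_leI)
        then show ?thesis using True B by (simp add: ennreal_mult)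
      qed (simp add: m)
    qed
    also have "\<dots> = ennreal B * (\<integral>\<^sup>+x\<in>K. ennreal (norm (fk n x - f x)) \<partial>lebesgue)"
      by (rule nn_integral_cmult) measurable
    finally show "(\<integral>\<^sup>+x. ennreal (norm (m x *\<^sub>R fk n x - m x *\<^sub>R f x)) \<partial>lebesgue) \<le> ennreal B * (\<integral>\<^sup>+x\<in>K. ennreal (norm (fk n x - f x)) \<partial>lebesgue)" .
  qed
qed

text \<open>The chain rule below rests on two properties: the contraction bound provides domination,
  and continuity of \<open>P'\<close> in the base point provides pointwise convergence. The radial
  projection onto the disc has a kink on the unit circle, which is why a smoother truncation is used
  later.\<close>

locale contraction_C1 =
  fixes P :: "'b::euclidean_space \<Rightarrow> 'b" and P' :: "'b \<Rightarrow> 'b \<Rightarrow> 'b"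
  assumes deriv: "(P has_derivative P' z) (at z)"
    and contract: "norm (P' z w) \<le> norm w"
    and cont: "continuous_on UNIV (\<lambda>z. P' z w)"
begin

lemma linear': "linear (P' z)"
  using deriv has_derivative_linear by blast

lemma lipschitz: "norm (P a - P b) \<le> norm (a - b)"
proof -
  have "onorm (P' z) \<le> 1" for z using contract by (intro onorm_bound) auto
  then show ?thesis using differentiable_bound[of UNIV P P' 1 b a] deriv by (simp add: norm_minus_commute)
qed

lemma continuous: "continuous_on UNIV P"
  using deriv has_derivative_continuous_on[of UNIV P P'] by simp

text \<open>Continuity in the base point is assumed for each fixed direction; expanding the
  direction over the finite basis turns this into measurability of \<open>P' (F x) (G x)\<close> in
  both arguments.\<close>

lemma expand: "P' z w = (\<Sum>b\<in>Basis. (w \<bullet> b) *\<^sub>R P' z b)"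
proof -
  have "P' z w = P' z (\<Sum>b\<in>Basis. (w \<bullet> b) *\<^sub>R b)" by (simp add: euclidean_representation)
  then show ?thesis by (simp add: linear_sum[OF linear'] linear_cmul[OF linear'])
qed

lemma measurable_deriv:
  assumes [measurable]: "F \<in> borel_measurable M" "G \<in> borel_measurable M"
  shows "(\<lambda>x. P' (F x) (G x)) \<in> borel_measurable M"
proof -
  have [measurable]: "(\<lambda>z. P' z b) \<in> borel_measurable borel" for b
    using cont by (rule borel_measurable_continuous_onI)
  have "(\<lambda>x. \<Sum>b\<in>Basis. (G x \<bullet> b) *\<^sub>R P' (F x) b) \<in> borel_measurable M" by measurable
  also have "(\<lambda>x. \<Sum>b\<in>Basis. (G x \<bullet> b) *\<^sub>R P' (F x) b) = (\<lambda>x. P' (F x) (G x))"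
    by (rule ext) (rule expand[symmetric])
  finally show ?thesis .
qed

lemma measurable_comp: "F \<in> borel_measurable M \<Longrightarrow> (\<lambda>x. P (F x)) \<in> borel_measurable M"
  using borel_measurable_continuous_onI[OF continuous] by measurable

text \<open>The classical chain rule holds for mollifications and passes to the limit. The
  difference of the derivatives splits into \<open>P'\<close> applied to \<open>dk - G\<close>,
  small by contraction, and the change of base point at the fixed vector \<open>G\<close>, handled
  by dominated convergence. Extending \<open>f\<close> and \<open>g\<close> by zero makes
  mollification possible on the whole space.\<close>

lemma weak_pderiv_compose:
  fixes f g :: "real^'n::finite \<Rightarrow> 'b"
  assumes U: "open U" and w: "has_weak_pderiv U i f g"
    and f0: "(\<lambda>x. indicator U x *\<^sub>R f x) \<in> Lp_loc 1 UNIV" and g0: "(\<lambda>x. indicator U x *\<^sub>R g x) \<in> Lp_loc 1 UNIV"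
  shows "has_weak_pderiv U i (\<lambda>x. P (f x)) (\<lambda>x. P' (f x) (g x))"
proof -
  define F where "F x = indicator U x *\<^sub>R f x" for x
  define G where "G x = indicator U x *\<^sub>R g x" for x
  have F0: "F \<in> Lp_loc 1 UNIV" and G0: "G \<in> Lp_loc 1 UNIV" using f0 g0 unfolding F_def[abs_def] G_def[abs_def] .
  note [measurable] = Lp_loc_measurable[OF F0] Lp_loc_measurable[OF G0]
  have PF [measurable]: "(\<lambda>x. P (F x)) \<in> borel_measurable lebesgue"
    by (rule measurable_comp) measurable
  have PG [measurable]: "(\<lambda>x. P' (F x) (G x)) \<in> borel_measurable lebesgue"
    by (rule measurable_deriv) measurable
  have cs: "K \<in> sets lebesgue" if "compact K" for K :: "(real^'n) set"
    using lmeasurable_compact[OF that] by auto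
  have i1: "integrable lebesgue (\<lambda>x. indicator K x *\<^sub>R P (F x))" if K: "compact K" for K
  proof (rule Bochner_Integration.integrable_bound)
    show "integrable lebesgue (\<lambda>x. indicator K x *\<^sub>R norm (P 0) + norm (indicator K x *\<^sub>R F x))"
      using lmeasurable_compact[OF K] Lp_loc_1_integrable[OF F0 K]
      by (intro Bochner_Integration.integrable_add integrable_norm integrable_scaleR_left) (auto simp: fmeasurable_def)
    show "(\<lambda>x. indicator K x *\<^sub>R P (F x)) \<in> borel_measurable lebesgue" using cs[OF K] by measurable
    have "norm (P v) \<le> norm (P 0) + norm v" for v
      using lipschitz[of v 0] norm_triangle_sub[of "P v" "P 0"] by simp
    then show "AE x in lebesgue. norm (indicator K x *\<^sub>R P (F x)) \<le> norm (indicator K x *\<^sub>R norm (P 0) + norm (indicator K x *\<^sub>R F x))"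
      by (intro AE_I2) (auto simp: indicator_def)
  qed
  have i2: "integrable lebesgue (\<lambda>x. indicator K x *\<^sub>R P' (F x) (G x))" if K: "compact K" for K
  proof (rule Bochner_Integration.integrable_bound)
    show "integrable lebesgue (\<lambda>x. indicator K x *\<^sub>R G x)" by (rule Lp_loc_1_integrable[OF G0 K]) simp
    show "(\<lambda>x. indicator K x *\<^sub>R P' (F x) (G x)) \<in> borel_measurable lebesgue" using cs[OF K] by measurable
    show "AE x in lebesgue. norm (indicator K x *\<^sub>R P' (F x) (G x)) \<le> norm (indicator K x *\<^sub>R G x)"
      by (intro AE_I2) (auto intro: mult_left_mono contract)
  qed
  have L1: "(\<lambda>x. P (f x)) \<in> Lp_loc 1 U"
  proof (rule Lp_loc_1I)
    fix K assume K: "compact K" "K \<subseteq> U"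
    have "(\<lambda>x. indicator K x *\<^sub>R P (f x)) = (\<lambda>x. indicator K x *\<^sub>R P (F x))"
      using K(2) by (auto simp: fun_eq_iff indicator_def F_def)
    then show "integrable lebesgue (\<lambda>x. indicator K x *\<^sub>R P (f x))" using i1[OF K(1)] by simp
  qed
  have L2: "(\<lambda>x. P' (f x) (g x)) \<in> Lp_loc 1 U"
  proof (rule Lp_loc_1I)
    fix K assume K: "compact K" "K \<subseteq> U"
    have "(\<lambda>x. indicator K x *\<^sub>R P' (f x) (g x)) = (\<lambda>x. indicator K x *\<^sub>R P' (F x) (G x))"
      using K(2) by (auto simp: fun_eq_iff indicator_def F_def G_def)
    then show "integrable lebesgue (\<lambda>x. indicator K x *\<^sub>R P' (f x) (g x))" using i2[OF K(1)] by simp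
  qed
  have main: "(LINT x|lebesgue. pderiv_at i \<phi> x *\<^sub>R P (F x)) = - (LINT x|lebesgue. \<phi> x *\<^sub>R P' (F x) (G x))"
    if \<phi>: "\<phi> \<in> test_functions U" for \<phi> :: "real^'n \<Rightarrow> real"
  proof -
    define K where "K = closure {x. \<phi> x \<noteq> 0}"
    have sm: "smooth \<phi>" and KU: "K \<subseteq> U" and Kc: "compact K"
      using \<phi> by (auto simp: test_functions_def K_def)
    have \<phi>U: "\<phi> \<in> test_functions UNIV" using \<phi> by (auto simp: test_functions_def)
    have z: "\<phi> x = 0" "pderiv_at i \<phi> x = 0" if "x \<notin> K" for x
      using pderiv_at_zero_outside_support[of x \<phi>] that unfolding K_def by auto
    obtain r where r: "r > 0" "\<And>x. r < norm x \<Longrightarrow> \<phi> x = 0" using test_functions_zero_outside[OF \<phi>] by blast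
    have dz: "pderiv_at i \<phi> x = 0" if "r < norm x" for x using pderiv_at_zero_outside[of r \<phi>, OF r(2) that] .
    have cp: "continuous_on UNIV \<phi>" "continuous_on UNIV (pderiv_at i \<phi>)"
      using smooth_continuous[OF sm] smooth_continuous[OF smooth_pderiv[OF sm]] by auto
    obtain M1 where M1: "M1 \<ge> 0" "\<And>x. \<bar>\<phi> x\<bar> \<le> M1" using continuous_zero_outside_bounded[OF cp(1) r(2)] by auto
    obtain M2 where M2: "M2 \<ge> 0" "\<And>x. \<bar>pderiv_at i \<phi> x\<bar> \<le> M2" using continuous_zero_outside_bounded[OF cp(2) dz] by auto
    obtain e where e: "e > 0" "(\<Union>x\<in>K. cball x e) \<subseteq> U" using compact_subset_open_imp_cball_epsilon_subset[OF Kc U KU] .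
    obtain k0 where k0: "1 / real (Suc k0) < e" using e(1) nat_approx_posE by blast
    define fk where "fk k = conv (mol_seq k) F" for k
    define dk where "dk k = pderiv_at i (fk k)" for k
    have fks: "smooth (fk k)" for k unfolding fk_def by (rule conv_mol_seq(1)[OF F0])
    \<comment> \<open>On the support of the test function, differentiation commutes with
      mollification once the kernel radius is below the distance \<open>e\<close> to the complement
      of \<open>U\<close>; hence only the tail \<open>k \<ge> k0\<close> counts.\<close>
    have dkg: "dk k x = conv (mol_seq k) G x" if "x \<in> K" "k \<ge> k0" for k x
    proof -
      have "1 / real (Suc k) \<le> 1 / real (Suc k0)" using that by (simp add: frac_le)
      then have "cball x (1 / real (Suc k)) \<subseteq> cball x e" using k0 by (intro subset_cball) simp
      then have "cball x (1 / real (Suc k)) \<subseteq> U" using e(2) that(1) by blast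
      then have "conv (pderiv_at i (mol_seq k)) F x = conv (mol_seq k) G x"
        unfolding F_def G_def mol_seq_def by (rule conv_weak_pderiv[OF w mol_seq_le(2)])
      then show ?thesis unfolding dk_def fk_def conv_mol_seq(2)[OF F0] .
    qed
    have fkc: "continuous_on UNIV (fk k)" "continuous_on UNIV (dk k)" for k
      unfolding dk_def by (intro smooth_continuous smooth_pderiv fks)+
    have [measurable]: "fk k \<in> borel_measurable lebesgue" "dk k \<in> borel_measurable lebesgue" for k
      by (intro borel_measurable_lebesgueI borel_measurable_continuous_onI fkc)+
    have Pd: "((\<lambda>x. P (fk k x)) has_derivative (\<lambda>h. P' (fk k x) (frechet_derivative (fk k) (at x) h))) (at x)" for k x
      by (rule has_derivative_compose[OF frechet_derivative_worksI[OF smooth_differentiable[OF fks]] deriv])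
    have pP: "pderiv_at i (\<lambda>x. P (fk k x)) x = P' (fk k x) (dk k x)" for k x
      using pderiv_at_eq[OF Pd] by (simp add: dk_def pderiv_at_def)
    have A: "(LINT x|lebesgue. pderiv_at i \<phi> x *\<^sub>R P (fk k x)) = - (LINT x|lebesgue. \<phi> x *\<^sub>R P' (fk k x) (dk k x))"
      and LP: "(\<lambda>x. P (fk k x)) \<in> Lp_loc 1 UNIV" "(\<lambda>x. P' (fk k x) (dk k x)) \<in> Lp_loc 1 UNIV" for k
    proof -
      have "has_weak_pderiv UNIV i (\<lambda>x. P (fk k x)) (pderiv_at i (\<lambda>x. P (fk k x)))"
      proof (rule has_weak_pderiv_differentiable)
        show "(\<lambda>x. P (fk k x)) differentiable (at x)" for x using Pd by (rule differentiableI)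
        fix r
        obtain M where "\<forall>x. norm x \<le> r \<longrightarrow> norm (dk k x) \<le> M" using bounded_on_balls_continuous[OF fkc(2)] by blast
        then show "\<exists>M. \<forall>x. norm x \<le> r \<longrightarrow> norm (pderiv_at i (\<lambda>x. P (fk k x)) x) \<le> M"
          unfolding pP using order_trans[OF contract] by blast
      qed
      then have h: "has_weak_pderiv UNIV i (\<lambda>x. P (fk k x)) (\<lambda>x. P' (fk k x) (dk k x))"
        by (simp only: ext[of "pderiv_at i (\<lambda>x. P (fk k x))", OF pP])
      then show "(LINT x|lebesgue. pderiv_at i \<phi> x *\<^sub>R P (fk k x)) = - (LINT x|lebesgue. \<phi> x *\<^sub>R P' (fk k x) (dk k x))"
        "(\<lambda>x. P (fk k x)) \<in> Lp_loc 1 UNIV" "(\<lambda>x. P' (fk k x) (dk k x)) \<in> Lp_loc 1 UNIV"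
        using \<phi>U by (auto simp: has_weak_pderiv_def set_lebesgue_integral_def)
    qed
    have Ks [measurable]: "K \<in> sets lebesgue" by (rule cs[OF Kc])
    have limf: "(\<lambda>k. \<integral>\<^sup>+x\<in>K. ennreal (norm (fk k x - F x)) \<partial>lebesgue) \<longlonglongrightarrow> 0"
      using conv_tendsto_Lp_loc[OF F0 _ Kc] by (simp add: fk_def)
    have "(\<lambda>k. \<integral>\<^sup>+x\<in>K. ennreal (norm (conv (mol_seq k) G x - G x)) \<partial>lebesgue) \<longlonglongrightarrow> 0"
      using conv_tendsto_Lp_loc[OF G0 _ Kc] by simp
    then have limd: "(\<lambda>k. \<integral>\<^sup>+x\<in>K. ennreal (norm (dk k x - G x)) \<partial>lebesgue) \<longlonglongrightarrow> 0"
    proof (rule Lim_transform_eventually)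
      show "\<forall>\<^sub>F k in sequentially. (\<integral>\<^sup>+x\<in>K. ennreal (norm (conv (mol_seq k) G x - G x)) \<partial>lebesgue) = (\<integral>\<^sup>+x\<in>K. ennreal (norm (dk k x - G x)) \<partial>lebesgue)"
        by (intro eventually_sequentiallyI[of k0] nn_integral_cong) (auto simp: dkg indicator_def)
    qed
    define W where "W k x = indicator K x *\<^sub>R (fk k x - F x)" for k x
    have fkL: "fk k \<in> Lp_loc 1 UNIV" for k by (rule Lp_loc_continuous[OF fkc(1)])
    have Wi: "integrable lebesgue (W k)" for k
      unfolding W_def using Lp_loc_1_integrable[OF Lp_loc_1_diff[OF fkL F0] Kc] by simp
    have "(\<lambda>k. ennreal (LINT x|lebesgue. norm (W k x))) \<longlonglongrightarrow> ennreal 0"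
    proof -
      have "ennreal (LINT x|lebesgue. norm (W k x)) = (\<integral>\<^sup>+x\<in>K. ennreal (norm (fk k x - F x)) \<partial>lebesgue)" for k
      proof -
        have "ennreal (LINT x|lebesgue. norm (W k x)) = (\<integral>\<^sup>+x. ennreal (norm (W k x)) \<partial>lebesgue)"
          using Wi by (intro nn_integral_eq_integral[symmetric]) auto
        also have "\<dots> = (\<integral>\<^sup>+x\<in>K. ennreal (norm (fk k x - F x)) \<partial>lebesgue)"
          by (intro nn_integral_cong) (auto simp: W_def indicator_def)
        finally show ?thesis .
      qed
      then show ?thesis using limf by simp
    qed
    then have "(\<lambda>k. LINT x|lebesgue. norm (W k x)) \<longlonglongrightarrow> 0"
      by (subst (asm) tendsto_ennreal_iff) auto
    \<comment> \<open>Continuity of \<open>P'\<close> in its base point needs pointwise convergence,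
      which convergence in the mean provides only along a subsequence.\<close>
    from tendsto_L1_AE_subseq[OF Wi this] obtain \<sigma> where \<sigma>: "strict_mono \<sigma>"
      and WAE: "AE x in lebesgue. (\<lambda>n. W (\<sigma> n) x) \<longlonglongrightarrow> 0" by blast
    have limf': "(\<lambda>k. \<integral>\<^sup>+x\<in>K. ennreal (norm (fk (\<sigma> k) x - F x)) \<partial>lebesgue) \<longlonglongrightarrow> 0"
      and limd': "(\<lambda>k. \<integral>\<^sup>+x\<in>K. ennreal (norm (dk (\<sigma> k) x - G x)) \<partial>lebesgue) \<longlonglongrightarrow> 0"
      using LIMSEQ_subseq_LIMSEQ[OF limf \<sigma>] LIMSEQ_subseq_LIMSEQ[OF limd \<sigma>] by (simp_all add: o_def)
    have PFL: "(\<lambda>x. P (F x)) \<in> Lp_loc 1 UNIV" by (rule Lp_loc_1I) (use i1 in auto)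
    have PGL: "(\<lambda>x. P' (F x) (G x)) \<in> Lp_loc 1 UNIV" by (rule Lp_loc_1I) (use i2 in auto)
    have pm: "\<phi> \<in> borel_measurable lebesgue" "pderiv_at i \<phi> \<in> borel_measurable lebesgue"
      by (intro borel_measurable_lebesgueI borel_measurable_continuous_onI cp)+
    have lP: "(\<lambda>k. \<integral>\<^sup>+x\<in>K. ennreal (norm (P (fk (\<sigma> k) x) - P (F x))) \<partial>lebesgue) \<longlonglongrightarrow> 0"
      by (rule tendsto_0_le_ennreal[OF limf']) (intro nn_integral_mono mult_right_mono ennreal_leI lipschitz zero_le)
    have T1: "(\<lambda>k. LINT x|lebesgue. pderiv_at i \<phi> x *\<^sub>R P (fk (\<sigma> k) x)) \<longlonglongrightarrow> (LINT x|lebesgue. pderiv_at i \<phi> x *\<^sub>R P (F x))"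
      by (rule tendsto_integral_mult_L1_loc[OF pm(2) M2(2) z(2) Kc LP(1) PFL lP])
    have [measurable]: "(\<lambda>x. P' (fk k x) (G x)) \<in> borel_measurable lebesgue" for k
      by (rule measurable_deriv) measurable
    have limP: "(\<lambda>n. \<integral>\<^sup>+x\<in>K. ennreal (norm (P' (fk (\<sigma> n) x) (G x) - P' (F x) (G x))) \<partial>lebesgue) \<longlonglongrightarrow> (\<integral>\<^sup>+x. 0 \<partial>(lebesgue :: (real^'n) measure))"
    proof (rule nn_integral_dominated_convergence[where w="\<lambda>x. ennreal (2 * norm (indicator K x *\<^sub>R G x))"])
      show "AE x in lebesgue. ennreal (norm (P' (fk (\<sigma> n) x) (G x) - P' (F x) (G x))) * indicator K x \<le> ennreal (2 * norm (indicator K x *\<^sub>R G x))" for n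
      proof (rule AE_I2)
        fix x
        have "norm (P' (fk (\<sigma> n) x) (G x) - P' (F x) (G x)) \<le> norm (G x) + norm (G x)"
          by (rule order_trans[OF norm_triangle_ineq4 add_mono[OF contract contract]])
        then show "ennreal (norm (P' (fk (\<sigma> n) x) (G x) - P' (F x) (G x))) * indicator K x \<le> ennreal (2 * norm (indicator K x *\<^sub>R G x))"
          by (auto simp: indicator_def intro: ennreal_leI)
      qed
      have "integrable lebesgue (\<lambda>x. 2 * norm (indicator K x *\<^sub>R G x))"
        using Lp_loc_1_integrable[OF G0 Kc] by (intro integrable_mult_right integrable_norm) auto
      from this[THEN integrableD(2)] show "(\<integral>\<^sup>+x. ennreal (2 * norm (indicator K x *\<^sub>R G x)) \<partial>lebesgue) < \<infinity>"
        by (simp add: less_top)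
      show "AE x in lebesgue. (\<lambda>n. ennreal (norm (P' (fk (\<sigma> n) x) (G x) - P' (F x) (G x))) * indicator K x) \<longlonglongrightarrow> 0"
        using WAE
      proof eventually_elim
        case (elim x)
        show ?case
        proof (cases "x \<in> K")
          case True
          then have "(\<lambda>n. fk (\<sigma> n) x) \<longlonglongrightarrow> F x" using elim by (simp add: W_def LIM_zero_iff)
          moreover have "isCont (\<lambda>z. P' z (G x)) (F x)" using cont continuous_on_eq_continuous_at by blast
          ultimately have "(\<lambda>n. P' (fk (\<sigma> n) x) (G x)) \<longlonglongrightarrow> P' (F x) (G x)" using isCont_tendsto_compose by fast
          then have "(\<lambda>n. norm (P' (fk (\<sigma> n) x) (G x) - P' (F x) (G x))) \<longlonglongrightarrow> 0"
            by (intro tendsto_norm_zero LIM_zero)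
          from tendsto_ennrealI[OF this] show ?thesis using True by simp
        qed simp
      qed
    qed measurable
    have lP': "(\<lambda>n. \<integral>\<^sup>+x\<in>K. ennreal (norm (P' (fk (\<sigma> n) x) (dk (\<sigma> n) x) - P' (F x) (G x))) \<partial>lebesgue) \<longlonglongrightarrow> 0"
    proof (rule tendsto_0_le_ennreal)
      show "(\<lambda>n. (\<integral>\<^sup>+x\<in>K. ennreal (norm (dk (\<sigma> n) x - G x)) \<partial>lebesgue)
          + (\<integral>\<^sup>+x\<in>K. ennreal (norm (P' (fk (\<sigma> n) x) (G x) - P' (F x) (G x))) \<partial>lebesgue)) \<longlonglongrightarrow> 0"
        using tendsto_add[OF limd' limP] by simp
      fix n
      let ?A = "\<lambda>x. ennreal (norm (dk (\<sigma> n) x - G x)) * indicator K x"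
      let ?B = "\<lambda>x. ennreal (norm (P' (fk (\<sigma> n) x) (G x) - P' (F x) (G x))) * indicator K x"
      have "(\<integral>\<^sup>+x\<in>K. ennreal (norm (P' (fk (\<sigma> n) x) (dk (\<sigma> n) x) - P' (F x) (G x))) \<partial>lebesgue) \<le> (\<integral>\<^sup>+x. ?A x + ?B x \<partial>lebesgue)"
      proof (rule nn_integral_mono)
        fix x
        have "norm (P' (fk (\<sigma> n) x) (dk (\<sigma> n) x) - P' (F x) (G x))
           = norm (P' (fk (\<sigma> n) x) (dk (\<sigma> n) x - G x) + (P' (fk (\<sigma> n) x) (G x) - P' (F x) (G x)))"
          by (simp add: linear_diff[OF linear'])
        also have "\<dots> \<le> norm (dk (\<sigma> n) x - G x) + norm (P' (fk (\<sigma> n) x) (G x) - P' (F x) (G x))"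
          by (rule order_trans[OF norm_triangle_ineq add_right_mono[OF contract]])
        finally have "ennreal (norm (P' (fk (\<sigma> n) x) (dk (\<sigma> n) x) - P' (F x) (G x)))
           \<le> ennreal (norm (dk (\<sigma> n) x - G x)) + ennreal (norm (P' (fk (\<sigma> n) x) (G x) - P' (F x) (G x)))"
          by (simp add: ennreal_leI flip: ennreal_plus)
        then show "ennreal (norm (P' (fk (\<sigma> n) x) (dk (\<sigma> n) x) - P' (F x) (G x))) * indicator K x \<le> ?A x + ?B x"
          by (simp add: indicator_def)
      qed
      also have "\<dots> = (\<integral>\<^sup>+x. ?A x \<partial>lebesgue) + (\<integral>\<^sup>+x. ?B x \<partial>lebesgue)"
        by (rule nn_integral_add) measurable
      finally show "(\<integral>\<^sup>+x\<in>K. ennreal (norm (P' (fk (\<sigma> n) x) (dk (\<sigma> n) x) - P' (F x) (G x))) \<partial>lebesgue)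
         \<le> (\<integral>\<^sup>+x. ?A x \<partial>lebesgue) + (\<integral>\<^sup>+x. ?B x \<partial>lebesgue)" .
    qed
    have T2: "(\<lambda>k. LINT x|lebesgue. \<phi> x *\<^sub>R P' (fk (\<sigma> k) x) (dk (\<sigma> k) x)) \<longlonglongrightarrow> (LINT x|lebesgue. \<phi> x *\<^sub>R P' (F x) (G x))"
      by (rule tendsto_integral_mult_L1_loc[OF pm(1) M1(2) z(1) Kc LP(2) PGL lP'])
    have "(\<lambda>k. - (LINT x|lebesgue. \<phi> x *\<^sub>R P' (fk (\<sigma> k) x) (dk (\<sigma> k) x))) \<longlonglongrightarrow> - (LINT x|lebesgue. \<phi> x *\<^sub>R P' (F x) (G x))"
      by (rule tendsto_minus[OF T2])
    with T1 show ?thesis unfolding A by (rule LIMSEQ_unique)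
  qed
  show ?thesis
    unfolding has_weak_pderiv_def
  proof (intro conjI L1 L2 allI impI)
    fix \<phi> :: "real^'n \<Rightarrow> real" assume \<phi>: "\<phi> \<in> test_functions U"
    then have supp: "closure {x. \<phi> x \<noteq> 0} \<subseteq> U" by (auto simp: test_functions_def)
    have z: "\<phi> x = 0" "pderiv_at i \<phi> x = 0" if "x \<notin> U" for x
      using pderiv_at_zero_outside_support[of x \<phi>] that supp by auto
    have e1: "indicator U x *\<^sub>R pderiv_at i \<phi> x *\<^sub>R P (f x) = pderiv_at i \<phi> x *\<^sub>R P (F x)" for x
      using z[of x] by (cases "x \<in> U") (auto simp: F_def)
    have e2: "indicator U x *\<^sub>R \<phi> x *\<^sub>R P' (f x) (g x) = \<phi> x *\<^sub>R P' (F x) (G x)" for x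
      using z[of x] by (cases "x \<in> U") (auto simp: F_def G_def)
    show "(LINT x:U|lebesgue. pderiv_at i \<phi> x *\<^sub>R P (f x)) = - (LINT x:U|lebesgue. \<phi> x *\<^sub>R P' (f x) (g x))"
      unfolding set_lebesgue_integral_def e1 e2 by (rule main[OF \<phi>])
  qed
qed

text \<open>The condition \<open>P 0 = 0\<close> makes \<open>P\<close> commute with extension by
  zero and turns the Lipschitz bound into \<open>norm (P v) \<le> norm v\<close>; the contraction
  bound does the same for the gradient, so square integrability is inherited.\<close>

lemma H1_compose:
  fixes f :: "real^'n::finite \<Rightarrow> 'b"
  assumes U: "open U" and f: "f \<in> H1 U" and P0: "P 0 = 0"
  shows "(\<lambda>x. P (f x)) \<in> H1 U"
    "AE x in lebesgue. x \<in> U \<longrightarrow> weak_pderiv U i (\<lambda>x. P (f x)) x = P' (f x) (weak_pderiv U i f x)"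
proof -
  have f2: "f \<in> Lp 2 U" using f by (simp add: H1_def)
  have F0: "(\<lambda>x. indicator U x *\<^sub>R f x) \<in> Lp_loc 1 UNIV"
    using Lp_loc_1[OF Lp_imp_Lp_loc_extension[OF f2]] by simp
  have U': "U \<in> sets lebesgue" using U by auto
  have Fm: "(\<lambda>x. indicator U x *\<^sub>R f x) \<in> borel_measurable lebesgue" by (rule Lp_loc_measurable[OF F0])
  have bound: "h \<in> Lp 2 U" if "g \<in> Lp 2 U" "\<And>x. norm (h x) \<le> norm (g x)" "(\<lambda>x. indicator U x *\<^sub>R h x) \<in> borel_measurable lebesgue" for g h :: "real^'n \<Rightarrow> 'b"
    unfolding Lp_def
  proof (intro CollectI conjI)
    show "set_borel_measurable lebesgue U h" using that(3) by (simp add: set_borel_measurable_def)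
    have m: "(\<lambda>x. indicator U x * norm (indicator U x *\<^sub>R h x) ^ 2) \<in> borel_measurable lebesgue"
      using that(3) U' by measurable
    have m': "(\<lambda>x. indicator U x * norm (h x) ^ 2) \<in> borel_measurable lebesgue"
      using m by (rule measurable_cong[THEN iffD1, rotated]) (auto simp: indicator_def)
    have "integrable lebesgue (\<lambda>x. indicator U x *\<^sub>R norm (g x) ^ 2)" using that(1) by (simp add: Lp_def set_integrable_def)
    then show "set_integrable lebesgue U (\<lambda>x. norm (h x) ^ 2)"
      unfolding set_integrable_def
      by (rule Bochner_Integration.integrable_bound) (use m' that(2) in \<open>auto intro!: AE_I2 mult_left_mono power_mono\<close>)
  qed
  have key: "\<exists>g. has_weak_pderiv U i f g \<and> g \<in> Lp 2 U \<and> has_weak_pderiv U i (\<lambda>x. P (f x)) (\<lambda>x. P' (f x) (g x)) \<and> (\<lambda>x. P' (f x) (g x)) \<in> Lp 2 U" for i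
  proof -
    obtain g where g: "has_weak_pderiv U i f g" "g \<in> Lp 2 U" using f by (auto simp: H1_def)
    have G0: "(\<lambda>x. indicator U x *\<^sub>R g x) \<in> Lp_loc 1 UNIV"
      using Lp_loc_1[OF Lp_imp_Lp_loc_extension[OF g(2)]] by simp
    have "(\<lambda>x. P' (indicator U x *\<^sub>R f x) (indicator U x *\<^sub>R g x)) \<in> borel_measurable lebesgue"
      by (rule measurable_deriv[OF Fm Lp_loc_measurable[OF G0]])
    also have "(\<lambda>x. P' (indicator U x *\<^sub>R f x) (indicator U x *\<^sub>R g x)) = (\<lambda>x. indicator U x *\<^sub>R P' (f x) (g x))"
      by (auto simp: fun_eq_iff indicator_def linear_0[OF linear'])
    finally have "(\<lambda>x. P' (f x) (g x)) \<in> Lp 2 U" using contract by (intro bound[OF g(2)]) auto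
    then show ?thesis using g weak_pderiv_compose[OF U g(1) F0 G0] by blast
  qed
  have "(\<lambda>x. P (indicator U x *\<^sub>R f x)) \<in> borel_measurable lebesgue" by (rule measurable_comp[OF Fm])
  also have "(\<lambda>x. P (indicator U x *\<^sub>R f x)) = (\<lambda>x. indicator U x *\<^sub>R P (f x))"
    by (auto simp: fun_eq_iff indicator_def P0)
  finally have "(\<lambda>x. P (f x)) \<in> Lp 2 U" using lipschitz[of _ 0] P0 by (intro bound[OF f2]) auto
  then show "(\<lambda>x. P (f x)) \<in> H1 U" unfolding H1_def using key by blast
  obtain g where g: "has_weak_pderiv U i f g" "has_weak_pderiv U i (\<lambda>x. P (f x)) (\<lambda>x. P' (f x) (g x))" using key by blast
  from weak_pderiv_AE[OF U g(1)] weak_pderiv_AE[OF U g(2)]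
  show "AE x in lebesgue. x \<in> U \<longrightarrow> weak_pderiv U i (\<lambda>x. P (f x)) x = P' (f x) (weak_pderiv U i f x)"
    by eventually_elim auto
qed

end

text \<open>This supplies the approximating sequence demanded by the definition of a plane trace.
  Derivatives are compared through witnesses \<open>g i\<close>, which agree with the chosen weak
  derivatives almost everywhere.\<close>

lemma H1_loc_mollify:
  fixes f :: "real^'n::finite \<Rightarrow> 'b::euclidean_space"
  assumes f: "f \<in> H1_loc UNIV" and K: "compact K"
  shows "smooth (conv (mol_seq k) f)"
    "(\<lambda>k. \<integral>\<^sup>+x\<in>K. ennreal ((norm (conv (mol_seq k) f x - f x))\<^sup>2 +
         (\<Sum>i\<in>UNIV. (norm (pderiv_at i (conv (mol_seq k) f) x - weak_pderiv UNIV i f x))\<^sup>2)) \<partial>lebesgue) \<longlonglongrightarrow> 0"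
proof -
  have f2: "f \<in> Lp_loc 2 UNIV" using f by (simp add: H1_loc_def)
  have f1: "f \<in> Lp_loc 1 UNIV" using Lp_loc_1[OF f2] by simp
  show s: "smooth (conv (mol_seq k) f)" for k by (rule conv_mol_seq(1)[OF f1])
  have "\<exists>g. \<forall>i. has_weak_pderiv UNIV i f (g i) \<and> g i \<in> Lp_loc 2 UNIV"
    using f by (intro choice) (auto simp: H1_loc_def)
  then obtain g where g: "\<And>i. has_weak_pderiv UNIV i f (g i)" "\<And>i. g i \<in> Lp_loc 2 UNIV" by blast
  have d: "pderiv_at i (conv (mol_seq k) f) x = conv (mol_seq k) (g i) x" for i k x
    using conv_weak_pderiv[OF g(1) mol_seq_le(2)[of k], of x i] unfolding conv_mol_seq(2)[OF f1]
    by (simp add: mol_seq_def)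
  have ae: "AE x in lebesgue. \<forall>i. weak_pderiv UNIV i f x = g i x"
    using weak_pderiv_AE[OF open_UNIV g(1)] by (simp add: AE_all_countable)
  note [measurable] = Lp_loc_measurable[OF f2] Lp_loc_measurable[OF g(2)]
  have [measurable]: "conv (mol_seq k) f \<in> borel_measurable lebesgue" "conv (mol_seq k) (g i) \<in> borel_measurable lebesgue" for k i
  proof -
    show "conv (mol_seq k) f \<in> borel_measurable lebesgue"
      by (intro borel_measurable_lebesgueI borel_measurable_continuous_onI smooth_continuous s)
    have "smooth (conv (mol_seq k) (g i))" by (rule conv_mol_seq(1)[OF Lp_loc_1[OF g(2)]]) simp
    then show "conv (mol_seq k) (g i) \<in> borel_measurable lebesgue"
      by (intro borel_measurable_lebesgueI borel_measurable_continuous_onI smooth_continuous)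
  qed
  have [measurable]: "K \<in> sets lebesgue" using lmeasurable_compact[OF K] by auto
  have "(\<integral>\<^sup>+x\<in>K. ennreal ((norm (conv (mol_seq k) f x - f x))\<^sup>2 +
         (\<Sum>i\<in>UNIV. (norm (pderiv_at i (conv (mol_seq k) f) x - weak_pderiv UNIV i f x))\<^sup>2)) \<partial>lebesgue)
     = (\<integral>\<^sup>+x\<in>K. ennreal ((norm (conv (mol_seq k) f x - f x))\<^sup>2) \<partial>lebesgue) +
       (\<Sum>i\<in>UNIV. \<integral>\<^sup>+x\<in>K. ennreal ((norm (conv (mol_seq k) (g i) x - g i x))\<^sup>2) \<partial>lebesgue)" for k
  proof -
    have "(\<integral>\<^sup>+x\<in>K. ennreal ((norm (conv (mol_seq k) f x - f x))\<^sup>2 +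
         (\<Sum>i\<in>UNIV. (norm (pderiv_at i (conv (mol_seq k) f) x - weak_pderiv UNIV i f x))\<^sup>2)) \<partial>lebesgue)
      = (\<integral>\<^sup>+x. ennreal ((norm (conv (mol_seq k) f x - f x))\<^sup>2) * indicator K x +
         (\<Sum>i\<in>UNIV. ennreal ((norm (conv (mol_seq k) (g i) x - g i x))\<^sup>2) * indicator K x) \<partial>lebesgue)"
    proof (rule nn_integral_cong_AE)
      show "AE x in lebesgue. ennreal ((norm (conv (mol_seq k) f x - f x))\<^sup>2 +
         (\<Sum>i\<in>UNIV. (norm (pderiv_at i (conv (mol_seq k) f) x - weak_pderiv UNIV i f x))\<^sup>2)) * indicator K x
        = ennreal ((norm (conv (mol_seq k) f x - f x))\<^sup>2) * indicator K x +
         (\<Sum>i\<in>UNIV. ennreal ((norm (conv (mol_seq k) (g i) x - g i x))\<^sup>2) * indicator K x)"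
        using ae by eventually_elim (simp add: d sum_nonneg distrib_right sum_distrib_right)
    qed
    also have "\<dots> = (\<integral>\<^sup>+x\<in>K. ennreal ((norm (conv (mol_seq k) f x - f x))\<^sup>2) \<partial>lebesgue) +
       (\<integral>\<^sup>+x. (\<Sum>i\<in>UNIV. ennreal ((norm (conv (mol_seq k) (g i) x - g i x))\<^sup>2) * indicator K x) \<partial>lebesgue)"
      by (rule nn_integral_add) measurable
    also have "(\<integral>\<^sup>+x. (\<Sum>i\<in>UNIV. ennreal ((norm (conv (mol_seq k) (g i) x - g i x))\<^sup>2) * indicator K x) \<partial>lebesgue)
      = (\<Sum>i\<in>UNIV. \<integral>\<^sup>+x\<in>K. ennreal ((norm (conv (mol_seq k) (g i) x - g i x))\<^sup>2) \<partial>lebesgue)"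
      by (rule nn_integral_sum) measurable
    finally show ?thesis .
  qed
  moreover have "(\<lambda>k. (\<integral>\<^sup>+x\<in>K. ennreal ((norm (conv (mol_seq k) f x - f x))\<^sup>2) \<partial>lebesgue) +
       (\<Sum>i\<in>UNIV. \<integral>\<^sup>+x\<in>K. ennreal ((norm (conv (mol_seq k) (g i) x - g i x))\<^sup>2) \<partial>lebesgue)) \<longlonglongrightarrow> 0 + (\<Sum>i\<in>(UNIV::'n set). 0)"
    by (intro tendsto_add tendsto_sum conv_tendsto_Lp_loc f2 g(2) K) auto
  ultimately show "(\<lambda>k. \<integral>\<^sup>+x\<in>K. ennreal ((norm (conv (mol_seq k) f x - f x))\<^sup>2 +
         (\<Sum>i\<in>UNIV. (norm (pderiv_at i (conv (mol_seq k) f) x - weak_pderiv UNIV i f x))\<^sup>2)) \<partial>lebesgue) \<longlonglongrightarrow> 0"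
    by simp
qed

section \<open>Traces on horizontal planes\<close>

lemma directional_derivative_pderiv_at:
  fixes f :: "real^'n::finite \<Rightarrow> 'b::euclidean_space"
  assumes "\<And>x. f differentiable (at x)"
  shows "((\<lambda>t. f (x + t *\<^sub>R axis i 1)) has_vector_derivative pderiv_at i f (x + s *\<^sub>R axis i 1)) (at s)"
proof -
  have "((\<lambda>t. t - s) has_vector_derivative 1) (at s)" by (auto intro!: derivative_eq_intros)
  from vector_diff_chain_at[OF this, of "\<lambda>t. f ((x + s *\<^sub>R axis i 1) + t *\<^sub>R axis i 1)" "pderiv_at i f (x + s *\<^sub>R axis i 1)"]
    directional_derivative_pderiv[OF assms, of "x + s *\<^sub>R axis i 1"]
  show ?thesis by (simp add: o_def algebra_simps)
qed

text \<open>The mean value theorem is applied along direction \<open>i\<close> to a difference in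
  direction \<open>j\<close>, then along \<open>j\<close> to the partial derivative in direction
  \<open>i\<close>. The second difference on the left is symmetric in \<open>i\<close> and
  \<open>j\<close>.\<close>

lemma second_difference_mvt:
  fixes f :: "real^'n::finite \<Rightarrow> real"
  assumes f: "smooth f" and s: "s > 0"
  shows "\<exists>r\<in>{0<..<s}. \<exists>q\<in>{0<..<s}. f (x + s *\<^sub>R axis i 1 + s *\<^sub>R axis j 1) - f (x + s *\<^sub>R axis i 1) - f (x + s *\<^sub>R axis j 1) + f x
     = s * (s * pderiv_at j (pderiv_at i f) (x + r *\<^sub>R axis i 1 + q *\<^sub>R axis j 1))"
proof -
  let ?k = "\<lambda>r. f ((x + s *\<^sub>R axis j 1) + r *\<^sub>R axis i 1) - f (x + r *\<^sub>R axis i 1)"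
  let ?k' = "\<lambda>r. pderiv_at i f ((x + s *\<^sub>R axis j 1) + r *\<^sub>R axis i 1) - pderiv_at i f (x + r *\<^sub>R axis i 1)"
  have kd: "(?k has_real_derivative ?k' r) (at r)" for r
    unfolding has_real_derivative_iff_has_vector_derivative
    by (intro has_vector_derivative_diff directional_derivative_pderiv_at smooth_differentiable f)
  from MVT2[OF s kd] obtain r where r: "0 < r" "r < s" "?k s - ?k 0 = (s - 0) * ?k' r" by blast
  let ?l = "\<lambda>q. pderiv_at i f ((x + r *\<^sub>R axis i 1) + q *\<^sub>R axis j 1)"
  let ?l' = "\<lambda>q. pderiv_at j (pderiv_at i f) ((x + r *\<^sub>R axis i 1) + q *\<^sub>R axis j 1)"
  have ld: "(?l has_real_derivative ?l' q) (at q)" for q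
    unfolding has_real_derivative_iff_has_vector_derivative
    by (intro directional_derivative_pderiv_at smooth_differentiable smooth_pderiv f)
  from MVT2[OF s ld] obtain q where q: "0 < q" "q < s" "?l s - ?l 0 = (s - 0) * ?l' q" by blast
  have "f (x + s *\<^sub>R axis i 1 + s *\<^sub>R axis j 1) - f (x + s *\<^sub>R axis i 1) - f (x + s *\<^sub>R axis j 1) + f x = ?k s - ?k 0"
    by (simp add: algebra_simps)
  also have "\<dots> = s * (?l s - ?l 0)" using r(3) by (simp add: algebra_simps)
  also have "\<dots> = s * (s * ?l' q)" using q(3) by simp
  finally show ?thesis using r q by (intro bexI[of _ r] bexI[of _ q]) auto
qed

text \<open>The same symmetric second difference, divided by the square of the step, equals either
  mixed derivative at points that approach \<open>x\<close>; continuity identifies the limits. The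
  symmetry cancels the vertical component of the potential in the flux formula.\<close>

lemma pderiv_at_commute:
  fixes f :: "real^'n::finite \<Rightarrow> real"
  assumes f: "smooth f"
  shows "pderiv_at i (pderiv_at j f) x = pderiv_at j (pderiv_at i f) x"
proof -
  have ex: "\<exists>p. (\<forall>k. norm (p k - x) \<le> 2 / real (Suc k)) \<and> (\<forall>k. pderiv_at j (pderiv_at i f) (p k) =
       (f (x + (1 / real (Suc k)) *\<^sub>R axis i 1 + (1 / real (Suc k)) *\<^sub>R axis j 1) - f (x + (1 / real (Suc k)) *\<^sub>R axis i 1) - f (x + (1 / real (Suc k)) *\<^sub>R axis j 1) + f x) * real (Suc k) * real (Suc k))"
    for i j
  proof -
    have "\<exists>p. norm (p - x) \<le> 2 / real (Suc k) \<and> pderiv_at j (pderiv_at i f) p =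
       (f (x + (1 / real (Suc k)) *\<^sub>R axis i 1 + (1 / real (Suc k)) *\<^sub>R axis j 1) - f (x + (1 / real (Suc k)) *\<^sub>R axis i 1) - f (x + (1 / real (Suc k)) *\<^sub>R axis j 1) + f x) * real (Suc k) * real (Suc k)" for k
    proof -
      have s: "1 / real (Suc k) > 0" by simp
      from second_difference_mvt[OF f s, of x i j] obtain r q where rq: "0 < r" "r < 1 / real (Suc k)" "0 < q" "q < 1 / real (Suc k)"
        and e: "f (x + (1 / real (Suc k)) *\<^sub>R axis i 1 + (1 / real (Suc k)) *\<^sub>R axis j 1) - f (x + (1 / real (Suc k)) *\<^sub>R axis i 1) - f (x + (1 / real (Suc k)) *\<^sub>R axis j 1) + f x
     = (1 / real (Suc k)) * ((1 / real (Suc k)) * pderiv_at j (pderiv_at i f) (x + r *\<^sub>R axis i 1 + q *\<^sub>R axis j 1))" by auto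
      have "norm (r *\<^sub>R axis i (1::real) + q *\<^sub>R axis j 1) \<le> r + q"
        by (rule order_trans[OF norm_triangle_ineq]) (use rq in \<open>simp add: norm_axis_1\<close>)
      also have "\<dots> \<le> 2 / real (Suc k)" using rq by simp
      finally have "norm ((x + r *\<^sub>R axis i 1 + q *\<^sub>R axis j 1) - x) \<le> 2 / real (Suc k)" by (simp add: algebra_simps)
      moreover have "pderiv_at j (pderiv_at i f) (x + r *\<^sub>R axis i 1 + q *\<^sub>R axis j 1) =
       (f (x + (1 / real (Suc k)) *\<^sub>R axis i 1 + (1 / real (Suc k)) *\<^sub>R axis j 1) - f (x + (1 / real (Suc k)) *\<^sub>R axis i 1) - f (x + (1 / real (Suc k)) *\<^sub>R axis j 1) + f x) * real (Suc k) * real (Suc k)"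
        unfolding e by simp
      ultimately show ?thesis by blast
    qed
    then show ?thesis by metis
  qed
  have lim: "(\<lambda>k. pderiv_at j (pderiv_at i f) (p k)) \<longlonglongrightarrow> pderiv_at j (pderiv_at i f) x"
    if "\<forall>k. norm (p k - x) \<le> 2 / real (Suc k)" for p i j
  proof -
    have "(\<lambda>k. 2 * (1 / real (Suc k))) \<longlonglongrightarrow> 2 * 0"
      using LIMSEQ_inverse_real_of_nat by (intro tendsto_mult tendsto_const) (simp add: inverse_eq_divide)
    then have "(\<lambda>k. 2 / real (Suc k)) \<longlonglongrightarrow> 0" by simp
    then have "(\<lambda>k. p k - x) \<longlonglongrightarrow> 0"
      by (rule Lim_null_comparison[rotated]) (use that in auto)
    then have "p \<longlonglongrightarrow> x" by (simp add: LIM_zero_iff)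
    moreover have "isCont (pderiv_at j (pderiv_at i f)) x"
      using smooth_continuous[OF smooth_pderiv[OF smooth_pderiv[OF f]]] continuous_on_eq_continuous_at by blast
    ultimately show ?thesis using isCont_tendsto_compose by blast
  qed
  obtain p where p: "\<forall>k. norm (p k - x) \<le> 2 / real (Suc k)" "\<And>k. pderiv_at j (pderiv_at i f) (p k) =
       (f (x + (1 / real (Suc k)) *\<^sub>R axis i 1 + (1 / real (Suc k)) *\<^sub>R axis j 1) - f (x + (1 / real (Suc k)) *\<^sub>R axis i 1) - f (x + (1 / real (Suc k)) *\<^sub>R axis j 1) + f x) * real (Suc k) * real (Suc k)"
    using ex[of j i] by blast
  obtain q where q: "\<forall>k. norm (q k - x) \<le> 2 / real (Suc k)" "\<And>k. pderiv_at i (pderiv_at j f) (q k) =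
       (f (x + (1 / real (Suc k)) *\<^sub>R axis j 1 + (1 / real (Suc k)) *\<^sub>R axis i 1) - f (x + (1 / real (Suc k)) *\<^sub>R axis j 1) - f (x + (1 / real (Suc k)) *\<^sub>R axis i 1) + f x) * real (Suc k) * real (Suc k)"
    using ex[of i j] by blast
  have "(\<lambda>k. pderiv_at j (pderiv_at i f) (p k)) = (\<lambda>k. pderiv_at i (pderiv_at j f) (q k))"
    unfolding p(2) q(2) by (rule ext) (simp add: algebra_simps)
  with lim[OF p(1), of j i] lim[OF q(1), of i j] show ?thesis using LIMSEQ_unique by metis
qed

section \<open>Coordinates adapted to a horizontal plane\<close>

lemma prod_Basis_cart: "(\<Prod>b\<in>(Basis::(real^'n::finite) set). f b) = (\<Prod>i\<in>UNIV. f (axis i 1))"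
proof -
  have B: "(Basis::(real^'n) set) = (\<lambda>i. axis i 1) ` UNIV" by (auto simp: Basis_vec_def)
  have inj: "inj (\<lambda>i. axis i (1::real) :: real^'n)" by (auto simp: inj_on_def axis_eq_axis)
  show ?thesis unfolding B prod.reindex[OF inj] by (simp add: o_def)
qed

lemma hat_at_height [simp]: "hat (at_height y t) = y" "at_height y t $ 3 = t"
  "at_height y t $ 1 = y $ 1" "at_height y t $ 2 = y $ 2" "hat v $ 1 = v $ 1" "hat v $ 2 = v $ 2"
  by (simp_all add: hat_def at_height_def vec_eq_iff forall_2)

lemma bounded_linear_hat: "bounded_linear hat"
proof -
  have "linear hat" by (rule linearI) (simp_all add: vec_eq_iff forall_2)
  then show ?thesis by (simp add: linear_conv_bounded_linear)
qed

lemma at_height_eq: "at_height y t = (y $ 1) *\<^sub>R axis 1 1 + (y $ 2) *\<^sub>R axis 2 1 + t *\<^sub>R axis 3 1"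
  by (simp add: vec_eq_iff forall_3 axis_def at_height_def)

lemma at_height_continuous: "continuous_on UNIV (\<lambda>(y, s). at_height y (t + s))"
  unfolding at_height_eq split_def by (intro continuous_intros)

text \<open>Lebesgue measure is determined by its values on boxes, and the preimage of a box is the
  product of a planar box and an interval shifted by \<open>t\<close>.\<close>

lemma lborel_at_height:
  "distr (lborel \<Otimes>\<^sub>M lborel) borel (\<lambda>(y, s). at_height y (t + s)) = (lborel :: (real^3) measure)"
proof (rule lborel_eqI[symmetric])
  have [measurable]: "(\<lambda>(y, s). at_height y (t + s)) \<in> borel_measurable (lborel \<Otimes>\<^sub>M lborel)"
    using borel_measurable_continuous_onI[OF at_height_continuous[of t]] by (simp add: lborel_prod)
  fix l u :: "real^3" assume lu: "\<And>b. b \<in> Basis \<Longrightarrow> l \<bullet> b \<le> u \<bullet> b"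
  have le: "l $ i \<le> u $ i" for i using lu[of "axis i 1"] by (simp add: inner_axis axis_in_Basis_iff)
  have pre: "(\<lambda>(y, s). at_height y (t + s)) -` box l u \<inter> space (lborel \<Otimes>\<^sub>M lborel) = box (hat l) (hat u) \<times> box (l $ 3 - t) (u $ 3 - t)"
    by (auto simp: space_pair_measure mem_box_cart forall_3 forall_2 box_real)
  have e1: "emeasure (distr (lborel \<Otimes>\<^sub>M lborel) borel (\<lambda>(y, s). at_height y (t + s))) (box l u)
     = emeasure (lborel \<Otimes>\<^sub>M lborel) (box (hat l) (hat u) \<times> box (l $ 3 - t) (u $ 3 - t))"
    by (subst emeasure_distr) (simp_all add: pre)
  have e2: "emeasure (lborel \<Otimes>\<^sub>M lborel) (box (hat l) (hat u) \<times> box (l $ 3 - t) (u $ 3 - t)) = emeasure lborel (box (hat l) (hat u)) * emeasure lborel (box (l $ 3 - t) (u $ 3 - t))"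
    by (rule lborel.emeasure_pair_measure_Times) auto
  have e3: "emeasure lborel (box (hat l) (hat u)) = ennreal ((u $ 1 - l $ 1) * (u $ 2 - l $ 2))"
  proof -
    have "hat l \<bullet> b \<le> hat u \<bullet> b" if "b \<in> Basis" for b
      using that le[of 1] le[of 2] by (auto simp: Basis_vec_def inner_axis UNIV_2)
    then have "emeasure lborel (box (hat l) (hat u)) = ennreal (\<Prod>b\<in>Basis. (hat u - hat l) \<bullet> b)"
      by (rule emeasure_lborel_box)
    then show ?thesis by (simp add: prod_Basis_cart UNIV_2 inner_axis mult.commute)
  qed
  have e4: "emeasure lborel (box (l $ 3 - t) (u $ 3 - t)) = ennreal (u $ 3 - l $ 3)"
    using le[of 3] by simp
  have e5: "ennreal ((u $ 1 - l $ 1) * (u $ 2 - l $ 2)) * ennreal (u $ 3 - l $ 3) = ennreal (\<Prod>b\<in>Basis. (u - l) \<bullet> b)"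
  proof -
    have pe: "(\<Prod>b\<in>Basis. (u - l) \<bullet> b) = ((u $ 1 - l $ 1) * (u $ 2 - l $ 2)) * (u $ 3 - l $ 3)"
      unfolding prod_Basis_cart UNIV_3 inner_axis by simp
    have "0 \<le> (u $ 1 - l $ 1) * (u $ 2 - l $ 2)" "0 \<le> u $ 3 - l $ 3"
      using le[of 1] le[of 2] le[of 3] by simp_all
    then show ?thesis unfolding pe by (rule ennreal_mult[symmetric])
  qed
  show "emeasure (distr (lborel \<Otimes>\<^sub>M lborel) borel (\<lambda>(y, s). at_height y (t + s))) (box l u) = ennreal (\<Prod>b\<in>Basis. (u - l) \<bullet> b)"
    by (simp only: e1 e2 e3 e4 e5)
qed simp

lemma measurable_at_height [measurable]: "(\<lambda>p. at_height (fst p) (t + snd p)) \<in> borel_measurable (lborel \<Otimes>\<^sub>M lborel)"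
  using borel_measurable_continuous_onI[OF at_height_continuous[of t]] by (simp add: lborel_prod split_def)

lemma measurable_at_height_section [measurable]: "(\<lambda>s. at_height y (t + s)) \<in> borel_measurable borel"
  unfolding at_height_eq by (intro borel_measurable_continuous_onI continuous_intros)

lemma nn_integral_at_height:
  assumes [measurable]: "H \<in> borel_measurable borel"
  shows "(\<integral>\<^sup>+x. H x \<partial>lborel) = (\<integral>\<^sup>+y. (\<integral>\<^sup>+s. H (at_height y (t + s)) \<partial>lborel) \<partial>lborel)"
proof -
  have "(\<integral>\<^sup>+x. H x \<partial>lborel) = (\<integral>\<^sup>+x. H x \<partial>distr (lborel \<Otimes>\<^sub>M lborel) borel (\<lambda>(y, s). at_height y (t + s)))"
    by (simp add: lborel_at_height)
  also have "\<dots> = (\<integral>\<^sup>+p. H (at_height (fst p) (t + snd p)) \<partial>(lborel \<Otimes>\<^sub>M lborel))"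
    by (subst nn_integral_distr) (simp_all add: split_def)
  also have "\<dots> = (\<integral>\<^sup>+y. (\<integral>\<^sup>+s. H (at_height y (t + s)) \<partial>lborel) \<partial>lborel)"
    by (subst lborel.nn_integral_fst[symmetric]) auto
  finally show ?thesis .
qed

lemma integral_at_height:
  fixes H :: "real^3 \<Rightarrow> real"
  assumes i: "integrable lborel H"
  shows "(LINT x|lborel. H x) = (LINT y|lborel. (LINT s|lborel. H (at_height y (t + s))))"
proof -
  have [measurable]: "H \<in> borel_measurable borel" using i by auto
  have i2: "integrable (lborel \<Otimes>\<^sub>M lborel) (\<lambda>p. H (at_height (fst p) (t + snd p)))"
    using i integrable_distr_eq[of "\<lambda>(y, s). at_height y (t + s)" "lborel \<Otimes>\<^sub>M lborel" borel H]
    by (simp add: lborel_at_height[unfolded split_def] split_def)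
  have "(LINT x|lborel. H x) = (LINT x|distr (lborel \<Otimes>\<^sub>M lborel) borel (\<lambda>(y, s). at_height y (t + s)). H x)"
    by (simp add: lborel_at_height)
  also have "\<dots> = (LINT p|(lborel \<Otimes>\<^sub>M lborel). H (at_height (fst p) (t + snd p)))"
    by (subst integral_distr) (simp_all add: split_def)
  also have "\<dots> = (LINT y|lborel. (LINT s|lborel. H (at_height y (t + s))))"
    using lborel_pair.integral_fst'[OF i2] by simp
  finally show ?thesis .
qed

section \<open>The trace as an average over a slab\<close>

text \<open>Jensen's inequality on the unit interval. If the right side is finite,
  \<open>norm v \<le> 1 + (norm v)\<^sup>2\<close> makes \<open>F\<close> integrable there; if it is
  infinite, nothing is claimed, so the default value of a divergent integral does no harm.\<close>

lemma norm_integral_difference_sq_le: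
  fixes \<Psi> F :: "real \<Rightarrow> 'b::euclidean_space"
  assumes \<Psi>: "continuous_on UNIV \<Psi>" and F [measurable]: "F \<in> borel_measurable borel"
  shows "ennreal ((norm ((LINT s|lborel. indicator {0..1} s *\<^sub>R \<Psi> s) - (LINT s|lborel. indicator {0..1} s *\<^sub>R F s)))\<^sup>2)
     \<le> (\<integral>\<^sup>+s. indicator {0..1} s * ennreal ((norm (\<Psi> s - F s))\<^sup>2) \<partial>lborel)" (is "_ \<le> ?R")
proof (cases "?R = \<infinity>")
  case False
  have [measurable]: "\<Psi> \<in> borel_measurable borel" using \<Psi> by (rule borel_measurable_continuous_onI)
  let ?D = "\<lambda>s. indicator {0..1} s *\<^sub>R (\<Psi> s - F s)"
  have iI: "integrable lborel (indicator {0..1::real} :: real \<Rightarrow> real)" by (intro integrable_real_indicator) auto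
  have sq: "integrable lborel (\<lambda>s. indicator {0..1} s * (norm (\<Psi> s - F s))\<^sup>2)"
  proof (rule integrableI_nonneg)
    have "(\<integral>\<^sup>+s. ennreal (indicator {0..1} s * (norm (\<Psi> s - F s))\<^sup>2) \<partial>lborel) = ?R"
      by (intro nn_integral_cong) (auto simp: indicator_def)
    then show "(\<integral>\<^sup>+s. ennreal (indicator {0..1} s * (norm (\<Psi> s - F s))\<^sup>2) \<partial>lborel) < \<infinity>" using False by (simp add: less_top)
  qed auto
  have iD: "integrable lborel ?D"
  proof (rule Bochner_Integration.integrable_bound)
    show "integrable lborel (\<lambda>s. indicator {0..1} s + indicator {0..1} s * (norm (\<Psi> s - F s))\<^sup>2)" using iI sq by simp
    have "norm v \<le> 1 + (norm v)\<^sup>2" for v :: 'b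
      using zero_le_power2[of "norm v - 1/2"] by (simp add: power2_eq_square algebra_simps)
    then show "AE s in lborel. norm (?D s) \<le> norm (indicator {0..1} s + indicator {0..1} s * (norm (\<Psi> s - F s))\<^sup>2)"
      by (intro AE_I2) (auto simp: indicator_def)
  qed measurable
  have i\<Psi>: "integrable lborel (\<lambda>s. indicator {0..1} s *\<^sub>R \<Psi> s)"
    by (intro borel_integrable_compact continuous_on_subset[OF \<Psi>]) auto
  have "integrable lborel (\<lambda>s. indicator {0..1} s *\<^sub>R \<Psi> s - ?D s)" using i\<Psi> iD by (rule Bochner_Integration.integrable_diff)
  then have iF: "integrable lborel (\<lambda>s. indicator {0..1} s *\<^sub>R F s)" by (simp add: scaleR_diff_right)
  have "(LINT s|lborel. indicator {0..1} s *\<^sub>R \<Psi> s) - (LINT s|lborel. indicator {0..1} s *\<^sub>R F s) = (LINT s|lborel. ?D s)"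
    using i\<Psi> iF by (simp add: scaleR_diff_right)
  then have "norm ((LINT s|lborel. indicator {0..1} s *\<^sub>R \<Psi> s) - (LINT s|lborel. indicator {0..1} s *\<^sub>R F s)) \<le> (LINT s|lborel. norm (?D s))"
    using integral_norm_bound by metis
  also have "\<dots> = (LINT s|lborel. indicator {0..1} s * norm (\<Psi> s - F s))" by simp
  finally have "ennreal ((norm ((LINT s|lborel. indicator {0..1} s *\<^sub>R \<Psi> s) - (LINT s|lborel. indicator {0..1} s *\<^sub>R F s)))\<^sup>2)
     \<le> ennreal ((LINT s|lborel. indicator {0..1} s * norm (\<Psi> s - F s)) ^ 2)"
    by (intro ennreal_leI power_mono) auto
  also have "\<dots> \<le> (\<integral>\<^sup>+s. ennreal (indicator {0..1} s * norm (\<Psi> s - F s) ^ 2) \<partial>lborel)"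
  proof (rule jensen_power)
    show "integrable lborel (\<lambda>s. indicator {0..1} s * norm (\<Psi> s - F s))" using integrable_norm[OF iD] by simp
  qed (use iI in auto)
  also have "\<dots> = ?R" by (intro nn_integral_cong) (auto simp: indicator_def)
  finally show ?thesis .
qed simp

text \<open>With \<open>g = \<partial>\<^sub>3 f\<close>, integration of \<open>d/ds ((1 - s) f (y, t + s))\<close> over the unit interval yields \<open>f (y, t)\<close>.\<close>

definition slab_trace :: "real \<Rightarrow> (real^3 \<Rightarrow> 'b::euclidean_space) \<Rightarrow> (real^3 \<Rightarrow> 'b) \<Rightarrow> real^2 \<Rightarrow> 'b" where
  "slab_trace t f g y = (LINT s|lborel. indicator {0..1} s *\<^sub>R (f (at_height y (t + s)) - (1 - s) *\<^sub>R g (at_height y (t + s))))"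

definition slab :: "real \<Rightarrow> (real^2) set \<Rightarrow> (real^3) set" where
  "slab t K = {x. hat x \<in> K \<and> t \<le> x $ 3 \<and> x $ 3 \<le> t + 1}"

lemma smooth_slab_trace:
  fixes \<psi> :: "real^3 \<Rightarrow> 'b::euclidean_space"
  assumes s: "smooth \<psi>"
  shows "\<psi> (at_height y t) = slab_trace t \<psi> (pderiv_at 3 \<psi>) y"
proof -
  have eq: "at_height y (t + s) = at_height y t + s *\<^sub>R axis 3 1" for s by (simp add: at_height_eq scaleR_add_left)
  have d: "((\<lambda>s. \<psi> (at_height y (t + s))) has_vector_derivative pderiv_at 3 \<psi> (at_height y (t + s))) (at s within {0..1})" for s
    unfolding eq using directional_derivative_pderiv_at[OF smooth_differentiable[OF s]] has_vector_derivative_at_within by blast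
  have "((\<lambda>s. - ((1 - s) *\<^sub>R \<psi> (at_height y (t + s)))) has_vector_derivative
      \<psi> (at_height y (t + s)) - (1 - s) *\<^sub>R pderiv_at 3 \<psi> (at_height y (t + s))) (at s within {0..1})" for s
  proof -
    have 1: "((\<lambda>s. 1 - s) has_real_derivative - 1) (at s within {0..1})" by (auto intro!: derivative_eq_intros)
    show ?thesis
      using has_vector_derivative_minus[OF has_vector_derivative_scaleR[OF 1 d]] by (simp add: algebra_simps)
  qed
  moreover have "continuous_on {0..1} (\<lambda>s. \<psi> (at_height y (t + s)) - (1 - s) *\<^sub>R pderiv_at 3 \<psi> (at_height y (t + s)))"
    unfolding eq
    by (intro continuous_intros continuous_on_compose2[OF smooth_continuous[OF s]] continuous_on_compose2[OF smooth_continuous[OF smooth_pderiv[OF s]]]) auto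
  ultimately have "slab_trace t \<psi> (pderiv_at 3 \<psi>) y = - ((1 - 1) *\<^sub>R \<psi> (at_height y (t + 1))) - - ((1 - 0) *\<^sub>R \<psi> (at_height y (t + 0)))"
    unfolding slab_trace_def by (intro integral_FTC_Icc) auto
  then show ?thesis by simp
qed

lemma slab_trace_measurable:
  assumes [measurable]: "f \<in> borel_measurable borel" "g \<in> borel_measurable borel"
  shows "slab_trace t f g \<in> borel_measurable borel"
proof -
  have "(\<lambda>y. LINT s|lborel. (case (y, s) of (y, s) \<Rightarrow> indicator {0..1} s *\<^sub>R (f (at_height y (t + s)) - (1 - s) *\<^sub>R g (at_height y (t + s))))) \<in> borel_measurable lborel"
    by (rule lborel.borel_measurable_lebesgue_integral) (simp add: split_def, measurable)
  then show ?thesis by (simp add: slab_trace_def[abs_def])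
qed

text \<open>Once a smooth function on the plane is written as its own slab average, its distance to
  \<open>slab_trace t f g\<close> is controlled by \<open>\<psi> - f\<close> and the difference of
  the vertical derivatives over the slab. The weight satisfies
  \<open>\<bar>1 - s\<bar> \<le> 1\<close>, and the factor 2 comes from squaring a sum of two
  terms.\<close>

lemma slab_trace_estimate:
  fixes \<psi> f g :: "real^3 \<Rightarrow> 'b::euclidean_space"
  assumes s: "smooth \<psi>" and [measurable]: "f \<in> borel_measurable borel" "g \<in> borel_measurable borel" and K: "K \<in> sets borel"
  shows "(\<integral>\<^sup>+y\<in>K. ennreal ((norm (\<psi> (at_height y t) - slab_trace t f g y))\<^sup>2) \<partial>lborel)
    \<le> 2 * (\<integral>\<^sup>+x\<in>slab t K. ennreal ((norm (\<psi> x - f x))\<^sup>2 + (norm (pderiv_at 3 \<psi> x - g x))\<^sup>2) \<partial>lborel)"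
proof -
  note [measurable] = K
  have c: "continuous_on UNIV \<psi>" "continuous_on UNIV (pderiv_at 3 \<psi>)"
    by (intro smooth_continuous smooth_pderiv s)+
  then have [measurable]: "\<psi> \<in> borel_measurable borel" "pderiv_at 3 \<psi> \<in> borel_measurable borel"
    by (auto intro: borel_measurable_continuous_onI)
  have [measurable]: "hat \<in> borel_measurable borel"
    by (intro borel_measurable_continuous_onI linear_continuous_on bounded_linear_hat)
  have Sl [measurable]: "slab t K \<in> sets borel" unfolding slab_def by measurable
  let ?H = "\<lambda>x. ennreal ((norm (\<psi> x - f x))\<^sup>2 + (norm (pderiv_at 3 \<psi> x - g x))\<^sup>2) * indicator (slab t K) x"
  have "ennreal ((norm (\<psi> (at_height y t) - slab_trace t f g y))\<^sup>2) * indicator K y \<le> 2 * (\<integral>\<^sup>+s. ?H (at_height y (t + s)) \<partial>lborel)" for y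
  proof (cases "y \<in> K")
    case True
    let ?P = "\<lambda>s. \<psi> (at_height y (t + s)) - (1 - s) *\<^sub>R pderiv_at 3 \<psi> (at_height y (t + s))"
    let ?F = "\<lambda>s. f (at_height y (t + s)) - (1 - s) *\<^sub>R g (at_height y (t + s))"
    have ac: "continuous_on UNIV (\<lambda>s. at_height y (t + s))" unfolding at_height_eq by (intro continuous_intros)
    have "ennreal ((norm (\<psi> (at_height y t) - slab_trace t f g y))\<^sup>2) \<le> (\<integral>\<^sup>+s. indicator {0..1} s * ennreal ((norm (?P s - ?F s))\<^sup>2) \<partial>lborel)"
      unfolding smooth_slab_trace[OF s, of y t] unfolding slab_trace_def
      by (intro norm_integral_difference_sq_le continuous_intros continuous_on_compose2[OF c(1) ac] continuous_on_compose2[OF c(2) ac]) auto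
    also have "\<dots> \<le> (\<integral>\<^sup>+s. 2 * ?H (at_height y (t + s)) \<partial>lborel)"
    proof (rule nn_integral_mono)
      fix s
      show "indicator {0..1} s * ennreal ((norm (?P s - ?F s))\<^sup>2) \<le> 2 * ?H (at_height y (t + s))"
      proof (cases "s \<in> {0..1}")
        case s01: True
        let ?a = "\<psi> (at_height y (t + s)) - f (at_height y (t + s))"
        let ?b = "pderiv_at 3 \<psi> (at_height y (t + s)) - g (at_height y (t + s))"
        have "norm (?P s - ?F s) = norm (?a - (1 - s) *\<^sub>R ?b)" by (simp add: algebra_simps)
        also have "\<dots> \<le> norm ?a + \<bar>1 - s\<bar> * norm ?b" by (rule order_trans[OF norm_triangle_ineq4]) simp
        also have "\<bar>1 - s\<bar> * norm ?b \<le> norm ?b" using s01 by (intro mult_left_le_one_le) auto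
        finally have "(norm (?P s - ?F s))\<^sup>2 \<le> (norm ?a + norm ?b)\<^sup>2" by (intro power_mono) auto
        also have "\<dots> \<le> 2 * ((norm ?a)\<^sup>2 + (norm ?b)\<^sup>2)"
          using zero_le_power2[of "norm ?a - norm ?b"] by (simp add: power2_eq_square algebra_simps)
        finally have "ennreal ((norm (?P s - ?F s))\<^sup>2) \<le> ennreal (2 * ((norm ?a)\<^sup>2 + (norm ?b)\<^sup>2))" by (rule ennreal_leI)
        also have "\<dots> = 2 * ennreal ((norm ?a)\<^sup>2 + (norm ?b)\<^sup>2)" by (simp add: ennreal_mult' distrib_left flip: ennreal_numeral)
        finally show ?thesis using s01 True by (simp add: slab_def)
      qed simp
    qed
    also have "\<dots> = 2 * (\<integral>\<^sup>+s. ?H (at_height y (t + s)) \<partial>lborel)" by (rule nn_integral_cmult) measurable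
    finally show ?thesis using True by simp
  qed simp
  then have "(\<integral>\<^sup>+y\<in>K. ennreal ((norm (\<psi> (at_height y t) - slab_trace t f g y))\<^sup>2) \<partial>lborel)
     \<le> (\<integral>\<^sup>+y. 2 * (\<integral>\<^sup>+s. ?H (at_height y (t + s)) \<partial>lborel) \<partial>lborel)" by (intro nn_integral_mono)
  also have "\<dots> = 2 * (\<integral>\<^sup>+y. (\<integral>\<^sup>+s. ?H (at_height y (t + s)) \<partial>lborel) \<partial>lborel)"
    by (rule nn_integral_cmult) (rule lborel.borel_measurable_nn_integral, measurable)
  also have "\<dots> = 2 * (\<integral>\<^sup>+x. ?H x \<partial>lborel)" by (subst nn_integral_at_height[of ?H t]) measurable
  finally show ?thesis .
qed

lemma compact_slab:
  assumes "compact K"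
  shows "compact (slab t K)"
proof -
  have "slab t K = (\<lambda>(y, s). at_height y (t + s)) ` (K \<times> {0..1})"
  proof (intro equalityI subsetI)
    fix x assume "x \<in> slab t K"
    moreover have "x = at_height (hat x) (t + (x $ 3 - t))" by (simp add: vec_eq_iff forall_3)
    ultimately show "x \<in> (\<lambda>(y, s). at_height y (t + s)) ` (K \<times> {0..1})"
      by (intro image_eqI[of _ _ "(hat x, x $ 3 - t)"]) (auto simp: slab_def)
  qed (auto simp: slab_def)
  then show ?thesis
    using assms continuous_on_subset[OF at_height_continuous subset_UNIV] by (auto intro!: compact_continuous_image compact_Times)
qed

text \<open>\<open>weak_pderiv\<close> is an arbitrary choice and need not be the witness provided
  by \<open>H1_loc\<close>; uniqueness almost everywhere transfers the square integrability.\<close>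

lemma weak_pderiv_H1_loc:
  assumes "f \<in> H1_loc UNIV"
  shows "has_weak_pderiv UNIV i f (weak_pderiv UNIV i f)" "weak_pderiv UNIV i f \<in> Lp_loc 2 UNIV"
proof -
  obtain g where g: "has_weak_pderiv UNIV i f g" "g \<in> Lp_loc 2 UNIV" using assms by (auto simp: H1_loc_def)
  show h: "has_weak_pderiv UNIV i f (weak_pderiv UNIV i f)" by (rule weak_pderivI[OF g(1)])
  have ae: "AE x in lebesgue. weak_pderiv UNIV i f x = g x" using weak_pderiv_AE[OF open_UNIV g(1)] by simp
  have "weak_pderiv UNIV i f \<in> Lp_loc 1 UNIV" using h by (simp add: has_weak_pderiv_def)
  note [measurable] = Lp_loc_measurable[OF this] Lp_loc_measurable[OF g(2)]
  show "weak_pderiv UNIV i f \<in> Lp_loc 2 UNIV"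
    unfolding Lp_loc_def Lp_def
  proof (intro CollectI allI impI conjI)
    fix K :: "(real^'a) set" assume K: "compact K \<and> K \<subseteq> UNIV"
    then have [measurable]: "K \<in> sets lebesgue" using lmeasurable_compact by blast
    show "set_borel_measurable lebesgue K (weak_pderiv UNIV i f)" unfolding set_borel_measurable_def by measurable
    have "integrable lebesgue (\<lambda>x. indicator K x *\<^sub>R norm (g x) ^ 2)"
      using g(2) K by (auto simp: Lp_loc_def Lp_def set_integrable_def)
    then show "set_integrable lebesgue K (\<lambda>x. norm (weak_pderiv UNIV i f x) ^ 2)"
      unfolding set_integrable_def
      by (rule integrable_cong_AE_imp) (measurable, use ae in \<open>auto elim!: eventually_mono\<close>)
  qed
qed

lemma H1_loc_trace_estimate:
  fixes \<psi> f :: "real^3 \<Rightarrow> 'b::euclidean_space"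
  assumes s: "smooth \<psi>" and f0: "f0 \<in> borel_measurable borel" "AE x in lebesgue. f0 x = f x"
    and g0: "g0 \<in> borel_measurable borel" "AE x in lebesgue. g0 x = weak_pderiv UNIV 3 f x" and K: "compact K"
  shows "(\<integral>\<^sup>+y\<in>K. ennreal ((norm (\<psi> (at_height y t) - slab_trace t f0 g0 y))\<^sup>2) \<partial>lebesgue)
    \<le> 2 * (\<integral>\<^sup>+x\<in>slab t K. ennreal ((norm (\<psi> x - f x))\<^sup>2 + (\<Sum>i\<in>UNIV. (norm (pderiv_at i \<psi> x - weak_pderiv UNIV i f x))\<^sup>2)) \<partial>lebesgue)"
proof -
  have "(\<integral>\<^sup>+y\<in>K. ennreal ((norm (\<psi> (at_height y t) - slab_trace t f0 g0 y))\<^sup>2) \<partial>lebesgue)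
     = (\<integral>\<^sup>+y\<in>K. ennreal ((norm (\<psi> (at_height y t) - slab_trace t f0 g0 y))\<^sup>2) \<partial>lborel)" by (rule nn_integral_completion)
  also have "\<dots> \<le> 2 * (\<integral>\<^sup>+x\<in>slab t K. ennreal ((norm (\<psi> x - f0 x))\<^sup>2 + (norm (pderiv_at 3 \<psi> x - g0 x))\<^sup>2) \<partial>lborel)"
    using compact_imp_closed[OF K] by (intro slab_trace_estimate s f0 g0) auto
  also have "(\<integral>\<^sup>+x\<in>slab t K. ennreal ((norm (\<psi> x - f0 x))\<^sup>2 + (norm (pderiv_at 3 \<psi> x - g0 x))\<^sup>2) \<partial>lborel)
     = (\<integral>\<^sup>+x\<in>slab t K. ennreal ((norm (\<psi> x - f0 x))\<^sup>2 + (norm (pderiv_at 3 \<psi> x - g0 x))\<^sup>2) \<partial>lebesgue)"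
    by (rule nn_integral_completion[symmetric])
  also have "\<dots> \<le> (\<integral>\<^sup>+x\<in>slab t K. ennreal ((norm (\<psi> x - f x))\<^sup>2 + (\<Sum>i\<in>UNIV. (norm (pderiv_at i \<psi> x - weak_pderiv UNIV i f x))\<^sup>2)) \<partial>lebesgue)"
  proof (rule nn_integral_mono_AE)
    show "AE x in lebesgue. ennreal ((norm (\<psi> x - f0 x))\<^sup>2 + (norm (pderiv_at 3 \<psi> x - g0 x))\<^sup>2) * indicator (slab t K) x
       \<le> ennreal ((norm (\<psi> x - f x))\<^sup>2 + (\<Sum>i\<in>UNIV. (norm (pderiv_at i \<psi> x - weak_pderiv UNIV i f x))\<^sup>2)) * indicator (slab t K) x"
      using f0(2) g0(2)
    proof eventually_elim
      case (elim x)
      have "(norm (pderiv_at 3 \<psi> x - weak_pderiv UNIV 3 f x))\<^sup>2 \<le> (\<Sum>i\<in>UNIV. (norm (pderiv_at i \<psi> x - weak_pderiv UNIV i f x))\<^sup>2)"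
        by (rule member_le_sum) auto
      then show ?case unfolding elim by (intro mult_right_mono ennreal_leI) auto
    qed
  qed
  finally show ?thesis by (simp add: mult_left_mono)
qed

lemma H1_loc_borel_representatives:
  fixes f :: "real^3 \<Rightarrow> 'b::euclidean_space"
  assumes "f \<in> H1_loc UNIV"
  obtains f0 g0 where "f0 \<in> borel_measurable borel" "AE x in lebesgue. f0 x = f x"
    "g0 \<in> borel_measurable borel" "AE x in lebesgue. g0 x = weak_pderiv UNIV 3 f x"
proof -
  have "f \<in> Lp_loc 2 UNIV" using assms by (simp add: H1_loc_def)
  from borel_representative[OF Lp_loc_measurable[OF this]] obtain f0 where 1: "f0 \<in> borel_measurable borel" "AE x in lebesgue. f0 x = f x" by metis
  from borel_representative[OF Lp_loc_measurable[OF weak_pderiv_H1_loc(2)[OF assms]]] obtain g0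
    where 2: "g0 \<in> borel_measurable borel" "AE x in lebesgue. g0 x = weak_pderiv UNIV 3 f x" by metis
  from that[OF 1 2] show ?thesis .
qed

text \<open>Existence of the trace: mollifications converge in the local Sobolev norm, and the slab
  estimate carries this convergence to the plane.\<close>

lemma is_plane_trace_slab_trace:
  fixes f :: "real^3 \<Rightarrow> 'b::euclidean_space"
  assumes f: "f \<in> H1_loc UNIV" and f0: "f0 \<in> borel_measurable borel" "AE x in lebesgue. f0 x = f x"
    and g0: "g0 \<in> borel_measurable borel" "AE x in lebesgue. g0 x = weak_pderiv UNIV 3 f x"
  shows "is_plane_trace t f (slab_trace t f0 g0)"
  unfolding is_plane_trace_def
proof (intro conjI exI[of _ "\<lambda>k. conv (mol_seq k) f"] allI impI f)
  let ?T = "slab_trace t f0 g0"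
  have Tm: "?T \<in> borel_measurable borel" by (rule slab_trace_measurable[OF f0(1) g0(1)])
  have Tml [measurable]: "?T \<in> borel_measurable lebesgue" by (rule borel_measurable_lebesgueI[OF Tm])
  show "smooth (conv (mol_seq k) f)" for k by (rule H1_loc_mollify(1)[OF f compact_empty])
  show conv: "(\<lambda>k. \<integral>\<^sup>+x\<in>K. ennreal ((norm (conv (mol_seq k) f x - f x))\<^sup>2 +
         (\<Sum>i\<in>UNIV. (norm (pderiv_at i (conv (mol_seq k) f) x - weak_pderiv UNIV i f x))\<^sup>2)) \<partial>lebesgue) \<longlonglongrightarrow> 0"
    if "compact K" for K using H1_loc_mollify(2)[OF f that] .
  show "(\<lambda>k. \<integral>\<^sup>+y\<in>K. ennreal ((norm (conv (mol_seq k) f (at_height y t) - ?T y))\<^sup>2) \<partial>lebesgue) \<longlonglongrightarrow> 0" if K: "compact K" for K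
  proof (rule tendsto_0_le_ennreal)
    show "(\<lambda>k. 2 * (\<integral>\<^sup>+x\<in>slab t K. ennreal ((norm (conv (mol_seq k) f x - f x))\<^sup>2 +
         (\<Sum>i\<in>UNIV. (norm (pderiv_at i (conv (mol_seq k) f) x - weak_pderiv UNIV i f x))\<^sup>2)) \<partial>lebesgue)) \<longlonglongrightarrow> 0"
      using ennreal_tendsto_cmult[OF _ conv[OF compact_slab[OF K]], of 2] by simp
  qed (rule H1_loc_trace_estimate[OF H1_loc_mollify(1)[OF f compact_empty] f0 g0 K])
  show "?T \<in> Lp_loc 2 UNIV"
    unfolding Lp_loc_def Lp_def
  proof (intro CollectI allI impI conjI)
    fix K :: "(real^2) set" assume K: "compact K \<and> K \<subseteq> UNIV"
    then have [measurable]: "K \<in> sets lebesgue" using lmeasurable_compact by blast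
    show "set_borel_measurable lebesgue K ?T" unfolding set_borel_measurable_def by measurable
    note c = compact_slab[OF conjunct1[OF K], of t]
    have "(\<integral>\<^sup>+y. ennreal (indicator K y * norm (?T y) ^ 2) \<partial>lebesgue) = (\<integral>\<^sup>+y\<in>K. ennreal ((norm (0 - ?T y))\<^sup>2) \<partial>lebesgue)"
      by (intro nn_integral_cong) (auto simp: indicator_def)
    \<comment> \<open>The estimate with the zero function in place of the smooth one bounds the slab
      trace itself.\<close>
    also have "\<dots> \<le> 2 * (\<integral>\<^sup>+x\<in>slab t K. ennreal ((norm (0 - f x))\<^sup>2 + (\<Sum>i\<in>UNIV. (norm (0 - weak_pderiv UNIV i f x))\<^sup>2)) \<partial>lebesgue)"
      using H1_loc_trace_estimate[OF smooth_const[of 0] f0 g0 conjunct1[OF K], of t] by simp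
    finally have A: "(\<integral>\<^sup>+y. ennreal (indicator K y * norm (?T y) ^ 2) \<partial>lebesgue) \<le> 2 * (\<integral>\<^sup>+x\<in>slab t K. ennreal ((norm (0 - f x))\<^sup>2 + (\<Sum>i\<in>UNIV. (norm (0 - weak_pderiv UNIV i f x))\<^sup>2)) \<partial>lebesgue)" .
    have "(\<integral>\<^sup>+x\<in>slab t K. ennreal ((norm (0 - f x))\<^sup>2 + (\<Sum>i\<in>UNIV. (norm (0 - weak_pderiv UNIV i f x))\<^sup>2)) \<partial>lebesgue)
       = (\<integral>\<^sup>+x. ennreal (indicator (slab t K) x * norm (f x) ^ 2 + (\<Sum>i\<in>UNIV. indicator (slab t K) x * norm (weak_pderiv UNIV i f x) ^ 2)) \<partial>lebesgue)"
      by (intro nn_integral_cong) (auto simp: indicator_def)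
    also have "\<dots> < \<infinity>"
    proof -
      have "f \<in> Lp_loc 2 UNIV" using f by (simp add: H1_loc_def)
      then have "integrable lebesgue (\<lambda>x. indicator (slab t K) x * norm (f x) ^ 2 + (\<Sum>i\<in>UNIV. indicator (slab t K) x * norm (weak_pderiv UNIV i f x) ^ 2))"
        using c weak_pderiv_H1_loc(2)[OF f]
        by (intro Bochner_Integration.integrable_add Bochner_Integration.integrable_sum) (auto simp: Lp_loc_def Lp_def set_integrable_def)
      then show ?thesis using integrableD(2) by (fastforce simp: less_top sum_nonneg)
    qed
    finally have "2 * (\<integral>\<^sup>+x\<in>slab t K. ennreal ((norm (0 - f x))\<^sup>2 + (\<Sum>i\<in>UNIV. (norm (0 - weak_pderiv UNIV i f x))\<^sup>2)) \<partial>lebesgue) < \<infinity>"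
      by (simp add: ennreal_mult_less_top)
    with A have fin: "(\<integral>\<^sup>+y. ennreal (indicator K y * norm (?T y) ^ 2) \<partial>lebesgue) < \<infinity>" by (rule le_less_trans)
    show "set_integrable lebesgue K (\<lambda>x. norm (?T x) ^ 2)"
      unfolding set_integrable_def using fin by (intro integrableI_nonneg) auto
  qed
qed

text \<open>Any sequence that witnesses a trace also converges on the plane to the slab average, by
  the same estimate, and limits in the mean square are unique. This removes the arbitrariness of the
  choice in \<open>plane_trace\<close>.\<close>

lemma is_plane_trace_unique:
  fixes f :: "real^3 \<Rightarrow> 'b::euclidean_space"
  assumes g: "is_plane_trace t f g" and f0: "f0 \<in> borel_measurable borel" "AE x in lebesgue. f0 x = f x"
    and g0: "g0 \<in> borel_measurable borel" "AE x in lebesgue. g0 x = weak_pderiv UNIV 3 f x"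
  shows "AE y in lebesgue. g y = slab_trace t f0 g0 y"
proof -
  let ?T = "slab_trace t f0 g0"
  obtain \<psi> where s: "\<And>k. smooth (\<psi> k)" and c: "\<And>K. compact K \<Longrightarrow> (\<lambda>k. \<integral>\<^sup>+x\<in>K. ennreal ((norm (\<psi> k x - f x))\<^sup>2 +
                  (\<Sum>i\<in>UNIV. (norm (pderiv_at i (\<psi> k) x - weak_pderiv UNIV i f x))\<^sup>2)) \<partial>lebesgue) \<longlonglongrightarrow> 0"
    and d: "\<And>K. compact K \<Longrightarrow> (\<lambda>k. \<integral>\<^sup>+y\<in>K. ennreal ((norm (\<psi> k (at_height y t) - g y))\<^sup>2) \<partial>lebesgue) \<longlonglongrightarrow> 0"
    using g unfolding is_plane_trace_def by blast
  have g2: "g \<in> Lp_loc 2 UNIV" using g by (simp add: is_plane_trace_def)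
  have Tml [measurable]: "?T \<in> borel_measurable lebesgue" by (intro borel_measurable_lebesgueI slab_trace_measurable f0 g0)
  have gm [measurable]: "g \<in> borel_measurable lebesgue" by (rule Lp_loc_measurable[OF g2])
  have "AE y in lebesgue. y \<in> UNIV \<longrightarrow> g y = ?T y"
  proof (rule lebesgue_AE_open_from_compact[OF open_UNIV])
    fix K :: "(real^2) set" assume K: "compact K"
    have Ks [measurable]: "K \<in> sets lebesgue" using lmeasurable_compact[OF K] by auto
    have e: "(\<lambda>k. \<integral>\<^sup>+y\<in>K. ennreal ((norm (\<psi> k (at_height y t) - ?T y))\<^sup>2) \<partial>lebesgue) \<longlonglongrightarrow> 0"
    proof (rule tendsto_0_le_ennreal)
      show "(\<lambda>k. 2 * (\<integral>\<^sup>+x\<in>slab t K. ennreal ((norm (\<psi> k x - f x))\<^sup>2 +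
           (\<Sum>i\<in>UNIV. (norm (pderiv_at i (\<psi> k) x - weak_pderiv UNIV i f x))\<^sup>2)) \<partial>lebesgue)) \<longlonglongrightarrow> 0"
        using ennreal_tendsto_cmult[OF _ c[OF compact_slab[OF K]], of 2] by simp
    qed (rule H1_loc_trace_estimate[OF s f0 g0 K])
    have pm [measurable]: "(\<lambda>y. \<psi> k (at_height y t)) \<in> borel_measurable lebesgue" for k
    proof -
      have "continuous_on UNIV (\<lambda>y. at_height y t)" unfolding at_height_eq by (intro continuous_intros)
      then show ?thesis
        by (intro borel_measurable_lebesgueI borel_measurable_continuous_onI continuous_on_compose2[OF smooth_continuous[OF s]]) auto
    qed
    have le: "(\<integral>\<^sup>+y\<in>K. ennreal ((norm (g y - ?T y))\<^sup>2) \<partial>lebesgue)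
       \<le> 2 * ((\<integral>\<^sup>+y\<in>K. ennreal ((norm (\<psi> k (at_height y t) - g y))\<^sup>2) \<partial>lebesgue) + (\<integral>\<^sup>+y\<in>K. ennreal ((norm (\<psi> k (at_height y t) - ?T y))\<^sup>2) \<partial>lebesgue))" for k
    proof -
      have "(\<integral>\<^sup>+y\<in>K. ennreal ((norm (g y - ?T y))\<^sup>2) \<partial>lebesgue)
         \<le> (\<integral>\<^sup>+y. 2 * (ennreal ((norm (\<psi> k (at_height y t) - g y))\<^sup>2) * indicator K y + ennreal ((norm (\<psi> k (at_height y t) - ?T y))\<^sup>2) * indicator K y) \<partial>lebesgue)"
      proof (rule nn_integral_mono)
        fix y
        let ?a = "norm (\<psi> k (at_height y t) - g y)" and ?b = "norm (\<psi> k (at_height y t) - ?T y)"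
        have "norm (g y - ?T y) \<le> ?a + ?b"
          using norm_triangle_ineq4[of "\<psi> k (at_height y t) - ?T y" "\<psi> k (at_height y t) - g y"] by simp
        then have "(norm (g y - ?T y))\<^sup>2 \<le> (?a + ?b)\<^sup>2" by (intro power_mono) auto
        also have "\<dots> \<le> 2 * (?a\<^sup>2 + ?b\<^sup>2)" using zero_le_power2[of "?a - ?b"] by (simp add: power2_eq_square algebra_simps)
        finally have "ennreal ((norm (g y - ?T y))\<^sup>2) \<le> ennreal (2 * (?a\<^sup>2 + ?b\<^sup>2))" by (rule ennreal_leI)
        also have "\<dots> = 2 * (ennreal (?a\<^sup>2) + ennreal (?b\<^sup>2))" by (simp add: ennreal_mult' distrib_left flip: ennreal_numeral)
        finally show "ennreal ((norm (g y - ?T y))\<^sup>2) * indicator K y \<le> 2 * (ennreal (?a\<^sup>2) * indicator K y + ennreal (?b\<^sup>2) * indicator K y)"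
          by (cases "y \<in> K") auto
      qed
      also have "\<dots> = 2 * (\<integral>\<^sup>+y. ennreal ((norm (\<psi> k (at_height y t) - g y))\<^sup>2) * indicator K y + ennreal ((norm (\<psi> k (at_height y t) - ?T y))\<^sup>2) * indicator K y \<partial>lebesgue)"
        by (rule nn_integral_cmult) measurable
      also have "(\<integral>\<^sup>+y. ennreal ((norm (\<psi> k (at_height y t) - g y))\<^sup>2) * indicator K y + ennreal ((norm (\<psi> k (at_height y t) - ?T y))\<^sup>2) * indicator K y \<partial>lebesgue)
         = (\<integral>\<^sup>+y\<in>K. ennreal ((norm (\<psi> k (at_height y t) - g y))\<^sup>2) \<partial>lebesgue) + (\<integral>\<^sup>+y\<in>K. ennreal ((norm (\<psi> k (at_height y t) - ?T y))\<^sup>2) \<partial>lebesgue)"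
        by (rule nn_integral_add) measurable
      finally show ?thesis .
    qed
    have "(\<lambda>k. 2 * ((\<integral>\<^sup>+y\<in>K. ennreal ((norm (\<psi> k (at_height y t) - g y))\<^sup>2) \<partial>lebesgue) + (\<integral>\<^sup>+y\<in>K. ennreal ((norm (\<psi> k (at_height y t) - ?T y))\<^sup>2) \<partial>lebesgue))) \<longlonglongrightarrow> 2 * (0 + 0)"
      by (intro ennreal_tendsto_cmult tendsto_add d[OF K] e) auto
    then have "(\<lambda>k::nat. \<integral>\<^sup>+y\<in>K. ennreal ((norm (g y - ?T y))\<^sup>2) \<partial>lebesgue) \<longlonglongrightarrow> 0"
      using le by (intro tendsto_0_le_ennreal[of _ "\<lambda>k. \<integral>\<^sup>+y\<in>K. ennreal ((norm (g y - ?T y))\<^sup>2) \<partial>lebesgue"]) auto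
    then have "(\<integral>\<^sup>+y\<in>K. ennreal ((norm (g y - ?T y))\<^sup>2) \<partial>lebesgue) = 0" by (simp add: LIMSEQ_const_iff)
    then have "AE y in lebesgue. ennreal ((norm (g y - ?T y))\<^sup>2) * indicator K y = 0"
      by (subst (asm) nn_integral_0_iff_AE) measurable
    then show "AE y in lebesgue. y \<in> K \<longrightarrow> g y = ?T y"
      by eventually_elim (auto simp: indicator_def split: if_splits)
  qed
  then show ?thesis by simp
qed

lemma plane_trace_slab_trace:
  fixes f :: "real^3 \<Rightarrow> 'b::euclidean_space"
  assumes f: "f \<in> H1_loc UNIV" and f0: "f0 \<in> borel_measurable borel" "AE x in lebesgue. f0 x = f x"
    and g0: "g0 \<in> borel_measurable borel" "AE x in lebesgue. g0 x = weak_pderiv UNIV 3 f x"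
  shows "is_plane_trace t f (plane_trace t f)" "AE y in lebesgue. plane_trace t f y = slab_trace t f0 g0 y"
proof -
  show "is_plane_trace t f (plane_trace t f)"
    unfolding plane_trace_def by (rule someI[of "is_plane_trace t f", OF is_plane_trace_slab_trace[OF assms]])
  then show "AE y in lebesgue. plane_trace t f y = slab_trace t f0 g0 y"
    by (rule is_plane_trace_unique[OF _ f0 g0])
qed

lemma continuous_hat: "continuous_on S hat"
  by (intro linear_continuous_on bounded_linear_hat)

lemma hat_measurable [measurable]: "hat \<in> borel_measurable borel"
  by (intro borel_measurable_continuous_onI continuous_hat)

lemma norm_hat_le: "norm (hat x) \<le> norm x"
proof -
  have "(\<Sum>i\<in>UNIV. (hat x $ i)\<^sup>2) \<le> (\<Sum>i\<in>UNIV. (x $ i)\<^sup>2)" unfolding sum_2 sum_3 by simp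
  then show ?thesis by (simp add: norm_vec_def L2_set_def)
qed

section \<open>Integration by parts in horizontal directions\<close>

text \<open>The weight \<open>\<omega>\<close> may jump at the faces of the slab, so its product
  with \<open>\<rho>\<close> is not a test function. A horizontal derivative does not see
  \<open>\<omega>\<close>, however: the identity holds for mollifications of \<open>A\<close> by
  translation invariance and passes to the limit, since the weights are bounded with compact
  support.\<close>

lemma horizontal_integration_by_parts:
  fixes A :: "real^3 \<Rightarrow> 'b::euclidean_space" and \<rho> :: "real^2 \<Rightarrow> real" and \<omega> :: "real \<Rightarrow> real"
  assumes w: "has_weak_pderiv UNIV i A D"
    and ij: "hat (axis i 1) = axis j 1" "(axis i 1 :: real^3) $ 3 = 0"
    and \<rho>: "\<rho> \<in> test_functions UNIV"
    and \<omega>: "\<omega> \<in> borel_measurable borel" "\<And>s. \<bar>\<omega> s\<bar> \<le> 1" "\<And>s. s < t \<or> t + 1 < s \<Longrightarrow> \<omega> s = 0"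
  shows "(LINT x|lebesgue. (\<omega> (x $ 3) * pderiv_at j \<rho> (hat x)) *\<^sub>R A x) = - (LINT x|lebesgue. (\<omega> (x $ 3) * \<rho> (hat x)) *\<^sub>R D x)"
    and "integrable lebesgue (\<lambda>x. (\<omega> (x $ 3) * pderiv_at j \<rho> (hat x)) *\<^sub>R A x)"
    and "integrable lebesgue (\<lambda>x. (\<omega> (x $ 3) * \<rho> (hat x)) *\<^sub>R D x)"
proof -
  have A1: "A \<in> Lp_loc 1 UNIV" and D1: "D \<in> Lp_loc 1 UNIV" using w by (auto simp: has_weak_pderiv_def)
  note [measurable] = \<omega>(1)
  have sm: "smooth \<rho>" using \<rho> by (simp add: test_functions_def)
  have cp: "continuous_on UNIV \<rho>" "continuous_on UNIV (pderiv_at j \<rho>)"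
    by (intro smooth_continuous smooth_pderiv sm)+
  then have [measurable]: "\<rho> \<in> borel_measurable borel" "pderiv_at j \<rho> \<in> borel_measurable borel"
    by (auto intro: borel_measurable_continuous_onI)
  obtain r where r: "r > 0" "\<And>x. r < norm x \<Longrightarrow> \<rho> x = 0" using test_functions_zero_outside[OF \<rho>] by blast
  have dz: "pderiv_at j \<rho> x = 0" if "r < norm x" for x using pderiv_at_zero_outside[of r \<rho>, OF r(2) that] .
  obtain M1 where M1: "M1 \<ge> 0" "\<And>x. \<bar>\<rho> x\<bar> \<le> M1" using continuous_zero_outside_bounded[OF cp(1) r(2)] by auto
  obtain M2 where M2: "M2 \<ge> 0" "\<And>x. \<bar>pderiv_at j \<rho> x\<bar> \<le> M2" using continuous_zero_outside_bounded[OF cp(2) dz] by auto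
  define m1 where "m1 x = \<omega> (x $ 3) * \<rho> (hat x)" for x :: "real^3"
  define m2 where "m2 x = \<omega> (x $ 3) * pderiv_at j \<rho> (hat x)" for x :: "real^3"
  have m1m: "m1 \<in> borel_measurable borel" and m2m: "m2 \<in> borel_measurable borel" unfolding m1_def m2_def by measurable
  have m1b: "\<bar>m1 x\<bar> \<le> M1" for x
    unfolding m1_def abs_mult by (rule order_trans[OF mult_mono[OF \<omega>(2) M1(2)]]) simp_all
  have m2b: "\<bar>m2 x\<bar> \<le> M2" for x
    unfolding m2_def abs_mult by (rule order_trans[OF mult_mono[OF \<omega>(2) M2(2)]]) simp_all
  define K where "K = slab t (cball 0 r)"
  have K: "compact K" unfolding K_def by (intro compact_slab compact_cball)
  have mz: "m1 x = 0" "m2 x = 0" if "x \<notin> K" for x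
  proof -
    have "r < norm (hat x) \<or> x $ 3 < t \<or> t + 1 < x $ 3" using that by (auto simp: K_def slab_def)
    then show "m1 x = 0" "m2 x = 0" using r(2) dz \<omega>(3) by (auto simp: m1_def m2_def)
  qed
  obtain R where R: "\<And>x. x \<in> K \<Longrightarrow> norm x \<le> R" using compact_imp_bounded[OF K] unfolding bounded_iff by blast
  have ml: "m1 \<in> borel_measurable lebesgue" "m2 \<in> borel_measurable lebesgue" by (intro borel_measurable_lebesgueI m1m m2m)+
  show i1: "integrable lebesgue (\<lambda>x. (\<omega> (x $ 3) * pderiv_at j \<rho> (hat x)) *\<^sub>R A x)"
    using integrable_mult_Lp_loc[OF A1 K subset_UNIV ml(2) m2b mz(2)] unfolding m2_def .
  show i2: "integrable lebesgue (\<lambda>x. (\<omega> (x $ 3) * \<rho> (hat x)) *\<^sub>R D x)"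
    using integrable_mult_Lp_loc[OF D1 K subset_UNIV ml(1) m1b mz(1)] unfolding m1_def .
  define Ak where "Ak k = conv (mol_seq k) A" for k
  have As: "smooth (Ak k)" for k unfolding Ak_def by (rule conv_mol_seq(1)[OF A1])
  have Ad: "pderiv_at i (Ak k) x = conv (mol_seq k) D x" for k x
    using conv_weak_pderiv[OF w mol_seq_le(2)[of k], of x] unfolding Ak_def conv_mol_seq(2)[OF A1] by (simp add: mol_seq_def)
  have Ac: "continuous_on UNIV (Ak k)" "continuous_on UNIV (pderiv_at i (Ak k))" for k
    by (intro smooth_continuous smooth_pderiv As)+
  have AL: "Ak k \<in> Lp_loc 1 UNIV" "pderiv_at i (Ak k) \<in> Lp_loc 1 UNIV" for k
    by (intro Lp_loc_continuous Ac)+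
  have zero: "(LINT x|lebesgue. m2 x *\<^sub>R Ak k x) = - (LINT x|lebesgue. m1 x *\<^sub>R pderiv_at i (Ak k) x)" for k
  proof -
    have [measurable]: "Ak k \<in> borel_measurable borel" "pderiv_at i (Ak k) \<in> borel_measurable borel"
      by (intro borel_measurable_continuous_onI Ac)+
    note [measurable] = m1m m2m
    define g where "g x = m1 x *\<^sub>R Ak k x" for x
    define g' where "g' x = m1 x *\<^sub>R pderiv_at i (Ak k) x + m2 x *\<^sub>R Ak k x" for x
    have gm [measurable]: "g \<in> borel_measurable borel" "g' \<in> borel_measurable borel" unfolding g_def g'_def by measurable
    have j1: "integrable lebesgue (\<lambda>x. m1 x *\<^sub>R Ak k x)" by (rule integrable_mult_Lp_loc[OF AL(1) K subset_UNIV ml(1) m1b mz(1)])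
    have j2: "integrable lebesgue (\<lambda>x. m1 x *\<^sub>R pderiv_at i (Ak k) x)" by (rule integrable_mult_Lp_loc[OF AL(2) K subset_UNIV ml(1) m1b mz(1)])
    have j3: "integrable lebesgue (\<lambda>x. m2 x *\<^sub>R Ak k x)" by (rule integrable_mult_Lp_loc[OF AL(1) K subset_UNIV ml(2) m2b mz(2)])
    have gi: "integrable lborel g" using j1 gm(1) unfolding g_def[abs_def, symmetric] by (simp add: integrable_completion)
    have gd: "((\<lambda>s. g (x + s *\<^sub>R axis i 1)) has_vector_derivative g' x) (at 0)" for x
    proof -
      have h: "hat (x + s *\<^sub>R axis i 1) = hat x + s *\<^sub>R axis j 1" "(x + s *\<^sub>R axis i 1) $ 3 = x $ 3" for s
        using ij by (simp_all add: linear_add linear_scale bounded_linear.linear[OF bounded_linear_hat])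
      have 1: "((\<lambda>s. \<rho> (hat x + s *\<^sub>R axis j 1)) has_field_derivative pderiv_at j \<rho> (hat x)) (at 0)"
        using directional_derivative_pderiv[OF smooth_differentiable[OF sm]] by (simp add: has_real_derivative_iff_has_vector_derivative)
      have 2: "((\<lambda>s. \<omega> (x $ 3) * \<rho> (hat x + s *\<^sub>R axis j 1)) has_field_derivative m2 x) (at 0)"
        unfolding m2_def by (rule DERIV_cmult[OF 1])
      show ?thesis using has_vector_derivative_scaleR[OF 2 directional_derivative_pderiv[OF smooth_differentiable[OF As]]]
        unfolding g_def g'_def m1_def h by simp
    qed
    obtain B1 where B1: "\<And>x. norm x \<le> R \<Longrightarrow> norm (Ak k x) \<le> B1" using bounded_on_balls_continuous[OF Ac(1)] by blast
    obtain B2 where B2: "\<And>x. norm x \<le> R \<Longrightarrow> norm (pderiv_at i (Ak k) x) \<le> B2" using bounded_on_balls_continuous[OF Ac(2)] by blast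
    have g'b: "norm (g' x) \<le> M1 * \<bar>B2\<bar> + M2 * \<bar>B1\<bar>" for x
    proof (cases "x \<in> K")
      case True
      have "norm (g' x) \<le> \<bar>m1 x\<bar> * norm (pderiv_at i (Ak k) x) + \<bar>m2 x\<bar> * norm (Ak k x)"
        unfolding g'_def by (rule order_trans[OF norm_triangle_ineq]) simp
      also have "\<dots> \<le> M1 * \<bar>B2\<bar> + M2 * \<bar>B1\<bar>"
        using B1[OF R[OF True]] B2[OF R[OF True]] by (intro add_mono mult_mono m1b m2b M1 M2) auto
      finally show ?thesis .
    qed (use M1 M2 in \<open>simp add: g'_def mz\<close>)
    have gz: "g x = 0" if "R < norm x" for x
    proof -
      have "x \<notin> K" using that R[of x] by auto
      then show ?thesis by (simp add: g_def mz)
    qed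
    have "(LINT x|lborel. g' x) = 0" by (rule integral_directional_derivative_zero(2)[OF gm(1) gi gd g'b gz])
    then have "(LINT x|lebesgue. g' x) = 0" by (subst integral_completion) auto
    then have "(LINT x|lebesgue. m1 x *\<^sub>R pderiv_at i (Ak k) x) + (LINT x|lebesgue. m2 x *\<^sub>R Ak k x) = 0"
      unfolding g'_def using j2 j3 by simp
    then show ?thesis by (simp add: add_eq_0_iff)
  qed
  have l1: "(\<lambda>k. \<integral>\<^sup>+x\<in>K. ennreal (norm (Ak k x - A x)) \<partial>lebesgue) \<longlonglongrightarrow> 0"
    using conv_tendsto_Lp_loc[OF A1 _ K] by (simp add: Ak_def)
  have l2: "(\<lambda>k. \<integral>\<^sup>+x\<in>K. ennreal (norm (pderiv_at i (Ak k) x - D x)) \<partial>lebesgue) \<longlonglongrightarrow> 0"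
    using conv_tendsto_Lp_loc[OF D1 _ K] by (simp add: Ad)
  have "(\<lambda>k. LINT x|lebesgue. m2 x *\<^sub>R Ak k x) \<longlonglongrightarrow> (LINT x|lebesgue. m2 x *\<^sub>R A x)"
    by (rule tendsto_integral_mult_L1_loc[OF ml(2) m2b mz(2) K AL(1) A1 l1])
  moreover have "(\<lambda>k. - (LINT x|lebesgue. m1 x *\<^sub>R pderiv_at i (Ak k) x)) \<longlonglongrightarrow> - (LINT x|lebesgue. m1 x *\<^sub>R D x)"
    by (rule tendsto_minus[OF tendsto_integral_mult_L1_loc[OF ml(1) m1b mz(1) K AL(2) D1 l2]])
  ultimately have "(LINT x|lebesgue. m2 x *\<^sub>R A x) = - (LINT x|lebesgue. m1 x *\<^sub>R D x)"
    unfolding zero by (rule LIMSEQ_unique)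
  then show "(LINT x|lebesgue. (\<omega> (x $ 3) * pderiv_at j \<rho> (hat x)) *\<^sub>R A x) = - (LINT x|lebesgue. (\<omega> (x $ 3) * \<rho> (hat x)) *\<^sub>R D x)"
    unfolding m1_def m2_def .
qed

lemma has_weak_pderiv_bounded_linear:
  fixes f g :: "real^'n::finite \<Rightarrow> 'b::euclidean_space" and T :: "'b \<Rightarrow> 'c::euclidean_space"
  assumes T: "bounded_linear T" and w: "has_weak_pderiv U i f g"
  shows "has_weak_pderiv U i (\<lambda>x. T (f x)) (\<lambda>x. T (g x))"
proof -
  note Tl = bounded_linear.linear[OF T]
  have f: "f \<in> Lp_loc 1 U" and g: "g \<in> Lp_loc 1 U" using w by (auto simp: has_weak_pderiv_def)
  have L: "(\<lambda>x. T (h x)) \<in> Lp_loc 1 U" if h: "h \<in> Lp_loc 1 U" for h :: "real^'n \<Rightarrow> 'b"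
  proof (rule Lp_loc_1I)
    fix K assume "compact K" "K \<subseteq> U"
    from integrable_bounded_linear[OF T Lp_loc_1_integrable[OF h this]]
    show "integrable lebesgue (\<lambda>x. indicator K x *\<^sub>R T (h x))" by (simp add: linear_scale[OF Tl])
  qed
  have I: "(LINT x:U|lebesgue. m x *\<^sub>R T (h x)) = T (LINT x:U|lebesgue. m x *\<^sub>R h x)"
    if "set_integrable lebesgue U (\<lambda>x. m x *\<^sub>R h x)" for m and h :: "real^'n \<Rightarrow> 'b"
    using integral_bounded_linear[OF T that[unfolded set_integrable_def]]
    by (simp add: set_lebesgue_integral_def linear_scale[OF Tl])
  show ?thesis
    unfolding has_weak_pderiv_def
  proof (intro conjI allI impI L f g)
    fix \<phi> :: "real^'n \<Rightarrow> real" assume \<phi>: "\<phi> \<in> test_functions U"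
    have "(LINT x:U|lebesgue. pderiv_at i \<phi> x *\<^sub>R f x) = - (LINT x:U|lebesgue. \<phi> x *\<^sub>R g x)"
      using w \<phi> by (simp add: has_weak_pderiv_def)
    then show "(LINT x:U|lebesgue. pderiv_at i \<phi> x *\<^sub>R T (f x)) = - (LINT x:U|lebesgue. \<phi> x *\<^sub>R T (g x))"
      using I[OF test_function_integrable(4)[OF \<phi> f]] I[OF test_function_integrable(3)[OF \<phi> g]]
      by (simp add: linear_neg[OF Tl])
  qed
qed

lemma Lp_loc_2_hat:
  assumes "f \<in> Lp_loc 2 UNIV"
  shows "(\<lambda>x::real^'n::finite. hat (f x)) \<in> Lp_loc 2 UNIV"
  unfolding Lp_loc_def Lp_def
proof (intro CollectI allI impI conjI)
  fix K :: "(real^'n) set" assume K: "compact K \<and> K \<subseteq> UNIV"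
  then have [measurable]: "K \<in> sets lebesgue" using lmeasurable_compact by blast
  note [measurable] = Lp_loc_measurable[OF assms]
  show "set_borel_measurable lebesgue K (\<lambda>x. hat (f x))" unfolding set_borel_measurable_def by measurable
  have "integrable lebesgue (\<lambda>x. indicator K x *\<^sub>R norm (f x) ^ 2)"
    using assms K by (auto simp: Lp_loc_def Lp_def set_integrable_def)
  then show "set_integrable lebesgue K (\<lambda>x. norm (hat (f x)) ^ 2)"
    unfolding set_integrable_def
    by (rule Bochner_Integration.integrable_bound)
       (measurable, auto intro!: AE_I2 mult_left_mono power_mono norm_hat_le)
qed

lemma H1_loc_hat:
  assumes A: "A \<in> H1_loc UNIV"
  shows "(\<lambda>x. hat (A x)) \<in> H1_loc UNIV"
    "AE x in lebesgue. weak_pderiv UNIV i (\<lambda>x. hat (A x)) x = hat (weak_pderiv UNIV i A x)"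
proof -
  have w: "has_weak_pderiv UNIV i (\<lambda>x. hat (A x)) (\<lambda>x. hat (weak_pderiv UNIV i A x))" for i
    by (rule has_weak_pderiv_bounded_linear[OF bounded_linear_hat weak_pderiv_H1_loc(1)[OF A]])
  show "(\<lambda>x. hat (A x)) \<in> H1_loc UNIV"
    unfolding H1_loc_def using A w Lp_loc_2_hat[OF weak_pderiv_H1_loc(2)[OF A]] Lp_loc_2_hat[of A] by (auto simp: H1_loc_def)
  show "AE x in lebesgue. weak_pderiv UNIV i (\<lambda>x. hat (A x)) x = hat (weak_pderiv UNIV i A x)"
    using weak_pderiv_AE[OF open_UNIV w] by simp
qed

text \<open>Fubini turns the pairing on the plane into an integral over the slab. The vertical
  sections are integrable only for almost every \<open>y\<close>, and \<open>slab_trace\<close>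
  takes a default value at the others, so the inner integral is identified almost
  everywhere.\<close>

lemma slab_trace_pairing:
  fixes f g :: "real^3 \<Rightarrow> 'b::euclidean_space" and \<psi> :: "real^2 \<Rightarrow> real"
  assumes [measurable]: "f \<in> borel_measurable borel" "g \<in> borel_measurable borel" "\<psi> \<in> borel_measurable borel"
    and K: "compact K" and \<psi>: "\<And>y. y \<notin> K \<Longrightarrow> \<psi> y = 0" "\<And>y. \<bar>\<psi> y\<bar> \<le> B"
    and fi: "integrable lborel (\<lambda>x. indicator (slab t K) x *\<^sub>R f x)" and gi: "integrable lborel (\<lambda>x. indicator (slab t K) x *\<^sub>R g x)"
  shows "(LINT y|lborel. \<psi> y * (slab_trace t f g y \<bullet> b)) =
      (LINT x|lborel. indicator {t..t+1} (x $ 3) * \<psi> (hat x) * ((f x - (1 - (x $ 3 - t)) *\<^sub>R g x) \<bullet> b))"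
    "integrable lborel (\<lambda>y. \<psi> y * (slab_trace t f g y \<bullet> b))"
proof -
  have Ks [measurable]: "K \<in> sets borel" "slab t K \<in> sets borel"
    using compact_imp_closed[OF K] compact_imp_closed[OF compact_slab[OF K]] by auto
  define V where "V x = indicator (slab t K) x *\<^sub>R (f x - (1 - (x $ 3 - t)) *\<^sub>R g x)" for x
  have Vm [measurable]: "V \<in> borel_measurable borel" unfolding V_def by measurable
  have Vi: "integrable lborel V"
  proof (rule Bochner_Integration.integrable_bound)
    show "integrable lborel (\<lambda>x. norm (indicator (slab t K) x *\<^sub>R f x) + norm (indicator (slab t K) x *\<^sub>R g x))"
      using fi gi by (intro Bochner_Integration.integrable_add integrable_norm)
    have "norm (V x) \<le> norm (f x) + norm (g x)" if "x \<in> slab t K" for x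
    proof -
      have "norm (V x) \<le> norm (f x) + norm ((1 - (x $ 3 - t)) *\<^sub>R g x)"
        using that norm_triangle_ineq4[of "f x" "(1 - (x $ 3 - t)) *\<^sub>R g x"] by (simp add: V_def)
      also have "norm ((1 - (x $ 3 - t)) *\<^sub>R g x) \<le> norm (g x)"
        using that by (auto simp: slab_def intro!: mult_left_le_one_le)
      finally show ?thesis by simp
    qed
    then show "AE x in lborel. norm (V x) \<le> norm (norm (indicator (slab t K) x *\<^sub>R f x) + norm (indicator (slab t K) x *\<^sub>R g x))"
      by (intro AE_I2) (auto simp: indicator_def V_def)
  qed measurable
  define H where "H x = \<psi> (hat x) * (V x \<bullet> b)" for x
  have Hm [measurable]: "H \<in> borel_measurable borel" unfolding H_def by measurable
  have Hi: "integrable lborel H"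
  proof (rule Bochner_Integration.integrable_bound)
    show "integrable lborel (\<lambda>x. (B * norm b) * norm (V x))" using Vi by simp
    have "norm (H x) \<le> norm (B * norm b * norm (V x))" for x
    proof -
      have "norm (H x) \<le> \<bar>\<psi> (hat x)\<bar> * (norm (V x) * norm b)"
        by (simp add: H_def abs_mult mult_left_mono Cauchy_Schwarz_ineq2)
      also have "\<dots> \<le> B * (norm (V x) * norm b)" by (intro mult_right_mono \<psi>) auto
      also have "\<dots> = B * norm b * norm (V x)" by simp
      also have "\<dots> \<le> norm (B * norm b * norm (V x))" unfolding real_norm_def by (rule abs_ge_self)
      finally show ?thesis .
    qed
    then show "AE x in lborel. norm (H x) \<le> norm (B * norm b * norm (V x))" by simp
  qed measurable
  have Heq: "indicator {t..t+1} (x $ 3) * \<psi> (hat x) * ((f x - (1 - (x $ 3 - t)) *\<^sub>R g x) \<bullet> b) = H x" for x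
    using \<psi>(1)[of "hat x"] by (auto simp: H_def V_def slab_def indicator_def)
  have Vi2: "integrable (lborel \<Otimes>\<^sub>M lborel) (\<lambda>p. V (at_height (fst p) (t + snd p)))"
    using Vi integrable_distr_eq[of "\<lambda>(y, s). at_height y (t + s)" "lborel \<Otimes>\<^sub>M lborel" borel V]
    by (simp add: lborel_at_height[unfolded split_def] split_def)
  have Hi2: "integrable (lborel \<Otimes>\<^sub>M lborel) (\<lambda>p. H (at_height (fst p) (t + snd p)))"
    using Hi integrable_distr_eq[of "\<lambda>(y, s). at_height y (t + s)" "lborel \<Otimes>\<^sub>M lborel" borel H]
    by (simp add: lborel_at_height[unfolded split_def] split_def)
  have aeV: "AE y in lborel. integrable lborel (\<lambda>s. V (at_height y (t + s)))"
    using lborel_pair.AE_integrable_fst'[OF Vi2] by simp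
  have sec: "AE y in lborel. (LINT s|lborel. H (at_height y (t + s))) = \<psi> y * (slab_trace t f g y \<bullet> b)"
    using aeV
  proof eventually_elim
    case (elim y)
    show ?case
    proof (cases "y \<in> K")
      case True
      have Ts: "slab_trace t f g y = (LINT s|lborel. V (at_height y (t + s)))"
        unfolding slab_trace_def V_def using True by (intro Bochner_Integration.integral_cong) (auto simp: slab_def indicator_def)
      show ?thesis unfolding Ts H_def hat_at_height using elim by simp
    next
      case False
      then show ?thesis by (simp add: H_def \<psi>)
    qed
  qed
  have Tm [measurable]: "slab_trace t f g \<in> borel_measurable borel" by (rule slab_trace_measurable) measurable
  have Hs: "integrable lborel (\<lambda>y. LINT s|lborel. H (at_height y (t + s)))"
    using lborel_pair.integrable_fst'[OF Hi2] by simp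
  show "integrable lborel (\<lambda>y. \<psi> y * (slab_trace t f g y \<bullet> b))"
    by (rule integrable_cong_AE_imp[OF Hs]) (measurable, use sec in \<open>auto elim!: eventually_mono\<close>)
  have "(LINT x|lborel. H x) = (LINT y|lborel. (LINT s|lborel. H (at_height y (t + s))))"
    by (rule integral_at_height[OF Hi])
  also have "\<dots> = (LINT y|lborel. \<psi> y * (slab_trace t f g y \<bullet> b))"
    by (rule integral_cong_AE) (use sec borel_measurable_integrable[OF Hs] in auto)
  finally show "(LINT y|lborel. \<psi> y * (slab_trace t f g y \<bullet> b)) =
      (LINT x|lborel. indicator {t..t+1} (x $ 3) * \<psi> (hat x) * ((f x - (1 - (x $ 3 - t)) *\<^sub>R g x) \<bullet> b))"
    unfolding Heq by simp
qed

section \<open>The flux through a layer\<close>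

lemma test_functions_pderiv:
  fixes \<phi> :: "real^'n::finite \<Rightarrow> real"
  assumes "\<phi> \<in> test_functions U"
  shows "pderiv_at i \<phi> \<in> test_functions U"
proof -
  have s: "smooth \<phi>" and c: "compact (closure {x. \<phi> x \<noteq> 0})" and u: "closure {x. \<phi> x \<noteq> 0} \<subseteq> U"
    using assms by (auto simp: test_functions_def)
  have "{x. pderiv_at i \<phi> x \<noteq> 0} \<subseteq> closure {x. \<phi> x \<noteq> 0}"
    using pderiv_at_zero_outside_support(2)[of _ \<phi> i] by blast
  then have "closure {x. pderiv_at i \<phi> x \<noteq> 0} \<subseteq> closure {x. \<phi> x \<noteq> 0}" by (simp add: closure_minimal)
  moreover from this have "compact (closure {x. pderiv_at i \<phi> x \<noteq> 0})"
    using c bounded_subset unfolding compact_eq_bounded_closed by blast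
  ultimately show ?thesis using smooth_pderiv[OF s] u by (auto simp: test_functions_def)
qed

lemma borel_measurable_component [measurable (raw)]:
  fixes f :: "'a \<Rightarrow> real^'n::finite"
  assumes "f \<in> borel_measurable M"
  shows "(\<lambda>x. f x $ i) \<in> borel_measurable M"
  by (rule measurable_compose[OF assms]) (intro borel_measurable_continuous_onI continuous_intros)

lemma test_functions_UNIV: "\<phi> \<in> test_functions U \<Longrightarrow> \<phi> \<in> test_functions UNIV"
  by (auto simp: test_functions_def)

lemma test_function_facts:
  fixes \<phi> :: "real^'n::finite \<Rightarrow> real"
  assumes \<phi>: "\<phi> \<in> test_functions U"
  shows "\<phi> \<in> borel_measurable borel" "\<exists>B. \<forall>x. \<bar>\<phi> x\<bar> \<le> B" "continuous_on UNIV \<phi>" "x \<notin> U \<Longrightarrow> \<phi> x = 0"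
    "integrable lborel \<phi>"
proof -
  have s: "smooth \<phi>" and u: "closure {x. \<phi> x \<noteq> 0} \<subseteq> U" using \<phi> by (auto simp: test_functions_def)
  show c: "continuous_on UNIV \<phi>" by (rule smooth_continuous[OF s])
  then show "\<phi> \<in> borel_measurable borel" by (rule borel_measurable_continuous_onI)
  obtain r where r: "\<And>x. r < norm x \<Longrightarrow> \<phi> x = 0" using test_functions_zero_outside[OF \<phi>] by blast
  show "\<exists>B. \<forall>x. \<bar>\<phi> x\<bar> \<le> B" using continuous_zero_outside_bounded[OF c r] by auto
  show "\<phi> x = 0" if "x \<notin> U" for x using that u closure_subset[of "{x. \<phi> x \<noteq> 0}"] by auto
  show "integrable lborel \<phi>" by (rule integrable_continuous_zero_outside[OF c r])
qed

lemma slab_weight_integrable: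
  fixes f :: "real^3 \<Rightarrow> 'b::euclidean_space" and \<rho> :: "real^2 \<Rightarrow> real"
  assumes f: "f \<in> Lp_loc 1 UNIV" and \<rho>: "\<rho> \<in> test_functions UNIV"
    and \<omega>: "\<omega> \<in> borel_measurable borel" "\<And>s. \<bar>\<omega> s\<bar> \<le> 1" "\<And>s. s < t \<or> t + 1 < s \<Longrightarrow> \<omega> s = 0"
  shows "integrable lebesgue (\<lambda>x. (\<omega> (x $ 3) * \<rho> (hat x)) *\<^sub>R f x)"
proof -
  obtain B where B: "\<And>x. \<bar>\<rho> x\<bar> \<le> B" using test_function_facts(2)[OF \<rho>] by blast
  note [measurable] = \<omega>(1) test_function_facts(1)[OF \<rho>]
  obtain r where r: "\<And>x. r < norm x \<Longrightarrow> \<rho> x = 0" using test_functions_zero_outside[OF \<rho>] by blast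
  show ?thesis
  proof (rule integrable_mult_Lp_loc[OF f compact_slab[OF compact_cball[of 0 r], of t] subset_UNIV])
    show "(\<lambda>x. \<omega> (x $ 3) * \<rho> (hat x)) \<in> borel_measurable lebesgue"
      by (rule borel_measurable_lebesgueI) measurable
    show "\<bar>\<omega> (x $ 3) * \<rho> (hat x)\<bar> \<le> B" for x :: "real^3"
      unfolding abs_mult by (rule order_trans[OF mult_mono[OF \<omega>(2) B]]) simp_all
    show "\<omega> (x $ 3) * \<rho> (hat x) = 0" if "x \<notin> slab t (cball 0 r)" for x
    proof -
      have "r < norm (hat x) \<or> x $ 3 < t \<or> t + 1 < x $ 3" using that by (auto simp: slab_def)
      then show ?thesis using r \<omega>(3) by auto
    qed
  qed
qed

lemma hat_axis: "hat (axis 1 1) = axis 1 1" "hat (axis 2 1) = axis 2 1"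
  "(axis 1 1 :: real^3) $ 3 = 0" "(axis 2 1 :: real^3) $ 3 = 0"
  by (simp_all add: vec_eq_iff forall_2 axis_def)

lemma layer_potential_measurable:
  assumes "A \<in> H1_loc UNIV"
  shows "layer_potential A t \<in> borel_measurable lebesgue"
proof -
  have F: "(\<lambda>x. hat (A x)) \<in> H1_loc UNIV" by (rule H1_loc_hat(1)[OF assms])
  obtain f0 g0 where f0: "f0 \<in> borel_measurable borel" "AE x in lebesgue. f0 x = hat (A x)"
    and g0: "g0 \<in> borel_measurable borel" "AE x in lebesgue. g0 x = weak_pderiv UNIV 3 (\<lambda>x. hat (A x)) x"
    by (rule H1_loc_borel_representatives[OF F])
  show ?thesis
    using plane_trace_slab_trace(1)[OF F f0 g0, of t] unfolding layer_potential_def is_plane_trace_def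
    by (blast intro: Lp_loc_measurable)
qed

lemma weak_curl_measurable:
  fixes A :: "real^3 \<Rightarrow> real^3"
  assumes A: "A \<in> H1_loc UNIV"
  shows "weak_curl A \<in> borel_measurable lebesgue"
proof -
  have D1: "weak_pderiv UNIV i A \<in> Lp_loc 1 UNIV" for i using weak_pderiv_H1_loc(1)[OF A] by (simp add: has_weak_pderiv_def)
  have [measurable]: "weak_pderiv UNIV i A \<in> borel_measurable lebesgue" for i by (rule Lp_loc_measurable[OF D1])
  have Dm: "(\<lambda>x. weak_pderiv UNIV i A x $ j) \<in> borel_measurable lebesgue" for i j by measurable
  have "(\<lambda>x. weak_curl A x $ j) \<in> borel_measurable lebesgue" for j
    using exhaust_3[of j] unfolding weak_curl_def by (elim disjE) (simp_all add: borel_measurable_diff[OF Dm Dm])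
  then have "(\<lambda>x. weak_curl A x \<bullet> b) \<in> borel_measurable lebesgue" if "b \<in> Basis" for b
    using that by (auto simp: Basis_vec_def inner_axis)
  then show ?thesis using borel_measurable_euclidean_space[of "weak_curl A"] by blast
qed

text \<open>A pointwise bound that can be integrated in \<open>ennreal\<close> before anything is
  known to be integrable. Leaving \<tau> free allows the two terms to be balanced once the size of
  the energy is known.\<close>

lemma weighted_young:
  fixes a b :: real
  assumes "\<tau> > 0"
  shows "\<bar>a * b\<bar> \<le> \<tau> / 2 * b\<^sup>2 + 1 / (2 * \<tau>) * a\<^sup>2"
proof -
  have "0 \<le> (\<tau> * \<bar>b\<bar> - \<bar>a\<bar>)\<^sup>2" by simp
  also have "\<dots> = \<tau>\<^sup>2 * b\<^sup>2 - 2 * \<tau> * \<bar>a * b\<bar> + a\<^sup>2" by (simp add: power2_eq_square algebra_simps abs_mult)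
  finally have "2 * \<tau> * \<bar>a * b\<bar> \<le> \<tau>\<^sup>2 * b\<^sup>2 + a\<^sup>2" by simp
  then show ?thesis using assms by (simp add: field_simps power2_eq_square)
qed

text \<open>In the case without integrability the left side is zero by convention, so the bound
  holds unconditionally.\<close>

lemma abs_set_lebesgue_integral_le:
  fixes f :: "'a \<Rightarrow> real"
  shows "ennreal \<bar>LINT x:S|M. f x\<bar> \<le> (\<integral>\<^sup>+x\<in>S. ennreal \<bar>f x\<bar> \<partial>M)"
proof (cases "integrable M (\<lambda>x. indicator S x *\<^sub>R f x)")
  case True
  have "ennreal (norm (LINT x|M. indicator S x *\<^sub>R f x)) \<le> (\<integral>\<^sup>+x. ennreal (norm (indicator S x *\<^sub>R f x)) \<partial>M)"
    by (rule integral_norm_bound_ennreal[OF True])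
  also have "\<dots> = (\<integral>\<^sup>+x\<in>S. ennreal \<bar>f x\<bar> \<partial>M)" by (intro nn_integral_cong) (auto simp: indicator_def)
  finally show ?thesis by (simp add: set_lebesgue_integral_def)
qed (simp add: set_lebesgue_integral_def not_integrable_integral_eq)

text \<open>The slab formula for the trace has two parts. In the part with \<open>\<omega>0\<close>
  the horizontal derivatives move from \<phi> to the potential and form the third component of the
  curl. The part with \<open>\<omega>1\<close> contains only vertical derivatives of the horizontal
  components; the missing derivatives of the third component may be added because their total
  contribution is zero, and this completes the first two components of the curl.\<close>

lemma dist_curl_layer_potential:
  fixes A :: "real^3 \<Rightarrow> real^3" and \<phi> :: "real^2 \<Rightarrow> real" and t :: real
  assumes A: "A \<in> H1_loc UNIV" and \<phi>: "\<phi> \<in> test_functions \<Omega>"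
  defines "\<omega>0 \<equiv> \<lambda>r. indicator {t..t+1} r :: real" and "\<omega>1 \<equiv> \<lambda>r. indicator {t..t+1} r * (1 - (r - t)) :: real"
  shows "dist_curl \<Omega> (layer_potential A t) \<phi> =
    (LINT x|lebesgue. (\<omega>0 (x $ 3) * \<phi> (hat x)) * weak_curl A x $ 3)
    - (LINT x|lebesgue. (\<omega>1 (x $ 3) * pderiv_at 1 \<phi> (hat x)) * weak_curl A x $ 1)
    - (LINT x|lebesgue. (\<omega>1 (x $ 3) * pderiv_at 2 \<phi> (hat x)) * weak_curl A x $ 2)"
    "integrable lebesgue (\<lambda>x. (\<omega>0 (x $ 3) * \<phi> (hat x)) * weak_curl A x $ 3)"
    "integrable lebesgue (\<lambda>x. (\<omega>1 (x $ 3) * pderiv_at 1 \<phi> (hat x)) * weak_curl A x $ 1)"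
    "integrable lebesgue (\<lambda>x. (\<omega>1 (x $ 3) * pderiv_at 2 \<phi> (hat x)) * weak_curl A x $ 2)"
proof -
  define D where "D i = weak_pderiv UNIV i A" for i
  have \<omega>0: "\<omega>0 \<in> borel_measurable borel" "\<And>s. \<bar>\<omega>0 s\<bar> \<le> 1" "\<And>s. s < t \<or> t + 1 < s \<Longrightarrow> \<omega>0 s = 0"
    by (auto simp: \<omega>0_def indicator_def)
  have \<omega>1: "\<omega>1 \<in> borel_measurable borel" "\<And>s. \<bar>\<omega>1 s\<bar> \<le> 1" "\<And>s. s < t \<or> t + 1 < s \<Longrightarrow> \<omega>1 s = 0"
    by (auto simp: \<omega>1_def indicator_def)
  have \<phi>U: "\<phi> \<in> test_functions UNIV" by (rule test_functions_UNIV[OF \<phi>])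
  have d\<phi>U: "pderiv_at j \<phi> \<in> test_functions UNIV" for j by (rule test_functions_pderiv[OF \<phi>U])
  have sm: "smooth \<phi>" using \<phi> by (simp add: test_functions_def)
  have A2: "A \<in> Lp_loc 2 UNIV" using A by (simp add: H1_loc_def)
  have A1: "A \<in> Lp_loc 1 UNIV" using Lp_loc_1[OF A2] by simp
  have w: "has_weak_pderiv UNIV i A (D i)" for i unfolding D_def by (rule weak_pderiv_H1_loc(1)[OF A])
  have D1: "D i \<in> Lp_loc 1 UNIV" for i using w by (simp add: has_weak_pderiv_def)
  have wk: "has_weak_pderiv UNIV i (\<lambda>x. A x $ k) (\<lambda>x. D i x $ k)" for i k
    by (rule has_weak_pderiv_bounded_linear[OF bounded_linear_vec_nth w])
  have Ak: "(\<lambda>x. A x $ k) \<in> Lp_loc 1 UNIV" and Dk: "(\<lambda>x. D i x $ k) \<in> Lp_loc 1 UNIV" for i k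
    using wk by (auto simp: has_weak_pderiv_def)
  note i0 = slab_weight_integrable[where 'b=real, OF _ _ \<omega>0, unfolded real_scaleR_def] and i1 = slab_weight_integrable[where 'b=real, OF _ _ \<omega>1, unfolded real_scaleR_def]
  note p0 = horizontal_integration_by_parts(1)[OF wk _ _ _ \<omega>0, unfolded real_scaleR_def]
    and p1 = horizontal_integration_by_parts(1)[OF wk _ _ _ \<omega>1, unfolded real_scaleR_def]
  define F where "F x = hat (A x)" for x
  have FH: "F \<in> H1_loc UNIV" and FD: "AE x in lebesgue. weak_pderiv UNIV 3 F x = hat (D 3 x)"
    using H1_loc_hat[OF A] unfolding F_def[abs_def] D_def by auto
  obtain f0 g0 where f0: "f0 \<in> borel_measurable borel" "AE x in lebesgue. f0 x = F x"
    and g0: "g0 \<in> borel_measurable borel" "AE x in lebesgue. g0 x = weak_pderiv UNIV 3 F x"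
    by (rule H1_loc_borel_representatives[OF FH])
  note tr = plane_trace_slab_trace[OF FH f0 g0, of t]
  let ?T = "slab_trace t f0 g0"
  have Tae: "AE y in lebesgue. layer_potential A t y = ?T y"
    using tr(2) unfolding layer_potential_def F_def[abs_def] .
  have Lm [measurable]: "layer_potential A t \<in> borel_measurable lebesgue"
    using tr(1) unfolding layer_potential_def F_def[abs_def] is_plane_trace_def by (blast intro: Lp_loc_measurable)
  have Tm [measurable]: "?T \<in> borel_measurable borel" by (rule slab_trace_measurable[OF f0(1) g0(1)])
  have Tml [measurable]: "?T \<in> borel_measurable lebesgue" by (rule borel_measurable_lebesgueI[OF Tm])
  define K where "K = closure {x. \<phi> x \<noteq> 0}"
  have K: "compact K" "K \<subseteq> \<Omega>" using \<phi> by (auto simp: test_functions_def K_def)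
  have z: "pderiv_at j \<phi> y = 0" if "y \<notin> K" for j y
    using pderiv_at_zero_outside_support[of y \<phi>] that unfolding K_def by auto
  have dm [measurable]: "pderiv_at j \<phi> \<in> borel_measurable borel" for j by (rule test_function_facts(1)[OF d\<phi>U])
  have dml [measurable]: "pderiv_at j \<phi> \<in> borel_measurable lebesgue" for j by (rule borel_measurable_lebesgueI[OF dm])
  have cs [measurable]: "slab t K \<in> sets lebesgue" "slab t K \<in> sets borel"
    using lmeasurable_compact[OF compact_slab[OF K(1)]] compact_imp_closed[OF compact_slab[OF K(1)]]
    by (simp_all add: fmeasurableD)
  have F1: "F \<in> Lp_loc 1 UNIV" using FH Lp_loc_1[of F 2 UNIV] by (simp add: H1_loc_def)
  have G1: "weak_pderiv UNIV 3 F \<in> Lp_loc 1 UNIV" using weak_pderiv_H1_loc(1)[OF FH] by (simp add: has_weak_pderiv_def)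
  have fi: "integrable lborel (\<lambda>x. indicator (slab t K) x *\<^sub>R f0 x)"
  proof -
    have "integrable lebesgue (\<lambda>x. indicator (slab t K) x *\<^sub>R f0 x)"
      by (rule integrable_cong_AE_imp[OF Lp_loc_1_integrable[OF F1 compact_slab[OF K(1)] subset_UNIV]])
         (use borel_measurable_lebesgueI[OF f0(1)] cs f0(2) in \<open>auto elim!: eventually_mono\<close>)
    then show ?thesis using f0(1) cs(2) by (subst (asm) integrable_completion) auto
  qed
  have gi: "integrable lborel (\<lambda>x. indicator (slab t K) x *\<^sub>R g0 x)"
  proof -
    have "integrable lebesgue (\<lambda>x. indicator (slab t K) x *\<^sub>R g0 x)"
      by (rule integrable_cong_AE_imp[OF Lp_loc_1_integrable[OF G1 compact_slab[OF K(1)] subset_UNIV]])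
         (use borel_measurable_lebesgueI[OF g0(1)] cs g0(2) in \<open>auto elim!: eventually_mono\<close>)
    then show ?thesis using g0(1) cs(2) by (subst (asm) integrable_completion) auto
  qed
  have pair: "(LINT y|lborel. pderiv_at j \<phi> y * (?T y \<bullet> b)) =
      (LINT x|lebesgue. (\<omega>0 (x $ 3) * pderiv_at j \<phi> (hat x)) * (A x $ k)) - (LINT x|lebesgue. (\<omega>1 (x $ 3) * pderiv_at j \<phi> (hat x)) * (D 3 x $ k))"
    "integrable lborel (\<lambda>y. pderiv_at j \<phi> y * (?T y \<bullet> b))"
    if b: "\<And>v. hat v \<bullet> b = v $ k" for j b k
  proof -
    obtain B where B: "\<And>y. \<bar>pderiv_at j \<phi> y\<bar> \<le> B" using test_function_facts(2)[OF d\<phi>U] by blast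
    note P = slab_trace_pairing[OF f0(1) g0(1) dm[of j] K(1) z B fi gi, of b]
    show "integrable lborel (\<lambda>y. pderiv_at j \<phi> y * (?T y \<bullet> b))" by (rule P(2))
    note [measurable] = f0(1) g0(1) dm[of j]
    have "(LINT y|lborel. pderiv_at j \<phi> y * (?T y \<bullet> b)) =
       (LINT x|lborel. indicator {t..t+1} (x $ 3) * pderiv_at j \<phi> (hat x) * ((f0 x - (1 - (x $ 3 - t)) *\<^sub>R g0 x) \<bullet> b))" by (rule P(1))
    also have "\<dots> = (LINT x|lebesgue. indicator {t..t+1} (x $ 3) * pderiv_at j \<phi> (hat x) * ((f0 x - (1 - (x $ 3 - t)) *\<^sub>R g0 x) \<bullet> b))"
      by (rule integral_completion[symmetric]) measurable
    also have "\<dots> = (LINT x|lebesgue. (\<omega>0 (x $ 3) * pderiv_at j \<phi> (hat x)) * (A x $ k) - (\<omega>1 (x $ 3) * pderiv_at j \<phi> (hat x)) * (D 3 x $ k))"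
    proof (rule integral_cong_AE)
      show "(\<lambda>x. indicator {t..t+1} (x $ 3) * pderiv_at j \<phi> (hat x) * ((f0 x - (1 - (x $ 3 - t)) *\<^sub>R g0 x) \<bullet> b)) \<in> borel_measurable lebesgue"
        by (rule borel_measurable_lebesgueI) measurable
      show "(\<lambda>x. (\<omega>0 (x $ 3) * pderiv_at j \<phi> (hat x)) * (A x $ k) - (\<omega>1 (x $ 3) * pderiv_at j \<phi> (hat x)) * (D 3 x $ k)) \<in> borel_measurable lebesgue"
        by (intro borel_measurable_diff borel_measurable_integrable[OF i0[OF Ak d\<phi>U]] borel_measurable_integrable[OF i1[OF Dk d\<phi>U]])
      show "AE x in lebesgue. indicator {t..t+1} (x $ 3) * pderiv_at j \<phi> (hat x) * ((f0 x - (1 - (x $ 3 - t)) *\<^sub>R g0 x) \<bullet> b)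
          = (\<omega>0 (x $ 3) * pderiv_at j \<phi> (hat x)) * (A x $ k) - (\<omega>1 (x $ 3) * pderiv_at j \<phi> (hat x)) * (D 3 x $ k)"
        using f0(2) g0(2) FD
      proof eventually_elim
        case (elim x)
        have "f0 x \<bullet> b = A x $ k" "g0 x \<bullet> b = D 3 x $ k" using elim b by (auto simp: F_def)
        then show ?case by (simp add: \<omega>0_def \<omega>1_def inner_diff_left algebra_simps)
      qed
    qed
    also have "\<dots> = (LINT x|lebesgue. (\<omega>0 (x $ 3) * pderiv_at j \<phi> (hat x)) * (A x $ k)) - (LINT x|lebesgue. (\<omega>1 (x $ 3) * pderiv_at j \<phi> (hat x)) * (D 3 x $ k))"
      by (rule Bochner_Integration.integral_diff[OF i0[OF Ak d\<phi>U] i1[OF Dk d\<phi>U]])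
    finally show "(LINT y|lborel. pderiv_at j \<phi> y * (?T y \<bullet> b)) =
      (LINT x|lebesgue. (\<omega>0 (x $ 3) * pderiv_at j \<phi> (hat x)) * (A x $ k)) - (LINT x|lebesgue. (\<omega>1 (x $ 3) * pderiv_at j \<phi> (hat x)) * (D 3 x $ k))" .
  qed
  have b1: "hat v \<bullet> axis 1 1 = v $ 1" and b2: "hat v \<bullet> axis 2 1 = v $ 2" for v by (simp_all add: inner_axis)
  have "dist_curl \<Omega> (layer_potential A t) \<phi> = - (LINT y|lebesgue. layer_potential A t y $ 2 * pderiv_at 1 \<phi> y - layer_potential A t y $ 1 * pderiv_at 2 \<phi> y)"
  proof -
    have "pderiv_at j \<phi> y = 0" if "y \<notin> \<Omega>" for j y using z[of y j] K(2) that by blast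
    then show ?thesis unfolding dist_curl_def by (subst set_integral_supported) simp_all
  qed
  also have "(LINT y|lebesgue. layer_potential A t y $ 2 * pderiv_at 1 \<phi> y - layer_potential A t y $ 1 * pderiv_at 2 \<phi> y)
     = (LINT y|lebesgue. pderiv_at 1 \<phi> y * (?T y \<bullet> axis 2 1) - pderiv_at 2 \<phi> y * (?T y \<bullet> axis 1 1))"
  proof (rule integral_cong_AE)
    show "(\<lambda>y. layer_potential A t y $ 2 * pderiv_at 1 \<phi> y - layer_potential A t y $ 1 * pderiv_at 2 \<phi> y) \<in> borel_measurable lebesgue" by measurable
    show "(\<lambda>y. pderiv_at 1 \<phi> y * (?T y \<bullet> axis 2 1) - pderiv_at 2 \<phi> y * (?T y \<bullet> axis 1 1)) \<in> borel_measurable lebesgue" by measurable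
    show "AE y in lebesgue. layer_potential A t y $ 2 * pderiv_at 1 \<phi> y - layer_potential A t y $ 1 * pderiv_at 2 \<phi> y
       = pderiv_at 1 \<phi> y * (?T y \<bullet> axis 2 1) - pderiv_at 2 \<phi> y * (?T y \<bullet> axis 1 1)"
      using Tae by eventually_elim (simp add: inner_axis mult.commute)
  qed
  also have "\<dots> = (LINT y|lborel. pderiv_at 1 \<phi> y * (?T y \<bullet> axis 2 1) - pderiv_at 2 \<phi> y * (?T y \<bullet> axis 1 1))"
    by (rule integral_completion) measurable
  also have "\<dots> = (LINT y|lborel. pderiv_at 1 \<phi> y * (?T y \<bullet> axis 2 1)) - (LINT y|lborel. pderiv_at 2 \<phi> y * (?T y \<bullet> axis 1 1))"
    by (rule Bochner_Integration.integral_diff[OF pair(2)[OF b2] pair(2)[OF b1]])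
  finally have dc: "dist_curl \<Omega> (layer_potential A t) \<phi> =
     - ((LINT x|lebesgue. (\<omega>0 (x $ 3) * pderiv_at 1 \<phi> (hat x)) * (A x $ 2)) - (LINT x|lebesgue. (\<omega>1 (x $ 3) * pderiv_at 1 \<phi> (hat x)) * (D 3 x $ 2))
      - ((LINT x|lebesgue. (\<omega>0 (x $ 3) * pderiv_at 2 \<phi> (hat x)) * (A x $ 1)) - (LINT x|lebesgue. (\<omega>1 (x $ 3) * pderiv_at 2 \<phi> (hat x)) * (D 3 x $ 1))))"
    unfolding pair(1)[OF b2] pair(1)[OF b1] .
  have e1: "(LINT x|lebesgue. (\<omega>0 (x $ 3) * pderiv_at 1 \<phi> (hat x)) * (A x $ 2)) = - (LINT x|lebesgue. (\<omega>0 (x $ 3) * \<phi> (hat x)) * (D 1 x $ 2))"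
    by (rule p0[OF hat_axis(1) hat_axis(3) \<phi>U])
  have e2: "(LINT x|lebesgue. (\<omega>0 (x $ 3) * pderiv_at 2 \<phi> (hat x)) * (A x $ 1)) = - (LINT x|lebesgue. (\<omega>0 (x $ 3) * \<phi> (hat x)) * (D 2 x $ 1))"
    by (rule p0[OF hat_axis(2) hat_axis(4) \<phi>U])
  have e3: "(LINT x|lebesgue. (\<omega>1 (x $ 3) * pderiv_at 2 (pderiv_at 1 \<phi>) (hat x)) * (A x $ 3)) = - (LINT x|lebesgue. (\<omega>1 (x $ 3) * pderiv_at 1 \<phi> (hat x)) * (D 2 x $ 3))"
    by (rule p1[OF hat_axis(2) hat_axis(4) d\<phi>U])
  have e4: "(LINT x|lebesgue. (\<omega>1 (x $ 3) * pderiv_at 1 (pderiv_at 2 \<phi>) (hat x)) * (A x $ 3)) = - (LINT x|lebesgue. (\<omega>1 (x $ 3) * pderiv_at 2 \<phi> (hat x)) * (D 1 x $ 3))"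
    by (rule p1[OF hat_axis(1) hat_axis(3) d\<phi>U])
  \<comment> \<open>Both sides are, up to sign, integrals of \<open>A x $ 3\<close> against a mixed
    second derivative of \<phi>; the symmetry of the latter makes the added terms cancel.\<close>
  have e5: "(LINT x|lebesgue. (\<omega>1 (x $ 3) * pderiv_at 1 \<phi> (hat x)) * (D 2 x $ 3)) = (LINT x|lebesgue. (\<omega>1 (x $ 3) * pderiv_at 2 \<phi> (hat x)) * (D 1 x $ 3))"
    using e3 e4 unfolding pderiv_at_commute[OF sm, of 2 1] by simp
  have c1: "weak_curl A x $ 1 = D 2 x $ 3 - D 3 x $ 2" and c2: "weak_curl A x $ 2 = D 3 x $ 1 - D 1 x $ 3"
    and c3: "weak_curl A x $ 3 = D 1 x $ 2 - D 2 x $ 1" for x by (simp_all add: weak_curl_def D_def)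
  note j3 = i0[OF Dk[of 1 2] \<phi>U] i0[OF Dk[of 2 1] \<phi>U]
  note j1 = i1[OF Dk[of 2 3] d\<phi>U[of 1]] i1[OF Dk[of 3 2] d\<phi>U[of 1]]
  note j2 = i1[OF Dk[of 3 1] d\<phi>U[of 2]] i1[OF Dk[of 1 3] d\<phi>U[of 2]]
  show "integrable lebesgue (\<lambda>x. (\<omega>0 (x $ 3) * \<phi> (hat x)) * weak_curl A x $ 3)"
    unfolding c3 right_diff_distrib by (intro Bochner_Integration.integrable_diff j3)
  show "integrable lebesgue (\<lambda>x. (\<omega>1 (x $ 3) * pderiv_at 1 \<phi> (hat x)) * weak_curl A x $ 1)"
    unfolding c1 right_diff_distrib by (intro Bochner_Integration.integrable_diff j1)
  show "integrable lebesgue (\<lambda>x. (\<omega>1 (x $ 3) * pderiv_at 2 \<phi> (hat x)) * weak_curl A x $ 2)"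
    unfolding c2 right_diff_distrib by (intro Bochner_Integration.integrable_diff j2)
  have s3: "(LINT x|lebesgue. (\<omega>0 (x $ 3) * \<phi> (hat x)) * weak_curl A x $ 3)
      = (LINT x|lebesgue. (\<omega>0 (x $ 3) * \<phi> (hat x)) * (D 1 x $ 2)) - (LINT x|lebesgue. (\<omega>0 (x $ 3) * \<phi> (hat x)) * (D 2 x $ 1))"
    unfolding c3 right_diff_distrib by (rule Bochner_Integration.integral_diff[OF j3])
  have s1: "(LINT x|lebesgue. (\<omega>1 (x $ 3) * pderiv_at 1 \<phi> (hat x)) * weak_curl A x $ 1)
      = (LINT x|lebesgue. (\<omega>1 (x $ 3) * pderiv_at 1 \<phi> (hat x)) * (D 2 x $ 3)) - (LINT x|lebesgue. (\<omega>1 (x $ 3) * pderiv_at 1 \<phi> (hat x)) * (D 3 x $ 2))"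
    unfolding c1 right_diff_distrib by (rule Bochner_Integration.integral_diff[OF j1])
  have s2: "(LINT x|lebesgue. (\<omega>1 (x $ 3) * pderiv_at 2 \<phi> (hat x)) * weak_curl A x $ 2)
      = (LINT x|lebesgue. (\<omega>1 (x $ 3) * pderiv_at 2 \<phi> (hat x)) * (D 3 x $ 1)) - (LINT x|lebesgue. (\<omega>1 (x $ 3) * pderiv_at 2 \<phi> (hat x)) * (D 1 x $ 3))"
    unfolding c2 right_diff_distrib by (rule Bochner_Integration.integral_diff[OF j2])
  show "dist_curl \<Omega> (layer_potential A t) \<phi> =
    (LINT x|lebesgue. (\<omega>0 (x $ 3) * \<phi> (hat x)) * weak_curl A x $ 3)
    - (LINT x|lebesgue. (\<omega>1 (x $ 3) * pderiv_at 1 \<phi> (hat x)) * weak_curl A x $ 1)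
    - (LINT x|lebesgue. (\<omega>1 (x $ 3) * pderiv_at 2 \<phi> (hat x)) * weak_curl A x $ 2)"
    using dc e1 e2 e5 s1 s2 s3 by linarith
qed

lemma H1_norm_test_function:
  fixes \<phi> :: "real^2 \<Rightarrow> real"
  assumes \<phi>: "\<phi> \<in> test_functions \<Omega>"
  shows "(\<integral>\<^sup>+y. ennreal ((\<phi> y)\<^sup>2 + (pderiv_at 1 \<phi> y)\<^sup>2 + (pderiv_at 2 \<phi> y)\<^sup>2) \<partial>lborel) = ennreal ((H1_norm \<Omega> \<phi>)\<^sup>2)"
proof -
  let ?h = "\<lambda>y. (\<phi> y)\<^sup>2 + (pderiv_at 1 \<phi> y)\<^sup>2 + (pderiv_at 2 \<phi> y)\<^sup>2"
  have c: "continuous_on UNIV \<phi>" "continuous_on UNIV (pderiv_at i \<phi>)" for i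
    by (rule test_function_facts(3)[OF \<phi>], rule test_function_facts(3)[OF test_functions_pderiv[OF \<phi>]])
  have hc: "continuous_on UNIV ?h" by (intro continuous_intros c)
  have z: "\<phi> y = 0" "pderiv_at i \<phi> y = 0" if "y \<notin> \<Omega>" for y i
    using that by (rule test_function_facts(4)[OF \<phi>], rule test_function_facts(4)[OF test_functions_pderiv[OF \<phi>]])
  obtain r where r: "\<And>x. r < norm x \<Longrightarrow> \<phi> x = 0" using test_functions_zero_outside[OF \<phi>] by blast
  have rz: "pderiv_at i \<phi> x = 0" if "r < norm x" for x i using pderiv_at_zero_outside[of r \<phi>, OF r that] .
  have hi: "integrable lborel ?h" by (rule integrable_continuous_zero_outside[OF hc, of r]) (simp add: r rz)
  have "(\<integral>\<^sup>+y. ennreal (?h y) \<partial>lborel) = ennreal (LINT y|lborel. ?h y)"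
    by (rule nn_integral_eq_integral[OF hi]) simp
  also have "(LINT y|lborel. ?h y) = (LINT y|lebesgue. ?h y)"
    by (rule integral_completion[symmetric]) (use borel_measurable_continuous_onI[OF hc] in simp)
  also have "\<dots> = (LINT y:\<Omega>|lebesgue. ?h y)" using z by (intro set_integral_supported[symmetric]) simp
  also have "\<dots> = (H1_norm \<Omega> \<phi>)\<^sup>2"
  proof -
    have "0 \<le> (LINT y:\<Omega>|lebesgue. ?h y)" unfolding set_lebesgue_integral_def by (intro integral_nonneg_AE) auto
    then show ?thesis unfolding H1_norm_def by (simp add: sum_2 add.assoc)
  qed
  finally show ?thesis .
qed

text \<open>Subtracting the constant \<open>h\<close> replaces \<open>weak_curl A\<close> by its
  deviation from \<open>h *\<^sub>R e3\<close>, and Young's inequality is applied componentwise.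
  Since the slab has thickness one, the weighted square of \<phi> and its gradient integrates to the
  planar norm; the bound therefore depends neither on \<open>t\<close> nor on the number of
  layers.\<close>

lemma dist_curl_layer_potential_bound:
  fixes A :: "real^3 \<Rightarrow> real^3" and \<phi> :: "real^2 \<Rightarrow> real"
  assumes A: "A \<in> H1_loc UNIV" and \<phi>: "\<phi> \<in> test_functions \<Omega>" and k: "\<kappa> > 0"
  shows "ennreal \<bar>dist_curl \<Omega> (layer_potential A t) \<phi> - h * (LINT y:\<Omega>|lebesgue. \<phi> y)\<bar>
     \<le> ennreal (\<kappa> / 2) * (\<integral>\<^sup>+x. ennreal ((norm (weak_curl A x - h *\<^sub>R e3))\<^sup>2) \<partial>lebesgue) + ennreal (1 / (2 * \<kappa>)) * ennreal ((H1_norm \<Omega> \<phi>)\<^sup>2)"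
proof -
  define \<omega>0 where "\<omega>0 r = (indicator {t..t+1} r :: real)" for r
  define \<omega>1 where "\<omega>1 r = (indicator {t..t+1} r * (1 - (r - t)) :: real)" for r
  define q where "q x = weak_curl A x - h *\<^sub>R e3" for x
  note dc = dist_curl_layer_potential[OF A \<phi>, of t, folded \<omega>0_def \<omega>1_def]
  let ?a = "\<lambda>x. \<phi> (hat x)" and ?b = "\<lambda>x. pderiv_at 1 \<phi> (hat x)" and ?c = "\<lambda>x. pderiv_at 2 \<phi> (hat x)"
  have q: "q x $ 1 = weak_curl A x $ 1" "q x $ 2 = weak_curl A x $ 2" "q x $ 3 = weak_curl A x $ 3 - h" for x
    by (simp_all add: q_def e3_def axis_def)
  have d\<phi>: "pderiv_at j \<phi> \<in> test_functions \<Omega>" for j by (rule test_functions_pderiv[OF \<phi>])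
  have [measurable]: "\<phi> \<in> borel_measurable borel" "pderiv_at j \<phi> \<in> borel_measurable borel" for j
    by (rule test_function_facts(1)[OF \<phi>], rule test_function_facts(1)[OF d\<phi>])
  have [measurable]: "\<omega>0 \<in> borel_measurable borel" "\<omega>1 \<in> borel_measurable borel" unfolding \<omega>0_def[abs_def] \<omega>1_def[abs_def] by measurable
  have \<phi>i: "integrable lborel \<phi>" by (rule test_function_facts(5)[OF \<phi>])
  have z: "\<phi> y = 0" if "y \<notin> \<Omega>" for y by (rule test_function_facts(4)[OF \<phi> that])
  \<comment> \<open>The weight \<open>\<omega>0\<close> has mass one in the vertical direction, so
    the constant field \<open>h *\<^sub>R e3\<close> contributes exactly \<open>h\<close> times the
    integral of \<phi>.\<close>
  have mi: "integrable lborel (\<lambda>x. \<omega>0 (x $ 3) * ?a x)" and mv: "(LINT x|lborel. \<omega>0 (x $ 3) * ?a x) = (LINT y|lborel. \<phi> y)"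
  proof -
    have "integrable lebesgue (\<lambda>x::real^3. (\<omega>0 (x $ 3) * \<phi> (hat x)) *\<^sub>R (1::real))"
      by (rule slab_weight_integrable[where t=t])
         (auto simp: \<omega>0_def indicator_def intro!: Lp_loc_continuous test_functions_UNIV[OF \<phi>])
    then show i: "integrable lborel (\<lambda>x. \<omega>0 (x $ 3) * ?a x)" by (simp add: integrable_completion)
    have "(LINT x|lborel. \<omega>0 (x $ 3) * ?a x) = (LINT y|lborel. (LINT s|lborel. \<omega>0 (at_height y (t + s) $ 3) * \<phi> (hat (at_height y (t + s)))))"
      by (rule integral_at_height[OF i])
    also have "\<dots> = (LINT y|lborel. \<phi> y)"
    proof (rule Bochner_Integration.integral_cong[OF refl])
      fix y
      have "(LINT s|lborel. \<omega>0 (at_height y (t + s) $ 3) * \<phi> (hat (at_height y (t + s)))) = (LINT s|lborel. indicator {0..1::real} s * \<phi> y)"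
        by (intro Bochner_Integration.integral_cong) (auto simp: \<omega>0_def indicator_def)
      then show "(LINT s|lborel. \<omega>0 (at_height y (t + s) $ 3) * \<phi> (hat (at_height y (t + s)))) = \<phi> y" by simp
    qed
    finally show "(LINT x|lborel. \<omega>0 (x $ 3) * ?a x) = (LINT y|lborel. \<phi> y)" .
  qed
  have mil: "integrable lebesgue (\<lambda>x. \<omega>0 (x $ 3) * ?a x)" using mi by (simp add: integrable_completion)
  have "h * (LINT y:\<Omega>|lebesgue. \<phi> y) = h * (LINT y|lebesgue. \<phi> y)" using z by (subst set_integral_supported) auto
  also have "\<dots> = h * (LINT y|lborel. \<phi> y)" by (subst integral_completion) auto
  also have "\<dots> = (LINT x|lebesgue. (\<omega>0 (x $ 3) * ?a x) * h)"
    using mv mil by (simp add: integral_completion mult.commute)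
  finally have "dist_curl \<Omega> (layer_potential A t) \<phi> - h * (LINT y:\<Omega>|lebesgue. \<phi> y) =
      (LINT x|lebesgue. (\<omega>0 (x $ 3) * ?a x) * weak_curl A x $ 3 - (\<omega>0 (x $ 3) * ?a x) * h - (\<omega>1 (x $ 3) * ?b x) * weak_curl A x $ 1 - (\<omega>1 (x $ 3) * ?c x) * weak_curl A x $ 2)"
    unfolding dc(1) using dc(2-4) mil by simp
  also have "\<dots> = (LINT x|lebesgue. \<omega>0 (x $ 3) * (?a x * q x $ 3 - (1 - (x $ 3 - t)) * (?b x * q x $ 1 + ?c x * q x $ 2)))"
    by (rule Bochner_Integration.integral_cong) (auto simp: q \<omega>0_def \<omega>1_def algebra_simps)
  finally have eq: "dist_curl \<Omega> (layer_potential A t) \<phi> - h * (LINT y:\<Omega>|lebesgue. \<phi> y) = (LINT x|lebesgue. \<omega>0 (x $ 3) * (?a x * q x $ 3 - (1 - (x $ 3 - t)) * (?b x * q x $ 1 + ?c x * q x $ 2)))"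
    (is "_ = (LINT x|_. ?G x)") .
  have pw: "ennreal \<bar>?G x\<bar> \<le> ennreal (\<kappa> / 2) * ennreal ((norm (q x))\<^sup>2) + ennreal (1 / (2 * \<kappa>)) * (ennreal (\<omega>0 (x $ 3) * ((?a x)\<^sup>2 + (?b x)\<^sup>2 + (?c x)\<^sup>2)))" for x
  proof (cases "x $ 3 \<in> {t..t+1}")
    case True
    have s: "\<bar>1 - (x $ 3 - t)\<bar> \<le> 1" using True by auto
    have "\<bar>?a x * q x $ 3 - (1 - (x $ 3 - t)) * (?b x * q x $ 1 + ?c x * q x $ 2)\<bar>
       \<le> \<bar>?a x * q x $ 3\<bar> + \<bar>1 - (x $ 3 - t)\<bar> * \<bar>?b x * q x $ 1 + ?c x * q x $ 2\<bar>"
      by (rule order_trans[OF abs_triangle_ineq4]) (simp add: abs_mult)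
    also have "\<dots> \<le> \<bar>?a x * q x $ 3\<bar> + 1 * (\<bar>?b x * q x $ 1\<bar> + \<bar>?c x * q x $ 2\<bar>)"
      by (intro add_mono mult_mono s) auto
    also have "\<dots> \<le> (\<kappa> / 2 * (q x $ 3)\<^sup>2 + 1 / (2 * \<kappa>) * (?a x)\<^sup>2) + 1 * ((\<kappa> / 2 * (q x $ 1)\<^sup>2 + 1 / (2 * \<kappa>) * (?b x)\<^sup>2) + (\<kappa> / 2 * (q x $ 2)\<^sup>2 + 1 / (2 * \<kappa>) * (?c x)\<^sup>2))"
      by (intro add_mono mult_left_mono weighted_young k) auto
    also have "\<dots> = \<kappa> / 2 * ((q x $ 1)\<^sup>2 + (q x $ 2)\<^sup>2 + (q x $ 3)\<^sup>2) + 1 / (2 * \<kappa>) * ((?a x)\<^sup>2 + (?b x)\<^sup>2 + (?c x)\<^sup>2)"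
      by (simp add: algebra_simps)
    also have "(q x $ 1)\<^sup>2 + (q x $ 2)\<^sup>2 + (q x $ 3)\<^sup>2 = (norm (q x))\<^sup>2"
      unfolding norm_vec_def L2_set_def sum_3 by (simp add: sum_nonneg)
    finally have "\<bar>?G x\<bar> \<le> \<kappa> / 2 * (norm (q x))\<^sup>2 + 1 / (2 * \<kappa>) * ((?a x)\<^sup>2 + (?b x)\<^sup>2 + (?c x)\<^sup>2)"
      using True by (simp add: \<omega>0_def)
    then have "ennreal \<bar>?G x\<bar> \<le> ennreal (\<kappa> / 2 * (norm (q x))\<^sup>2 + 1 / (2 * \<kappa>) * ((?a x)\<^sup>2 + (?b x)\<^sup>2 + (?c x)\<^sup>2))" by (rule ennreal_leI)
    also have "\<dots> = ennreal (\<kappa> / 2 * (norm (q x))\<^sup>2) + ennreal (1 / (2 * \<kappa>) * ((?a x)\<^sup>2 + (?b x)\<^sup>2 + (?c x)\<^sup>2))"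
      using k by (intro ennreal_plus) auto
    also have "ennreal (\<kappa> / 2 * (norm (q x))\<^sup>2) = ennreal (\<kappa> / 2) * ennreal ((norm (q x))\<^sup>2)" using k by (intro ennreal_mult) auto
    also have "ennreal (1 / (2 * \<kappa>) * ((?a x)\<^sup>2 + (?b x)\<^sup>2 + (?c x)\<^sup>2)) = ennreal (1 / (2 * \<kappa>)) * ennreal ((?a x)\<^sup>2 + (?b x)\<^sup>2 + (?c x)\<^sup>2)" using k by (intro ennreal_mult) auto
    finally show ?thesis using True by (simp add: \<omega>0_def)
  qed (simp add: \<omega>0_def)
  have [measurable]: "weak_curl A \<in> borel_measurable lebesgue" by (rule weak_curl_measurable[OF A])
  have qm [measurable]: "q \<in> borel_measurable lebesgue" unfolding q_def[abs_def] by measurable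
  have Wm: "(\<lambda>x. ennreal (\<omega>0 (x $ 3) * ((?a x)\<^sup>2 + (?b x)\<^sup>2 + (?c x)\<^sup>2))) \<in> borel_measurable borel" by measurable
  have Wml [measurable]: "(\<lambda>x. ennreal (\<omega>0 (x $ 3) * ((?a x)\<^sup>2 + (?b x)\<^sup>2 + (?c x)\<^sup>2))) \<in> borel_measurable lebesgue"
    by (rule borel_measurable_lebesgueI[OF Wm])
  have W: "(\<integral>\<^sup>+x. ennreal (\<omega>0 (x $ 3) * ((?a x)\<^sup>2 + (?b x)\<^sup>2 + (?c x)\<^sup>2)) \<partial>lebesgue) = ennreal ((H1_norm \<Omega> \<phi>)\<^sup>2)"
  proof -
    have "(\<integral>\<^sup>+x. ennreal (\<omega>0 (x $ 3) * ((?a x)\<^sup>2 + (?b x)\<^sup>2 + (?c x)\<^sup>2)) \<partial>lebesgue) = (\<integral>\<^sup>+x. ennreal (\<omega>0 (x $ 3) * ((?a x)\<^sup>2 + (?b x)\<^sup>2 + (?c x)\<^sup>2)) \<partial>lborel)"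
      by (rule nn_integral_completion)
    also have "\<dots> = (\<integral>\<^sup>+y. (\<integral>\<^sup>+s. ennreal (\<omega>0 (at_height y (t + s) $ 3) * ((?a (at_height y (t + s)))\<^sup>2 + (?b (at_height y (t + s)))\<^sup>2 + (?c (at_height y (t + s)))\<^sup>2)) \<partial>lborel) \<partial>lborel)"
      by (rule nn_integral_at_height[OF Wm])
    also have "\<dots> = (\<integral>\<^sup>+y. ennreal ((\<phi> y)\<^sup>2 + (pderiv_at 1 \<phi> y)\<^sup>2 + (pderiv_at 2 \<phi> y)\<^sup>2) \<partial>lborel)"
    proof (rule nn_integral_cong)
      fix y
      have "(\<integral>\<^sup>+s. ennreal (\<omega>0 (at_height y (t + s) $ 3) * ((?a (at_height y (t + s)))\<^sup>2 + (?b (at_height y (t + s)))\<^sup>2 + (?c (at_height y (t + s)))\<^sup>2)) \<partial>lborel)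
        = (\<integral>\<^sup>+s. ennreal ((\<phi> y)\<^sup>2 + (pderiv_at 1 \<phi> y)\<^sup>2 + (pderiv_at 2 \<phi> y)\<^sup>2) * indicator {0..1::real} s \<partial>lborel)"
        by (intro nn_integral_cong) (auto simp: \<omega>0_def indicator_def)
      also have "\<dots> = ennreal ((\<phi> y)\<^sup>2 + (pderiv_at 1 \<phi> y)\<^sup>2 + (pderiv_at 2 \<phi> y)\<^sup>2)"
        by (subst nn_integral_cmult_indicator) auto
      finally show "(\<integral>\<^sup>+s. ennreal (\<omega>0 (at_height y (t + s) $ 3) * ((?a (at_height y (t + s)))\<^sup>2 + (?b (at_height y (t + s)))\<^sup>2 + (?c (at_height y (t + s)))\<^sup>2)) \<partial>lborel)
        = ennreal ((\<phi> y)\<^sup>2 + (pderiv_at 1 \<phi> y)\<^sup>2 + (pderiv_at 2 \<phi> y)\<^sup>2)" .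
    qed
    also have "\<dots> = ennreal ((H1_norm \<Omega> \<phi>)\<^sup>2)" by (rule H1_norm_test_function[OF \<phi>])
    finally show ?thesis .
  qed
  have "ennreal \<bar>dist_curl \<Omega> (layer_potential A t) \<phi> - h * (LINT y:\<Omega>|lebesgue. \<phi> y)\<bar> \<le> (\<integral>\<^sup>+x. ennreal \<bar>?G x\<bar> \<partial>lebesgue)"
  proof (cases "integrable lebesgue ?G")
    case True
    show ?thesis unfolding eq using integral_norm_bound_ennreal[OF True] by simp
  next
    case False
    then show ?thesis unfolding eq by (simp add: not_integrable_integral_eq)
  qed
  also have "\<dots> \<le> (\<integral>\<^sup>+x. ennreal (\<kappa> / 2) * ennreal ((norm (q x))\<^sup>2) + ennreal (1 / (2 * \<kappa>)) * (ennreal (\<omega>0 (x $ 3) * ((?a x)\<^sup>2 + (?b x)\<^sup>2 + (?c x)\<^sup>2))) \<partial>lebesgue)"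
    by (intro nn_integral_mono pw)
  also have "\<dots> = (\<integral>\<^sup>+x. ennreal (\<kappa> / 2) * ennreal ((norm (q x))\<^sup>2) \<partial>lebesgue) + (\<integral>\<^sup>+x. ennreal (1 / (2 * \<kappa>)) * (ennreal (\<omega>0 (x $ 3) * ((?a x)\<^sup>2 + (?b x)\<^sup>2 + (?c x)\<^sup>2))) \<partial>lebesgue)"
    by (rule nn_integral_add) measurable
  also have "(\<integral>\<^sup>+x. ennreal (\<kappa> / 2) * ennreal ((norm (q x))\<^sup>2) \<partial>lebesgue) = ennreal (\<kappa> / 2) * (\<integral>\<^sup>+x. ennreal ((norm (q x))\<^sup>2) \<partial>lebesgue)"
    by (rule nn_integral_cmult) measurable
  also have "(\<integral>\<^sup>+x. ennreal (1 / (2 * \<kappa>)) * (ennreal (\<omega>0 (x $ 3) * ((?a x)\<^sup>2 + (?b x)\<^sup>2 + (?c x)\<^sup>2))) \<partial>lebesgue) = ennreal (1 / (2 * \<kappa>)) * ennreal ((H1_norm \<Omega> \<phi>)\<^sup>2)"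
    by (subst nn_integral_cmult) (measurable, simp add: W)
  finally show ?thesis by (simp add: q_def)
qed

section \<open>A periodic vortex lattice\<close>

text \<open>Near \<open>x\<close> each value of \<open>f\<close> is a value of \<open>f1\<close> or
  of \<open>f2\<close>, and both satisfy the same first order estimate at \<open>x\<close>. The
  lemma serves the strip edges of the lattice and the unit sphere of the truncation.\<close>

lemma has_derivative_glue:
  fixes f :: "'a::real_normed_vector \<Rightarrow> 'b::real_normed_vector"
  assumes 1: "(f1 has_derivative D) (at x)" and 2: "(f2 has_derivative D) (at x)" and x: "f1 x = f x" "f2 x = f x"
    and ev: "d0 > 0" "\<And>z. norm (z - x) < d0 \<Longrightarrow> f z = f1 z \<or> f z = f2 z"
  shows "(f has_derivative D) (at x)"
  unfolding has_derivative_at_alt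
proof (intro conjI allI impI)
  show "bounded_linear D" using 1 by (rule has_derivative_bounded_linear)
  fix e :: real assume "e > 0"
  then obtain d1 d2 where d: "d1 > 0" "\<And>y. norm (y - x) < d1 \<Longrightarrow> norm (f1 y - f1 x - D (y - x)) \<le> e * norm (y - x)"
    "d2 > 0" "\<And>y. norm (y - x) < d2 \<Longrightarrow> norm (f2 y - f2 x - D (y - x)) \<le> e * norm (y - x)"
    using 1 2 unfolding has_derivative_at_alt by metis
  show "\<exists>d>0. \<forall>y. norm (y - x) < d \<longrightarrow> norm (f y - f x - D (y - x)) \<le> e * norm (y - x)"
  proof (intro exI[of _ "min d0 (min d1 d2)"] conjI allI impI)
    fix y assume y: "norm (y - x) < min d0 (min d1 d2)"
    then have "f y = f1 y \<or> f y = f2 y" by (intro ev(2)) simp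
    then show "norm (f y - f x - D (y - x)) \<le> e * norm (y - x)"
      using d(2)[of y] d(4)[of y] x y by auto
  qed (use d ev in simp)
qed

text \<open>A crude Jordan inequality: up to \<open>pi / 3\<close> the mean value theorem applies
  with \<open>cos \<ge> 1 / 2\<close>; beyond that the sine is at least \<open>1 / 2\<close>, while
  \<open>pi < 4\<close> bounds \<open>x / 4\<close>.\<close>

lemma sin_ge_quarter: "0 \<le> x \<Longrightarrow> x \<le> pi / 2 \<Longrightarrow> x / 4 \<le> sin x"
proof -
  assume x: "0 \<le> x" "x \<le> pi / 2"
  show "x / 4 \<le> sin x"
  proof (cases "x \<le> pi / 3")
    case True
    show ?thesis
    proof (cases "x = 0")
      case False
      then have "0 < x" using x by simp
      from MVT2[OF this, of sin cos] obtain z where z: "0 < z" "z < x" "sin x - sin 0 = (x - 0) * cos z"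
        by (auto simp: DERIV_sin)
      have "cos (pi / 3) \<le> cos z" using z True by (intro cos_monotone_0_pi_le) auto
      then have "x * (1 / 2) \<le> x * cos z" using x by (intro mult_left_mono) (simp_all add: cos_60)
      then show ?thesis using z x by simp
    qed simp
  next
    case False
    then have "sin (pi / 6) \<le> sin x" using x by (intro sin_monotone_2pi_le) auto
    moreover have "x / 4 \<le> 1 / 2" using x pi_less_4 by simp
    ultimately show ?thesis by (simp add: sin_30)
  qed
qed

text \<open>The cosine vanishes exactly where \<open>frac y = 1 / 2\<close>, and a shift by a
  quarter period reduces the claim to the bound for the sine; the remaining factor
  \<open>pi / 2\<close> exceeds one. This is the linear growth of the lattice function away from the
  vortices in the second coordinate.\<close>

lemma cos_pi_lower_bound: "\<bar>1 - 2 * frac y\<bar> / 4 \<le> \<bar>cos (pi * y)\<bar>"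
proof -
  define f where "f = frac y"
  have f: "0 \<le> f" "f < 1" using frac_lt_1[of y] by (auto simp: f_def)
  have "y = of_int \<lfloor>y\<rfloor> + f" by (simp add: f_def frac_def)
  then have "cos (pi * y) = cos (pi * f + pi * of_int \<lfloor>y\<rfloor>)" by (metis add.commute distrib_left)
  also have "\<bar>\<dots>\<bar> = \<bar>cos (pi * f)\<bar>"
    by (simp add: cos_add abs_mult)
  also have "\<dots> = \<bar>sin (pi / 2 - pi * f)\<bar>" by (simp add: sin_diff)
  also have "\<bar>sin z\<bar> = \<bar>sin \<bar>z\<bar>\<bar>" for z :: real by (cases "0 \<le> z") simp_all
  finally have c: "\<bar>cos (pi * y)\<bar> = \<bar>sin \<bar>pi / 2 - pi * f\<bar>\<bar>" .
  have w: "\<bar>pi / 2 - pi * f\<bar> = pi * \<bar>1 / 2 - f\<bar>"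
    by (simp add: abs_mult_pos' right_diff_distrib)
  have "\<bar>1 / 2 - f\<bar> \<le> 1 / 2" using f by linarith
  then have "pi * \<bar>1 / 2 - f\<bar> \<le> pi * (1 / 2)" by (intro mult_left_mono) auto
  then have "\<bar>pi / 2 - pi * f\<bar> / 4 \<le> sin \<bar>pi / 2 - pi * f\<bar>" unfolding w by (intro sin_ge_quarter) auto
  also have "\<dots> \<le> \<bar>cos (pi * y)\<bar>" unfolding c by (rule abs_ge_self)
  also have "\<bar>pi / 2 - pi * f\<bar> = (pi / 2) * \<bar>1 - 2 * f\<bar>"
    unfolding w by (simp add: abs_if)
  finally have "(pi / 2) * \<bar>1 - 2 * f\<bar> / 4 \<le> \<bar>cos (pi * y)\<bar>" .
  moreover have "1 * \<bar>1 - 2 * f\<bar> \<le> (pi / 2) * \<bar>1 - 2 * f\<bar>" using pi_ge_two by (intro mult_right_mono) auto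
  ultimately show ?thesis by (simp add: f_def)
qed

text \<open>
  \<open>l\<close> is the period and \<open>\<delta> l\<close> the core size. On the strip \<open>k \<le> x\<^sub>1 / l < k + 1\<close> the function
  \<open>lattice\<close> interpolates between two phases whose gradients match the potential at the two edges
  of the strip; it vanishes at the centres of the cells, where the phases differ by an odd multiple of \<open>pi\<close>.
\<close>

locale vortex_lattice =
  fixes l \<delta> :: real
  assumes l_pos: "l > 0" and \<delta>_pos: "\<delta> > 0"
begin

text \<open>One flux quantum \<open>2 * pi\<close> through each square cell of side
  \<open>l\<close>, to balance the winding of a single vortex.\<close>

definition field :: real where "field = 2 * pi / l\<^sup>2"

text \<open>The cubic interpolation from 0 to 1 with vanishing slope at both ends; the vanishing
  slopes are what makes neighbouring strips fit to first order.\<close>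

definition eta :: "real \<Rightarrow> real" where "eta t = 3 * t\<^sup>2 - 2 * t ^ 3"

definition eta' :: "real \<Rightarrow> real" where "eta' t = 6 * t - 6 * t\<^sup>2"

text \<open>The first component of the gradient equals that of the potential everywhere; the second
  does so exactly on the line \<open>x $ 1 = k * l\<close>, because
  \<open>field * l = 2 * pi / l\<close>. A nonzero curl rules out a single phase that matches on a
  whole strip.\<close>

definition phase :: "int \<Rightarrow> real^2 \<Rightarrow> real" where
  "phase k x = - (field / 2) * (x $ 1 * x $ 2) + 2 * pi * of_int k * (x $ 2 / l)"

definition dphase :: "int \<Rightarrow> real^2 \<Rightarrow> real^2 \<Rightarrow> real" where
  "dphase k x v = - (field / 2) * (x $ 1 * v $ 2 + v $ 1 * x $ 2) + 2 * pi * of_int k * (v $ 2 / l)"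

definition piece :: "int \<Rightarrow> real^2 \<Rightarrow> complex" where
  "piece k x = (1 - eta (x $ 1 / l - of_int k)) *\<^sub>R cis (phase k x) + eta (x $ 1 / l - of_int k) *\<^sub>R cis (phase (k + 1) x)"

definition dpiece :: "int \<Rightarrow> real^2 \<Rightarrow> real^2 \<Rightarrow> complex" where
  "dpiece k x v = (eta' (x $ 1 / l - of_int k) * (v $ 1 / l)) *\<^sub>R (cis (phase (k + 1) x) - cis (phase k x))
     + (1 - eta (x $ 1 / l - of_int k)) *\<^sub>R (dphase k x v *\<^sub>R (\<i> * cis (phase k x)))
     + eta (x $ 1 / l - of_int k) *\<^sub>R (dphase (k + 1) x v *\<^sub>R (\<i> * cis (phase (k + 1) x)))"

definition lattice :: "real^2 \<Rightarrow> complex" where "lattice x = piece \<lfloor>x $ 1 / l\<rfloor> x"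

definition dlattice :: "real^2 \<Rightarrow> real^2 \<Rightarrow> complex" where "dlattice x = dpiece \<lfloor>x $ 1 / l\<rfloor> x"

text \<open>A regularized modulus. Division by it yields modulus close to one away from the zeros of
  \<open>lattice\<close>, while \<open>core x \<ge> \<delta>\<close> keeps the quotient
  differentiable across the zeros.\<close>

definition core :: "real^2 \<Rightarrow> real" where "core x = sqrt ((cmod (lattice x))\<^sup>2 + \<delta>\<^sup>2)"

definition trial :: "real^2 \<Rightarrow> complex" where "trial x = (1 / core x) *\<^sub>R lattice x"

lemma phase_deriv: "(phase k has_derivative dphase k x) (at x)"
  unfolding phase_def[abs_def] dphase_def[abs_def] using l_pos
  by (auto intro!: derivative_eq_intros bounded_linear_imp_has_derivative bounded_linear_vec_nth)

lemma eta_deriv: "(eta has_real_derivative eta' t) (at t)"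
  unfolding eta_def[abs_def] eta'_def by (auto intro!: derivative_eq_intros simp: power2_eq_square)

lemma piece_deriv: "(piece k has_derivative dpiece k x) (at x)"
proof -
  have "((\<lambda>x::real^2. (1 / l) * x $ 1 - of_int k) has_derivative (\<lambda>v. (1 / l) * v $ 1 - 0)) (at x)"
    by (intro has_derivative_diff has_derivative_const has_derivative_mult_right bounded_linear_imp_has_derivative bounded_linear_vec_nth)
  then have c: "((\<lambda>x::real^2. x $ 1 / l - of_int k) has_derivative (\<lambda>v. v $ 1 / l)) (at x)" by simp
  have e: "((\<lambda>x::real^2. eta (x $ 1 / l - of_int k)) has_derivative (\<lambda>v. eta' (x $ 1 / l - of_int k) * (v $ 1 / l))) (at x)"
    using DERIV_compose_FDERIV[OF eta_deriv c] by (simp add: o_def mult.commute)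
  have 1: "((\<lambda>x::real^2. 1 - eta (x $ 1 / l - of_int k)) has_derivative (\<lambda>v. - (eta' (x $ 1 / l - of_int k) * (v $ 1 / l)))) (at x)"
    using has_derivative_diff[OF has_derivative_const e, of 1] by simp
  have "(piece k has_derivative (\<lambda>v.
      ((1 - eta (x $ 1 / l - of_int k)) *\<^sub>R (dphase k x v *\<^sub>R (\<i> * cis (phase k x))) + (- (eta' (x $ 1 / l - of_int k) * (v $ 1 / l))) *\<^sub>R cis (phase k x))
    + (eta (x $ 1 / l - of_int k) *\<^sub>R (dphase (k + 1) x v *\<^sub>R (\<i> * cis (phase (k + 1) x))) + (eta' (x $ 1 / l - of_int k) * (v $ 1 / l)) *\<^sub>R cis (phase (k + 1) x)))) (at x)"
    unfolding piece_def[abs_def]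
    by (intro has_derivative_add has_derivative_scaleR 1 e has_derivative_cis phase_deriv)
  also have "(\<lambda>v.
      ((1 - eta (x $ 1 / l - of_int k)) *\<^sub>R (dphase k x v *\<^sub>R (\<i> * cis (phase k x))) + (- (eta' (x $ 1 / l - of_int k) * (v $ 1 / l))) *\<^sub>R cis (phase k x))
    + (eta (x $ 1 / l - of_int k) *\<^sub>R (dphase (k + 1) x v *\<^sub>R (\<i> * cis (phase (k + 1) x))) + (eta' (x $ 1 / l - of_int k) * (v $ 1 / l)) *\<^sub>R cis (phase (k + 1) x))) = dpiece k x"
    by (rule ext) (simp add: dpiece_def scaleR_diff_right)
  finally show ?thesis .
qed

text \<open>On the common edge the interpolation parameter is 1 for the left strip and 0 for the
  right one, so both pieces reduce to \<open>cis (phase k x)\<close>, and the terms with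
  \<open>eta'\<close> vanish.\<close>

lemma piece_match:
  assumes "x $ 1 / l = of_int k"
  shows "piece (k - 1) x = piece k x" "dpiece (k - 1) x = dpiece k x"
  using assms by (auto simp: fun_eq_iff piece_def dpiece_def eta_def eta'_def)

lemma lattice_deriv: "(lattice has_derivative dlattice x) (at x)"
proof -
  define k where "k = \<lfloor>x $ 1 / l\<rfloor>"
  define X where "X = x $ 1 / l"
  have kX: "of_int k \<le> X" "X < of_int k + 1" unfolding k_def X_def by linarith+
  have near: "\<bar>z $ 1 / l - X\<bar> < e" if "norm (z - x) < l * e" for z e
  proof -
    have "\<bar>z $ 1 - x $ 1\<bar> < l * e" using that component_le_norm_cart[of "z - x" 1] by simp
    then have "\<bar>z $ 1 - x $ 1\<bar> / l < e" using l_pos by (simp add: divide_less_eq mult.commute)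
    then show ?thesis using l_pos by (simp add: X_def diff_divide_distrib[symmetric])
  qed
  show ?thesis
  proof (cases "X = of_int k")
    case True
    have m: "piece (k - 1) x = piece k x" "dpiece (k - 1) x = dpiece k x"
      using piece_match[of x k] True by (auto simp: X_def)
    show ?thesis
    proof (rule has_derivative_glue[of "piece k" _ _ "piece (k - 1)" lattice "l * 1"])
      show "(piece k has_derivative dlattice x) (at x)" using piece_deriv[of k x] by (simp add: dlattice_def k_def)
      show "(piece (k - 1) has_derivative dlattice x) (at x)" using piece_deriv[of "k - 1" x] unfolding m by (simp add: dlattice_def k_def)
      show "piece k x = lattice x" "piece (k - 1) x = lattice x" unfolding m by (simp_all add: lattice_def k_def)
      fix z assume "norm (z - x) < l * 1"
      from near[OF this] True have "\<lfloor>z $ 1 / l\<rfloor> = k \<or> \<lfloor>z $ 1 / l\<rfloor> = k - 1" by linarith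
      then show "lattice z = piece k z \<or> lattice z = piece (k - 1) z" by (auto simp: lattice_def)
    qed (use l_pos in simp)
  next
    case False
    define e where "e = min (X - of_int k) (of_int k + 1 - X)"
    show ?thesis
    proof (rule has_derivative_glue[of "piece k" _ _ "piece k" lattice "l * e"])
      show "(piece k has_derivative dlattice x) (at x)" "(piece k has_derivative dlattice x) (at x)"
        using piece_deriv[of k x] by (simp_all add: dlattice_def k_def)
      fix z assume "norm (z - x) < l * e"
      from near[OF this] have "\<lfloor>z $ 1 / l\<rfloor> = k" unfolding e_def by linarith
      then show "lattice z = piece k z \<or> lattice z = piece k z" by (simp add: lattice_def)
    qed (use l_pos kX False in \<open>simp_all add: lattice_def k_def e_def\<close>)
  qed
qed

lemma core_pos: "core x > 0"
  unfolding core_def using \<delta>_pos by (simp add: add_nonneg_pos)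

lemma core_sq: "(core x)\<^sup>2 = (cmod (lattice x))\<^sup>2 + \<delta>\<^sup>2"
  unfolding core_def by simp

lemma cmod_lattice_le_core: "cmod (lattice x) \<le> core x"
  unfolding core_def by (rule real_le_rsqrt) simp

definition dtrial :: "real^2 \<Rightarrow> real^2 \<Rightarrow> complex" where
  "dtrial x v = (1 / core x) *\<^sub>R dlattice x v - ((lattice x \<bullet> dlattice x v) / core x ^ 3) *\<^sub>R lattice x"

lemma trial_deriv: "(trial has_derivative dtrial x) (at x)"
proof -
  have n: "((\<lambda>x. (cmod (lattice x))\<^sup>2 + \<delta>\<^sup>2) has_derivative (\<lambda>v. 2 * (lattice x \<bullet> dlattice x v))) (at x)"
    unfolding power2_norm_eq_inner
    by (auto intro!: derivative_eq_intros lattice_deriv simp: inner_commute)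
  have p: "0 < (cmod (lattice x))\<^sup>2 + \<delta>\<^sup>2" using \<delta>_pos by (simp add: add_nonneg_pos)
  have s: "(core has_derivative (\<lambda>v. (lattice x \<bullet> dlattice x v) / core x)) (at x)"
    using DERIV_compose_FDERIV[OF DERIV_real_sqrt[OF p] n] unfolding core_def[abs_def]
    by (simp add: o_def field_simps inverse_eq_divide)
  have "((\<lambda>x. 1 / core x) has_derivative (\<lambda>v. - ((lattice x \<bullet> dlattice x v) / core x ^ 3))) (at x)"
    using core_pos[of x]
    by (auto intro!: derivative_eq_intros s simp: field_simps power2_eq_square power3_eq_cube)
  from has_derivative_scaleR[OF this lattice_deriv]
  show ?thesis unfolding trial_def[abs_def] dtrial_def by (simp add: algebra_simps)
qed

lemma pderiv_trial: "pderiv_at j trial x = dtrial x (axis j 1)"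
  by (rule pderiv_at_eq[OF trial_deriv])

text \<open>\<open>a_field\<close> does not depend on the third coordinate, so height zero stands
  for every layer.\<close>

definition pot :: "real^2 \<Rightarrow> real^2" where "pot x = hat (field *\<^sub>R a_field (at_height x 0))"

lemma pot_nth: "pot x $ 1 = - (field / 2) * x $ 2" "pot x $ 2 = field / 2 * x $ 1"
  by (simp_all add: pot_def a_field_def)

definition cov_lattice :: "real^2 \<Rightarrow> 2 \<Rightarrow> complex" where
  "cov_lattice x j = dlattice x (axis j 1) - \<i> * complex_of_real (pot x $ j) * lattice x"

text \<open>A rotation of \<open>lattice x\<close> is orthogonal to it, so the derivative of
  \<open>core\<close> only sees the covariant part of the gradient. The quotient rule then leaves
  two terms, and \<open>cmod (lattice x) \<le> core x\<close> bounds each by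
  \<open>cmod (cov_lattice x j) / core x\<close>.\<close>

lemma cov_trial_norm:
  "cmod (pderiv_at j trial x - \<i> * complex_of_real (pot x $ j) * trial x) \<le> 2 * cmod (cov_lattice x j) / core x"
proof -
  let ?C = "cov_lattice x j"
  have "lattice x \<bullet> (\<i> * complex_of_real (pot x $ j) * lattice x) = 0"
    by (simp add: inner_complex_def algebra_simps)
  then have ip: "lattice x \<bullet> dlattice x (axis j 1) = lattice x \<bullet> ?C" by (simp add: cov_lattice_def inner_diff_right)
  have "pderiv_at j trial x - \<i> * complex_of_real (pot x $ j) * trial x = (1 / core x) *\<^sub>R ?C - ((lattice x \<bullet> ?C) / core x ^ 3) *\<^sub>R lattice x"
    unfolding pderiv_trial dtrial_def ip by (simp add: cov_lattice_def trial_def scaleR_diff_right)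
  also have "cmod \<dots> \<le> cmod ?C / core x + \<bar>lattice x \<bullet> ?C\<bar> / core x ^ 3 * cmod (lattice x)"
    using core_pos[of x] by (intro order_trans[OF norm_triangle_ineq4]) (simp add: abs_of_pos)
  also have "\<bar>lattice x \<bullet> ?C\<bar> / core x ^ 3 * cmod (lattice x) \<le> (core x * cmod ?C) / core x ^ 3 * core x"
    using core_pos[of x] cmod_lattice_le_core[of x] Cauchy_Schwarz_ineq2[of "lattice x" ?C]
    by (intro mult_mono divide_right_mono order_trans[OF Cauchy_Schwarz_ineq2] mult_right_mono) auto
  also have "\<dots> = cmod ?C / core x" using core_pos[of x] by (simp add: field_simps power3_eq_cube)
  finally show ?thesis by simp
qed

text \<open>Each bound is read off a factorization. The last one bounds the imbalance of the two
  amplitudes from below by the distance to the middle of the strip, where the vortices sit.\<close>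

lemma eta_bounds:
  assumes "0 \<le> t" "t \<le> 1"
  shows "0 \<le> eta t" "eta t \<le> 1" "0 \<le> eta' t" "eta' t \<le> 3/2" "\<bar>1 - 2 * t\<bar> \<le> \<bar>1 - 2 * eta t\<bar>"
proof -
  have "eta t = t\<^sup>2 * (3 - 2 * t)" by (simp add: eta_def power2_eq_square power3_eq_cube algebra_simps)
  then show "0 \<le> eta t" using assms by simp
  have "1 - eta t = (1 - t)\<^sup>2 * (1 + 2 * t)" by (simp add: eta_def power2_eq_square power3_eq_cube algebra_simps)
  moreover have "0 \<le> (1 - t)\<^sup>2 * (1 + 2 * t)" using assms by simp
  ultimately show "eta t \<le> 1" by linarith
  have "eta' t = 6 * t * (1 - t)" by (simp add: eta'_def power2_eq_square algebra_simps)
  then show "0 \<le> eta' t" using assms by simp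
  have "eta' t = 3/2 - 6 * (t - 1/2)\<^sup>2" by (simp add: eta'_def power2_eq_square algebra_simps)
  then show "eta' t \<le> 3/2" using zero_le_power2[of "t - 1/2"] by linarith
  have "1 - 2 * eta t = (1 - 2 * t) * (1 + 2 * t * (1 - t))" by (simp add: eta_def power2_eq_square power3_eq_cube algebra_simps)
  then have "\<bar>1 - 2 * eta t\<bar> = \<bar>1 - 2 * t\<bar> * (1 + 2 * t * (1 - t))" using assms by (simp add: abs_mult)
  moreover have "\<bar>1 - 2 * t\<bar> * 1 \<le> \<bar>1 - 2 * t\<bar> * (1 + 2 * t * (1 - t))" using assms by (intro mult_left_mono) auto
  ultimately show "\<bar>1 - 2 * t\<bar> \<le> \<bar>1 - 2 * eta t\<bar>" by simp
qed

text \<open>Both phases match the potential in this direction, so only the derivative of the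
  interpolation remains.\<close>

lemma cov_lattice_1: "cmod (cov_lattice x 1) \<le> 3 / l"
proof -
  define k where "k = \<lfloor>x $ 1 / l\<rfloor>"
  define t where "t = x $ 1 / l - of_int k"
  have t: "0 \<le> t" "t \<le> 1" unfolding t_def k_def by linarith+
  have dp: "dphase m x (axis 1 1) = pot x $ 1" for m by (simp add: dphase_def pot_nth axis_def)
  have "cov_lattice x 1 = (eta' t / l) *\<^sub>R (cis (phase (k + 1) x) - cis (phase k x))"
    unfolding cov_lattice_def dlattice_def lattice_def k_def[symmetric] dpiece_def piece_def dp t_def[symmetric]
    by (simp add: axis_def scaleR_conv_of_real algebra_simps)
  then have "cmod (cov_lattice x 1) = eta' t / l * cmod (cis (phase (k + 1) x) - cis (phase k x))"
    using eta_bounds[OF t] l_pos by simp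
  also have "\<dots> \<le> (3 / 2) / l * 2"
    using eta_bounds[OF t] l_pos norm_triangle_ineq4[of "cis (phase (k + 1) x)" "cis (phase k x)"]
    by (intro mult_mono divide_right_mono) auto
  finally show ?thesis by simp
qed

text \<open>The interpolation is constant in this direction; what remains is the mismatch between
  the phase gradients and the potential, which grows linearly across the strip from zero to
  \<open>2 * pi / l\<close>.\<close>

lemma cov_lattice_2: "cmod (cov_lattice x 2) \<le> 8 / l"
proof -
  define k where "k = \<lfloor>x $ 1 / l\<rfloor>"
  define t where "t = x $ 1 / l - of_int k"
  have t: "0 \<le> t" "t \<le> 1" unfolding t_def k_def by linarith+
  define c where "c = 2 * pi / l"
  have dp: "dphase k x (axis 2 1) = pot x $ 2 - c * t" "dphase (k + 1) x (axis 2 1) = pot x $ 2 + c * (1 - t)"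
    using l_pos by (simp_all add: dphase_def pot_nth axis_def t_def c_def field_def field_simps power2_eq_square)
  have "cov_lattice x 2 = c *\<^sub>R (\<i> * ((eta t * (1 - t)) *\<^sub>R cis (phase (k + 1) x) - ((1 - eta t) * t) *\<^sub>R cis (phase k x)))"
    unfolding cov_lattice_def dlattice_def lattice_def k_def[symmetric] dpiece_def piece_def dp t_def[symmetric]
    by (simp add: axis_def scaleR_conv_of_real algebra_simps)
  then have "cmod (cov_lattice x 2) = 2 * pi / l * cmod ((eta t * (1 - t)) *\<^sub>R cis (phase (k + 1) x) - ((1 - eta t) * t) *\<^sub>R cis (phase k x))"
    using l_pos by (simp add: norm_mult c_def)
  also have "\<dots> \<le> 2 * pi / l * (eta t * 1 + (1 - eta t) * 1)"
  proof (rule mult_left_mono)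
    have "cmod ((eta t * (1 - t)) *\<^sub>R cis (phase (k + 1) x) - ((1 - eta t) * t) *\<^sub>R cis (phase k x)) \<le> eta t * (1 - t) + (1 - eta t) * t"
      using eta_bounds[OF t] t by (intro order_trans[OF norm_triangle_ineq4]) simp
    also have "\<dots> \<le> eta t * 1 + (1 - eta t) * 1"
      using eta_bounds[OF t] t by (intro add_mono mult_left_mono) auto
    finally show "cmod ((eta t * (1 - t)) *\<^sub>R cis (phase (k + 1) x) - ((1 - eta t) * t) *\<^sub>R cis (phase k x)) \<le> eta t * 1 + (1 - eta t) * 1" .
  qed (use l_pos in simp)
  also have "\<dots> \<le> 8 / l" using l_pos pi_less_4 by (simp add: divide_right_mono)
  finally show ?thesis .
qed

text \<open>With \<open>q = 1 - 2 * eta t\<close> and \<open>c\<close> the cosine of half the phase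
  difference, the squared modulus of \<open>lattice\<close> is
  \<open>q\<^sup>2 + (1 - q\<^sup>2) * c\<^sup>2\<close>, which dominates both squares. The modulus
  thus grows at least linearly with the distance from the centre of the cell.\<close>

lemma core_lower_bound:
  "(\<bar>1 - 2 * frac (x $ 1 / l)\<bar> + \<bar>1 - 2 * frac (x $ 2 / l)\<bar> + \<delta>)\<^sup>2 \<le> 96 * (core x)\<^sup>2"
proof -
  define k where "k = \<lfloor>x $ 1 / l\<rfloor>"
  define t where "t = frac (x $ 1 / l)"
  define c where "c = cos (pi * (x $ 2 / l))"
  define q where "q = 1 - 2 * eta t"
  have t: "0 \<le> t" "t \<le> 1" using frac_lt_1[of "x $ 1 / l"] by (auto simp: t_def)
  have tk: "x $ 1 / l - of_int k = t" by (simp add: t_def k_def frac_def)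
  have ph: "phase (k + 1) x = phase k x + 2 * (pi * (x $ 2 / l))" by (simp add: phase_def algebra_simps)
  have "(cmod (lattice x))\<^sup>2 = (1 - eta t)\<^sup>2 + (eta t)\<^sup>2 + 2 * eta t * (1 - eta t) * cos (phase (k + 1) x - phase k x)"
  proof -
    let ?a = "phase k x" and ?b = "phase (k + 1) x"
    have "(cmod (lattice x))\<^sup>2 = ((1 - eta t) * cos ?a + eta t * cos ?b)\<^sup>2 + ((1 - eta t) * sin ?a + eta t * sin ?b)\<^sup>2"
      unfolding lattice_def k_def[symmetric] piece_def tk by (simp add: cmod_power2)
    also have "(p * ca + q * cb)\<^sup>2 + (p * sa + q * sb)\<^sup>2 = p\<^sup>2 * (sa\<^sup>2 + ca\<^sup>2) + q\<^sup>2 * (sb\<^sup>2 + cb\<^sup>2) + 2 * q * p * (cb * ca + sb * sa)"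
      for p q ca cb sa sb :: real by (simp add: power2_eq_square algebra_simps)
    also have "(1 - eta t)\<^sup>2 * ((sin ?a)\<^sup>2 + (cos ?a)\<^sup>2) + (eta t)\<^sup>2 * ((sin ?b)\<^sup>2 + (cos ?b)\<^sup>2) + 2 * eta t * (1 - eta t) * (cos ?b * cos ?a + sin ?b * sin ?a)
        = (1 - eta t)\<^sup>2 + (eta t)\<^sup>2 + 2 * eta t * (1 - eta t) * cos (?b - ?a)"
      by (simp add: cos_diff)
    finally show ?thesis .
  qed
  also have "cos (phase (k + 1) x - phase k x) = 2 * c\<^sup>2 - 1"
    unfolding ph c_def using cos_double_cos[of "pi * (x $ 2 / l)"] by simp
  finally have rho: "(cmod (lattice x))\<^sup>2 = q\<^sup>2 + (1 - q\<^sup>2) * c\<^sup>2" by (simp add: q_def power2_eq_square algebra_simps)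
  have q1: "q\<^sup>2 \<le> 1" using eta_bounds(1,2)[OF t] by (simp add: q_def abs_square_le_1 abs_le_iff)
  have c1: "c\<^sup>2 \<le> 1" by (simp add: c_def abs_square_le_1)
  have "q\<^sup>2 \<le> (cmod (lattice x))\<^sup>2" unfolding rho using q1 by simp
  moreover have "c\<^sup>2 \<le> (cmod (lattice x))\<^sup>2"
  proof -
    have "(cmod (lattice x))\<^sup>2 = c\<^sup>2 + q\<^sup>2 * (1 - c\<^sup>2)" unfolding rho by (simp add: algebra_simps)
    then show ?thesis using c1 by simp
  qed
  ultimately have r: "q\<^sup>2 + c\<^sup>2 \<le> 2 * (cmod (lattice x))\<^sup>2" by simp
  define a where "a = \<bar>1 - 2 * frac (x $ 1 / l)\<bar>"
  define b where "b = \<bar>1 - 2 * frac (x $ 2 / l)\<bar>"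
  have "a\<^sup>2 \<le> q\<^sup>2" using eta_bounds(5)[OF t] by (simp add: a_def q_def t_def abs_le_square_iff[symmetric])
  moreover have "(b / 4)\<^sup>2 \<le> c\<^sup>2" using cos_pi_lower_bound[of "x $ 2 / l"] by (simp add: b_def c_def abs_le_square_iff[symmetric])
  ultimately have "a\<^sup>2 + b\<^sup>2 / 16 \<le> 2 * (cmod (lattice x))\<^sup>2" using r by (simp add: power_divide)
  then have "16 * a\<^sup>2 + b\<^sup>2 \<le> 32 * (cmod (lattice x))\<^sup>2" by simp
  moreover have "0 \<le> a\<^sup>2" "0 \<le> \<delta>\<^sup>2" by simp_all
  ultimately have m: "a\<^sup>2 + b\<^sup>2 + \<delta>\<^sup>2 \<le> 32 * (core x)\<^sup>2" unfolding core_sq distrib_left by linarith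
  \<comment> \<open>The factor 3 from squaring three terms, times the 32 just obtained, gives 96;
    that 32 is 16 from the quarter in the cosine bound, times 2 from adding the two lower
    bounds.\<close>
  have "(a + b + \<delta>)\<^sup>2 \<le> 3 * (a\<^sup>2 + b\<^sup>2 + \<delta>\<^sup>2)"
    using zero_le_power2[of "a - b"] zero_le_power2[of "a - \<delta>"] zero_le_power2[of "b - \<delta>"]
    by (simp add: power2_eq_square algebra_simps)
  with m show ?thesis by (simp add: a_def b_def)
qed

text \<open>Up to the factor 96 an upper bound for the inverse square of \<open>core\<close>. The
  coordinates enter only through separate sawtooth functions, so the integral can be reduced to unit
  intervals.\<close>

definition profile :: "real^2 \<Rightarrow> real" where
  "profile x = 1 / (\<bar>1 - 2 * frac (x $ 1 / l)\<bar> + \<bar>1 - 2 * frac (x $ 2 / l)\<bar> + \<delta>)\<^sup>2"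

text \<open>The identity \<open>1 - (cmod (trial x))\<^sup>2 = \<delta>\<^sup>2 / (core
  x)\<^sup>2\<close> and the choice \<open>\<epsilon> = \<delta> * l\<close> bring the potential
  term down to the scale of the gradient term, the inverse square of
  \<open>l * core x\<close>.\<close>

lemma trial_energy_density:
  fixes \<epsilon> :: real
  assumes e: "\<epsilon> = \<delta> * l"
  shows "1/2 * (norm (\<chi> j. pderiv_at j trial x - \<i> * complex_of_real (pot x $ j) * trial x))\<^sup>2
     + 1 / (4 * \<epsilon>\<^sup>2) * (1 - (cmod (trial x))\<^sup>2)\<^sup>2 \<le> 15000 / l\<^sup>2 * profile x"
proof -
  let ?C = "\<lambda>j. pderiv_at j trial x - \<i> * complex_of_real (pot x $ j) * trial x"
  note cp = core_pos[of x]
  have "(norm (\<chi> j. ?C j))\<^sup>2 = (cmod (?C 1))\<^sup>2 + (cmod (?C 2))\<^sup>2"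
    unfolding norm_vec_def L2_set_def sum_2 by simp
  also have "\<dots> \<le> (2 * (3 / l) / core x)\<^sup>2 + (2 * (8 / l) / core x)\<^sup>2"
    using cp l_pos cov_lattice_1[of x] cov_lattice_2[of x]
    by (intro add_mono power_mono order_trans[OF cov_trial_norm] divide_right_mono mult_left_mono) auto
  also have "\<dots> = 292 / l\<^sup>2 * (1 / (core x)\<^sup>2)" using cp l_pos by (simp add: power_divide field_simps)
  finally have 1: "(norm (\<chi> j. ?C j))\<^sup>2 \<le> 292 / l\<^sup>2 * (1 / (core x)\<^sup>2)" .
  have "(cmod (trial x))\<^sup>2 = (cmod (lattice x))\<^sup>2 / (core x)\<^sup>2" unfolding trial_def using cp by (simp add: power_divide)
  also have "(cmod (lattice x))\<^sup>2 = (core x)\<^sup>2 - \<delta>\<^sup>2" using core_sq[of x] by simp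
  finally have "1 - (cmod (trial x))\<^sup>2 = \<delta>\<^sup>2 / (core x)\<^sup>2" using cp by (simp add: diff_divide_distrib)
  then have "1 / (4 * \<epsilon>\<^sup>2) * (1 - (cmod (trial x))\<^sup>2)\<^sup>2 = 1 / (4 * \<epsilon>\<^sup>2) * (\<delta>\<^sup>2 / (core x)\<^sup>2)\<^sup>2" by (simp only:)
  also have "\<dots> = 1 / (4 * l\<^sup>2) * (1 / (core x)\<^sup>2) * (\<delta>\<^sup>2 / (core x)\<^sup>2)"
    using \<delta>_pos l_pos by (simp add: e power_mult_distrib field_simps power2_eq_square)
  also have "\<dots> \<le> 1 / (4 * l\<^sup>2) * (1 / (core x)\<^sup>2) * 1"
  proof (rule mult_left_mono)
    have "\<delta>\<^sup>2 \<le> (core x)\<^sup>2" unfolding core_sq by simp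
    then show "\<delta>\<^sup>2 / (core x)\<^sup>2 \<le> 1" using cp by simp
  qed (use l_pos in simp)
  finally have 2: "1 / (4 * \<epsilon>\<^sup>2) * (1 - (cmod (trial x))\<^sup>2)\<^sup>2 \<le> 1 / (4 * l\<^sup>2) * (1 / (core x)\<^sup>2)" by simp
  have "0 < \<bar>1 - 2 * frac (x $ 1 / l)\<bar> + \<bar>1 - 2 * frac (x $ 2 / l)\<bar> + \<delta>" using \<delta>_pos by simp
  then have "1 / (core x)\<^sup>2 \<le> 96 * profile x"
    unfolding profile_def using core_lower_bound[of x] cp by (simp add: divide_le_eq le_divide_eq)
  then have 3: "150 / l\<^sup>2 * (1 / (core x)\<^sup>2) \<le> 150 / l\<^sup>2 * (96 * profile x)" by (intro mult_left_mono) auto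
  have p: "0 \<le> profile x / l\<^sup>2" by (simp add: profile_def)
  \<comment> \<open>The constants combine as \<open>292 / 2 + 1 / 4 \<le> 150\<close> and
    \<open>150 * 96 \<le> 15000\<close>.\<close>
  have "1/2 * (norm (\<chi> j. ?C j))\<^sup>2 + 1 / (4 * \<epsilon>\<^sup>2) * (1 - (cmod (trial x))\<^sup>2)\<^sup>2 \<le> 1/2 * (292 / l\<^sup>2 * (1 / (core x)\<^sup>2)) + 1 / (4 * l\<^sup>2) * (1 / (core x)\<^sup>2)"
    using 1 2 by simp
  also have "\<dots> \<le> 150 / l\<^sup>2 * (1 / (core x)\<^sup>2)"
  proof -
    define w where "w = 1 / l\<^sup>2 * (1 / (core x)\<^sup>2)"
    have w: "0 \<le> w" by (simp add: w_def)
    have e: "1/2 * (292 / l\<^sup>2 * (1 / (core x)\<^sup>2)) = 146 * w" "1 / (4 * l\<^sup>2) * (1 / (core x)\<^sup>2) = w / 4"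
      "150 / l\<^sup>2 * (1 / (core x)\<^sup>2) = 150 * w" by (simp_all add: w_def)
    show ?thesis unfolding e using w by simp
  qed
  also have "\<dots> \<le> 15000 / l\<^sup>2 * profile x" using 3 p by simp
  finally show ?thesis .
qed

lemma cmod_trial_le: "cmod (trial x) \<le> 1"
  unfolding trial_def using cmod_lattice_le_core[of x] core_pos[of x] by simp

text \<open>The covariant gradient is bounded, but the plain gradient inherits the linear growth of
  the potential. A bound on each ball is what the criterion for weak derivatives asks for.\<close>

lemma pderiv_trial_bound: "cmod (pderiv_at j trial x) \<le> 16 / (l * \<delta>) + field * norm x"
proof -
  have c: "\<delta> \<le> core x" unfolding core_def by (rule real_le_rsqrt) simp
  have "cmod (cov_lattice x j) \<le> 8 / l"
    using exhaust_2[of j] order_trans[OF cov_lattice_1[of x], of "8 / l"] cov_lattice_2[of x] l_pos by (auto simp: divide_right_mono)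
  then have "cmod (pderiv_at j trial x - \<i> * complex_of_real (pot x $ j) * trial x) \<le> 2 * (8 / l) / \<delta>"
    using c \<delta>_pos l_pos core_pos[of x] by (intro order_trans[OF cov_trial_norm] frac_le mult_left_mono) auto
  moreover have "cmod (\<i> * complex_of_real (pot x $ j) * trial x) \<le> field * norm x * 1"
    unfolding norm_mult
  proof (rule mult_mono)
    have f: "field > 0" using l_pos by (simp add: field_def)
    have "\<bar>pot x $ j\<bar> \<le> field / 2 * norm x"
      using exhaust_2[of j] f component_le_norm_cart[of x 1] component_le_norm_cart[of x 2]
      by (auto simp: pot_nth abs_mult intro!: mult_left_mono)
    also have "\<dots> \<le> field * norm x" using f by (intro mult_right_mono) auto
    finally show "cmod \<i> * cmod (complex_of_real (pot x $ j)) \<le> field * norm x" by simp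
  qed (use cmod_trial_le l_pos in \<open>auto simp: field_def\<close>)
  ultimately show ?thesis
    using norm_triangle_sub[of "pderiv_at j trial x" "\<i> * complex_of_real (pot x $ j) * trial x"] by (simp add: field_simps)
qed

lemma trial_differentiable: "trial differentiable (at x)"
  using trial_deriv by (rule differentiableI)

lemma trial_weak_pderiv: "has_weak_pderiv U j trial (pderiv_at j trial)"
proof (rule has_weak_pderiv_differentiable[OF trial_differentiable])
  fix r :: real
  have f: "field \<ge> 0" by (simp add: field_def)
  show "\<exists>M. \<forall>x. norm x \<le> r \<longrightarrow> norm (pderiv_at j trial x) \<le> M"
    by (intro exI[of _ "16 / (l * \<delta>) + field * r"] allI impI order_trans[OF pderiv_trial_bound] add_left_mono mult_left_mono f)
qed

lemma trial_H1:
  assumes U: "open U" "bounded U"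
  shows "trial \<in> H1 U"
proof -
  have L: "f \<in> Lp 2 U" if "f \<in> Lp_loc 2 UNIV" for f :: "real^2 \<Rightarrow> complex"
  proof -
    have "compact (closure U)" using U by (simp add: compact_closure)
    then have 1: "(\<lambda>x. indicator (closure U) x *\<^sub>R f x) \<in> borel_measurable lebesgue" "set_integrable lebesgue (closure U) (\<lambda>x. norm (f x) ^ 2)"
      using that by (auto simp: Lp_loc_def Lp_def set_borel_measurable_def)
    have Us: "U \<in> sets lebesgue" using U by auto
    have "(\<lambda>x. indicator U x *\<^sub>R (indicator (closure U) x *\<^sub>R f x)) \<in> borel_measurable lebesgue"
      by (intro borel_measurable_scaleR 1 borel_measurable_indicator Us)
    also have "(\<lambda>x. indicator U x *\<^sub>R (indicator (closure U) x *\<^sub>R f x)) = (\<lambda>x. indicator U x *\<^sub>R f x)"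
      using closure_subset[of U] by (auto simp: fun_eq_iff indicator_def)
    finally have "set_borel_measurable lebesgue U f" by (simp add: set_borel_measurable_def)
    moreover have "set_integrable lebesgue U (\<lambda>x. norm (f x) ^ 2)"
      by (rule set_integrable_subset[OF 1(2) Us closure_subset])
    ultimately show ?thesis by (simp add: Lp_def)
  qed
  note m = differentiable_pderiv_measurable[OF trial_differentiable]
  have "pderiv_at j trial \<in> Lp_loc 2 UNIV" for j
  proof (rule Lp_loc_bounded[OF m(2)])
    fix r :: real
    have f: "field \<ge> 0" by (simp add: field_def)
    show "\<exists>M. \<forall>x. norm x \<le> r \<longrightarrow> norm (pderiv_at j trial x) \<le> M"
      by (intro exI[of _ "16 / (l * \<delta>) + field * r"] allI impI order_trans[OF pderiv_trial_bound] add_left_mono mult_left_mono f)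
  qed
  then show ?thesis unfolding H1_def using L Lp_loc_continuous[OF m(3)] trial_weak_pderiv by blast
qed

end

section \<open>The logarithmic energy integral\<close>

lemma borel_measurable_frac [measurable]: "(frac :: real \<Rightarrow> real) \<in> borel_measurable borel"
  unfolding frac_def[abs_def] by measurable

text \<open>On each period the sawtooth covers the unit interval twice with slope two in modulus, so
  the period contributes the plain integral of \<open>G\<close> over that interval.\<close>

lemma nn_integral_sawtooth:
  fixes G :: "real \<Rightarrow> ennreal"
  assumes [measurable]: "G \<in> borel_measurable borel"
  shows "(\<integral>\<^sup>+x. G \<bar>1 - 2 * frac x\<bar> * indicator {of_int c..<of_int c + real n} x \<partial>lborel)
     \<le> of_nat n * (\<integral>\<^sup>+z. G z * indicator {0..1} z \<partial>lborel)"
proof (induction n)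
  case 0 then show ?case by simp
next
  case (Suc n)
  let ?J = "\<integral>\<^sup>+z. G z * indicator {0..1} z \<partial>lborel"
  have cell: "(\<integral>\<^sup>+x. G \<bar>1 - 2 * frac x\<bar> * indicator {of_int d..<of_int d + 1} x \<partial>lborel) \<le> ?J" for d :: int
  proof -
    \<comment> \<open>The substitution centres the cell and rescales it so that
      \<open>1 - 2 * frac x\<close> becomes the new variable \<open>z\<close>, running from -1 to 1;
      the two signs of \<open>z\<close> give the two summands of the next step.\<close>
    have c1: "(\<integral>\<^sup>+x. G \<bar>1 - 2 * frac x\<bar> * indicator {of_int d..<of_int d + 1} x \<partial>lborel)
       = ennreal \<bar>-1/2\<bar> * (\<integral>\<^sup>+z. G \<bar>1 - 2 * frac (of_int d + 1/2 + (-1/2) * z)\<bar> * indicator {of_int d..<of_int d + 1} (of_int d + 1/2 + (-1/2) * z) \<partial>lborel)"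
      by (rule nn_integral_real_affine) auto
    have c2: "(\<integral>\<^sup>+z. G \<bar>1 - 2 * frac (of_int d + 1/2 + (-1/2) * z)\<bar> * indicator {of_int d..<of_int d + 1} (of_int d + 1/2 + (-1/2) * z) \<partial>lborel)
       \<le> (\<integral>\<^sup>+z. G z * indicator {0..1} z + G (0 + (-1) * z) * indicator {0..1} (0 + (-1) * z) \<partial>lborel)"
    proof (rule nn_integral_mono)
      fix z :: real
      show "G \<bar>1 - 2 * frac (of_int d + 1/2 + (-1/2) * z)\<bar> * indicator {of_int d..<of_int d + 1} (of_int d + 1/2 + (-1/2) * z)
         \<le> G z * indicator {0..1} z + G (0 + (-1) * z) * indicator {0..1} (0 + (-1) * z)"
      proof (cases "-1 < z \<and> z \<le> 1")
        case True
        have "\<lfloor>of_int d + 1/2 + (-1/2) * z\<rfloor> = d" using True by linarith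
        then have "frac (of_int d + 1/2 + (-1/2) * z) = 1/2 - z / 2" by (simp add: frac_def)
        then have "1 - 2 * frac (of_int d + 1/2 + (-1/2) * z) = z" by simp
        then show ?thesis using True by (cases "0 \<le> z") (auto simp: indicator_def)
      next
        case False
        then have "indicator {of_int d..<of_int d + 1} (of_int d + 1/2 + (-1/2) * z) = (0::ennreal)" by (auto simp: indicator_def)
        then show ?thesis by simp
      qed
    qed
    have c3: "(\<integral>\<^sup>+z. G z * indicator {0..1} z + G (0 + (-1) * z) * indicator {0..1} (0 + (-1) * z) \<partial>lborel) = ?J + (\<integral>\<^sup>+z. G (0 + (-1) * z) * indicator {0..1} (0 + (-1) * z) \<partial>lborel)"
      by (rule nn_integral_add) measurable
    have c4: "(\<integral>\<^sup>+z. G (0 + (-1) * z) * indicator {0..1} (0 + (-1) * z) \<partial>lborel) = ?J"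
      using nn_integral_real_affine[of "\<lambda>z. G z * indicator {0..1} z" "-1" 0] by simp
    have "(\<integral>\<^sup>+x. G \<bar>1 - 2 * frac x\<bar> * indicator {of_int d..<of_int d + 1} x \<partial>lborel) \<le> ennreal \<bar>-1/2\<bar> * (?J + ?J)"
      unfolding c1 by (rule mult_left_mono[OF c2[unfolded c3 c4]]) simp
    moreover have "ennreal \<bar>-1/2\<bar> * (?J + ?J) = ?J"
    proof -
      have "ennreal \<bar>-1/2\<bar> * ennreal 2 = ennreal (\<bar>-1/2\<bar> * 2)" by (rule ennreal_mult[symmetric]) auto
      then have "ennreal \<bar>-1/2\<bar> * 2 = 1" by (simp only: ennreal_numeral) simp
      then show ?thesis by (simp only: mult_2[symmetric] mult.assoc[symmetric] mult_1_left)
    qed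
    ultimately show ?thesis by (simp only:)
  qed
  have "(\<integral>\<^sup>+x. G \<bar>1 - 2 * frac x\<bar> * indicator {of_int c..<of_int c + real (Suc n)} x \<partial>lborel)
     = (\<integral>\<^sup>+x. G \<bar>1 - 2 * frac x\<bar> * indicator {of_int c..<of_int c + real n} x + G \<bar>1 - 2 * frac x\<bar> * indicator {of_int (c + int n)..<of_int (c + int n) + 1} x \<partial>lborel)"
    by (intro nn_integral_cong) (auto simp: indicator_def)
  also have "\<dots> = (\<integral>\<^sup>+x. G \<bar>1 - 2 * frac x\<bar> * indicator {of_int c..<of_int c + real n} x \<partial>lborel)
      + (\<integral>\<^sup>+x. G \<bar>1 - 2 * frac x\<bar> * indicator {of_int (c + int n)..<of_int (c + int n) + 1} x \<partial>lborel)"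
    by (rule nn_integral_add) measurable
  also have "\<dots> \<le> of_nat n * ?J + ?J" by (intro add_mono Suc cell)
  finally show ?case by (simp add: distrib_right add.commute)
qed

text \<open>After rescaling, the interval from \<open>-M\<close> to \<open>M\<close> is covered by
  the \<open>2 * m\<close> unit cells between \<open>-m\<close> and \<open>m\<close>; the strict
  inequality in the hypothesis accounts for the half-open cells.\<close>

lemma nn_integral_sawtooth_scaled:
  fixes G :: "real \<Rightarrow> ennreal"
  assumes [measurable]: "G \<in> borel_measurable borel" and l: "l > 0" and m: "M / l < real m"
  shows "(\<integral>\<^sup>+x. G \<bar>1 - 2 * frac (x / l)\<bar> * indicator {x. \<bar>x\<bar> \<le> M} x \<partial>lborel)
     \<le> ennreal (l * (2 * real m)) * (\<integral>\<^sup>+z. G z * indicator {0..1} z \<partial>lborel)"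
proof -
  have "(\<integral>\<^sup>+x. G \<bar>1 - 2 * frac (x / l)\<bar> * indicator {x. \<bar>x\<bar> \<le> M} x \<partial>lborel)
     = ennreal \<bar>l\<bar> * (\<integral>\<^sup>+x. G \<bar>1 - 2 * frac ((0 + l * x) / l)\<bar> * indicator {x. \<bar>x\<bar> \<le> M} (0 + l * x) \<partial>lborel)"
    using l by (intro nn_integral_real_affine) auto
  also have "\<dots> \<le> ennreal \<bar>l\<bar> * (\<integral>\<^sup>+x. G \<bar>1 - 2 * frac x\<bar> * indicator {of_int (- int m)..<of_int (- int m) + real (2 * m)} x \<partial>lborel)"
  proof (intro mult_left_mono nn_integral_mono)
    fix x :: real
    have "x \<in> {of_int (- int m)..<of_int (- int m) + real (2 * m)}" if "\<bar>l * x\<bar> \<le> M"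
    proof -
      have "\<bar>x\<bar> \<le> M / l" using that l by (simp add: abs_mult le_divide_eq mult.commute)
      then show ?thesis using m by auto
    qed
    then show "G \<bar>1 - 2 * frac ((0 + l * x) / l)\<bar> * indicator {x. \<bar>x\<bar> \<le> M} (0 + l * x)
       \<le> G \<bar>1 - 2 * frac x\<bar> * indicator {of_int (- int m)..<of_int (- int m) + real (2 * m)} x"
      using l by (auto simp: indicator_def)
  qed simp
  also have "\<dots> \<le> ennreal \<bar>l\<bar> * (of_nat (2 * m) * (\<integral>\<^sup>+z. G z * indicator {0..1} z \<partial>lborel))"
    by (intro mult_left_mono nn_integral_sawtooth) auto
  also have "\<dots> = ennreal (l * (2 * real m)) * (\<integral>\<^sup>+z. G z * indicator {0..1} z \<partial>lborel)"
  proof -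
    have "(of_nat (2 * m) :: ennreal) = ennreal (2 * real m)" by (simp add: ennreal_of_nat_eq_real_of_nat)
    then show ?thesis using l by (simp only: ennreal_mult' abs_of_pos mult.assoc)
  qed
  finally show ?thesis .
qed

lemma nn_integral_vec2:
  fixes F :: "real^2 \<Rightarrow> ennreal"
  assumes [measurable]: "F \<in> borel_measurable borel"
  shows "(\<integral>\<^sup>+x. F x \<partial>lborel) = (\<integral>\<^sup>+a. (\<integral>\<^sup>+b. F (a *\<^sub>R axis 1 1 + b *\<^sub>R axis 2 1) \<partial>lborel) \<partial>lborel)"
proof -
  let ?J = "\<lambda>p. fst p *\<^sub>R axis 1 1 + snd p *\<^sub>R axis 2 1 :: real^2"
  have [measurable]: "?J \<in> borel_measurable (lborel \<Otimes>\<^sub>M lborel)" by measurable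
  have nth: "?J p $ 1 = fst p" "?J p $ 2 = snd p" for p by (simp_all add: axis_def)
  have D: "distr (lborel \<Otimes>\<^sub>M lborel) borel ?J = lborel"
  proof (rule lborel_eqI[symmetric])
    fix l u :: "real^2" assume lu: "\<And>b. b \<in> Basis \<Longrightarrow> l \<bullet> b \<le> u \<bullet> b"
    have le: "l $ i \<le> u $ i" for i using lu[of "axis i 1"] by (simp add: inner_axis axis_in_Basis_iff)
    have pre: "?J -` box l u \<inter> space (lborel \<Otimes>\<^sub>M lborel) = box (l $ 1) (u $ 1) \<times> box (l $ 2) (u $ 2)"
      by (auto simp: space_pair_measure mem_box_cart forall_2 box_real axis_def)
    have e1: "emeasure (distr (lborel \<Otimes>\<^sub>M lborel) borel ?J) (box l u) = emeasure (lborel \<Otimes>\<^sub>M lborel) (box (l $ 1) (u $ 1) \<times> box (l $ 2) (u $ 2))"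
      by (subst emeasure_distr) (simp_all add: pre)
    have e2: "emeasure (lborel \<Otimes>\<^sub>M lborel) (box (l $ 1) (u $ 1) \<times> box (l $ 2) (u $ 2)) = emeasure lborel (box (l $ 1) (u $ 1)) * emeasure lborel (box (l $ 2) (u $ 2))"
      by (rule lborel.emeasure_pair_measure_Times) auto
    have e3: "emeasure lborel (box (l $ i) (u $ i)) = ennreal (u $ i - l $ i)" for i using le[of i] by simp
    have pe: "(\<Prod>b\<in>Basis. (u - l) \<bullet> b) = (u $ 1 - l $ 1) * (u $ 2 - l $ 2)"
      unfolding prod_Basis_cart UNIV_2 inner_axis by simp
    have "0 \<le> u $ 1 - l $ 1" "0 \<le> u $ 2 - l $ 2" using le[of 1] le[of 2] by simp_all
    then show "emeasure (distr (lborel \<Otimes>\<^sub>M lborel) borel ?J) (box l u) = ennreal (\<Prod>b\<in>Basis. (u - l) \<bullet> b)"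
      unfolding e1 e2 e3 pe by (rule ennreal_mult[symmetric])
  qed simp
  have "(\<integral>\<^sup>+x. F x \<partial>lborel) = (\<integral>\<^sup>+x. F x \<partial>distr (lborel \<Otimes>\<^sub>M lborel) borel ?J)" unfolding D ..
  also have "\<dots> = (\<integral>\<^sup>+p. F (?J p) \<partial>(lborel \<Otimes>\<^sub>M lborel))" by (rule nn_integral_distr) measurable
  also have "\<dots> = (\<integral>\<^sup>+a. (\<integral>\<^sup>+b. F (a *\<^sub>R axis 1 1 + b *\<^sub>R axis 2 1) \<partial>lborel) \<partial>lborel)"
    by (subst lborel.nn_integral_fst[symmetric]) auto
  finally show ?thesis .
qed

lemma nn_integral_inverse_square_le:
  assumes c: "c > (0::real)"
  shows "(\<integral>\<^sup>+z. ennreal (1 / (c + z)\<^sup>2) * indicator {0..1} z \<partial>lborel) \<le> ennreal (1 / c)"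
proof -
  have "(\<integral>\<^sup>+z. ennreal (1 / (c + z)\<^sup>2) * indicator {0..1} z \<partial>lborel) = ennreal (- (1 / (c + 1)) - (- (1 / (c + 0))))"
  proof (rule nn_integral_FTC_Icc)
    fix z :: real assume "z \<in> {0..1}"
    then have "c + z \<noteq> 0" using c by auto
    then show "((\<lambda>z. - (1 / (c + z))) has_real_derivative 1 / (c + z)\<^sup>2) (at z)"
      by (auto intro!: derivative_eq_intros simp: power2_eq_square)
  qed auto
  also have "\<dots> \<le> ennreal (1 / c)" using c by (intro ennreal_leI) simp
  finally show ?thesis .
qed

lemma nn_integral_inverse:
  assumes c: "c > (0::real)"
  shows "(\<integral>\<^sup>+z. ennreal (1 / (z + c)) * indicator {0..1} z \<partial>lborel) = ennreal (ln (1 + 1 / c))"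
proof -
  have "(\<integral>\<^sup>+z. ennreal (1 / (z + c)) * indicator {0..1} z \<partial>lborel) = ennreal (ln (1 + c) - ln (0 + c))"
  proof (rule nn_integral_FTC_Icc)
    fix z :: real assume "z \<in> {0..1}"
    then have "z + c > 0" using c by auto
    then show "((\<lambda>z. ln (z + c)) has_real_derivative 1 / (z + c)) (at z)"
      by (auto intro!: derivative_eq_intros)
    show "0 \<le> 1 / (z + c)" using \<open>z + c > 0\<close> by simp
  qed auto
  also have "ln (1 + c) - ln (0 + c) = ln ((1 + c) / c)" using c by (simp add: ln_div)
  also have "(1 + c) / c = 1 + 1 / c" using c by (simp add: field_simps)
  finally show ?thesis .
qed

context vortex_lattice
begin

text \<open>By Tonelli the inverse square integrates in one coordinate to at most
  \<open>1 / (a + \<delta>)\<close>, and this integrates in the other coordinate to the logarithm.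
  The prefactor bounds the area of the cells that cover \<open>U\<close>.\<close>

lemma profile_integral:
  assumes m: "M / l < real m" and U: "\<And>x. x \<in> U \<Longrightarrow> norm x \<le> M"
  shows "(\<integral>\<^sup>+x\<in>U. ennreal (profile x) \<partial>lebesgue) \<le> ennreal ((l * (2 * real m))\<^sup>2 * ln (1 + 1 / \<delta>))"
proof -
  let ?B = "{x. \<bar>x\<bar> \<le> M}"
  let ?a = "\<lambda>x. \<bar>1 - 2 * frac (x / l)\<bar>"
  define F where "F x = ennreal (profile x) * (indicator ?B (x $ 1) * indicator ?B (x $ 2))" for x :: "real^2"
  have Fm [measurable]: "F \<in> borel_measurable borel" unfolding F_def profile_def by measurable
  have "(\<integral>\<^sup>+x\<in>U. ennreal (profile x) \<partial>lebesgue) \<le> (\<integral>\<^sup>+x. F x \<partial>lebesgue)"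
  proof (rule nn_integral_mono)
    fix x :: "real^2"
    have "\<bar>x $ i\<bar> \<le> M" if "x \<in> U" for i using component_le_norm_cart[of x i] U[OF that] by simp
    then show "ennreal (profile x) * indicator U x \<le> F x" by (auto simp: F_def indicator_def)
  qed
  also have "\<dots> = (\<integral>\<^sup>+x. F x \<partial>lborel)" by (rule nn_integral_completion)
  also have "\<dots> = (\<integral>\<^sup>+a. (\<integral>\<^sup>+b. F (a *\<^sub>R axis 1 1 + b *\<^sub>R axis 2 1) \<partial>lborel) \<partial>lborel)" by (rule nn_integral_vec2[OF Fm])
  also have "\<dots> \<le> (\<integral>\<^sup>+a. ennreal (l * (2 * real m)) * (ennreal (1 / (?a a + \<delta>)) * indicator ?B a) \<partial>lborel)"
  proof (rule nn_integral_mono)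
    fix a :: real
    have "F (a *\<^sub>R axis 1 1 + b *\<^sub>R axis 2 1) = indicator ?B a * (ennreal (1 / ((?a a + \<delta>) + ?a b)\<^sup>2) * indicator ?B b)" for b
      by (simp add: F_def profile_def axis_def add_ac mult_ac)
    then have "(\<integral>\<^sup>+b. F (a *\<^sub>R axis 1 1 + b *\<^sub>R axis 2 1) \<partial>lborel) = indicator ?B a * (\<integral>\<^sup>+b. ennreal (1 / ((?a a + \<delta>) + ?a b)\<^sup>2) * indicator ?B b \<partial>lborel)"
      by (simp add: nn_integral_cmult)
    also have "\<dots> \<le> indicator ?B a * (ennreal (l * (2 * real m)) * (\<integral>\<^sup>+z. ennreal (1 / ((?a a + \<delta>) + z)\<^sup>2) * indicator {0..1} z \<partial>lborel))"
      by (intro mult_left_mono nn_integral_sawtooth_scaled[where G = "\<lambda>z. ennreal (1 / ((?a a + \<delta>) + z)\<^sup>2)"] l_pos m) auto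
    also have "\<dots> \<le> indicator ?B a * (ennreal (l * (2 * real m)) * ennreal (1 / (?a a + \<delta>)))"
      using \<delta>_pos by (intro mult_left_mono nn_integral_inverse_square_le) auto
    finally show "(\<integral>\<^sup>+b. F (a *\<^sub>R axis 1 1 + b *\<^sub>R axis 2 1) \<partial>lborel) \<le> ennreal (l * (2 * real m)) * (ennreal (1 / (?a a + \<delta>)) * indicator ?B a)"
      by (simp add: mult_ac)
  qed
  also have "\<dots> = ennreal (l * (2 * real m)) * (\<integral>\<^sup>+a. ennreal (1 / (?a a + \<delta>)) * indicator ?B a \<partial>lborel)"
    by (rule nn_integral_cmult) measurable
  also have "\<dots> \<le> ennreal (l * (2 * real m)) * (ennreal (l * (2 * real m)) * (\<integral>\<^sup>+z. ennreal (1 / (z + \<delta>)) * indicator {0..1} z \<partial>lborel))"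
    by (intro mult_left_mono nn_integral_sawtooth_scaled[where G = "\<lambda>z. ennreal (1 / (z + \<delta>))"] l_pos m) auto
  also have "\<dots> = ennreal ((l * (2 * real m))\<^sup>2 * ln (1 + 1 / \<delta>))"
    unfolding nn_integral_inverse[OF \<delta>_pos] using l_pos \<delta>_pos
    by (simp add: power2_eq_square mult.assoc ennreal_mult[symmetric] ln_ge_zero)
  finally show ?thesis .
qed

end

section \<open>The uniform field as comparison potential\<close>

lemma smooth_bounded_linear:
  fixes T :: "real^'n::finite \<Rightarrow> 'b::euclidean_space"
  assumes "bounded_linear T"
  shows "smooth T" "pderiv_at i T x = T (axis i 1)"
proof -
  have d: "(T has_derivative T) (at x)" for x by (rule bounded_linear_imp_has_derivative[OF assms])
  show p: "pderiv_at i T x = T (axis i 1)" for i x by (rule pderiv_at_eq[OF d])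
  have "Ck k T" for k
  proof (cases k)
    case 0 then show ?thesis by (simp add: linear_continuous_on assms)
  next
    case (Suc m)
    have "pderiv_at i T = (\<lambda>x. T (axis i 1))" for i by (rule ext) (rule p)
    then show ?thesis using Suc differentiableI[OF d] by (simp add: Ck_const)
  qed
  then show "smooth T" by (simp add: smooth_def)
qed

lemma smooth_has_weak_pderiv:
  fixes f :: "real^'n::finite \<Rightarrow> 'b::euclidean_space"
  assumes "smooth f"
  shows "has_weak_pderiv U i f (pderiv_at i f)"
  by (rule has_weak_pderiv_differentiable[OF smooth_differentiable[OF assms] bounded_on_balls_continuous[OF smooth_continuous[OF smooth_pderiv[OF assms]]]])

lemma smooth_H1_loc:
  fixes f :: "real^'n::finite \<Rightarrow> 'b::euclidean_space"
  assumes "smooth f"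
  shows "f \<in> H1_loc UNIV" "AE x in lebesgue. weak_pderiv UNIV i f x = pderiv_at i f x"
proof -
  show "f \<in> H1_loc UNIV"
    unfolding H1_loc_def
    using smooth_has_weak_pderiv[OF assms] Lp_loc_continuous[OF smooth_continuous[OF assms]]
      Lp_loc_continuous[OF smooth_continuous[OF smooth_pderiv[OF assms]]] by blast
  show "AE x in lebesgue. weak_pderiv UNIV i f x = pderiv_at i f x"
    using weak_pderiv_AE[OF open_UNIV smooth_has_weak_pderiv[OF assms]] by simp
qed

lemma Lp_AE_zero:
  fixes f :: "real^'n::finite \<Rightarrow> 'b::euclidean_space"
  assumes f: "AE x in lebesgue. f x = 0" and p: "p \<ge> 1"
  shows "f \<in> Lp p UNIV"
  unfolding Lp_def
proof (intro CollectI conjI)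
  have m: "f \<in> borel_measurable lebesgue"
    by (rule borel_measurable_AE[of "\<lambda>x. 0"]) (use f in \<open>auto elim!: eventually_mono\<close>)
  then show "set_borel_measurable lebesgue UNIV f" by (simp add: set_borel_measurable_def)
  note [measurable] = m
  have "integrable lebesgue (\<lambda>x. norm (f x) ^ p)"
    by (rule integrable_cong_AE_imp[of _ "\<lambda>x. 0"]) (measurable, use f p in \<open>auto elim!: eventually_mono simp: power_0_left\<close>)
  then show "set_integrable lebesgue UNIV (\<lambda>x. norm (f x) ^ p)" by (simp add: set_integrable_def)
qed

lemma a_field_nth: "a_field x $ 1 = - x $ 2 / 2" "a_field x $ 2 = x $ 1 / 2" "a_field x $ 3 = 0"
  by (simp_all add: a_field_def)

lemma bounded_linear_a_field: "bounded_linear (\<lambda>x. h *\<^sub>R a_field x)"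
proof -
  have "linear (\<lambda>x. h *\<^sub>R a_field x)"
    by (rule linearI) (simp_all add: vec_eq_iff forall_3 a_field_nth field_simps)
  then show ?thesis by (simp add: linear_conv_bounded_linear)
qed

lemma weak_curl_a_field: "AE x in lebesgue. weak_curl (\<lambda>x. h *\<^sub>R a_field x) x = h *\<^sub>R e3"
  and weak_div_a_field: "AE x in lebesgue. weak_div (\<lambda>x. h *\<^sub>R a_field x) x = 0"
proof -
  let ?T = "\<lambda>x. h *\<^sub>R a_field x"
  note T = smooth_bounded_linear[OF bounded_linear_a_field[of h]]
  have ae: "AE x in lebesgue. \<forall>i. weak_pderiv UNIV i ?T x = ?T (axis i 1)"
    using smooth_H1_loc(2)[OF T(1)] unfolding T(2) by (simp add: AE_all_countable)
  then show "AE x in lebesgue. weak_curl ?T x = h *\<^sub>R e3"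
    by eventually_elim (simp add: weak_curl_def vec_eq_iff forall_3 e3_def axis_def a_field_nth)
  from ae show "AE x in lebesgue. weak_div ?T x = 0"
    by eventually_elim (simp add: weak_div_def sum_3 axis_def a_field_nth)
qed

lemma zero_Hcheck1: "(\<lambda>x. 0) \<in> Hcheck1"
proof -
  have s: "smooth (\<lambda>x::real^3. 0 :: real^3)" by (rule smooth_const)
  have w: "has_weak_pderiv UNIV i (\<lambda>x::real^3. 0 :: real^3) (\<lambda>x. 0)" for i
    using smooth_has_weak_pderiv[OF s, of UNIV i] by simp
  have ae: "AE x in lebesgue. \<forall>i. weak_pderiv UNIV i (\<lambda>x::real^3. 0 :: real^3) x = 0"
    using smooth_H1_loc(2)[OF s] by (simp add: AE_all_countable)
  have "(\<integral>\<^sup>+x. ennreal (\<Sum>i\<in>UNIV. (norm (pderiv_at i (\<lambda>x::real^3. 0 :: real^3) x - weak_pderiv UNIV i (\<lambda>x. 0) x))\<^sup>2) \<partial>lebesgue) = (\<integral>\<^sup>+x. 0 \<partial>(lebesgue :: (real^3) measure))"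
    by (rule nn_integral_cong_AE) (use ae in \<open>auto elim!: eventually_mono\<close>)
  then have "(\<lambda>k::nat. \<integral>\<^sup>+x. ennreal (\<Sum>i\<in>UNIV. (norm (pderiv_at i (\<lambda>x::real^3. 0 :: real^3) x - weak_pderiv UNIV i (\<lambda>x. 0) x))\<^sup>2) \<partial>lebesgue) \<longlonglongrightarrow> 0"
    by simp
  moreover have "(\<lambda>x::real^3. 0 :: real^3) \<in> test_functions UNIV" using s by (simp add: test_functions_def)
  moreover have "(\<lambda>x::real^3. 0 :: real^3) \<in> Lp 2 UNIV" by (rule Lp_AE_zero) auto
  ultimately show ?thesis unfolding Hcheck1_def using w
    by (intro CollectI conjI allI exI[of _ "\<lambda>x. 0"] exI[of _ "\<lambda>k x. 0"]) auto
qed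

lemma a_field_K_space: "(\<lambda>x. h *\<^sub>R a_field x) \<in> K_space h"
proof -
  have "AE x in lebesgue. weak_curl (\<lambda>x. h *\<^sub>R a_field x) x - h *\<^sub>R e3 = 0"
    using weak_curl_a_field[of h] by eventually_elim simp
  then have "(\<lambda>x. weak_curl (\<lambda>x. h *\<^sub>R a_field x) x - h *\<^sub>R e3) \<in> Lp 2 UNIV" by (rule Lp_AE_zero) simp
  moreover have "(\<lambda>x::real^3. 0 :: real^3) \<in> Lp 6 UNIV" by (rule Lp_AE_zero) auto
  ultimately show ?thesis
    unfolding K_space_def E_space_def
    using smooth_H1_loc(1)[OF smooth_bounded_linear(1)[OF bounded_linear_a_field]] weak_div_a_field zero_Hcheck1 by simp
qed

lemma layer_potential_a_field:
  "AE y in lebesgue. layer_potential (\<lambda>x. h *\<^sub>R a_field x) t y = hat (h *\<^sub>R a_field (at_height y t))"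
proof -
  let ?f = "\<lambda>x. hat (h *\<^sub>R a_field x)"
  have bl: "bounded_linear ?f" by (rule bounded_linear_compose[OF bounded_linear_hat bounded_linear_a_field])
  note s = smooth_bounded_linear(1)[OF bl]
  have "AE y in lebesgue. plane_trace t ?f y = slab_trace t ?f (pderiv_at 3 ?f) y"
  proof (rule plane_trace_slab_trace(2)[OF smooth_H1_loc(1)[OF s]])
    show "?f \<in> borel_measurable borel" "pderiv_at 3 ?f \<in> borel_measurable borel"
      by (intro borel_measurable_continuous_onI smooth_continuous smooth_pderiv s)+
    show "AE x in lebesgue. pderiv_at 3 ?f x = weak_pderiv UNIV 3 ?f x"
      using smooth_H1_loc(2)[OF s, of 3] by eventually_elim simp
  qed simp
  then show ?thesis unfolding layer_potential_def smooth_slab_trace[OF s, symmetric] .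
qed

text \<open>The magnetic term vanishes because the curl of \<open>h *\<^sub>R a_field x\<close> is
  the applied field, and the coupling vanishes because all layers carry the same function while the
  third component of the potential is zero. What remains is \<open>N + 1\<close> copies of one
  planar energy with total weight \<open>L * (N + 1) / N\<close>, hence a constant independent of
  \<open>N\<close> and \<open>lam\<close>.\<close>

lemma trial_configuration:
  assumes U: "open \<Omega>" "bounded \<Omega>" and L: "L > 0"
  obtains C where "C > 0" "\<And>h \<epsilon> N. h \<ge> 2 \<Longrightarrow> \<epsilon> > 0 \<Longrightarrow> N \<ge> 1 \<Longrightarrow>
     \<exists>v B. LD_admissible \<Omega> N h v B \<and>
       LD_energy \<Omega> lam \<epsilon> (L / real N) N h v B \<le> ennreal (C * h * ln (1 + sqrt (2 * pi / h) / \<epsilon>))"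
proof -
  obtain M0 where M0: "\<And>x. x \<in> \<Omega> \<Longrightarrow> norm x \<le> M0" using U(2) unfolding bounded_iff by blast
  define M where "M = max M0 0"
  have M: "M \<ge> 0" "\<And>x. x \<in> \<Omega> \<Longrightarrow> norm x \<le> M" using M0 by (auto simp: M_def le_max_iff_disj)
  \<comment> \<open>The factor \<open>2 * L\<close> bounds the total weight of the layers, 60000 is
    15000 times the square of the 2 in the cell count, and \<open>M\<^sup>2 + 1\<close> measures the
    area to be covered.\<close>
  define C where "C = 2 * L * (60000 * (M\<^sup>2 + 1))"
  have C: "C > 0" using L by (simp add: C_def add_nonneg_pos)
  have main: "\<exists>v B. LD_admissible \<Omega> N h v B \<and>
       LD_energy \<Omega> lam \<epsilon> (L / real N) N h v B \<le> ennreal (C * h * ln (1 + sqrt (2 * pi / h) / \<epsilon>))"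
    if h: "h \<ge> 2" and e: "\<epsilon> > 0" and N: "N \<ge> 1" for h \<epsilon> N
  proof -
    define l where "l = sqrt (2 * pi / h)"
    define \<delta> where "\<delta> = \<epsilon> / l"
    have l: "l > 0" using h by (simp add: l_def)
    have \<delta>: "\<delta> > 0" using e l by (simp add: \<delta>_def)
    interpret vortex_lattice l \<delta> using l \<delta> by unfold_locales
    have l2: "l\<^sup>2 = 2 * pi / h" using h by (simp add: l_def)
    have fh: "field = h" using h by (simp add: field_def l2)
    have el: "\<epsilon> = \<delta> * l" using l by (simp add: \<delta>_def)
    \<comment> \<open>The number of cells between the origin and the edge of a square containing
      \<Omega>, rounded up strictly.\<close>
    define m where "m = nat \<lfloor>M / l\<rfloor> + 1"
    have Ml: "0 \<le> M / l" using M l by simp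
    have m1: "M / l < real m" "real m \<le> M / l + 1" using Ml unfolding m_def by linarith+
    let ?B = "\<lambda>x. h *\<^sub>R a_field x"
    let ?v = "\<lambda>n::nat. trial"
    let ?E = "60000 * (M\<^sup>2 + 1) * h * ln (1 + l / \<epsilon>)"
    have ln0: "0 \<le> ln (1 + l / \<epsilon>)" using l e by (intro ln_ge_zero) simp
    have adm: "LD_admissible \<Omega> N h ?v ?B" unfolding LD_admissible_def using trial_H1[OF U] a_field_K_space by blast
    have layer: "(\<integral>\<^sup>+y\<in>\<Omega>. ennreal (1/2 * (norm (cov_grad \<Omega> (layer_potential ?B t) trial y))\<^sup>2
         + 1 / (4 * \<epsilon>\<^sup>2) * (1 - (cmod (trial y))\<^sup>2)\<^sup>2) \<partial>lebesgue) \<le> ennreal ?E" for t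
    proof -
      have ae: "AE y in lebesgue. \<forall>j. y \<in> \<Omega> \<longrightarrow> weak_pderiv \<Omega> j trial y = pderiv_at j trial y"
        unfolding AE_all_countable using weak_pderiv_AE[OF U(1) trial_weak_pderiv] by blast
      have "(\<integral>\<^sup>+y\<in>\<Omega>. ennreal (1/2 * (norm (cov_grad \<Omega> (layer_potential ?B t) trial y))\<^sup>2
         + 1 / (4 * \<epsilon>\<^sup>2) * (1 - (cmod (trial y))\<^sup>2)\<^sup>2) \<partial>lebesgue) \<le> (\<integral>\<^sup>+y. ennreal (15000 / l\<^sup>2) * (ennreal (profile y) * indicator \<Omega> y) \<partial>lebesgue)"
      proof (rule nn_integral_mono_AE)
        show "AE y in lebesgue. ennreal (1/2 * (norm (cov_grad \<Omega> (layer_potential ?B t) trial y))\<^sup>2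
         + 1 / (4 * \<epsilon>\<^sup>2) * (1 - (cmod (trial y))\<^sup>2)\<^sup>2) * indicator \<Omega> y \<le> ennreal (15000 / l\<^sup>2) * (ennreal (profile y) * indicator \<Omega> y)"
          using ae layer_potential_a_field[of h t]
        proof eventually_elim
          case (elim y)
          show ?case
          proof (cases "y \<in> \<Omega>")
            case True
            have "layer_potential ?B t y = pot y"
              using elim(2) by (simp add: pot_def fh vec_eq_iff forall_2 a_field_nth)
            then have cg: "cov_grad \<Omega> (layer_potential ?B t) trial y = (\<chi> j. pderiv_at j trial y - \<i> * complex_of_real (pot y $ j) * trial y)"
              using elim(1) True by (simp add: cov_grad_def)
            have "ennreal (1/2 * (norm (cov_grad \<Omega> (layer_potential ?B t) trial y))\<^sup>2
         + 1 / (4 * \<epsilon>\<^sup>2) * (1 - (cmod (trial y))\<^sup>2)\<^sup>2) \<le> ennreal (15000 / l\<^sup>2 * profile y)"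
              unfolding cg by (rule ennreal_leI[OF trial_energy_density[OF el, of y]])
            also have "\<dots> = ennreal (15000 / l\<^sup>2) * ennreal (profile y)" by (intro ennreal_mult) (simp_all add: profile_def)
            finally show ?thesis using True by simp
          qed simp
        qed
      qed
      also have "\<dots> = ennreal (15000 / l\<^sup>2) * (\<integral>\<^sup>+y\<in>\<Omega>. ennreal (profile y) \<partial>lebesgue)"
      proof (rule nn_integral_cmult)
              have "profile \<in> borel_measurable borel" unfolding profile_def[abs_def] by measurable
        then have [measurable]: "profile \<in> borel_measurable lebesgue" by (rule borel_measurable_lebesgueI)
        have [measurable]: "\<Omega> \<in> sets lebesgue" using U(1) by auto
        show "(\<lambda>y. ennreal (profile y) * indicator \<Omega> y) \<in> borel_measurable lebesgue" by measurable
      qed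
      also have "\<dots> \<le> ennreal (15000 / l\<^sup>2) * ennreal ((l * (2 * real m))\<^sup>2 * ln (1 + 1 / \<delta>))"
        by (intro mult_left_mono profile_integral[OF m1(1) M(2)]) auto
      also have "\<dots> = ennreal (15000 / l\<^sup>2 * ((l * (2 * real m))\<^sup>2 * ln (1 + 1 / \<delta>)))"
        by (rule ennreal_mult[symmetric]) (use ln0 in \<open>auto simp: \<delta>_def\<close>)
      also have "15000 / l\<^sup>2 * ((l * (2 * real m))\<^sup>2 * ln (1 + 1 / \<delta>)) = 60000 * (real m)\<^sup>2 * ln (1 + l / \<epsilon>)"
        using l by (simp add: \<delta>_def power_mult_distrib)
      also have "ennreal \<dots> \<le> ennreal ?E"
      proof (intro ennreal_leI mult_right_mono ln0)
        \<comment> \<open>The cell count is of order \<open>h\<close> because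
          \<open>l\<^sup>2 = 2 * pi / h\<close>; the additive 2 caused by rounding is absorbed by
          the assumption \<open>h \<ge> 2\<close>.\<close>
        have sq: "(x + 1)\<^sup>2 \<le> 2 * x\<^sup>2 + 2" for x :: real
          using zero_le_power2[of "x - 1"] by (simp add: power2_eq_square algebra_simps)
        have "(real m)\<^sup>2 \<le> (M / l + 1)\<^sup>2" using m1 by (intro power_mono) auto
        also have "\<dots> \<le> 2 * (M / l)\<^sup>2 + 2" by (rule sq)
        also have "2 * (M / l)\<^sup>2 = M\<^sup>2 * h / pi" using h by (simp add: power_divide l2)
        also have "M\<^sup>2 * h / pi \<le> M\<^sup>2 * h" using h pi_ge_two mult_left_mono[of 1 pi "M\<^sup>2 * h"] by (simp add: divide_le_eq)
        finally have "(real m)\<^sup>2 \<le> (M\<^sup>2 + 1) * h" using h by (simp add: algebra_simps)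
        then show "60000 * (real m)\<^sup>2 \<le> 60000 * (M\<^sup>2 + 1) * h" unfolding mult.assoc by (rule mult_left_mono) simp
      qed
      finally show ?thesis .
    qed
    have mag: "(\<integral>\<^sup>+x. ennreal ((norm (weak_curl ?B x - h *\<^sub>R e3))\<^sup>2) \<partial>lebesgue) = (\<integral>\<^sup>+x. 0 \<partial>(lebesgue :: (real^3) measure))"
      by (rule nn_integral_cong_AE) (use weak_curl_a_field[of h] in \<open>auto elim!: eventually_mono\<close>)
    have "LD_energy \<Omega> lam \<epsilon> (L / real N) N h ?v ?B = ennreal (L / real N) * (\<Sum>n=0..N. \<integral>\<^sup>+y\<in>\<Omega>. ennreal (
         1/2 * (norm (cov_grad \<Omega> (layer_potential ?B (real n * (L / real N))) trial y))\<^sup>2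
         + 1 / (4 * \<epsilon>\<^sup>2) * (1 - (cmod (trial y))\<^sup>2)\<^sup>2) \<partial>lebesgue)"
      unfolding LD_energy_def mag by (simp add: a_field_nth)
    also have "\<dots> \<le> ennreal (L / real N) * (\<Sum>n=0..N. ennreal ?E)" by (intro mult_left_mono sum_mono layer) auto
    also have "(\<Sum>n=0..N. ennreal ?E) = ennreal (real (N + 1) * ?E)"
      by (simp add: ennreal_of_nat_eq_real_of_nat[symmetric] ennreal_mult' del: of_nat_Suc of_nat_add)
    also have "ennreal (L / real N) * ennreal (real (N + 1) * ?E) = ennreal (L / real N * (real (N + 1) * ?E))"
      using L by (intro ennreal_mult'[symmetric]) auto
    also have "\<dots> \<le> ennreal (2 * L * ?E)"
    proof (rule ennreal_leI)
      have "0 \<le> ?E" using h ln0 by (intro mult_nonneg_nonneg) auto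
      moreover have "L / real N * real (N + 1) \<le> 2 * L"
        using N L by (simp add: divide_le_eq field_simps)
      ultimately have "L / real N * real (N + 1) * ?E \<le> 2 * L * ?E" by (intro mult_right_mono) auto
      then show "L / real N * (real (N + 1) * ?E) \<le> 2 * L * ?E" by (simp add: mult.assoc)
    qed
    also have "2 * L * ?E = C * h * ln (1 + sqrt (2 * pi / h) / \<epsilon>)" by (simp add: C_def l_def)
    finally show ?thesis using adm by blast
  qed
  show ?thesis by (rule that[OF C main])
qed

section \<open>Truncation of minimizers\<close>

definition unit_bound :: "'a::real_normed_vector \<Rightarrow> real" where
  "unit_bound z = max 1 (norm z)"

text \<open>The radial profile \<open>2 - 1 / r\<close> outside the unit disc is chosen to match the identity to first order at \<open>r = 1\<close> and to be a contraction that stays above \<open>1\<close>.\<close>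

definition truncate :: "'a::real_inner \<Rightarrow> 'a" where
  "truncate z = (2 / unit_bound z - 1 / (unit_bound z)\<^sup>2) *\<^sub>R z"

definition truncate_deriv :: "'a::real_inner \<Rightarrow> 'a \<Rightarrow> 'a" where
  "truncate_deriv z w = (2 / unit_bound z - 1 / (unit_bound z)\<^sup>2) *\<^sub>R w
     + ((2 / (unit_bound z) ^ 4 - 2 / (unit_bound z) ^ 3) * (z \<bullet> w)) *\<^sub>R z"

lemma unit_bound: "unit_bound z \<ge> 1" "norm z \<le> unit_bound z" "unit_bound z > 0"
  by (auto simp: unit_bound_def)

lemma truncate_id: "norm z \<le> 1 \<Longrightarrow> truncate z = z"
  by (simp add: truncate_def unit_bound_def max_absorb1)

lemma norm_truncate_ge: "norm z \<ge> 1 \<Longrightarrow> norm (truncate z) = 2 - 1 / norm z"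
proof -
  assume z: "norm z \<ge> 1"
  then have z0: "norm z > 0" by linarith
  have "2 / norm z - 1 / (norm z)\<^sup>2 = (2 - 1 / norm z) / norm z" using z0 by (simp add: field_simps power2_eq_square)
  moreover have "0 \<le> 2 - 1 / norm z" using z by (simp add: divide_le_eq)
  ultimately show ?thesis using z z0 by (simp add: truncate_def unit_bound_def max_absorb2)
qed

lemma norm_truncate_gt:
  assumes "norm z > 1"
  shows "1 < norm (truncate z)" "norm (truncate z) < norm z"
proof -
  have z0: "norm z > 0" using assms by linarith
  have "1 / norm z < 1" using assms by (simp add: divide_less_eq)
  then show "1 < norm (truncate z)" using assms by (simp add: norm_truncate_ge)
  have "0 < (norm z - 1)\<^sup>2" using assms by simp
  then have "2 * norm z < (norm z)\<^sup>2 + 1" by (simp add: power2_eq_square algebra_simps)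
  then have "2 - 1 / norm z < norm z" using z0 by (simp add: field_simps power2_eq_square)
  then show "norm (truncate z) < norm z" using assms by (simp add: norm_truncate_ge)
qed

lemma truncate_has_derivative: "(truncate has_derivative truncate_deriv z) (at z)"
proof -
  let ?f = "\<lambda>z::'a. (2 / norm z - 1 / (norm z)\<^sup>2) *\<^sub>R z"
  have outer: "(?f has_derivative truncate_deriv z) (at z)" if z: "norm z \<ge> 1"
  proof -
    have z0: "z \<noteq> 0" using z by auto
    have u: "unit_bound z = norm z" using z by (simp add: unit_bound_def)
    let ?D = "\<lambda>w. (2 / norm z - 1 / (norm z)\<^sup>2) *\<^sub>R w + ((2 / norm z ^ 3 - 2 / (norm z)\<^sup>2) * (w \<bullet> sgn z)) *\<^sub>R z"
    have "(?f has_derivative ?D) (at z)"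
      by (rule derivative_eq_intros has_derivative_norm z0 refl | simp add: z0)+
         (simp add: fun_eq_iff z0 field_simps power2_eq_square power3_eq_cube)
    moreover have "?D = truncate_deriv z"
      using z0 by (simp add: fun_eq_iff truncate_deriv_def u sgn_div_norm inner_commute field_simps power2_eq_square power3_eq_cube power4_eq_xxxx)
    ultimately show ?thesis by simp
  qed
  have inner: "((\<lambda>z. z) has_derivative truncate_deriv z) (at z)" if "norm z \<le> 1"
  proof -
    have "truncate_deriv z = (\<lambda>w. w)" using that by (simp add: fun_eq_iff truncate_deriv_def unit_bound_def max_absorb1)
    then show ?thesis by simp
  qed
  have out: "?f y = truncate y" if "norm y \<ge> 1" for y using that by (simp add: truncate_def unit_bound_def max_absorb2)
  consider "norm z < 1" | "norm z = 1" | "norm z > 1" by linarith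
  then show ?thesis
  proof cases
    case 1
    show ?thesis
    proof (rule has_derivative_transform_within_open[OF inner])
      show "norm z \<le> 1" using 1 by simp
      show "open (ball (0::'a) 1)" "z \<in> ball 0 1" using 1 by auto
      show "y = truncate y" if "y \<in> ball 0 1" for y using that by (simp add: truncate_id)
    qed
  next
    case 2
    show ?thesis
    proof (rule has_derivative_glue[OF inner outer])
      show "norm z \<le> 1" "1 \<le> norm z" "z = truncate z" "?f z = truncate z" using 2 truncate_id[of z] out[of z] by simp_all
      show "(0::real) < 1" by simp
      show "truncate y = y \<or> truncate y = ?f y" for y
        using truncate_id[of y] out[of y] by (cases "norm y \<le> 1") auto
    qed
  next
    case 3
    show ?thesis
    proof (rule has_derivative_transform_within_open[OF outer])
      show "1 \<le> norm z" using 3 by simp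
      show "open (- cball (0::'a) 1)" "z \<in> - cball 0 1" using 3 by auto
      show "?f y = truncate y" if "y \<in> - cball 0 1" for y using that by (intro out) simp
    qed
  qed
qed

text \<open>In the squared norm the radial corrections combine to
  \<open>k * (2 * g + k * (norm z)\<^sup>2) * (z \<bullet> w)\<^sup>2\<close>. Here
  \<open>k \<le> 0\<close>, and the bracket is at least its value \<open>2 / m\<close> at
  \<open>norm z = m\<close>, so the correction only shortens; the remaining factor satisfies
  \<open>g \<le> 1\<close> because \<open>(m - 1)\<^sup>2 \<ge> 0\<close>.\<close>

lemma norm_truncate_deriv_le: "norm (truncate_deriv z w) \<le> norm w"
proof -
  define m where "m = unit_bound z"
  define g where "g = 2 / m - 1 / m\<^sup>2"
  define k where "k = 2 / m ^ 4 - 2 / m ^ 3"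
  have m: "m \<ge> 1" "norm z \<le> m" "m > 0" using unit_bound[of z] by (simp_all add: m_def)
  have k0: "k \<le> 0"
  proof -
    have "2 / m ^ 4 \<le> 2 / m ^ 3" using m by (intro divide_left_mono power_increasing) auto
    then show ?thesis by (simp add: k_def)
  qed
  have g: "0 \<le> g" "g \<le> 1"
  proof -
    have e: "g = (2 * m - 1) / m\<^sup>2" using m by (simp add: g_def field_simps power2_eq_square)
    show "0 \<le> g" unfolding e using m by simp
    have "2 * m - 1 \<le> m\<^sup>2" using zero_le_power2[of "m - 1"] by (simp add: power2_eq_square algebra_simps)
    then show "g \<le> 1" unfolding e using m by (simp add: divide_le_eq)
  qed
  have s: "0 \<le> 2 * g + k * (norm z)\<^sup>2"
  proof -
    have "k * m\<^sup>2 \<le> k * (norm z)\<^sup>2" using k0 m by (intro mult_left_mono_neg power_mono) auto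
    moreover have "2 * g + k * m\<^sup>2 = 2 / m" using m by (simp add: g_def k_def field_simps power2_eq_square power3_eq_cube power4_eq_xxxx)
    ultimately show ?thesis using m by (smt (verit) divide_nonneg_pos)
  qed
  have "(norm (truncate_deriv z w))\<^sup>2 = g\<^sup>2 * (norm w)\<^sup>2 + k * (2 * g + k * (norm z)\<^sup>2) * (z \<bullet> w)\<^sup>2"
    unfolding truncate_deriv_def m_def[symmetric] g_def[symmetric] k_def[symmetric] power2_norm_eq_inner
    by (simp add: inner_add_left inner_add_right inner_commute power2_eq_square algebra_simps)
  also have "\<dots> \<le> g\<^sup>2 * (norm w)\<^sup>2"
    using mult_nonpos_nonneg[OF mult_nonpos_nonneg[OF k0 s], of "(z \<bullet> w)\<^sup>2"] by simp
  also have "\<dots> \<le> 1\<^sup>2 * (norm w)\<^sup>2" using g by (intro mult_right_mono power_mono) auto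
  finally show ?thesis by (intro power2_le_imp_le[OF _ norm_ge_zero]) simp
qed

interpretation truncate: contraction_C1 "truncate :: 'a::euclidean_space \<Rightarrow> 'a" truncate_deriv
proof
  fix z w :: 'a
  show "(truncate has_derivative truncate_deriv z) (at z)" by (rule truncate_has_derivative)
  show "norm (truncate_deriv z w) \<le> norm w" by (rule norm_truncate_deriv_le)
  have "(unit_bound :: 'a \<Rightarrow> real) z \<noteq> 0" for z using unit_bound(3)[of z] by simp
  moreover have "continuous_on UNIV (unit_bound :: 'a \<Rightarrow> real)" unfolding unit_bound_def[abs_def] by (intro continuous_intros)
  ultimately show "continuous_on UNIV (\<lambda>z. truncate_deriv z w)"
    unfolding truncate_deriv_def by (intro continuous_intros) auto
qed

lemma truncate_0: "truncate 0 = 0" by (simp add: truncate_def)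

text \<open>Equivariance under phase changes allows the truncation to pass through the phase factor
  in the coupling between layers.\<close>

lemma truncate_mult_unimodular:
  fixes z w :: complex
  assumes "cmod w = 1"
  shows "truncate (z * w) = truncate z * w"
  using assms by (simp add: truncate_def unit_bound_def norm_mult scaleR_conv_of_real)

text \<open>The infinitesimal form of the equivariance. It lets the term with the potential pass
  through the derivative, so that a covariant gradient is mapped by \<open>truncate_deriv\<close>
  like an ordinary one.\<close>

lemma truncate_deriv_rotation:
  fixes z :: complex
  shows "truncate_deriv z (\<i> * of_real b * z) = \<i> * of_real b * truncate z"
proof -
  have "z \<bullet> (\<i> * of_real b * z) = 0" by (simp add: inner_complex_def)
  then show ?thesis by (simp add: truncate_deriv_def truncate_def scaleR_conv_of_real)
qed

lemma truncate_cov_grad: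
  fixes u :: "real^2 \<Rightarrow> complex"
  assumes U: "open \<Omega>" and u: "u \<in> H1 \<Omega>"
  shows "AE y in lebesgue. y \<in> \<Omega> \<longrightarrow> norm (cov_grad \<Omega> B (\<lambda>y. truncate (u y)) y) \<le> norm (cov_grad \<Omega> B u y)"
proof -
  have "AE y in lebesgue. \<forall>j. y \<in> \<Omega> \<longrightarrow> weak_pderiv \<Omega> j (\<lambda>y. truncate (u y)) y = truncate_deriv (u y) (weak_pderiv \<Omega> j u y)"
    unfolding AE_all_countable using truncate.H1_compose(2)[OF U u truncate_0] by blast
  then show ?thesis
  proof eventually_elim
    case (elim y)
    show ?case
    proof (intro impI norm_le_componentwise_cart)
      fix j assume y: "y \<in> \<Omega>"
      have "cov_grad \<Omega> B (\<lambda>y. truncate (u y)) y $ j = truncate_deriv (u y) (weak_pderiv \<Omega> j u y) - truncate_deriv (u y) (\<i> * of_real (B y $ j) * u y)"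
        using elim y by (simp add: cov_grad_def truncate_deriv_rotation)
      also have "\<dots> = truncate_deriv (u y) (cov_grad \<Omega> B u y $ j)"
        by (simp add: cov_grad_def linear_diff[OF truncate.linear'])
      finally show "norm (cov_grad \<Omega> B (\<lambda>y. truncate (u y)) y $ j) \<le> norm (cov_grad \<Omega> B u y $ j)"
        by (simp add: norm_truncate_deriv_le)
    qed
  qed
qed

lemma truncate_potential_le:
  "(1 - (norm (truncate z))\<^sup>2)\<^sup>2 \<le> (1 - (norm z)\<^sup>2)\<^sup>2"
  "norm z > 1 \<Longrightarrow> (1 - (norm (truncate z))\<^sup>2)\<^sup>2 < (1 - (norm z)\<^sup>2)\<^sup>2"
proof -
  show lt: "(1 - (norm (truncate z))\<^sup>2)\<^sup>2 < (1 - (norm z)\<^sup>2)\<^sup>2" if "norm z > 1" for z :: 'a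
  proof -
    have "1\<^sup>2 < (norm (truncate z))\<^sup>2" "(norm (truncate z))\<^sup>2 < (norm z)\<^sup>2"
      using norm_truncate_gt[OF that] by (intro power_strict_mono; simp)+
    then have "((norm (truncate z))\<^sup>2 - 1)\<^sup>2 < ((norm z)\<^sup>2 - 1)\<^sup>2" by (intro power_strict_mono) auto
    then show ?thesis by (simp add: power2_commute)
  qed
  show "(1 - (norm (truncate z))\<^sup>2)\<^sup>2 \<le> (1 - (norm z)\<^sup>2)\<^sup>2"
    using lt[of z] truncate_id[of z] by (cases "norm z > 1") auto
qed

section \<open>The modulus of minimizers\<close>

lemma indicator_weak_pderiv_measurable:
  fixes u :: "real^'n::finite \<Rightarrow> 'b::euclidean_space"
  assumes U: "open \<Omega>" and u: "u \<in> H1 \<Omega>"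
  shows "(\<lambda>y. indicator \<Omega> y *\<^sub>R u y) \<in> borel_measurable lebesgue"
    "(\<lambda>y. indicator \<Omega> y *\<^sub>R weak_pderiv \<Omega> j u y) \<in> borel_measurable lebesgue"
proof -
  show "(\<lambda>y. indicator \<Omega> y *\<^sub>R u y) \<in> borel_measurable lebesgue"
    using u by (simp add: H1_def Lp_def set_borel_measurable_def)
  obtain g where g: "has_weak_pderiv \<Omega> j u g" "g \<in> Lp 2 \<Omega>" using u by (auto simp: H1_def)
  show "(\<lambda>y. indicator \<Omega> y *\<^sub>R weak_pderiv \<Omega> j u y) \<in> borel_measurable lebesgue"
  proof (rule borel_measurable_AE)
    show "(\<lambda>y. indicator \<Omega> y *\<^sub>R g y) \<in> borel_measurable lebesgue"
      using g(2) by (simp add: Lp_def set_borel_measurable_def)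
    show "AE y in lebesgue. indicator \<Omega> y *\<^sub>R g y = indicator \<Omega> y *\<^sub>R weak_pderiv \<Omega> j u y"
      using weak_pderiv_AE[OF U g(1)] by eventually_elim (auto simp: indicator_def)
  qed
qed

lemma cov_grad_measurable:
  assumes U: "open \<Omega>" and u: "u \<in> H1 \<Omega>" and [measurable]: "B \<in> borel_measurable lebesgue"
  shows "(\<lambda>y. indicator \<Omega> y *\<^sub>R cov_grad \<Omega> B u y) \<in> borel_measurable lebesgue"
proof -
  note [measurable] = indicator_weak_pderiv_measurable[OF U u]
  have c: "(\<lambda>y. indicator \<Omega> y *\<^sub>R weak_pderiv \<Omega> j u y - \<i> * complex_of_real (B y $ j) * (indicator \<Omega> y *\<^sub>R u y)) \<in> borel_measurable lebesgue" for j
    by measurable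
  have *: "(\<lambda>y. (indicator \<Omega> y *\<^sub>R cov_grad \<Omega> B u y) $ j) \<in> borel_measurable lebesgue" for j
  proof -
    have "(indicator \<Omega> y *\<^sub>R cov_grad \<Omega> B u y) $ j = indicator \<Omega> y *\<^sub>R weak_pderiv \<Omega> j u y - \<i> * complex_of_real (B y $ j) * (indicator \<Omega> y *\<^sub>R u y)" for y
      by (simp only: vector_scaleR_component) (simp add: cov_grad_def scaleR_diff_right)
    then show ?thesis using c[of j] by simp
  qed
  then have "(\<lambda>y. (indicator \<Omega> y *\<^sub>R cov_grad \<Omega> B u y) \<bullet> b) \<in> borel_measurable lebesgue" if "b \<in> Basis" for b :: "complex^2"
  proof -
    have "\<exists>i c. b = axis i c" using that unfolding Basis_vec_def by blast
    then obtain i c where b: "b = axis i c" by blast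
    show ?thesis unfolding b inner_axis by (rule borel_measurable_inner[OF * borel_measurable_const])
  qed
  then show ?thesis
    using borel_measurable_euclidean_space[of "\<lambda>y. indicator \<Omega> y *\<^sub>R cov_grad \<Omega> B u y"] by blast
qed

lemma layer_energy_density_measurable:
  assumes U: "open \<Omega>" and u: "u \<in> H1 \<Omega>" and B: "B \<in> borel_measurable lebesgue"
  shows "(\<lambda>y. ennreal (1/2 * (norm (cov_grad \<Omega> B u y))\<^sup>2 + 1 / (4 * \<epsilon>\<^sup>2) * (1 - (cmod (u y))\<^sup>2)\<^sup>2) * indicator \<Omega> y) \<in> borel_measurable lebesgue"
proof -
  note [measurable] = indicator_weak_pderiv_measurable(1)[OF U u] cov_grad_measurable[OF U u B]
  have [measurable]: "\<Omega> \<in> sets lebesgue" using U by auto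
  have "(\<lambda>y. ennreal (1/2 * (norm (indicator \<Omega> y *\<^sub>R cov_grad \<Omega> B u y))\<^sup>2 + 1 / (4 * \<epsilon>\<^sup>2) * (1 - (cmod (indicator \<Omega> y *\<^sub>R u y))\<^sup>2)\<^sup>2) * indicator \<Omega> y) \<in> borel_measurable lebesgue"
    by measurable
  moreover have "(\<lambda>y. ennreal (1/2 * (norm (indicator \<Omega> y *\<^sub>R cov_grad \<Omega> B u y))\<^sup>2 + 1 / (4 * \<epsilon>\<^sup>2) * (1 - (cmod (indicator \<Omega> y *\<^sub>R u y))\<^sup>2)\<^sup>2) * indicator \<Omega> y)
     = (\<lambda>y. ennreal (1/2 * (norm (cov_grad \<Omega> B u y))\<^sup>2 + 1 / (4 * \<epsilon>\<^sup>2) * (1 - (cmod (u y))\<^sup>2)\<^sup>2) * indicator \<Omega> y)"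
    by (rule ext) (auto simp: indicator_def)
  ultimately show ?thesis by simp
qed

text \<open>A total that does not drop although no term rises forces equality term by term; the
  finite total permits the other terms to be cancelled in \<open>ennreal\<close>.\<close>

lemma ennreal_sum_le_imp_le:
  fixes F G :: "'i \<Rightarrow> ennreal"
  assumes I: "finite I" "k \<in> I" and le: "\<And>i. i \<in> I \<Longrightarrow> G i \<le> F i" and sum: "sum F I \<le> sum G I" "sum F I \<noteq> \<infinity>"
  shows "F k \<le> G k"
proof -
  have "sum F (I - {k}) + F k = sum F I" using I by (simp add: sum.remove add.commute)
  also have "\<dots> \<le> sum G I" by (rule sum(1))
  also have "\<dots> = sum G (I - {k}) + G k" using I by (simp add: sum.remove add.commute)
  also have "\<dots> \<le> sum F (I - {k}) + G k" using le by (intro add_right_mono sum_mono) auto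
  finally have "sum F (I - {k}) + F k \<le> sum F (I - {k}) + G k" .
  moreover have "sum F (I - {k}) \<noteq> \<infinity>"
    using sum(2) sum_mono2[of I "I - {k}" F] I by (auto simp: top.extremum_unique)
  ultimately show ?thesis by (simp add: ennreal_add_left_cancel_le)
qed

text \<open>Truncating all layers at once changes no potential and raises no term, while the quartic
  term of a layer drops strictly if its modulus exceeds one on a set of positive measure. Finite
  energy makes the cancellation of the remaining terms legitimate.\<close>

lemma minimizer_norm_le_1:
  assumes U: "open \<Omega>" and e: "\<epsilon> > 0" and s: "s > 0" and m: "is_LD_minimizer \<Omega> lam \<epsilon> s N h u A"
    and fin: "LD_energy \<Omega> lam \<epsilon> s N h u A \<noteq> \<infinity>" and k: "k \<le> N"
  shows "AE y in lebesgue. y \<in> \<Omega> \<longrightarrow> cmod (u k y) \<le> 1"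
proof (rule ccontr)
  assume bad: "\<not> (AE y in lebesgue. y \<in> \<Omega> \<longrightarrow> cmod (u k y) \<le> 1)"
  define v where "v n y = truncate (u n y)" for n y
  have adm: "LD_admissible \<Omega> N h u A" using m by (simp add: is_LD_minimizer_def)
  then have u: "u n \<in> H1 \<Omega>" if "n \<le> N" for n using that by (simp add: LD_admissible_def)
  have v: "v n \<in> H1 \<Omega>" if "n \<le> N" for n
    unfolding v_def[abs_def] by (rule truncate.H1_compose(1)[OF U u[OF that] truncate_0])
  have A: "A \<in> H1_loc UNIV" using adm by (simp add: LD_admissible_def K_space_def E_space_def)
  define f where "f n w y = ennreal (1/2 * (norm (cov_grad \<Omega> (layer_potential A (real n * s)) (w n) y))\<^sup>2
         + 1 / (4 * \<epsilon>\<^sup>2) * (1 - (cmod (w n y))\<^sup>2)\<^sup>2) * indicator \<Omega> y" for n w y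
  define F where "F w n = (\<integral>\<^sup>+y. f n w y \<partial>lebesgue)" for w n
  define J where "J w = ennreal s * (\<Sum>n<N. \<integral>\<^sup>+y\<in>\<Omega>. ennreal (
         1 / (2 * lam\<^sup>2 * s\<^sup>2) *
         (cmod (w (Suc n) y - w n y *
            exp (\<i> * complex_of_real
               (LINT t:{real n * s..real (Suc n) * s}|lebesgue. A (at_height y t) $ 3))))\<^sup>2)
       \<partial>lebesgue)" for w
  define M where "M = ennreal (1/2) * (\<integral>\<^sup>+x. ennreal ((norm (weak_curl A x - h *\<^sub>R e3))\<^sup>2) \<partial>lebesgue)"
  have En: "LD_energy \<Omega> lam \<epsilon> s N h w A = ennreal s * sum (F w) {0..N} + J w + M" for w
    by (simp only: LD_energy_def F_def[abs_def] f_def[abs_def] J_def M_def)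
  have "LD_energy \<Omega> lam \<epsilon> s N h u A \<le> LD_energy \<Omega> lam \<epsilon> s N h v A"
    using m v adm unfolding is_LD_minimizer_def by (simp add: LD_admissible_def)
  then have le: "ennreal s * sum (F u) {0..N} + J u + M \<le> ennreal s * sum (F v) {0..N} + J v + M" by (simp only: En)
  have finE: "ennreal s * sum (F u) {0..N} + J u + M \<noteq> \<infinity>" by (rule fin[unfolded En])
  have JM: "J u + M \<noteq> \<infinity>" and SF: "ennreal s * sum (F u) {0..N} \<noteq> \<infinity>"
    using finE by (metis add.assoc ennreal_add_eq_top infinity_ennreal_def)+
  \<comment> \<open>The phase factor has modulus one, so the truncated difference is a difference of
    two truncated values, and the contraction property applies at every point.\<close>
  have "J v \<le> J u" unfolding J_def
  proof (intro mult_left_mono sum_mono nn_integral_mono mult_right_mono ennreal_leI power_mono)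
    fix n y
    let ?x = "exp (\<i> * complex_of_real (LINT t:{real n * s..real (Suc n) * s}|lebesgue. A (at_height y t) $ 3))"
    have "cmod ?x = 1" by (rule norm_exp_i_times)
    then have "v n y * ?x = truncate (u n y * ?x)" by (simp only: v_def truncate_mult_unimodular)
    then show "cmod (v (Suc n) y - v n y * ?x) \<le> cmod (u (Suc n) y - u n y * ?x)"
      using truncate.lipschitz[of "u (Suc n) y" "u n y * ?x"] by (simp add: v_def)
  qed auto
  then have "ennreal s * sum (F u) {0..N} + J u + M \<le> ennreal s * sum (F v) {0..N} + J u + M"
    by (intro order_trans[OF le] add_mono order_refl)
  then have "(J u + M) + ennreal s * sum (F u) {0..N} \<le> (J u + M) + ennreal s * sum (F v) {0..N}" by (simp only: ac_simps)
  then have "ennreal s * sum (F u) {0..N} \<le> ennreal s * sum (F v) {0..N}"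
    unfolding ennreal_add_left_cancel_le using JM by blast
  then have sumle: "sum (F u) {0..N} \<le> sum (F v) {0..N}" using s by (subst (asm) ennreal_mult_le_mult_iff) auto
  have sumfin: "sum (F u) {0..N} \<noteq> \<infinity>" using SF s by (auto simp: ennreal_mult_eq_top_iff)
  have fle: "AE y in lebesgue. f n v y \<le> f n u y" if "n \<le> N" for n
    using truncate_cov_grad[OF U u[OF that], of "layer_potential A (real n * s)"]
  proof eventually_elim
    case (elim y)
    show ?case
    proof (cases "y \<in> \<Omega>")
      case True
      have "norm (cov_grad \<Omega> (layer_potential A (real n * s)) (v n) y) \<le> norm (cov_grad \<Omega> (layer_potential A (real n * s)) (u n) y)"
        using elim True by (simp add: v_def[abs_def])
      then have "(norm (cov_grad \<Omega> (layer_potential A (real n * s)) (v n) y))\<^sup>2 \<le> (norm (cov_grad \<Omega> (layer_potential A (real n * s)) (u n) y))\<^sup>2"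
        by (intro power_mono) auto
      moreover have "(1 - (cmod (v n y))\<^sup>2)\<^sup>2 \<le> (1 - (cmod (u n y))\<^sup>2)\<^sup>2" by (simp only: v_def truncate_potential_le)
      ultimately show ?thesis unfolding f_def
        by (intro mult_right_mono ennreal_leI add_mono mult_left_mono) auto
    qed (simp add: f_def)
  qed
  have Fle: "F v n \<le> F u n" if "n \<in> {0..N}" for n
    unfolding F_def using fle that by (intro nn_integral_mono_AE) auto
  have Fk: "F u k \<le> F v k"
    by (rule ennreal_sum_le_imp_le[OF _ _ Fle sumle sumfin]) (use k in auto)
  have Fvk: "F v k \<noteq> \<infinity>"
  proof
    assume i: "F v k = \<infinity>"
    then have "F u k = \<infinity>" using Fle[of k] k by (simp add: top.extremum_unique)
    then show False using sumfin k sum.remove[of "{0..N}" k "F u"] by auto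
  qed
  have meas: "f k w \<in> borel_measurable lebesgue" if "w k \<in> H1 \<Omega>" for w
    unfolding f_def by (rule layer_energy_density_measurable[OF U that layer_potential_measurable[OF A]])
  have "F v k < F u k" unfolding F_def
  proof (rule nn_integral_less)
    show "f k v \<in> borel_measurable lebesgue" "f k u \<in> borel_measurable lebesgue" using k u v by (auto intro!: meas)
    show "(\<integral>\<^sup>+y. f k v y \<partial>lebesgue) \<noteq> \<infinity>" using Fvk by (simp add: F_def)
    show "AE y in lebesgue. f k v y \<le> f k u y" by (rule fle[OF k])
    \<comment> \<open>Where the modulus exceeds one, the quartic term decreases strictly and the
      gradient term does not grow; the reversed inequality would therefore confine the modulus to
      the unit disc almost everywhere.\<close>
    show "\<not> (AE y in lebesgue. f k u y \<le> f k v y)"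
    proof
      assume "AE y in lebesgue. f k u y \<le> f k v y"
      then have "AE y in lebesgue. y \<in> \<Omega> \<longrightarrow> cmod (u k y) \<le> 1"
        using truncate_cov_grad[OF U u[OF k], of "layer_potential A (real k * s)"]
      proof eventually_elim
        case (elim y)
        show ?case
        proof (rule impI, rule ccontr)
          assume y: "y \<in> \<Omega>" and g: "\<not> cmod (u k y) \<le> 1"
          let ?g = "\<lambda>w. (norm (cov_grad \<Omega> (layer_potential A (real k * s)) (w k) y))\<^sup>2"
          have "?g v \<le> ?g u" using elim(2) y by (intro power_mono) (auto simp: v_def[abs_def])
          moreover have "1 / (4 * \<epsilon>\<^sup>2) * (1 - (cmod (v k y))\<^sup>2)\<^sup>2 < 1 / (4 * \<epsilon>\<^sup>2) * (1 - (cmod (u k y))\<^sup>2)\<^sup>2"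
            using truncate_potential_le(2)[of "u k y"] g e by (intro mult_strict_left_mono) (auto simp: v_def)
          ultimately have "1/2 * ?g v + 1 / (4 * \<epsilon>\<^sup>2) * (1 - (cmod (v k y))\<^sup>2)\<^sup>2 < 1/2 * ?g u + 1 / (4 * \<epsilon>\<^sup>2) * (1 - (cmod (u k y))\<^sup>2)\<^sup>2"
            by linarith
          then have "ennreal (1/2 * ?g v + 1 / (4 * \<epsilon>\<^sup>2) * (1 - (cmod (v k y))\<^sup>2)\<^sup>2) < ennreal (1/2 * ?g u + 1 / (4 * \<epsilon>\<^sup>2) * (1 - (cmod (u k y))\<^sup>2)\<^sup>2)"
            by (subst ennreal_less_iff) (auto intro!: add_nonneg_nonneg)
          then show False using elim(1) y unfolding f_def by (simp only: indicator_simps(1) mult_1_right not_le[symmetric])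
        qed
      qed
      then show False using bad by simp
    qed
  qed
  then show False using Fk by simp
qed

section \<open>Convergence\<close>

lemma ennreal_sum_le_scaled:
  fixes X Y :: "'i \<Rightarrow> ennreal"
  assumes s: "s > 0" and c: "c \<ge> 0" and k: "\<kappa> \<ge> 0" and XY: "\<And>n. n \<in> I \<Longrightarrow> X n \<le> ennreal c * Y n"
    and Y: "ennreal s * sum Y I \<le> ennreal \<kappa>"
  shows "sum X I \<le> ennreal (c * \<kappa> / s)"
proof -
  have s1: "ennreal (1 / s) * ennreal s = 1" using s by (simp add: ennreal_mult[symmetric])
  have "sum X I \<le> (\<Sum>n\<in>I. ennreal c * Y n)" using XY by (rule sum_mono)
  also have "\<dots> = ennreal c * sum Y I" by (rule sum_distrib_left[symmetric])
  also have "sum Y I = ennreal (1 / s) * (ennreal s * sum Y I)" by (simp only: mult.assoc[symmetric] s1 mult_1_left)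
  also have "ennreal c * (ennreal (1 / s) * (ennreal s * sum Y I)) \<le> ennreal c * (ennreal (1 / s) * ennreal \<kappa>)"
    by (intro mult_left_mono Y) auto
  also have "\<dots> = ennreal (c * \<kappa> / s)" using s c k by (simp add: ennreal_mult[symmetric] del: ennreal_mult')
  finally show ?thesis .
qed

lemma LD_energy_parts:
  assumes U: "open \<Omega>" and e: "\<epsilon> > 0" and s: "s > 0" and k: "\<kappa> \<ge> 0"
    and u: "\<And>n. n \<le> N \<Longrightarrow> u n \<in> H1 \<Omega>" and A: "A \<in> H1_loc UNIV"
    and E: "LD_energy \<Omega> lam \<epsilon> s N h u A \<le> ennreal \<kappa>"
  shows "(\<Sum>n=0..N. \<integral>\<^sup>+y\<in>\<Omega>. ennreal ((1 - (cmod (u n y))\<^sup>2)\<^sup>2) \<partial>lebesgue) \<le> ennreal (4 * \<epsilon>\<^sup>2 * \<kappa> / s)"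
    "(\<Sum>n=0..N. \<integral>\<^sup>+y\<in>\<Omega>. ennreal ((norm (cov_grad \<Omega> (layer_potential A (real n * s)) (u n) y))\<^sup>2) \<partial>lebesgue) \<le> ennreal (2 * \<kappa> / s)"
    "(\<integral>\<^sup>+x. ennreal ((norm (weak_curl A x - h *\<^sub>R e3))\<^sup>2) \<partial>lebesgue) \<le> ennreal (2 * \<kappa>)"
proof -
  define c where "c n y = (norm (cov_grad \<Omega> (layer_potential A (real n * s)) (u n) y))\<^sup>2" for n y
  define w where "w n y = (1 - (cmod (u n y))\<^sup>2)\<^sup>2" for n y
  have nn: "c n y \<ge> 0" "w n y \<ge> 0" for n y by (simp_all add: c_def w_def)
  let ?f = "\<lambda>n y. ennreal (1/2 * c n y + 1 / (4 * \<epsilon>\<^sup>2) * w n y) * indicator \<Omega> y"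
  let ?M = "\<integral>\<^sup>+x. ennreal ((norm (weak_curl A x - h *\<^sub>R e3))\<^sup>2) \<partial>lebesgue"
  have le3: "a \<le> a + b + d" "d \<le> a + b + d" for a b d :: ennreal
    by (simp_all add: add.assoc add_increasing add_increasing2)
  have layers: "ennreal s * (\<Sum>n=0..N. \<integral>\<^sup>+y. ?f n y \<partial>lebesgue) \<le> ennreal \<kappa>"
    by (rule order_trans[OF _ E]) (unfold LD_energy_def c_def w_def, rule le3(1))
  have mag: "ennreal (1/2) * ?M \<le> ennreal \<kappa>"
    by (rule order_trans[OF _ E]) (unfold LD_energy_def, rule le3(2))
  have m: "?f n \<in> borel_measurable lebesgue" if "n \<le> N" for n
    unfolding c_def w_def by (rule layer_energy_density_measurable[OF U u[OF that] layer_potential_measurable[OF A]])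
  have dom: "(\<integral>\<^sup>+y\<in>\<Omega>. ennreal (g y) \<partial>lebesgue) \<le> ennreal a * (\<integral>\<^sup>+y. ?f n y \<partial>lebesgue)"
    if n: "n \<le> N" and a: "a \<ge> 0" and g: "\<And>y. g y \<le> a * (1/2 * c n y + 1 / (4 * \<epsilon>\<^sup>2) * w n y)" for n a g
  proof -
    have "(\<integral>\<^sup>+y\<in>\<Omega>. ennreal (g y) \<partial>lebesgue) \<le> (\<integral>\<^sup>+y. ennreal a * ?f n y \<partial>lebesgue)"
    proof (rule nn_integral_mono)
      fix y
      have "ennreal (g y) \<le> ennreal (a * (1/2 * c n y + 1 / (4 * \<epsilon>\<^sup>2) * w n y))" by (rule ennreal_leI[OF g])
      also have "\<dots> = ennreal a * ennreal (1/2 * c n y + 1 / (4 * \<epsilon>\<^sup>2) * w n y)" using a by (rule ennreal_mult')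
      finally show "ennreal (g y) * indicator \<Omega> y \<le> ennreal a * ?f n y"
        unfolding mult.assoc[symmetric] by (rule mult_right_mono) simp
    qed
    also have "\<dots> = ennreal a * (\<integral>\<^sup>+y. ?f n y \<partial>lebesgue)" by (rule nn_integral_cmult[OF m[OF n]])
    finally show ?thesis .
  qed
  show "(\<Sum>n=0..N. \<integral>\<^sup>+y\<in>\<Omega>. ennreal ((1 - (cmod (u n y))\<^sup>2)\<^sup>2) \<partial>lebesgue) \<le> ennreal (4 * \<epsilon>\<^sup>2 * \<kappa> / s)"
    by (rule ennreal_sum_le_scaled[OF s _ k dom layers]) (use nn e in \<open>auto simp: w_def[symmetric] field_simps\<close>)
  show "(\<Sum>n=0..N. \<integral>\<^sup>+y\<in>\<Omega>. ennreal ((norm (cov_grad \<Omega> (layer_potential A (real n * s)) (u n) y))\<^sup>2) \<partial>lebesgue) \<le> ennreal (2 * \<kappa> / s)"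
    by (rule ennreal_sum_le_scaled[OF s _ k dom layers]) (use nn e in \<open>auto simp: c_def[symmetric]\<close>)
  have "?M = ennreal 2 * (ennreal (1/2) * ?M)"
    unfolding mult.assoc[symmetric] by (subst ennreal_mult[symmetric]) auto
  also have "\<dots> \<le> ennreal 2 * ennreal \<kappa>" by (intro mult_left_mono mag) simp
  also have "\<dots> = ennreal (2 * \<kappa>)" using k by (simp add: ennreal_mult)
  finally show "?M \<le> ennreal (2 * \<kappa>)" .
qed

text \<open>The bound on the modulus makes each component of the current at most the corresponding
  component of the covariant gradient; the curl is tested weakly, so only first derivatives of
  \<phi> appear and Young's inequality separates the two factors.\<close>

lemma dist_curl_current_bound:
  fixes u :: "real^2 \<Rightarrow> complex" and \<phi> :: "real^2 \<Rightarrow> real"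
  assumes U: "open \<Omega>" and u: "u \<in> H1 \<Omega>" and B: "B \<in> borel_measurable lebesgue"
    and le1: "AE y in lebesgue. y \<in> \<Omega> \<longrightarrow> cmod (u y) \<le> 1"
    and \<phi>: "\<phi> \<in> test_functions \<Omega>" and t: "\<tau> > 0"
  shows "ennreal \<bar>dist_curl \<Omega> (current \<Omega> B u) \<phi>\<bar>
    \<le> ennreal (\<tau> / 2) * (\<integral>\<^sup>+y\<in>\<Omega>. ennreal ((norm (cov_grad \<Omega> B u y))\<^sup>2) \<partial>lebesgue) + ennreal (1 / (2 * \<tau>)) * ennreal ((H1_norm \<Omega> \<phi>)\<^sup>2)"
proof -
  let ?j = "current \<Omega> B u" and ?g = "\<lambda>y. (norm (cov_grad \<Omega> B u y))\<^sup>2"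
  let ?p = "\<lambda>y. (\<phi> y)\<^sup>2 + (pderiv_at 1 \<phi> y)\<^sup>2 + (pderiv_at 2 \<phi> y)\<^sup>2"
  have "\<phi> \<in> borel_measurable borel" "pderiv_at j \<phi> \<in> borel_measurable borel" for j
    by (rule test_function_facts(1)[OF \<phi>], rule test_function_facts(1)[OF test_functions_pderiv[OF \<phi>]])
  then have [measurable]: "\<phi> \<in> borel_measurable lebesgue" "pderiv_at j \<phi> \<in> borel_measurable lebesgue" for j
    by (blast intro: borel_measurable_lebesgueI)+
  have pm [measurable]: "(\<lambda>y. ennreal (?p y)) \<in> borel_measurable lebesgue" by measurable
  have gm [measurable]: "(\<lambda>y. ennreal (?g y) * indicator \<Omega> y) \<in> borel_measurable lebesgue"
  proof -
    note [measurable] = cov_grad_measurable[OF U u B]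
    have [measurable]: "\<Omega> \<in> sets lebesgue" using U by auto
    have "(\<lambda>y. ennreal ((norm (indicator \<Omega> y *\<^sub>R cov_grad \<Omega> B u y))\<^sup>2) * indicator \<Omega> y) \<in> borel_measurable lebesgue" by measurable
    moreover have "(\<lambda>y. ennreal ((norm (indicator \<Omega> y *\<^sub>R cov_grad \<Omega> B u y))\<^sup>2) * indicator \<Omega> y) = (\<lambda>y. ennreal (?g y) * indicator \<Omega> y)"
      by (rule ext) (auto simp: indicator_def)
    ultimately show ?thesis by simp
  qed
  have "ennreal \<bar>dist_curl \<Omega> ?j \<phi>\<bar> \<le> (\<integral>\<^sup>+y\<in>\<Omega>. ennreal \<bar>?j y $ 2 * pderiv_at 1 \<phi> y - ?j y $ 1 * pderiv_at 2 \<phi> y\<bar> \<partial>lebesgue)"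
    unfolding dist_curl_def abs_minus_cancel by (rule abs_set_lebesgue_integral_le)
  also have "\<dots> \<le> (\<integral>\<^sup>+y. ennreal (\<tau> / 2) * (ennreal (?g y) * indicator \<Omega> y) + ennreal (1 / (2 * \<tau>)) * ennreal (?p y) \<partial>lebesgue)"
  proof (rule nn_integral_mono_AE)
    show "AE y in lebesgue. ennreal \<bar>?j y $ 2 * pderiv_at 1 \<phi> y - ?j y $ 1 * pderiv_at 2 \<phi> y\<bar> * indicator \<Omega> y
      \<le> ennreal (\<tau> / 2) * (ennreal (?g y) * indicator \<Omega> y) + ennreal (1 / (2 * \<tau>)) * ennreal (?p y)"
      using le1
    proof eventually_elim
      case (elim y)
      show ?case
      proof (cases "y \<in> \<Omega>")
        case True
        let ?c = "cov_grad \<Omega> B u y"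
        have j: "\<bar>?j y $ k\<bar> \<le> cmod (?c $ k)" for k
        proof -
          have "\<bar>?j y $ k\<bar> \<le> cmod (\<i> * u y * cnj (?c $ k))" unfolding current_def vec_lambda_beta by (rule abs_Re_le_cmod)
          also have "\<dots> \<le> 1 * cmod (?c $ k)" using elim True unfolding norm_mult by (intro mult_mono) auto
          finally show ?thesis by simp
        qed
        have j2: "(?j y $ k)\<^sup>2 \<le> (cmod (?c $ k))\<^sup>2" for k using power_mono[OF j[of k] abs_ge_zero, of 2] by simp
        have "\<bar>?j y $ 2 * pderiv_at 1 \<phi> y - ?j y $ 1 * pderiv_at 2 \<phi> y\<bar> \<le> \<bar>pderiv_at 1 \<phi> y * ?j y $ 2\<bar> + \<bar>pderiv_at 2 \<phi> y * ?j y $ 1\<bar>"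
          by (simp add: mult.commute)
        also have "\<dots> \<le> (\<tau> / 2 * (?j y $ 2)\<^sup>2 + 1 / (2 * \<tau>) * (pderiv_at 1 \<phi> y)\<^sup>2) + (\<tau> / 2 * (?j y $ 1)\<^sup>2 + 1 / (2 * \<tau>) * (pderiv_at 2 \<phi> y)\<^sup>2)"
          by (intro add_mono weighted_young t)
        also have "\<dots> \<le> (\<tau> / 2 * (cmod (?c $ 2))\<^sup>2 + 1 / (2 * \<tau>) * (pderiv_at 1 \<phi> y)\<^sup>2) + (\<tau> / 2 * (cmod (?c $ 1))\<^sup>2 + 1 / (2 * \<tau>) * (pderiv_at 2 \<phi> y)\<^sup>2)"
          using t by (intro add_mono mult_left_mono j2) auto
        also have "\<dots> \<le> \<tau> / 2 * ((cmod (?c $ 1))\<^sup>2 + (cmod (?c $ 2))\<^sup>2) + 1 / (2 * \<tau>) * ?p y"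
          using t by (simp add: algebra_simps)
        also have "(cmod (?c $ 1))\<^sup>2 + (cmod (?c $ 2))\<^sup>2 = ?g y"
          unfolding norm_vec_def L2_set_def sum_2 by (simp add: sum_nonneg)
        finally have "ennreal \<bar>?j y $ 2 * pderiv_at 1 \<phi> y - ?j y $ 1 * pderiv_at 2 \<phi> y\<bar> \<le> ennreal (\<tau> / 2 * ?g y + 1 / (2 * \<tau>) * ?p y)" by (rule ennreal_leI)
        moreover have "ennreal (\<tau> / 2 * ?g y + 1 / (2 * \<tau>) * ?p y) = ennreal (\<tau> / 2 * ?g y) + ennreal (1 / (2 * \<tau>) * ?p y)"
          using t by (intro ennreal_plus) auto
        moreover have "ennreal (\<tau> / 2 * ?g y) = ennreal (\<tau> / 2) * ennreal (?g y)" using t by (intro ennreal_mult) auto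
        moreover have "ennreal (1 / (2 * \<tau>) * ?p y) = ennreal (1 / (2 * \<tau>)) * ennreal (?p y)" using t by (intro ennreal_mult) auto
        ultimately show ?thesis using True by (simp only: indicator_simps(1) mult_1_right)
      qed simp
    qed
  qed
  also have "\<dots> = (\<integral>\<^sup>+y. ennreal (\<tau> / 2) * (ennreal (?g y) * indicator \<Omega> y) \<partial>lebesgue) + (\<integral>\<^sup>+y. ennreal (1 / (2 * \<tau>)) * ennreal (?p y) \<partial>lebesgue)"
    by (rule nn_integral_add) measurable
  also have "(\<integral>\<^sup>+y. ennreal (\<tau> / 2) * (ennreal (?g y) * indicator \<Omega> y) \<partial>lebesgue) = ennreal (\<tau> / 2) * (\<integral>\<^sup>+y\<in>\<Omega>. ennreal (?g y) \<partial>lebesgue)"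
    by (rule nn_integral_cmult[OF gm])
  also have "(\<integral>\<^sup>+y. ennreal (1 / (2 * \<tau>)) * ennreal (?p y) \<partial>lebesgue) = ennreal (1 / (2 * \<tau>)) * ennreal ((H1_norm \<Omega> \<phi>)\<^sup>2)"
    unfolding nn_integral_cmult[OF pm] by (simp only: nn_integral_completion H1_norm_test_function[OF \<phi>])
  finally show ?thesis .
qed

text \<open>The currents are controlled only in the sum over the layers, by
  \<open>2 * \<kappa> / s\<close>, and become harmless after averaging because
  \<open>s * (N + 1) \<ge> L\<close>. The curls of the potentials are controlled in each layer
  separately. Both bounds hold for all test functions of norm at most one, hence for the
  supremum.\<close>

lemma vorticity_average_bound:
  assumes U: "open \<Omega>" and e: "\<epsilon> > 0" and L: "L > 0" and N: "N \<ge> 1" and h: "h > 0" and k: "\<kappa> > 0"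
    and m: "is_LD_minimizer \<Omega> lam \<epsilon> (L / real N) N h u A"
    and E: "LD_energy \<Omega> lam \<epsilon> (L / real N) N h u A \<le> ennreal \<kappa>"
  shows "Hminus1_norm \<Omega> (\<lambda>\<phi>. 1 / real (N + 1) *
      (\<Sum>n=0..N. vorticity \<Omega> (layer_potential A (real n * (L / real N))) (u n) \<phi> / h) - (LINT y:\<Omega>|lebesgue. \<phi> y))
    \<le> ennreal ((2 + 1 / L) * sqrt (\<kappa> / h\<^sup>2))"
  unfolding Hminus1_norm_def
proof (rule SUP_least, clarify)
  fix \<phi> :: "real^2 \<Rightarrow> real" assume \<phi>: "\<phi> \<in> test_functions \<Omega>" and \<phi>1: "H1_norm \<Omega> \<phi> \<le> 1"
  define s where "s = L / real N"
  \<comment> \<open>This weight balances the two sides of Young's inequality: both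
    \<open>\<tau> * \<kappa>\<close> and \<open>1 / \<tau>\<close> become
    \<open>sqrt \<kappa>\<close>.\<close>
  define \<tau> where "\<tau> = 1 / sqrt \<kappa>"
  have s: "s > 0" using L N by (simp add: s_def)
  \<comment> \<open>There is one layer more than there are gaps, so \<open>s * (N + 1)\<close>
    exceeds \<open>L\<close> slightly; this is what divides the summed current bound by
    \<open>L\<close>.\<close>
  have sN: "L \<le> s * real (N + 1)" using L N by (simp add: s_def field_simps)
  have t: "\<tau> > 0" using k by (simp add: \<tau>_def)
  have tk: "\<tau> * \<kappa> = sqrt \<kappa>" "1 / \<tau> = sqrt \<kappa>" using k by (simp_all add: \<tau>_def real_div_sqrt)
  have adm: "LD_admissible \<Omega> N h u A" using m by (simp add: is_LD_minimizer_def)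
  then have u: "u n \<in> H1 \<Omega>" if "n \<le> N" for n using that by (simp add: LD_admissible_def)
  have A: "A \<in> H1_loc UNIV" using adm by (simp add: LD_admissible_def K_space_def E_space_def)
  note m = m[folded s_def] and E = E[folded s_def]
  have fin: "LD_energy \<Omega> lam \<epsilon> s N h u A \<noteq> \<infinity>" using E by (auto simp: top_unique)
  note parts = LD_energy_parts[OF U e s less_imp_le[OF k] u A E]
  have H: "ennreal ((H1_norm \<Omega> \<phi>)\<^sup>2) \<le> 1"
  proof -
    have "0 \<le> H1_norm \<Omega> \<phi>" unfolding H1_norm_def set_lebesgue_integral_def
      by (intro real_sqrt_ge_zero Bochner_Integration.integral_nonneg) (auto intro!: mult_nonneg_nonneg add_nonneg_nonneg sum_nonneg)
    then show ?thesis using \<phi>1 by (simp add: power_le_one)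
  qed
  define B where "B n = layer_potential A (real n * s)" for n
  define G where "G n = (\<integral>\<^sup>+y\<in>\<Omega>. ennreal ((norm (cov_grad \<Omega> (B n) (u n) y))\<^sup>2) \<partial>lebesgue)" for n
  define I where "I = (LINT y:\<Omega>|lebesgue. \<phi> y)"
  define X where "X n = \<bar>dist_curl \<Omega> (current \<Omega> (B n) (u n)) \<phi>\<bar>" for n
  define Y where "Y n = \<bar>dist_curl \<Omega> (B n) \<phi> - h * I\<bar>" for n
  let ?b = "1 / (2 * \<tau>)"
  have X: "ennreal (X n) \<le> ennreal (\<tau> / 2) * G n + ennreal ?b" if n: "n \<le> N" for n
  proof -
    have "ennreal (X n) \<le> ennreal (\<tau> / 2) * G n + ennreal ?b * ennreal ((H1_norm \<Omega> \<phi>)\<^sup>2)"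
      unfolding X_def G_def B_def
      by (rule dist_curl_current_bound[OF U u[OF n] layer_potential_measurable[OF A] minimizer_norm_le_1[OF U e s m fin n] \<phi> t])
    also have "\<dots> \<le> ennreal (\<tau> / 2) * G n + ennreal ?b * 1" by (intro add_left_mono mult_left_mono H) simp
    finally show ?thesis by (simp only: mult_1_right)
  qed
  have Y: "ennreal (Y n) \<le> ennreal (\<tau> * \<kappa> + ?b)" for n
  proof -
    have "ennreal (Y n) \<le> ennreal (\<tau> / 2) * (\<integral>\<^sup>+x. ennreal ((norm (weak_curl A x - h *\<^sub>R e3))\<^sup>2) \<partial>lebesgue) + ennreal ?b * ennreal ((H1_norm \<Omega> \<phi>)\<^sup>2)"
      unfolding Y_def B_def I_def by (rule dist_curl_layer_potential_bound[OF A \<phi> t])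
    also have "\<dots> \<le> ennreal (\<tau> / 2) * ennreal (2 * \<kappa>) + ennreal ?b * 1" by (intro add_mono mult_left_mono H parts(3)) auto
    also have "\<dots> = ennreal (\<tau> * \<kappa> + ?b)"
    proof -
      have "ennreal (\<tau> / 2) * ennreal (2 * \<kappa>) = ennreal (\<tau> / 2 * (2 * \<kappa>))" using t k by (intro ennreal_mult[symmetric]) auto
      then show ?thesis using t k by (simp add: ennreal_plus)
    qed
    finally show ?thesis .
  qed
  have "ennreal (\<Sum>n=0..N. X n) = (\<Sum>n=0..N. ennreal (X n))" by (rule sum_ennreal[symmetric]) (simp add: X_def)
  also have "\<dots> \<le> (\<Sum>n=0..N. ennreal (\<tau> / 2) * G n + ennreal ?b)" using X by (intro sum_mono) auto
  also have "\<dots> = ennreal (\<tau> / 2) * sum G {0..N} + (\<Sum>n=0..N. ennreal ?b)" by (simp only: sum.distrib sum_distrib_left)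
  also have "\<dots> \<le> ennreal (\<tau> / 2) * ennreal (2 * \<kappa> / s) + (\<Sum>n=0..N. ennreal ?b)"
    using parts(2) unfolding B_def[symmetric] G_def[symmetric] by (intro add_right_mono mult_left_mono) auto
  also have "(\<Sum>n=0..N. ennreal ?b) = ennreal (\<Sum>n=0..N. ?b)" using t by (intro sum_ennreal) auto
  also have "ennreal (\<tau> / 2) * ennreal (2 * \<kappa> / s) = ennreal (\<tau> / 2 * (2 * \<kappa> / s))" using t k s by (intro ennreal_mult[symmetric]) auto
  also have "ennreal (\<tau> / 2 * (2 * \<kappa> / s)) + ennreal (\<Sum>n=0..N. ?b) = ennreal (\<tau> / 2 * (2 * \<kappa> / s) + (\<Sum>n=0..N. ?b))"
    using t k s by (intro ennreal_plus[symmetric]) (auto intro: sum_nonneg)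
  finally have SX: "(\<Sum>n=0..N. X n) \<le> \<tau> * \<kappa> / s + real (N + 1) * ?b"
    using t k s by (subst (asm) ennreal_le_iff) auto
  have "(\<Sum>n=0..N. Y n) \<le> (\<Sum>n=0..N. \<tau> * \<kappa> + ?b)"
    using Y t k by (intro sum_mono) (simp add: ennreal_le_iff del: ennreal_plus)
  then have SY: "(\<Sum>n=0..N. Y n) \<le> real (N + 1) * (\<tau> * \<kappa> + ?b)" by simp
  let ?v = "\<lambda>n. vorticity \<Omega> (layer_potential A (real n * s)) (u n) \<phi>"
  have N1: "real (N + 1) > 0" by simp
  have v: "\<bar>?v n - h * I\<bar> \<le> X n + Y n" for n
    unfolding X_def Y_def vorticity_def B_def[symmetric] by linarith
  have "1 / real (N + 1) * (\<Sum>n=0..N. ?v n / h) - I = (\<Sum>n=0..N. ?v n - h * I) / (real (N + 1) * h)"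
  proof -
    have 1: "(\<Sum>n=0..N. ?v n / h) = sum ?v {0..N} / h" by (rule sum_divide_distrib[symmetric])
    have 2: "(\<Sum>n=0..N. ?v n - h * I) = sum ?v {0..N} - real (N + 1) * (h * I)" unfolding sum_subtractf by simp
    have "1 / r * (S / h) - I = (S - r * (h * I)) / (r * h)" if "r > 0" for r S :: real
      using that h by (simp add: field_simps)
    from this[OF N1] show ?thesis unfolding 1 2 .
  qed
  then have "\<bar>1 / real (N + 1) * (\<Sum>n=0..N. ?v n / h) - I\<bar> = \<bar>\<Sum>n=0..N. ?v n - h * I\<bar> / (real (N + 1) * h)"
    using h by (simp add: abs_mult)
  also have "\<dots> \<le> (\<Sum>n=0..N. X n + Y n) / (real (N + 1) * h)"
    using h by (intro divide_right_mono order_trans[OF sum_abs] sum_mono v) auto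
  also have "\<dots> \<le> ((\<tau> * \<kappa> / s + real (N + 1) * ?b) + real (N + 1) * (\<tau> * \<kappa> + ?b)) / (real (N + 1) * h)"
    using h SX SY unfolding sum.distrib by (intro divide_right_mono add_mono) auto
  also have "\<dots> = (\<tau> * \<kappa> / (s * real (N + 1)) + \<tau> * \<kappa> + 1 / \<tau>) / h"
  proof -
    have "((\<tau> * \<kappa> / s + r * ?b) + r * (\<tau> * \<kappa> + ?b)) / (r * h) = (\<tau> * \<kappa> / (s * r) + \<tau> * \<kappa> + 1 / \<tau>) / h" if "r > 0" for r
      using that h s t by (simp add: field_simps)
    from this[OF N1] show ?thesis .
  qed
  also have "\<dots> \<le> (\<tau> * \<kappa> / L + \<tau> * \<kappa> + 1 / \<tau>) / h"
    using h s t k L sN by (intro divide_right_mono add_mono divide_left_mono mult_pos_pos) auto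
  \<comment> \<open>The summand \<open>1 / L\<close> comes from the currents; the 2 collects
    \<open>\<tau> * \<kappa>\<close> from the potentials and the halves of \<open>1 / \<tau>\<close>
    from both parts.\<close>
  also have "\<dots> = (2 + 1 / L) * (sqrt \<kappa> / h)" unfolding tk using h L by (simp add: field_simps)
  also have "sqrt \<kappa> / h = sqrt (\<kappa> / h\<^sup>2)" using h by (simp add: real_sqrt_divide)
  finally show "ennreal \<bar>1 / real (N + 1) * (\<Sum>n=0..N. vorticity \<Omega> (layer_potential A (real n * (L / real N))) (u n) \<phi> / h) - (LINT y:\<Omega>|lebesgue. \<phi> y)\<bar>
     \<le> ennreal ((2 + 1 / L) * sqrt (\<kappa> / h\<^sup>2))"
    unfolding s_def[symmetric] I_def[symmetric] by (rule ennreal_leI)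
qed

lemma energy_average_bound:
  assumes U: "open \<Omega>" and e: "\<epsilon> > 0" and L: "L > 0" and N: "N \<ge> 1" and h: "h > 0" and k: "\<kappa> > 0"
    and adm: "LD_admissible \<Omega> N h u A"
    and E: "LD_energy \<Omega> lam \<epsilon> (L / real N) N h u A \<le> ennreal \<kappa>"
  shows "ennreal (1 / real (N + 1)) * (\<Sum>n=0..N. \<integral>\<^sup>+y\<in>\<Omega>. ennreal ((1 - (cmod (u n y))\<^sup>2)\<^sup>2) \<partial>lebesgue)
      + ennreal (1/2) * (\<integral>\<^sup>+x. ennreal ((norm ((1 / h) *\<^sub>R weak_curl A x - e3))\<^sup>2) \<partial>lebesgue)
    \<le> ennreal (4 / L * (\<epsilon>\<^sup>2 * \<kappa>) + \<kappa> / h\<^sup>2)"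
proof -
  define s where "s = L / real N"
  have s: "s > 0" using L N by (simp add: s_def)
  have sN: "L \<le> s * real (N + 1)" using L N by (simp add: s_def field_simps)
  have u: "u n \<in> H1 \<Omega>" if "n \<le> N" for n using adm that by (simp add: LD_admissible_def)
  have A: "A \<in> H1_loc UNIV" using adm by (simp add: LD_admissible_def K_space_def E_space_def)
  note parts = LD_energy_parts[OF U e s less_imp_le[OF k] u A E[folded s_def]]
  have "ennreal (1 / real (N + 1)) * (\<Sum>n=0..N. \<integral>\<^sup>+y\<in>\<Omega>. ennreal ((1 - (cmod (u n y))\<^sup>2)\<^sup>2) \<partial>lebesgue)
     \<le> ennreal (1 / real (N + 1)) * ennreal (4 * \<epsilon>\<^sup>2 * \<kappa> / s)" by (intro mult_left_mono parts(1)) auto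
  also have "\<dots> = ennreal (4 * \<epsilon>\<^sup>2 * \<kappa> / (s * real (N + 1)))"
    using s k by (subst ennreal_mult[symmetric]) (auto simp: mult.commute)
  also have "\<dots> \<le> ennreal (4 / L * (\<epsilon>\<^sup>2 * \<kappa>))"
  proof (rule ennreal_leI)
    have "4 * \<epsilon>\<^sup>2 * \<kappa> / (s * real (N + 1)) \<le> 4 * \<epsilon>\<^sup>2 * \<kappa> / L"
      using sN L s k by (intro divide_left_mono mult_pos_pos) auto
    then show "4 * \<epsilon>\<^sup>2 * \<kappa> / (s * real (N + 1)) \<le> 4 / L * (\<epsilon>\<^sup>2 * \<kappa>)" by simp
  qed
  finally have 1: "ennreal (1 / real (N + 1)) * (\<Sum>n=0..N. \<integral>\<^sup>+y\<in>\<Omega>. ennreal ((1 - (cmod (u n y))\<^sup>2)\<^sup>2) \<partial>lebesgue) \<le> ennreal (4 / L * (\<epsilon>\<^sup>2 * \<kappa>))" .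
  have [measurable]: "weak_curl A \<in> borel_measurable lebesgue" by (rule weak_curl_measurable[OF A])
  have m: "(\<lambda>x. ennreal ((norm (weak_curl A x - h *\<^sub>R e3))\<^sup>2)) \<in> borel_measurable lebesgue" by measurable
  have "ennreal ((norm ((1 / h) *\<^sub>R weak_curl A x - e3))\<^sup>2) = ennreal (1 / h\<^sup>2) * ennreal ((norm (weak_curl A x - h *\<^sub>R e3))\<^sup>2)" for x
  proof -
    have "(1 / h) *\<^sub>R weak_curl A x - e3 = (1 / h) *\<^sub>R (weak_curl A x - h *\<^sub>R e3)" using h by (simp add: scaleR_diff_right)
    then have "(norm ((1 / h) *\<^sub>R weak_curl A x - e3))\<^sup>2 = 1 / h\<^sup>2 * (norm (weak_curl A x - h *\<^sub>R e3))\<^sup>2"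
      by (simp add: power_mult_distrib power_divide)
    then show ?thesis by (simp only:) (rule ennreal_mult; simp)
  qed
  then have "(\<integral>\<^sup>+x. ennreal ((norm ((1 / h) *\<^sub>R weak_curl A x - e3))\<^sup>2) \<partial>lebesgue) = ennreal (1 / h\<^sup>2) * (\<integral>\<^sup>+x. ennreal ((norm (weak_curl A x - h *\<^sub>R e3))\<^sup>2) \<partial>lebesgue)"
    using nn_integral_cmult[OF m, of "ennreal (1 / h\<^sup>2)"] by (simp only:)
  then have "ennreal (1/2) * (\<integral>\<^sup>+x. ennreal ((norm ((1 / h) *\<^sub>R weak_curl A x - e3))\<^sup>2) \<partial>lebesgue) \<le> ennreal (1/2) * (ennreal (1 / h\<^sup>2) * ennreal (2 * \<kappa>))"
    by (simp only:) (intro mult_left_mono parts(3); simp)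
  also have "ennreal (1 / h\<^sup>2) * ennreal (2 * \<kappa>) = ennreal (1 / h\<^sup>2 * (2 * \<kappa>))" using k by (intro ennreal_mult[symmetric]) auto
  also have "ennreal (1/2) * ennreal (1 / h\<^sup>2 * (2 * \<kappa>)) = ennreal (1/2 * (1 / h\<^sup>2 * (2 * \<kappa>)))" using k by (intro ennreal_mult[symmetric]) auto
  also have "1/2 * (1 / h\<^sup>2 * (2 * \<kappa>)) = \<kappa> / h\<^sup>2" by simp
  finally have 2: "ennreal (1/2) * (\<integral>\<^sup>+x. ennreal ((norm ((1 / h) *\<^sub>R weak_curl A x - e3))\<^sup>2) \<partial>lebesgue) \<le> ennreal (\<kappa> / h\<^sup>2)" .
  have "ennreal (4 / L * (\<epsilon>\<^sup>2 * \<kappa>) + \<kappa> / h\<^sup>2) = ennreal (4 / L * (\<epsilon>\<^sup>2 * \<kappa>)) + ennreal (\<kappa> / h\<^sup>2)"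
    using L k by (intro ennreal_plus) auto
  then show ?thesis using add_mono[OF 1 2] by (simp only:)
qed

section \<open>Passing to the limit\<close>

text \<open>A bound that depends on \<epsilon> alone and holds for all \<open>N \<ge> 1\<close>
  gives the joint limit, however \<epsilon> and the layer spacing tend to zero relative to each
  other.\<close>

lemma tendsto_0_prod_sequentially:
  fixes F :: "real \<Rightarrow> nat \<Rightarrow> ennreal" and g :: "real \<Rightarrow> real"
  assumes ev: "\<forall>\<^sub>F \<epsilon> in at_right 0. \<forall>N\<ge>1. F \<epsilon> N \<le> ennreal (g \<epsilon>)" and g: "(g \<longlongrightarrow> 0) (at_right 0)"
  shows "((\<lambda>(\<epsilon>, N). F \<epsilon> N) \<longlongrightarrow> 0) (at_right 0 \<times>\<^sub>F sequentially)"
proof (rule tendsto_sandwich[OF _ _ tendsto_const])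
  show "\<forall>\<^sub>F p in at_right 0 \<times>\<^sub>F sequentially. 0 \<le> (case p of (\<epsilon>, N) \<Rightarrow> F \<epsilon> N)" by simp
  have "\<forall>\<^sub>F p in at_right 0 \<times>\<^sub>F sequentially. (\<forall>N\<ge>1. F (fst p) N \<le> ennreal (g (fst p))) \<and> snd p \<ge> 1"
    by (rule eventually_prodI[OF ev eventually_ge_at_top])
  then show "\<forall>\<^sub>F p in at_right 0 \<times>\<^sub>F sequentially. (case p of (\<epsilon>, N) \<Rightarrow> F \<epsilon> N) \<le> ennreal (g (fst p))"
    by eventually_elim (auto simp: case_prod_beta)
  have "((\<lambda>p. g (fst p)) \<longlongrightarrow> 0) (at_right 0 \<times>\<^sub>F (sequentially :: nat filter))"
    by (rule filterlim_compose[OF g filterlim_fst])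
  then show "((\<lambda>p. ennreal (g (fst p))) \<longlongrightarrow> 0) (at_right 0 \<times>\<^sub>F (sequentially :: nat filter))"
    using tendsto_ennrealI by fastforce
qed

text \<open>The logarithm is bounded by \<open>2 * \<bar>ln \<epsilon>\<bar>\<close> in the quotient
  by the squared field and by its argument minus one in the product with
  \<open>\<epsilon>\<^sup>2\<close>. The first leaves the ratio assumed small here, the second
  leaves \<open>sqrt (\<epsilon>\<^sup>2 * hex \<epsilon>)\<close>.\<close>

lemma trial_energy_asymptotics:
  fixes hex :: "real \<Rightarrow> real"
  assumes C: "C > 0" and pos: "\<forall>\<^sub>F \<epsilon> in at_right 0. hex \<epsilon> > 0"
    and low: "((\<lambda>\<epsilon>. \<bar>ln \<epsilon>\<bar> / hex \<epsilon>) \<longlongrightarrow> 0) (at_right 0)"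
  shows "\<forall>\<^sub>F \<epsilon> in at_right 0. \<epsilon> > 0 \<and> hex \<epsilon> \<ge> 2 \<and>
     0 < C * hex \<epsilon> * ln (1 + sqrt (2 * pi / hex \<epsilon>) / \<epsilon>) \<and>
     \<epsilon>\<^sup>2 * (C * hex \<epsilon> * ln (1 + sqrt (2 * pi / hex \<epsilon>) / \<epsilon>)) \<le> C * sqrt (2 * pi) * sqrt (\<epsilon>\<^sup>2 * hex \<epsilon>) \<and>
     C * hex \<epsilon> * ln (1 + sqrt (2 * pi / hex \<epsilon>) / \<epsilon>) / (hex \<epsilon>)\<^sup>2 \<le> 2 * C * (\<bar>ln \<epsilon>\<bar> / hex \<epsilon>)"
proof -
  \<comment> \<open>Below \<open>exp (-1)\<close> the logarithm exceeds one in modulus; together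
    with a ratio below \<open>1 / 8\<close> this forces the field above 8, so that the spacing
    \<open>sqrt (2 * pi / h)\<close> is at most one.\<close>
  have "\<forall>\<^sub>F \<epsilon> in at_right (0::real). \<epsilon> \<in> {0<..<exp (-1)}" by (rule eventually_at_right_real) simp
  moreover have "\<forall>\<^sub>F \<epsilon> in at_right 0. \<bar>ln \<epsilon>\<bar> / hex \<epsilon> < 1 / 8" by (rule order_tendstoD(2)[OF low]) simp
  ultimately show ?thesis using pos
  proof eventually_elim
    case (elim \<epsilon>)
    define h where "h = hex \<epsilon>"
    have e: "\<epsilon> > 0" "\<epsilon> < exp (-1)" and h0: "h > 0" and lh: "\<bar>ln \<epsilon>\<bar> / h < 1/8" using elim by (auto simp: h_def)
    have "ln \<epsilon> < -1" using e by (metis exp_gt_zero ln_exp ln_less_cancel_iff)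
    then have le: "\<bar>ln \<epsilon>\<bar> = - ln \<epsilon>" "\<bar>ln \<epsilon>\<bar> > 1" by simp_all
    have e1: "\<epsilon> < 1" using e(2) exp_less_one_iff[of "-1"] by linarith
    have "\<bar>ln \<epsilon>\<bar> < 1/8 * h" using lh h0 by (simp only: pos_divide_less_eq)
    then have h8: "h > 8" using le by linarith
    let ?q = "sqrt (2 * pi / h)"
    have q: "0 < ?q" using h0 by simp
    have "2 * pi / h \<le> 1" using h8 pi_less_4 by (simp add: divide_le_eq)
    then have q1: "?q \<le> 1" by simp
    let ?l = "ln (1 + ?q / \<epsilon>)"
    have l0: "0 < ?l" using q e by (intro ln_gt_zero) simp
    have "?l \<le> ln (2 / \<epsilon>)"
    proof (rule ln_mono)
      have "1 + ?q / \<epsilon> = (\<epsilon> + ?q) / \<epsilon>" using e by (simp add: field_simps)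
      also have "\<dots> \<le> 2 / \<epsilon>" by (rule divide_right_mono) (use e(1) e1 q1 in linarith)+
      finally show "1 + ?q / \<epsilon> \<le> 2 / \<epsilon>" .
      show "0 < 1 + ?q / \<epsilon>" using q e by (intro add_pos_pos) auto
    qed
    also have "\<dots> = ln 2 - ln \<epsilon>" using e by (simp add: ln_div)
    also have "\<dots> \<le> 2 * \<bar>ln \<epsilon>\<bar>" using le ln_2_less_1 by linarith
    finally have l2: "?l \<le> 2 * \<bar>ln \<epsilon>\<bar>" .
    have "C * h * ?l / h\<^sup>2 = C * ?l / h" using h0 by (simp add: power2_eq_square)
    also have "\<dots> \<le> C * (2 * \<bar>ln \<epsilon>\<bar>) / h" using C h0 l2 by (intro divide_right_mono mult_left_mono) auto
    finally have a: "C * h * ?l / h\<^sup>2 \<le> 2 * C * (\<bar>ln \<epsilon>\<bar> / h)" by (simp add: mult_ac)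
    \<comment> \<open>Here \<open>ln (1 + x) \<le> x\<close> is the right estimate: \<open>h\<close>
      times the spacing equals \<open>sqrt (2 * pi) * sqrt h\<close>, and one of the two factors
      \<epsilon> is used up.\<close>
    have "?l \<le> ?q / \<epsilon>" using q e by (intro ln_add_one_self_le_self) auto
    then have "\<epsilon>\<^sup>2 * (C * h * ?l) \<le> \<epsilon>\<^sup>2 * (C * h * (?q / \<epsilon>))" using C h0 by (intro mult_left_mono) auto
    also have "\<dots> = C * sqrt (2 * pi) * (\<epsilon> * (h / sqrt h))" using e by (simp add: real_sqrt_divide power2_eq_square)
    also have "\<dots> = C * sqrt (2 * pi) * sqrt (\<epsilon>\<^sup>2 * h)" using e h0 by (simp add: real_div_sqrt real_sqrt_mult)
    finally have b: "\<epsilon>\<^sup>2 * (C * h * ?l) \<le> C * sqrt (2 * pi) * sqrt (\<epsilon>\<^sup>2 * h)" .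
    show ?case using a b e(1) h8 C h0 l0 unfolding h_def[symmetric] by auto
  qed
qed

theorem theorem3:
  fixes \<Omega> :: "(real^2) set" and L lam :: real
    and hex :: "real \<Rightarrow> real"
    and u :: "real \<Rightarrow> nat \<Rightarrow> nat \<Rightarrow> real^2 \<Rightarrow> complex"
    and A :: "real \<Rightarrow> nat \<Rightarrow> real^3 \<Rightarrow> real^3"
  assumes "lipschitz_domain \<Omega>" and "bounded \<Omega>" and "simply_connected \<Omega>"
    and "L > 0" and "lam > 0"
    and "\<forall>\<^sub>F \<epsilon> in at_right 0. hex \<epsilon> > 0"
    and "((\<lambda>\<epsilon>. \<bar>ln \<epsilon>\<bar> / hex \<epsilon>) \<longlongrightarrow> 0) (at_right 0)"
    and "((\<lambda>\<epsilon>. \<epsilon>\<^sup>2 * hex \<epsilon>) \<longlongrightarrow> 0) (at_right 0)"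
    and "\<And>\<epsilon> N. \<epsilon> > 0 \<Longrightarrow> N \<ge> 1 \<Longrightarrow>
           is_LD_minimizer \<Omega> lam \<epsilon> (L / real N) N (hex \<epsilon>) (u \<epsilon> N) (A \<epsilon> N)"
  shows "((\<lambda>(\<epsilon>, N).
            ennreal (1 / real (N + 1)) *
              (\<Sum>n=0..N. \<integral>\<^sup>+y\<in>\<Omega>. ennreal ((1 - (cmod (u \<epsilon> N n y))\<^sup>2)\<^sup>2) \<partial>lebesgue)
            + ennreal (1/2) *
              (\<integral>\<^sup>+x. ennreal ((norm ((1 / hex \<epsilon>) *\<^sub>R weak_curl (A \<epsilon> N) x - e3))\<^sup>2) \<partial>lebesgue))
          \<longlongrightarrow> 0) (at_right 0 \<times>\<^sub>F sequentially)
       \<and>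
         ((\<lambda>(\<epsilon>, N). Hminus1_norm \<Omega> (\<lambda>\<phi>.
            1 / real (N + 1) *
              (\<Sum>n=0..N. vorticity \<Omega> (layer_potential (A \<epsilon> N) (real n * (L / real N))) (u \<epsilon> N n) \<phi>
                          / hex \<epsilon>)
            - (LINT y:\<Omega>|lebesgue. \<phi> y)))
          \<longlongrightarrow> 0) (at_right 0 \<times>\<^sub>F sequentially)"
proof -
  have U: "open \<Omega>" using assms(1) by (simp add: lipschitz_domain_def)
  obtain C where C: "C > 0" and trial: "\<And>h \<epsilon> N. h \<ge> 2 \<Longrightarrow> \<epsilon> > 0 \<Longrightarrow> N \<ge> 1 \<Longrightarrow>
     \<exists>v B. LD_admissible \<Omega> N h v B \<and>
       LD_energy \<Omega> lam \<epsilon> (L / real N) N h v B \<le> ennreal (C * h * ln (1 + sqrt (2 * pi / h) / \<epsilon>))"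
    by (rule trial_configuration[OF U assms(2,4), where lam = lam]) blast
  define \<kappa> where "\<kappa> \<epsilon> = C * hex \<epsilon> * ln (1 + sqrt (2 * pi / hex \<epsilon>) / \<epsilon>)" for \<epsilon>
  note asym = trial_energy_asymptotics[OF C assms(6,7), folded \<kappa>_def]
  have E: "LD_energy \<Omega> lam \<epsilon> (L / real N) N (hex \<epsilon>) (u \<epsilon> N) (A \<epsilon> N) \<le> ennreal (\<kappa> \<epsilon>)"
    if "hex \<epsilon> \<ge> 2" "\<epsilon> > 0" "N \<ge> 1" for \<epsilon> N
  proof -
    note ex = trial[OF that]
    obtain v B where vB: "LD_admissible \<Omega> N (hex \<epsilon>) v B"
      "LD_energy \<Omega> lam \<epsilon> (L / real N) N (hex \<epsilon>) v B \<le> ennreal (\<kappa> \<epsilon>)"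
      using ex unfolding \<kappa>_def by blast
    have "LD_energy \<Omega> lam \<epsilon> (L / real N) N (hex \<epsilon>) (u \<epsilon> N) (A \<epsilon> N) \<le> LD_energy \<Omega> lam \<epsilon> (L / real N) N (hex \<epsilon>) v B"
      using assms(9)[OF that(2,3)] vB(1) unfolding is_LD_minimizer_def by blast
    then show ?thesis using vB(2) by (rule order_trans)
  qed
  show ?thesis
  proof
    \<comment> \<open>The first summand bounds the quartic term and tends to zero by the upper
      growth condition on the field; the second bounds the magnetic term and tends to zero by the
      lower one.\<close>
    let ?g = "\<lambda>\<epsilon>. 4 / L * (C * sqrt (2 * pi) * sqrt (\<epsilon>\<^sup>2 * hex \<epsilon>)) + 2 * C * (\<bar>ln \<epsilon>\<bar> / hex \<epsilon>)"
    show "((\<lambda>(\<epsilon>, N).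
            ennreal (1 / real (N + 1)) *
              (\<Sum>n=0..N. \<integral>\<^sup>+y\<in>\<Omega>. ennreal ((1 - (cmod (u \<epsilon> N n y))\<^sup>2)\<^sup>2) \<partial>lebesgue)
            + ennreal (1/2) *
              (\<integral>\<^sup>+x. ennreal ((norm ((1 / hex \<epsilon>) *\<^sub>R weak_curl (A \<epsilon> N) x - e3))\<^sup>2) \<partial>lebesgue))
          \<longlongrightarrow> 0) (at_right 0 \<times>\<^sub>F sequentially)"
    proof (rule tendsto_0_prod_sequentially[where g = ?g])
      show "\<forall>\<^sub>F \<epsilon> in at_right 0. \<forall>N\<ge>1. ennreal (1 / real (N + 1)) *
              (\<Sum>n=0..N. \<integral>\<^sup>+y\<in>\<Omega>. ennreal ((1 - (cmod (u \<epsilon> N n y))\<^sup>2)\<^sup>2) \<partial>lebesgue)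
            + ennreal (1/2) *
              (\<integral>\<^sup>+x. ennreal ((norm ((1 / hex \<epsilon>) *\<^sub>R weak_curl (A \<epsilon> N) x - e3))\<^sup>2) \<partial>lebesgue) \<le> ennreal (?g \<epsilon>)"
        using asym
      proof eventually_elim
        case (elim \<epsilon>)
        show ?case
        proof (intro allI impI)
          fix N :: nat assume N: "1 \<le> N"
          have e: "0 < \<epsilon>" and h: "2 \<le> hex \<epsilon>" "0 < hex \<epsilon>" and k: "0 < \<kappa> \<epsilon>" using elim by auto
          have adm: "LD_admissible \<Omega> N (hex \<epsilon>) (u \<epsilon> N) (A \<epsilon> N)" using assms(9)[OF e N] by (simp add: is_LD_minimizer_def)
          have "4 / L * (\<epsilon>\<^sup>2 * \<kappa> \<epsilon>) + \<kappa> \<epsilon> / (hex \<epsilon>)\<^sup>2 \<le> ?g \<epsilon>"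
            using elim assms(4) by (intro add_mono mult_left_mono) auto
          then show "ennreal (1 / real (N + 1)) *
              (\<Sum>n=0..N. \<integral>\<^sup>+y\<in>\<Omega>. ennreal ((1 - (cmod (u \<epsilon> N n y))\<^sup>2)\<^sup>2) \<partial>lebesgue)
            + ennreal (1/2) *
              (\<integral>\<^sup>+x. ennreal ((norm ((1 / hex \<epsilon>) *\<^sub>R weak_curl (A \<epsilon> N) x - e3))\<^sup>2) \<partial>lebesgue) \<le> ennreal (?g \<epsilon>)"
            by (intro order_trans[OF energy_average_bound[OF U e assms(4) N h(2) k adm E[OF h(1) e N]] ennreal_leI])
        qed
      qed
      have "(?g \<longlongrightarrow> 4 / L * (C * sqrt (2 * pi) * sqrt 0) + 2 * C * 0) (at_right 0)"
        by (intro tendsto_intros assms(7,8))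
      then show "(?g \<longlongrightarrow> 0) (at_right 0)" by simp
    qed
    let ?k = "\<lambda>\<epsilon>. (2 + 1 / L) * sqrt (2 * C * (\<bar>ln \<epsilon>\<bar> / hex \<epsilon>))"
    show "((\<lambda>(\<epsilon>, N). Hminus1_norm \<Omega> (\<lambda>\<phi>.
            1 / real (N + 1) *
              (\<Sum>n=0..N. vorticity \<Omega> (layer_potential (A \<epsilon> N) (real n * (L / real N))) (u \<epsilon> N n) \<phi>
                          / hex \<epsilon>)
            - (LINT y:\<Omega>|lebesgue. \<phi> y)))
          \<longlongrightarrow> 0) (at_right 0 \<times>\<^sub>F sequentially)"
    proof (rule tendsto_0_prod_sequentially[where g = ?k])
      show "\<forall>\<^sub>F \<epsilon> in at_right 0. \<forall>N\<ge>1. Hminus1_norm \<Omega> (\<lambda>\<phi>.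
            1 / real (N + 1) *
              (\<Sum>n=0..N. vorticity \<Omega> (layer_potential (A \<epsilon> N) (real n * (L / real N))) (u \<epsilon> N n) \<phi>
                          / hex \<epsilon>)
            - (LINT y:\<Omega>|lebesgue. \<phi> y)) \<le> ennreal (?k \<epsilon>)"
        using asym
      proof eventually_elim
        case (elim \<epsilon>)
        show ?case
        proof (intro allI impI)
          fix N :: nat assume N: "1 \<le> N"
          have e: "0 < \<epsilon>" and h: "2 \<le> hex \<epsilon>" "0 < hex \<epsilon>" and k: "0 < \<kappa> \<epsilon>" using elim by auto
          have "(2 + 1 / L) * sqrt (\<kappa> \<epsilon> / (hex \<epsilon>)\<^sup>2) \<le> ?k \<epsilon>"
            using elim assms(4) by (intro mult_left_mono real_sqrt_le_mono) auto
          then show "Hminus1_norm \<Omega> (\<lambda>\<phi>.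
            1 / real (N + 1) *
              (\<Sum>n=0..N. vorticity \<Omega> (layer_potential (A \<epsilon> N) (real n * (L / real N))) (u \<epsilon> N n) \<phi>
                          / hex \<epsilon>)
            - (LINT y:\<Omega>|lebesgue. \<phi> y)) \<le> ennreal (?k \<epsilon>)"
            by (intro order_trans[OF vorticity_average_bound[OF U e assms(4) N h(2) k assms(9)[OF e N] E[OF h(1) e N]] ennreal_leI])
        qed
      qed
      have "(?k \<longlongrightarrow> (2 + 1 / L) * sqrt (2 * C * 0)) (at_right 0)"
        by (intro tendsto_intros assms(7))
      then show "(?k \<longlongrightarrow> 0) (at_right 0)" by simp
    qed
  qed
qed

end
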